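(* Let $n\ge 1$, $T>0$, and let $a\in\mathrm{Lip}(\mathbb{R}^n;\mathbb{R}^n)$ be one-to-one with $J_{a^{-1}}\in L^\infty$. Let $f\in L^\infty(\mathbb{R}_+\times\mathbb{R}^n_x\times\mathbb{R}^n_v)$ and $u$ satisfy $$u(t,x)=\int_{\mathbb{R}^n} f(t,x,v)\,dv,\qquad -1\le f\le 1,$$ and let $f$ solve $$\partial_t f+a(v)\cdot\nabla_x f=\partial_v m$$ for some finite Radon measure $m$. Assume moreover that $f\in L^\infty([0,T],L^1(\mathbb{R}^n_x\times\mathbb{R}^n_v))$ and that $f$ is compactly supported in velocity $v$. Then $u\in L^2([0,T],H^s(\mathbb{R}^n))$ for any $s<1/4$.
   Context: The equation holds in the sense of distributions. The measure $m$ is a finite (signed) Radon measure in $(t,x,v)$; when $n=1$, $\partial_v m$ is its ordinary distributional derivative in $v\in\mathbb{R}$, and when $n>1$, $m=(m_1,\dots,m_n)$ is $\mathbb{R}^n$-valued and $\partial_v m=\sum_{i=1}^n\partial_{v_i}m_i$. $J_{a^{-1}}=\det(Da^{-1})$ (taken in absolute value, extended by $0$ outside $a(\mathbb{R}^n)$); the condition $J_{a^{-1}}\in L^\infty$ is understood together with the change of variables formula $\int_{\mathbb{R}^n}\psi(a(v))\,dv=\int_{\mathbb{R}^n}\psi(v')J_{a^{-1}}(v')\,dv'$ for nonnegative measurable $\psi$. "Compactly supported in velocity" means there is a compact $K\subset\mathbb{R}^n$ with $f(t,x,v)=0$ for $v\notin K$. *)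

theory Defs
  imports "HOL-Analysis.Analysis"
begin

section \<open>Smooth functions, test functions and Schwartz functions\<close>

definition partial :: "'a::euclidean_space \<Rightarrow> ('a \<Rightarrow> 'b::real_normed_vector) \<Rightarrow> 'a \<Rightarrow> 'b"
  where "partial b \<phi> z = frechet_derivative \<phi> (at z) b"

primrec iterated_partial ::
    "'a::euclidean_space list \<Rightarrow> ('a \<Rightarrow> 'b::real_normed_vector) \<Rightarrow> 'a \<Rightarrow> 'b"
  where
    "iterated_partial [] \<phi> = \<phi>"
  | "iterated_partial (b # bs) \<phi> = iterated_partial bs (partial b \<phi>)"

definition smooth :: "('a::euclidean_space \<Rightarrow> 'b::real_normed_vector) \<Rightarrow> bool"
  where "smooth \<phi> \<longleftrightarrow> (\<forall>bs\<in>lists Basis. iterated_partial bs \<phi> differentiable_on UNIV)"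

definition test_function :: "'a::euclidean_space set \<Rightarrow> ('a \<Rightarrow> real) \<Rightarrow> bool"
  where "test_function \<Omega> \<phi> \<longleftrightarrow>
    smooth \<phi> \<and> (\<exists>K. compact K \<and> K \<subseteq> \<Omega> \<and> (\<forall>z. z \<notin> K \<longrightarrow> \<phi> z = 0))"

definition schwartz :: "('a::euclidean_space \<Rightarrow> complex) \<Rightarrow> bool"
  where "schwartz \<phi> \<longleftrightarrow>
    smooth \<phi> \<and>
    (\<forall>k. \<forall>bs\<in>lists Basis. \<exists>C. \<forall>x. norm x ^ k * norm (iterated_partial bs \<phi> x) \<le> C)"


section \<open>Lebesgue spaces\<close>

definition Linfty :: "'a measure \<Rightarrow> ('a \<Rightarrow> real) \<Rightarrow> bool"
  where "Linfty M g \<longleftrightarrow> g \<in> borel_measurable M \<and> (\<exists>C. AE z in M. \<bar>g z\<bar> \<le> C)"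

text \<open>For jointly measurable \<open>f\<close>, as in all uses below, measurability of
  \<open>t \<mapsto> f(t,\<cdot>)\<close> as a map into the separable space \<open>L\<^sup>1\<close> is automatic.\<close>

definition Linfty_L1 :: "real \<Rightarrow> (real \<times> 'a::euclidean_space \<Rightarrow> real) \<Rightarrow> bool"
  where "Linfty_L1 T f \<longleftrightarrow>
    (\<exists>C. AE t in lebesgue_on {0..T}.
      integrable lebesgue (\<lambda>z. f (t, z)) \<and> (LINT z|lebesgue. \<bar>f (t, z)\<bar>) \<le> C)"


section \<open>Fourier transform and Sobolev spaces\<close>

definition fourier :: "('a::euclidean_space \<Rightarrow> complex) \<Rightarrow> 'a \<Rightarrow> complex"
  where "fourier \<phi> \<xi> = (LINT x|lebesgue. exp (- \<i> * complex_of_real (x \<bullet> \<xi>)) * \<phi> x)"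

text \<open>The Fourier transform of \<open>g\<close>, taken in the sense of tempered distributions, is the
  function \<open>G\<close>. Such a \<open>G\<close> is unique up to null sets.\<close>

definition has_fourier_transform ::
    "('a::euclidean_space \<Rightarrow> real) \<Rightarrow> ('a \<Rightarrow> complex) \<Rightarrow> bool"
  where "has_fourier_transform g G \<longleftrightarrow>
    (\<forall>\<phi>. schwartz \<phi> \<longrightarrow>
      integrable lebesgue (\<lambda>x. complex_of_real (g x) * fourier \<phi> x) \<and>
      integrable lebesgue (\<lambda>\<xi>. G \<xi> * \<phi> \<xi>) \<and>
      (LINT x|lebesgue. complex_of_real (g x) * fourier \<phi> x) = (LINT \<xi>|lebesgue. G \<xi> * \<phi> \<xi>))"

definition fourier_transform :: "('a::euclidean_space \<Rightarrow> real) \<Rightarrow> 'a \<Rightarrow> complex"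
  where "fourier_transform g = (SOME G. has_fourier_transform g G)"

definition Hs :: "real \<Rightarrow> ('a::euclidean_space \<Rightarrow> real) set"
  where "Hs s = {g. \<exists>G. has_fourier_transform g G \<and>
    integrable lebesgue (\<lambda>\<xi>. (1 + (norm \<xi>)\<^sup>2) powr s * (norm (G \<xi>))\<^sup>2)}"

definition Hs_norm :: "real \<Rightarrow> ('a::euclidean_space \<Rightarrow> real) \<Rightarrow> real"
  where "Hs_norm s g =
    sqrt (LINT \<xi>|lebesgue. (1 + (norm \<xi>)\<^sup>2) powr s * (norm (fourier_transform g \<xi>))\<^sup>2)"

text \<open>The second conjunct says that preimages of balls under \<open>t \<mapsto> u(t,\<cdot>)\<close> are measurable.
  As \<open>H\<^sup>s\<close> is separable (and functions are dense in it when \<open>s < 0\<close>), this is Borel, and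
  equivalently Bochner, measurability.\<close>

definition L2_Hs :: "real \<Rightarrow> real \<Rightarrow> (real \<times> 'a::euclidean_space \<Rightarrow> real) \<Rightarrow> bool"
  where "L2_Hs T s u \<longleftrightarrow>
    (AE t in lebesgue_on {0..T}. (\<lambda>x. u (t, x)) \<in> Hs s) \<and>
    (\<forall>g\<in>Hs s. (\<lambda>t. Hs_norm s (\<lambda>x. u (t, x) - g x)) \<in> borel_measurable (lebesgue_on {0..T})) \<and>
    integrable (lebesgue_on {0..T}) (\<lambda>t. (Hs_norm s (\<lambda>x. u (t, x)))\<^sup>2)"


section \<open>The velocity field\<close>

text \<open>If \<open>a\<close> is continuous and injective then \<open>range a\<close> is open, so the derivative of
  \<open>inv a\<close> at a point of \<open>range a\<close> does not see the values of \<open>inv a\<close> outside \<open>range a\<close>.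
  For Lipschitz \<open>a\<close> satisfying the change of variables formula below, \<open>inv a\<close> is
  differentiable almost everywhere on \<open>range a\<close>.\<close>

definition inverse_jacobian :: "(real^'n \<Rightarrow> real^'n) \<Rightarrow> real^'n \<Rightarrow> real"
  where "inverse_jacobian a w =
    (if w \<in> range a \<and> inv a differentiable (at w)
     then \<bar>det (matrix (frechet_derivative (inv a) (at w)))\<bar> else 0)"

definition change_of_variables :: "(real^'n \<Rightarrow> real^'n) \<Rightarrow> bool"
  where "change_of_variables a \<longleftrightarrow>
    (\<forall>\<psi>::real^'n \<Rightarrow> ennreal. \<psi> \<in> borel_measurable borel \<longrightarrow>
      (\<integral>\<^sup>+v. \<psi> (a v) \<partial>lebesgue) = (\<integral>\<^sup>+w. \<psi> w * ennreal (inverse_jacobian a w) \<partial>lebesgue))"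


section \<open>The kinetic equation\<close>

text \<open>A finite signed Radon measure is given as the difference of two finite Borel measures
  (on a Euclidean space every finite Borel measure is Radon).\<close>

type_synonym 'a signed_measure = "'a measure \<times> 'a measure"

definition finite_signed_measure :: "'a::topological_space signed_measure \<Rightarrow> bool"
  where "finite_signed_measure \<mu> \<longleftrightarrow>
    finite_measure (fst \<mu>) \<and> sets (fst \<mu>) = sets borel \<and>
    finite_measure (snd \<mu>) \<and> sets (snd \<mu>) = sets borel"

definition signed_integral :: "'a signed_measure \<Rightarrow> ('a \<Rightarrow> real) \<Rightarrow> real"
  where "signed_integral \<mu> g = integral\<^sup>L (fst \<mu>) g - integral\<^sup>L (snd \<mu>) g"

abbreviation positive_time :: "(real \<times> 'a) set"
  where "positive_time \<equiv> {0<..} \<times> UNIV"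

text \<open>\<open>\<partial>\<^sub>t f + a(v) \<cdot> \<nabla>\<^sub>x f = \<Sum>\<^sub>i \<partial>\<^bsub>v\<^sub>i\<^esub> m\<^sub>i\<close> in the sense of distributions on
  \<open>(0,\<infinity>) \<times> \<real>\<^sup>n \<times> \<real>\<^sup>n\<close>; both sides of the weak formulation carry a minus sign, which is
  cancelled. The measures may be taken on the whole space, since only their restriction to
  positive times is tested.\<close>

definition solves_kinetic_equation ::
    "(real^'n \<Rightarrow> real^'n) \<Rightarrow> (real \<times> (real^'n) \<times> (real^'n) \<Rightarrow> real) \<Rightarrow>
     ('n \<Rightarrow> (real \<times> (real^'n) \<times> (real^'n)) signed_measure) \<Rightarrow> bool"
  where "solves_kinetic_equation a f m \<longleftrightarrow>
    (\<forall>\<phi>. test_function positive_time \<phi> \<longrightarrow>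
      (LINT (t, x, v)|lebesgue_on positive_time.
         f (t, x, v) * (partial (1, 0, 0) \<phi> (t, x, v) +
                        (\<Sum>i\<in>UNIV. a v $ i * partial (0, axis i 1, 0) \<phi> (t, x, v))))
      = (\<Sum>i\<in>UNIV. signed_integral (m i) (partial (0, 0, axis i 1) \<phi>)))"

end

theory Submission
 imports Defs
begin

text \<open>Let \<open>D = \<tau> + a(v) \<bullet> \<xi>\<close> be the symbol of the transport operator and \<open>g\<close> the Fourier transform of
 \<open>f\<close> in \<open>(t,x)\<close>, cut off near \<open>t = 0\<close> and \<open>t = T\<close>. Averaging \<open>g\<close> in \<open>v\<close> at frequency \<open>|\<xi>| ~ N = 4^j\<close>, the region
 \<open>|D| < \<eta>\<close> has measure at most \<open>O(\<eta>/N)\<close> by the slab estimate, which uses the bound on the Jacobian. For the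
 region \<open>|D| > \<eta>\<close> one tests the equation with the transport resolvent at level \<open>\<eta>\<close> applied to an
 average of \<open>f\<close> itself over velocity balls of radius \<open>\<delta> = \<eta>/N\<close>: on such balls \<open>D\<close> varies by at most
 \<open>O(\<eta>)\<close>, and the test function is bounded with velocity gradient \<open>O(1/(\<delta>\<^sup>2 N))\<close>, so the finite measure \<open>m\<close> yields an
 \<open>L\<^sup>2\<close> bound of that size for the damped averages. Decomposing over the dyadic levels
 \<open>\<eta> = 2^j, ..., 4^j\<close>, the Cauchy-Schwarz inequality gains \<open>\<delta>\<close> at each level, and every level contributes
 \<open>O(\<delta> / (\<delta>\<^sup>2 N)) \<le> O(2^{-j})\<close>. The energy of \<open>u\<close> on the shell is thus \<open>O(j^2 2^{-j}) = O(j^2 N^{-1/2})\<close>, which is summable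
 against \<open>N^{2s}\<close> for \<open>s < 1/4\<close>. The convolution kernel below only serves to make the energy
 integrable in \<open>\<tau>\<close>; its time scale is sent to zero at the end.\<close>

section \<open>Smooth functions with compact support\<close>

text \<open>The measure \<open>m\<close> can only be paired with bounded functions of bounded
  velocity gradient. The L^2 bound therefore comes from duality: if S maps g to its damped, smoothed
  velocity average and S' is the adjoint, then |S g|^2 = <g, S' S g>, and S' S g is minus the
  transport derivative of an explicit function \<open>phi\<close>, the test function. Two obstacles
  shape the rest. First, \<open>phi\<close> and \<open>a\<close> are only Lipschitz, while the
  equation is tested with smooth functions; increments along characteristics replace derivatives,
  and the mollification errors are shown to vanish. Secondly, the time cutoff and the time rate of
  the kernel are both removed in the end, so no constant may depend on them: the cutoff has slope of
  order 1/\<alpha>, but only on times of total length of order \<alpha>, where the uniform L^1 bound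
  pays for it; and the time component of the direction (1, a(v)) does not vary with v. The exponent
  1/4 is the balance at the lowest level: the slab contributes \<eta>/N, testing contributes
  1/\<eta>, and both equal N^(-1/2) for \<eta> = N^(1/2).\<close>

definition jet :: "(nat \<Rightarrow> real \<Rightarrow> real) \<Rightarrow> bool"
 where "jet G \<longleftrightarrow> (\<forall>k x. (G k has_real_derivative G (Suc k) x) (at x))"

text \<open>The whole sequence of derivatives is the witness, so that products over coordinates can
  index their partial derivatives by orders of differentiation without evaluating
  \<open>frechet_derivative\<close>.\<close>

definition smooth1 :: "(real \<Rightarrow> real) \<Rightarrow> bool"
 where "smooth1 g \<longleftrightarrow> (\<exists>G. G 0 = g \<and> jet G)"

text \<open>Choosing for each member of the class a derivative inside the class and iterating the
  choice yields the jet. Smoothness is thus reduced to exhibiting a class closed under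
  differentiation.\<close>

lemma smooth1_coinduct:
 assumes "g \<in> S" and S: "\<And>h. h \<in> S \<Longrightarrow> \<exists>h'\<in>S. \<forall>x. (h has_real_derivative h' x) (at x)"
 shows "smooth1 g"
proof -
 obtain D where D: "\<And>h. h \<in> S \<Longrightarrow> D h \<in> S \<and> (\<forall>x. (h has_real_derivative D h x) (at x))"
  using S by metis
 have "(D ^^ k) g \<in> S" for k
  using assms(1) D by (induction k) auto
 then show ?thesis
  unfolding smooth1_def jet_def using D by (intro exI[of _ "\<lambda>k. (D ^^ k) g"]) auto
qed

lemma smooth1_affine:
 assumes "smooth1 g" shows "smooth1 (\<lambda>x. g (c * x + d))"
proof -
 obtain G where G: "G 0 = g" "\<And>k x. (G k has_real_derivative G (Suc k) x) (at x)"
  using assms unfolding smooth1_def jet_def by blast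
 have "((\<lambda>x. c ^ k * G k (c * x + d)) has_real_derivative c ^ Suc k * G (Suc k) (c * x + d)) (at x)" for k x
  by (auto intro!: derivative_eq_intros DERIV_chain'[OF _ G(2)])
 then show ?thesis
  unfolding smooth1_def jet_def using G(1) by (intro exI[of _ "\<lambda>k x. c ^ k * G k (c * x + d)"]) auto
qed

text \<open>Finite lists of products of members of the two jets are closed under differentiation.
  Repeated terms stay in the list, so no binomial coefficients appear.\<close>

lemma smooth1_mult:
 assumes "smooth1 g" "smooth1 h" shows "smooth1 (\<lambda>x. g x * h x)"
proof -
 obtain G where G: "G 0 = g" "\<And>k x. (G k has_real_derivative G (Suc k) x) (at x)"
  using assms unfolding smooth1_def jet_def by blast
 obtain H where H: "H 0 = h" "\<And>k x. (H k has_real_derivative H (Suc k) x) (at x)"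
  using assms unfolding smooth1_def jet_def by blast
 define S where "S = {f. \<exists>xs::(nat \<times> nat) list. f = (\<lambda>x. \<Sum>p\<leftarrow>xs. G (fst p) x * H (snd p) x)}"
 show ?thesis
 proof (rule smooth1_coinduct[of _ S])
  show "(\<lambda>x. g x * h x) \<in> S"
   unfolding S_def using G(1) H(1) by (auto intro!: exI[of _ "[(0,0)]"])
 next
  fix f assume "f \<in> S"
  then obtain xs where f: "f = (\<lambda>x. \<Sum>p\<leftarrow>xs. G (fst p) x * H (snd p) x)" unfolding S_def by blast
  have "\<exists>ys. \<forall>x. ((\<lambda>x. \<Sum>p\<leftarrow>xs. G (fst p) x * H (snd p) x) has_real_derivative
      (\<Sum>p\<leftarrow>ys. G (fst p) x * H (snd p) x)) (at x)"
  proof (induction xs)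
   case Nil then show ?case by (intro exI[of _ "[]"]) auto
  next
   case (Cons a xs)
   then obtain ys where ys: "\<And>x. ((\<lambda>x. \<Sum>p\<leftarrow>xs. G (fst p) x * H (snd p) x) has_real_derivative
      (\<Sum>p\<leftarrow>ys. G (fst p) x * H (snd p) x)) (at x)" by blast
   show ?case
    by (rule exI[of _ "(Suc (fst a), snd a) # (fst a, Suc (snd a)) # ys"])
     (auto intro!: derivative_eq_intros G(2) H(2) ys)
  qed
  then show "\<exists>h'\<in>S. \<forall>x. (f has_real_derivative h' x) (at x)"
   unfolding f S_def mem_Collect_eq by (fast intro: bexI[rotated])
 qed
qed

section \<open>Bump functions on the line\<close>

definition flat :: "real \<Rightarrow> real"
 where "flat x = (if 0 < x then exp (- (1 / x)) else 0)"

lemma poly_exp_inverse_tendsto: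
 "((\<lambda>x. poly p (1 / x) * exp (- (1 / x))) \<longlongrightarrow> (0::real)) (at_right 0)"
proof -
 have mono: "((\<lambda>y. c * (y ^ k / exp y)) \<longlongrightarrow> (0::real)) at_top" for k c
  using tendsto_mult[OF tendsto_const tendsto_power_div_exp_0, of c k] by simp
 have "((\<lambda>y. \<Sum>i\<le>degree p. coeff p i * (y ^ i / exp y)) \<longlongrightarrow> (\<Sum>i\<le>degree p. 0)) at_top"
  by (intro tendsto_sum mono)
 then have "((\<lambda>y. poly p y * exp (- y)) \<longlongrightarrow> (0::real)) at_top"
  by (simp add: poly_altdef sum_distrib_right exp_minus divide_inverse mult.assoc)
 from filterlim_compose[OF this filterlim_inverse_at_top_right]
 show ?thesis by (simp add: inverse_eq_divide)
qed

lemma smooth1_flat: "smooth1 flat"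
proof (rule smooth1_coinduct)
 let ?q = "\<lambda>p x. if 0 < x then poly p (1 / x) * exp (- (1 / x)) else (0::real)"
 show "flat \<in> range ?q"
  by (rule range_eqI[of _ _ 1]) (auto simp: flat_def)
 fix h assume "h \<in> range ?q"
 then obtain p where h: "h = ?q p" by blast
 \<comment> \<open>With y = 1/x and dy/dx = -y^2, the derivative of p(y) exp(-y) is y^2 (p(y) -
   p'(y)) exp(-y).\<close>
 define p' where "p' = [:0, 0, 1:] * (p - pderiv p)"
 have "(?q p has_real_derivative ?q p' x) (at x)" for x
 proof (cases x "0::real" rule: linorder_cases)
  case less
  have "((\<lambda>_. 0) has_real_derivative 0) (at x)" by simp
  moreover have "\<forall>\<^sub>F y in nhds x. ?q p y = 0"
   using eventually_nhds_in_open[of "{..<0}" x] less by (auto elim: eventually_mono)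
  ultimately show ?thesis using less
   by (subst DERIV_cong_ev[OF refl _ refl, where g = "\<lambda>_. 0"]) auto
 next
  case greater
  have "((\<lambda>x. poly p (1 / x) * exp (- (1 / x))) has_real_derivative ?q p' x) (at x)"
   using greater unfolding p'_def
   by (auto intro!: derivative_eq_intros DERIV_chain'[OF _ poly_DERIV]
     simp: field_simps power2_eq_square)
  moreover have "\<forall>\<^sub>F y in nhds x. ?q p y = poly p (1 / y) * exp (- (1 / y))"
   using eventually_nhds_in_open[of "{0<..}" x] greater by (auto elim: eventually_mono)
  ultimately show ?thesis
   by (subst DERIV_cong_ev[OF refl _ refl]) auto
 next
  case equal
  have "((\<lambda>y. ?q p y / y) \<longlongrightarrow> 0) (at_left 0)"
   by (rule tendsto_eventually) (auto simp: eventually_at_filter)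
  \<comment> \<open>Division by y multiplies the polynomial in 1/y by its variable, which is
    \<open>pCons 0 p\<close>; the exponential still wins.\<close>
  moreover have "((\<lambda>y. ?q p y / y) \<longlongrightarrow> 0) (at_right 0)"
  proof (rule Lim_transform_eventually[OF poly_exp_inverse_tendsto[of "pCons 0 p"]])
   show "\<forall>\<^sub>F y in at_right 0. poly (pCons 0 p) (1 / y) * exp (- (1 / y)) = ?q p y / y"
    by (auto simp: eventually_at_filter)
  qed
  ultimately have "((\<lambda>y. ?q p y / y) \<longlongrightarrow> 0) (at 0)"
   by (rule filterlim_split_at)
  then show ?thesis
   using equal by (simp add: has_field_derivative_iff)
 qed
 then show "\<exists>h'\<in>range ?q. \<forall>x. (h has_real_derivative h' x) (at x)"
  unfolding h by (intro bexI[of _ "?q p'"]) auto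
qed

text \<open>For k tending to infinity these bumps tend to the indicator of the open interval, which
  is how test integrals determine box integrals; with k = 1 they supply mollifiers.\<close>

definition box_bump :: "real \<Rightarrow> real \<Rightarrow> real \<Rightarrow> real \<Rightarrow> real"
 where "box_bump k a c x = flat (k * (x - a)) * flat (k * (c - x))"

lemma smooth1_box_bump: "smooth1 (box_bump k a c)"
proof -
 have "smooth1 (\<lambda>x. flat (k * x + (- (k * a))) * flat (- k * x + k * c))"
  by (intro smooth1_mult smooth1_affine smooth1_flat)
 then show ?thesis by (simp add: box_bump_def[abs_def] algebra_simps)
qed

lemma flat_bounds: "0 \<le> flat x" "flat x \<le> 1"
 by (auto simp: flat_def)

lemma box_bump_bounds: "0 \<le> box_bump k a c x" "box_bump k a c x \<le> 1"
 by (auto simp: box_bump_def flat_bounds intro!: mult_le_one)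

lemma box_bump_pos: "k > 0 \<Longrightarrow> a < x \<Longrightarrow> x < c \<Longrightarrow> 0 < box_bump k a c x"
 by (auto simp: box_bump_def flat_def)

lemma box_bump_eq_0: "k > 0 \<Longrightarrow> x \<le> a \<or> c \<le> x \<Longrightarrow> box_bump k a c x = 0"
 by (auto simp: box_bump_def flat_def zero_less_mult_iff)

lemma jet_vanish:
 assumes "jet G" and "\<And>x. x \<notin> {a..c} \<Longrightarrow> G 0 x = 0" and "x \<notin> {a..c}"
 shows "G k x = 0"
 using assms(3)
proof (induction k arbitrary: x)
 case 0 then show ?case using assms(2) by simp
next
 case (Suc k)
 have "\<forall>\<^sub>F y in nhds x. G k y = 0"
  using eventually_nhds_in_open[of "- {a..c}" x] Suc.prems
  by (auto simp: closed_atLeastAtMost open_Compl elim!: eventually_mono intro!: Suc.IH)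
 then have "(G k has_real_derivative 0) (at x)"
  by (subst DERIV_cong_ev[OF refl _ refl, where g = "\<lambda>_. 0"]) auto
 then show ?case
  using assms(1) unfolding jet_def using DERIV_unique by blast
qed

lemma jet_continuous: "jet G \<Longrightarrow> continuous_on A (G k)"
 unfolding jet_def by (meson DERIV_continuous_on has_field_derivative_at_within)

lemma jet_bounded:
 assumes "jet G" and "\<And>x. x \<notin> {a..c} \<Longrightarrow> G 0 x = 0"
 shows "\<exists>B. \<forall>x. \<bar>G k x\<bar> \<le> B"
proof -
 have "bounded (G k ` {a..c})"
  by (intro compact_imp_bounded compact_continuous_image jet_continuous[OF assms(1)]) auto
 then obtain B where B: "\<forall>y\<in>G k ` {a..c}. norm y \<le> B"
  unfolding bounded_iff by blast
 then have "\<bar>G k x\<bar> \<le> max B 0" for x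
  using jet_vanish[OF assms, where x = x and k = k] B by (cases "x \<in> {a..c}") (auto simp: max.coboundedI1)
 then show ?thesis by blast
qed

lemma box_bump_jet: obtains G where "jet G" "G 0 = box_bump k a c"
 using smooth1_box_bump unfolding smooth1_def by blast

text \<open>The argument \<open>m\<close> records how often each coordinate factor has been
  differentiated, so that every partial derivative of such a product is again one, with one entry of
  \<open>m\<close> raised.\<close>

definition tensor :: "('a::euclidean_space \<Rightarrow> nat \<Rightarrow> real \<Rightarrow> real) \<Rightarrow> ('a \<Rightarrow> nat) \<Rightarrow> 'a \<Rightarrow> real"
 where "tensor G m z = (\<Prod>b\<in>Basis. G b (m b) (z \<bullet> b))"

lemma tensor_has_derivative:
 fixes G :: "'a::euclidean_space \<Rightarrow> nat \<Rightarrow> real \<Rightarrow> real"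
 assumes "\<And>b. b \<in> Basis \<Longrightarrow> jet (G b)"
 shows "(tensor G m has_derivative
  (\<lambda>h. \<Sum>b\<in>Basis. (h \<bullet> b) * tensor G (m(b := Suc (m b))) z)) (at z)"
proof -
 have 1: "((\<lambda>z. G b (m b) (z \<bullet> b)) has_derivative (\<lambda>h. (h \<bullet> b) * G b (Suc (m b)) (z \<bullet> b))) (at z)"
  if "b \<in> Basis" for b
  using assms[OF that] unfolding jet_def
  by (intro DERIV_compose_FDERIV[where f = "G b (m b)"]) (auto intro!: derivative_eq_intros)
 have "((\<lambda>z. \<Prod>b\<in>Basis. G b (m b) (z \<bullet> b)) has_derivative
   (\<lambda>h. \<Sum>b\<in>Basis. ((h \<bullet> b) * G b (Suc (m b)) (z \<bullet> b)) * (\<Prod>j\<in>Basis - {b}. G j (m j) (z \<bullet> j)))) (at z)"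
  by (rule has_derivative_prod[OF 1])
 moreover have "G b (Suc (m b)) (z \<bullet> b) * (\<Prod>j\<in>Basis - {b}. G j (m j) (z \<bullet> j)) =
   tensor G (m(b := Suc (m b))) z" if "b \<in> Basis" for b
  unfolding tensor_def by (subst prod.remove[OF _ that]) auto
 ultimately show ?thesis
  unfolding tensor_def[abs_def, symmetric] by (simp add: mult.assoc tensor_def[abs_def] cong: sum.cong)
qed

text \<open>A family closed under \<open>partial\<close> through raising an index is smooth. The
  abstract form serves the tensor products, their complex versions and their convolutions
  alike.\<close>

lemma smooth_of_partials:
 fixes \<Phi> :: "('a::euclidean_space \<Rightarrow> nat) \<Rightarrow> 'a \<Rightarrow> 'b::real_normed_vector"
 assumes "\<And>m z. (\<Phi> m has_derivative (\<lambda>h. \<Sum>b\<in>Basis. (h \<bullet> b) *\<^sub>R \<Phi> (m(b := Suc (m b))) z)) (at z)"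
 shows "smooth (\<Phi> m)" "bs \<in> lists Basis \<Longrightarrow> \<exists>m'. iterated_partial bs (\<Phi> m) = \<Phi> m'"
proof -
 have p: "partial b (\<Phi> m) = \<Phi> (m(b := Suc (m b)))" if "b \<in> Basis" for b m
  using that
  by (auto simp: partial_def fun_eq_iff frechet_derivative_at[OF assms, symmetric] inner_Basis
    if_distrib[of "\<lambda>x. x *\<^sub>R _"] cong: if_cong)
 show *: "bs \<in> lists Basis \<Longrightarrow> \<exists>m'. iterated_partial bs (\<Phi> m) = \<Phi> m'" for bs m
  by (induction bs arbitrary: m) (auto simp: p)
 show "smooth (\<Phi> m)"
  unfolding smooth_def
 proof
  fix bs :: "'a list" assume "bs \<in> lists Basis"
  then obtain m' where "iterated_partial bs (\<Phi> m) = \<Phi> m'" using * by blast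
  then show "iterated_partial bs (\<Phi> m) differentiable_on UNIV"
   using assms by (auto simp: differentiable_on_def differentiable_def)
 qed
qed

lemma tensor_bounded:
 fixes G :: "'a::euclidean_space \<Rightarrow> nat \<Rightarrow> real \<Rightarrow> real"
 assumes "\<And>b. b \<in> Basis \<Longrightarrow> jet (G b)"
  and "\<And>b x. b \<in> Basis \<Longrightarrow> x \<notin> {l \<bullet> b..r \<bullet> b} \<Longrightarrow> G b 0 x = 0"
 shows "\<exists>B. \<forall>z. \<bar>tensor G m z\<bar> \<le> B"
proof -
 have "\<forall>b\<in>Basis. \<exists>B. \<forall>x. \<bar>G b (m b) x\<bar> \<le> B"
  using jet_bounded[OF assms(1) assms(2)] by blast
 then obtain B where B: "\<And>b x. b \<in> Basis \<Longrightarrow> \<bar>G b (m b) x\<bar> \<le> B b" by metis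
 have "\<bar>tensor G m z\<bar> \<le> (\<Prod>b\<in>Basis. B b)" for z
  unfolding tensor_def abs_prod by (intro prod_mono) (auto intro: B)
 then show ?thesis by blast
qed

lemma tensor_vanish:
 assumes "\<And>b. b \<in> Basis \<Longrightarrow> jet (G b)"
  and "\<And>b x. b \<in> Basis \<Longrightarrow> x \<notin> {l \<bullet> b..r \<bullet> b} \<Longrightarrow> G b 0 x = 0"
  and "z \<notin> cbox l r"
 shows "tensor G m z = 0"
proof -
 obtain b where b: "b \<in> Basis" "z \<bullet> b \<notin> {l \<bullet> b..r \<bullet> b}"
  using assms(3) by (auto simp: mem_box)
 have "G b (m b) (z \<bullet> b) = 0"
  using jet_vanish[OF assms(1,2)[OF b(1)] b(2)] by simp
 then show ?thesis using b(1) by (auto simp: tensor_def intro!: prod_zero)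
qed

text \<open>A quadratic remainder that is uniform in the point can be integrated; this criterion
  stands in for differentiation under the integral sign in \<open>conv_smooth\<close>.\<close>

lemma has_derivative_of_quadratic_remainder:
 fixes f :: "'a::real_normed_vector \<Rightarrow> 'b::real_normed_vector"
 assumes "bounded_linear D" and "\<And>h. norm (f (z + h) - f z - D h) \<le> C * (norm h)\<^sup>2"
 shows "(f has_derivative D) (at z)"
 unfolding has_derivative_at
proof (intro conjI assms(1))
 have "(\<lambda>h::'a. C * norm h) \<midarrow>0\<rightarrow> C * norm (0::'a)"
  by (rule tendsto_mult_left[OF tendsto_norm[OF tendsto_ident_at]])
 moreover have "\<forall>\<^sub>F h in at (0::'a). norm (norm (f (z + h) - f z - D h) / norm h) \<le> C * norm h"
 proof (rule eventuallyI)
  fix h :: 'a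
  show "norm (norm (f (z + h) - f z - D h) / norm h) \<le> C * norm h"
   using assms(2)[of h] by (cases "h = 0") (auto simp: divide_simps power2_eq_square mult.assoc)
 qed
 ultimately show "(\<lambda>h. norm (f (z + h) - f z - D h) / norm h) \<midarrow>0\<rightarrow> 0"
  by (auto intro: Lim_null_comparison)
qed

locale compact_tensor =
 fixes G :: "'a::euclidean_space \<Rightarrow> nat \<Rightarrow> real \<Rightarrow> real" and l r :: 'a
 assumes jets: "\<And>b. b \<in> Basis \<Longrightarrow> jet (G b)"
  and supp: "\<And>b x. b \<in> Basis \<Longrightarrow> x \<notin> {l \<bullet> b..r \<bullet> b} \<Longrightarrow> G b 0 x = 0"
begin

lemma has_deriv: "(tensor G m has_derivative
  (\<lambda>h. \<Sum>b\<in>Basis. (h \<bullet> b) * tensor G (m(b := Suc (m b))) z)) (at z)"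
 by (rule tensor_has_derivative) (rule jets)

lemma vanish: "z \<notin> cbox l r \<Longrightarrow> tensor G m z = 0"
 by (rule tensor_vanish[OF jets supp])

lemma continuous: "continuous_on A (tensor G m)"
 by (intro continuous_at_imp_continuous_on ballI has_derivative_continuous[OF has_deriv])

lemma measurable [measurable]: "tensor G m \<in> borel_measurable borel"
 by (intro borel_measurable_continuous_onI continuous)

lemma bounded: obtains B where "B \<ge> 0" "\<And>z. \<bar>tensor G m z\<bar> \<le> B"
 using tensor_bounded[where G = G, OF jets supp] by (metis abs_ge_zero order_trans)

text \<open>All partial derivatives are bounded by compact support. The second ones make the first
  ones Lipschitz, and linearisation on the ball of radius \<open>norm h\<close> then costs one more
  factor \<open>norm h\<close>.\<close>

lemma quadratic_remainder:
 obtains C where "\<And>z h. \<bar>tensor G m (z + h) - tensor G m z -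
   (\<Sum>b\<in>Basis. (h \<bullet> b) * tensor G (m(b := Suc (m b))) z)\<bar> \<le> C * (norm h)\<^sup>2"
proof -
 let ?D = "\<lambda>m z h. \<Sum>b\<in>Basis. (h \<bullet> b) * tensor G (m(b := Suc (m b))) z"
 have "\<exists>B\<ge>0. \<forall>z. \<bar>tensor G m z\<bar> \<le> B" for m using bounded by metis
 then obtain B where B: "\<And>m. B m \<ge> 0" "\<And>m z. \<bar>tensor G m z\<bar> \<le> B m" by metis
 have on: "onorm (?D m z) \<le> (\<Sum>b\<in>Basis. B (m(b := Suc (m b))))" for m z
 proof (rule onorm_le)
  fix h :: 'a
  have "\<bar>?D m z h\<bar> \<le> (\<Sum>b\<in>Basis. \<bar>h \<bullet> b\<bar> * \<bar>tensor G (m(b := Suc (m b))) z\<bar>)"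
   by (rule order_trans[OF sum_abs]) (simp add: abs_mult)
  also have "\<dots> \<le> (\<Sum>b\<in>Basis. norm h * B (m(b := Suc (m b))))"
   by (intro sum_mono mult_mono) (auto intro: Basis_le_norm B)
  finally show "norm (?D m z h) \<le> (\<Sum>b\<in>Basis. B (m(b := Suc (m b)))) * norm h"
   by (simp add: sum_distrib_left mult.commute)
 qed
 have lip: "\<bar>tensor G m x - tensor G m y\<bar> \<le> (\<Sum>b\<in>Basis. B (m(b := Suc (m b)))) * norm (x - y)" for m x y
  using differentiable_bound[of UNIV "tensor G m" "?D m", OF _ _ on] has_deriv by auto
 \<comment> \<open>The sum of the bounds of all second partial derivatives.\<close>
 define C where "C = (\<Sum>b\<in>Basis. \<Sum>c\<in>Basis. B ((m(b := Suc (m b)))(c := Suc ((m(b := Suc (m b))) c))))"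
 have C0: "C \<ge> 0" unfolding C_def by (intro sum_nonneg B)
 have "\<bar>tensor G m (z + h) - tensor G m z - ?D m z h\<bar> \<le> norm h * (norm h * C)" for z h
 proof -
  have "norm (tensor G m (z + h) - tensor G m z - ?D m z (z + h - z)) \<le> norm (z + h - z) * (norm h * C)"
  proof (rule differentiable_bound_linearization[where S = "cball z (norm h)"])
   show "z + t *\<^sub>R (z + h - z) \<in> cball z (norm h)" if "t \<in> {0..1}" for t
    using that by (auto simp: dist_norm mult_left_le_one_le)
   show "(tensor G m has_derivative ?D m x) (at x within cball z (norm h))" for x
    using has_deriv has_derivative_at_withinI by blast
   show "onorm (?D m x - ?D m z) \<le> norm h * C" if x: "x \<in> cball z (norm h)" for x
   proof (rule onorm_le)
    fix k :: 'a
    have "\<bar>(?D m x - ?D m z) k\<bar> = \<bar>\<Sum>b\<in>Basis. (k \<bullet> b) * (tensor G (m(b := Suc (m b))) x - tensor G (m(b := Suc (m b))) z)\<bar>"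
     by (simp add: sum_subtractf algebra_simps)
    also have "\<dots> \<le> (\<Sum>b\<in>Basis. \<bar>k \<bullet> b\<bar> * \<bar>tensor G (m(b := Suc (m b))) x - tensor G (m(b := Suc (m b))) z\<bar>)"
     by (rule order_trans[OF sum_abs]) (simp add: abs_mult)
    also have "\<dots> \<le> (\<Sum>b\<in>Basis. norm k * ((\<Sum>c\<in>Basis. B ((m(b := Suc (m b)))(c := Suc ((m(b := Suc (m b))) c)))) * norm h))"
    proof (intro sum_mono mult_mono)
     fix b :: 'a assume "b \<in> Basis"
     have "norm (x - z) \<le> norm h" using x by (simp add: dist_norm norm_minus_commute)
     then show "\<bar>tensor G (m(b := Suc (m b))) x - tensor G (m(b := Suc (m b))) z\<bar> \<le>
      (\<Sum>c\<in>Basis. B ((m(b := Suc (m b)))(c := Suc ((m(b := Suc (m b))) c)))) * norm h"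
      by (rule order_trans[OF lip mult_left_mono]) (auto intro!: sum_nonneg B)
    qed (auto intro: Basis_le_norm)
    also have "\<dots> = norm h * C * norm k"
     unfolding C_def by (simp add: sum_distrib_left sum_distrib_right ac_simps)
    finally show "norm ((?D m x - ?D m z) k) \<le> norm h * C * norm k" by simp
   qed
  qed simp
  then show ?thesis by simp
 qed
 then show thesis by (intro that[of C]) (simp add: power2_eq_square ac_simps)
qed

definition conv :: "('a \<Rightarrow> real) \<Rightarrow> ('a \<Rightarrow> nat) \<Rightarrow> 'a \<Rightarrow> real"
 where "conv \<psi> m z = (LINT y|lborel. tensor G m (z - y) * \<psi> y)"

lemma conv_integrable:
 assumes [measurable]: "integrable lborel \<psi>"
 shows "integrable lborel (\<lambda>y. tensor G m (z - y) * \<psi> y)"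
proof -
 obtain B where B: "B \<ge> 0" "\<And>z. \<bar>tensor G m z\<bar> \<le> B" using bounded by blast
 have "integrable lborel (\<lambda>y. B * \<bar>\<psi> y\<bar>)" using assms by auto
 then show ?thesis
  by (rule Bochner_Integration.integrable_bound)
   (auto simp: abs_mult B intro!: mult_right_mono)
qed

text \<open>The constant in \<open>quadratic_remainder\<close> does not depend on the point, so
  integration against \<psi> multiplies it by the L^1 norm of \<psi>. Only integrability of \<psi>
  enters.\<close>

lemma conv_smooth:
 assumes \<psi> [measurable]: "integrable lborel \<psi>"
 shows "smooth (conv \<psi> m)"
proof (rule smooth_of_partials(1))
 fix m z
 obtain C where C: "\<And>z h. \<bar>tensor G m (z + h) - tensor G m z -
   (\<Sum>b\<in>Basis. (h \<bullet> b) * tensor G (m(b := Suc (m b))) z)\<bar> \<le> C * (norm h)\<^sup>2"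
  using quadratic_remainder by blast
 let ?D = "\<lambda>h. \<Sum>b\<in>Basis. (h \<bullet> b) *\<^sub>R conv \<psi> (m(b := Suc (m b))) z"
 show "(conv \<psi> m has_derivative ?D) (at z)"
 proof (rule has_derivative_of_quadratic_remainder)
  show "bounded_linear ?D"
   by (intro bounded_linear_sum bounded_linear_scaleR_const bounded_linear_inner_left)
  fix h
  let ?R = "\<lambda>y. (tensor G m (z - y + h) - tensor G m (z - y) -
   (\<Sum>b\<in>Basis. (h \<bullet> b) * tensor G (m(b := Suc (m b))) (z - y))) * \<psi> y"
  let ?R' = "\<lambda>y. tensor G m (z + h - y) * \<psi> y - tensor G m (z - y) * \<psi> y -
   (\<Sum>b\<in>Basis. (h \<bullet> b) * (tensor G (m(b := Suc (m b))) (z - y) * \<psi> y))"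
  have R: "?R = ?R'"
   by (simp add: fun_eq_iff left_diff_distrib sum_distrib_right mult.assoc add_diff_eq diff_add_eq)
  note int = conv_integrable[OF \<psi>]
  have eq: "conv \<psi> m (z + h) - conv \<psi> m z - ?D h = (LINT y|lborel. ?R y)"
   unfolding R conv_def real_scaleR_def
   by (subst Bochner_Integration.integral_diff, intro Bochner_Integration.integrable_diff int,
     intro Bochner_Integration.integrable_sum integrable_mult_right int,
     subst Bochner_Integration.integral_diff, rule int, rule int,
     subst Bochner_Integration.integral_sum, intro integrable_mult_right int) simp
  have "norm (LINT y|lborel. ?R y) \<le> (LINT y|lborel. C * (norm h)\<^sup>2 * \<bar>\<psi> y\<bar>)"
  proof (rule Bochner_Integration.integral_norm_bound_integral)
   show "integrable lborel (\<lambda>y. C * (norm h)\<^sup>2 * \<bar>\<psi> y\<bar>)"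
    using \<psi> by auto
   show "integrable lborel ?R"
    unfolding R by (intro Bochner_Integration.integrable_diff Bochner_Integration.integrable_sum integrable_mult_right int)
   show "norm (?R y) \<le> C * (norm h)\<^sup>2 * \<bar>\<psi> y\<bar>" for y
    using C[of "z - y" h] by (simp add: abs_mult mult_right_mono)
  qed
  also have "\<dots> = (C * (LINT y|lborel. \<bar>\<psi> y\<bar>)) * (norm h)\<^sup>2" by simp
  finally show "norm (conv \<psi> m (z + h) - conv \<psi> m z - ?D h) \<le> (C * (LINT y|lborel. \<bar>\<psi> y\<bar>)) * (norm h)\<^sup>2"
   unfolding eq .
 qed
qed

lemma complex_has_deriv:
 "((\<lambda>z. complex_of_real (tensor G m z)) has_derivative
  (\<lambda>h. \<Sum>b\<in>Basis. (h \<bullet> b) *\<^sub>R complex_of_real (tensor G (m(b := Suc (m b))) z))) (at z)"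
 using bounded_linear.has_derivative[OF bounded_linear_of_real has_deriv, of m z]
 by (simp add: scaleR_conv_of_real)

lemma schwartz: "schwartz (\<lambda>z. complex_of_real (tensor G m z))"
 unfolding schwartz_def
proof (intro conjI allI ballI)
 note * = smooth_of_partials[where \<Phi> = "\<lambda>m z. complex_of_real (tensor G m z)", OF complex_has_deriv]
 show "smooth (\<lambda>z. complex_of_real (tensor G m z))" by (rule *(1))
 fix k bs assume "bs \<in> lists (Basis :: 'a set)"
 then obtain m' where m': "iterated_partial bs (\<lambda>z. complex_of_real (tensor G m z)) = (\<lambda>z. complex_of_real (tensor G m' z))"
  using *(2) by meson
 obtain B where B: "B \<ge> 0" "\<And>z. \<bar>tensor G m' z\<bar> \<le> B" using bounded by blast
 obtain R where R: "\<And>z. z \<in> cbox l r \<Longrightarrow> norm z \<le> R"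
  using bounded_cbox[of l r] by (auto simp: bounded_iff)
 have "norm x ^ k * \<bar>tensor G m' x\<bar> \<le> max R 0 ^ k * B" for x
 proof (cases "x \<in> cbox l r")
  case True then show ?thesis
   by (intro mult_mono power_mono B) (auto simp: max.coboundedI1 R)
 next
  case False then show ?thesis using vanish[where z = x and m = m'] B by simp
 qed
 then show "\<exists>C. \<forall>x. norm x ^ k * norm (iterated_partial bs (\<lambda>z. complex_of_real (tensor G m z)) x) \<le> C"
  unfolding m' by auto
qed

end

lemma box_bump_tensor:
 fixes p q :: "'a::euclidean_space"
 assumes "k > 0"
 obtains G where "compact_tensor G p q"
  "tensor G (\<lambda>_. 0) = (\<lambda>z. \<Prod>b\<in>Basis. box_bump k (p \<bullet> b) (q \<bullet> b) (z \<bullet> b))"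
proof -
 have "\<forall>b. \<exists>G. jet G \<and> G 0 = box_bump k (p \<bullet> b) (q \<bullet> b)" using box_bump_jet by metis
 then obtain G where G: "\<And>b. jet (G b)" "\<And>b. G b 0 = box_bump k (p \<bullet> b) (q \<bullet> b)" by metis
 show thesis
 proof (rule that[of G])
  show "compact_tensor G p q"
   by standard (use assms in \<open>auto simp: G intro!: box_bump_eq_0\<close>)
  show "tensor G (\<lambda>_. 0) = (\<lambda>z. \<Prod>b\<in>Basis. box_bump k (p \<bullet> b) (q \<bullet> b) (z \<bullet> b))"
   by (simp add: tensor_def fun_eq_iff G)
 qed
qed

section \<open>Mollifiers\<close>

lemma mollifier_exists:
 assumes "e > 0"
 obtains \<rho> :: "'a::euclidean_space \<Rightarrow> real" where "\<And>z. 0 \<le> \<rho> z" "\<And>z. e < norm z \<Longrightarrow> \<rho> z = 0"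
  "integrable lborel \<rho>" "(LINT z|lborel. \<rho> z) = 1"
  "\<And>\<psi>. integrable lborel \<psi> \<Longrightarrow> smooth (\<lambda>z. LINT y|lborel. \<rho> (z - y) * \<psi> y)"
  "\<And>z \<psi>. integrable lborel \<psi> \<Longrightarrow> integrable lborel (\<lambda>y. \<rho> (z - y) * \<psi> y)"
proof -
 \<comment> \<open>Half-width e / DIM in each coordinate bounds the l^1 norm, hence the norm, by e
   on the box.\<close>
 define q :: 'a where "q = (e / DIM('a)) *\<^sub>R One"
 have qb: "q \<bullet> b = e / DIM('a)" if "b \<in> Basis" for b
  using that by (simp add: q_def)
 obtain G where "compact_tensor G (- q) q"
  and G: "tensor G (\<lambda>_. 0) = (\<lambda>z. \<Prod>b\<in>Basis. box_bump 1 (- q \<bullet> b) (q \<bullet> b) (z \<bullet> b))"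
  using box_bump_tensor[of 1 "- q" q] by auto
 interpret compact_tensor G "- q" q by fact
 let ?t = "tensor G (\<lambda>_. 0)"
 define I where "I = (LINT z|lborel. ?t z)"
 have nn: "0 \<le> ?t z" for z unfolding G by (intro prod_nonneg ballI box_bump_bounds)
 have int: "integrable lborel ?t"
 proof -
  have "integrable lborel (\<lambda>z. indicator (cbox (- q) q) z *\<^sub>R ?t z)"
   by (intro borel_integrable_compact compact_cbox continuous)
  then show ?thesis
   by (rule Bochner_Integration.integrable_cong[THEN iffD1, rotated -1])
    (auto simp: indicator_def vanish)
 qed
 \<comment> \<open>The bump is nonnegative, continuous and positive at 0; a vanishing integral would
   make a nonempty open set negligible.\<close>
 have "I \<noteq> 0"
 proof
  assume "I = 0"
  then have "AE z in lborel. ?t z = 0"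
   using integral_nonneg_eq_0_iff_AE[OF int] nn by (auto simp: I_def)
  then have "{z. ?t z \<noteq> 0} \<in> null_sets lborel"
   by (subst AE_iff_null_sets) (auto simp: borel_measurable_continuous_onI[OF continuous])
  then have "negligible {z. ?t z \<noteq> 0}"
   using negligible_iff_null_sets null_sets_completionI by blast
  moreover have "open {z. ?t z \<noteq> 0}"
   by (intro open_Collect_neq continuous continuous_on_const)
  moreover have "?t 0 > 0"
   unfolding G using assms by (auto intro!: zero_less_power box_bump_pos simp: qb)
  ultimately show False using open_not_negligible[of "{z. ?t z \<noteq> 0}"] by force
 qed
 moreover have "I \<ge> 0" unfolding I_def using nn by simp
 ultimately have I: "I > 0" by simp
 show thesis
 proof (rule that[of "\<lambda>z. ?t z / I"])
  show "0 \<le> ?t z / I" for z using nn I by simp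
  show "?t z / I = 0" if "e < norm z" for z
  proof -
   have "z \<notin> cbox (- q) q"
   proof
    assume z: "z \<in> cbox (- q) q"
    have "norm z \<le> (\<Sum>b\<in>Basis. \<bar>z \<bullet> b\<bar>)" by (rule norm_le_l1)
    also have "\<dots> \<le> (\<Sum>b\<in>(Basis::'a set). e / DIM('a))"
     using z by (intro sum_mono) (auto simp: mem_box qb abs_le_iff minus_le_iff)
    finally show False using that by simp
   qed
   then show ?thesis using vanish by simp
  qed
  show "integrable lborel (\<lambda>z. ?t z / I)" using int by simp
  show "(LINT z|lborel. ?t z / I) = 1" using I by (simp add: I_def[symmetric])
  fix \<psi> :: "'a \<Rightarrow> real" assume \<psi>: "integrable lborel \<psi>"
  then have \<psi>': "integrable lborel (\<lambda>y. \<psi> y / I)" by simp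
  show "smooth (\<lambda>z. LINT y|lborel. ?t (z - y) / I * \<psi> y)"
   using conv_smooth[OF \<psi>', of "\<lambda>_. 0"] unfolding conv_def[abs_def] by (simp only: times_divide_eq_right times_divide_eq_left)
  show "integrable lborel (\<lambda>y. ?t (z - y) / I * \<psi> y)" for z
   using conv_integrable[OF \<psi>', of "\<lambda>_. 0" z] by (simp only: times_divide_eq_right times_divide_eq_left)
 qed
qed

section \<open>Integration on Euclidean space\<close>

lemma lborel_reflect: "distr lborel borel (\<lambda>x. t - x) = (lborel :: 'a::euclidean_space measure)"
 using lborel_affine[of "-1" t] by (simp add: density_1)

lemma nn_integral_lborel_translate:
 fixes f :: "'a::euclidean_space \<Rightarrow> ennreal"
 assumes [measurable]: "f \<in> borel_measurable borel"
 shows "(\<integral>\<^sup>+x. f (t + x) \<partial>lborel) = (\<integral>\<^sup>+x. f x \<partial>lborel)"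
  and "(\<integral>\<^sup>+x. f (t - x) \<partial>lborel) = (\<integral>\<^sup>+x. f x \<partial>lborel)"
  and "(\<integral>\<^sup>+x. f (x - t) \<partial>lborel) = (\<integral>\<^sup>+x. f x \<partial>lborel)"
proof -
 show plus: "(\<integral>\<^sup>+x. f (t + x) \<partial>lborel) = (\<integral>\<^sup>+x. f x \<partial>lborel)" for t
  by (subst (2) lborel_distr_plus[of t, symmetric]) (simp add: nn_integral_distr)
 show "(\<integral>\<^sup>+x. f (t - x) \<partial>lborel) = (\<integral>\<^sup>+x. f x \<partial>lborel)"
  by (subst (2) lborel_reflect[of t, symmetric]) (simp add: nn_integral_distr)
 show "(\<integral>\<^sup>+x. f (x - t) \<partial>lborel) = (\<integral>\<^sup>+x. f x \<partial>lborel)"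
  using plus[of "- t"] by simp
qed

lemma integral_lborel_translate:
 fixes f :: "'a::euclidean_space \<Rightarrow> 'b::{banach, second_countable_topology}"
 assumes [measurable]: "f \<in> borel_measurable borel"
 shows "(LINT x|lborel. f (t + x)) = (LINT x|lborel. f x)"
  and "(LINT x|lborel. f (t - x)) = (LINT x|lborel. f x)"
  and "(LINT x|lborel. f (x - t)) = (LINT x|lborel. f x)"
proof -
 show plus: "(LINT x|lborel. f (t + x)) = (LINT x|lborel. f x)" for t
  by (subst (2) lborel_distr_plus[of t, symmetric]) (simp add: integral_distr)
 show "(LINT x|lborel. f (t - x)) = (LINT x|lborel. f x)"
  by (subst (2) lborel_reflect[of t, symmetric]) (simp add: integral_distr)
 show "(LINT x|lborel. f (x - t)) = (LINT x|lborel. f x)"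
  using plus[of "- t"] by simp
qed

lemma integrable_lborel_translate:
 fixes f :: "'a::euclidean_space \<Rightarrow> 'b::{banach, second_countable_topology}"
 assumes f: "integrable lborel f"
 shows "integrable lborel (\<lambda>x. f (t + x))" "integrable lborel (\<lambda>x. f (t - x))"
  "integrable lborel (\<lambda>x. f (x - t))"
proof -
 have [measurable]: "f \<in> borel_measurable borel" using f by auto
 show plus: "integrable lborel (\<lambda>x. f (t + x))" for t
  using f by (subst (asm) lborel_distr_plus[of t, symmetric]) (simp add: integrable_distr_eq)
 show "integrable lborel (\<lambda>x. f (t - x))"
  using f by (subst (asm) lborel_reflect[of t, symmetric]) (simp add: integrable_distr_eq)
 show "integrable lborel (\<lambda>x. f (x - t))"
  using plus[of "- t"] by simp
qed

lemma
 fixes g :: "'a::euclidean_space \<Rightarrow> real \<Rightarrow> 'b::{real_normed_field, banach, second_countable_topology}"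
 assumes g: "\<And>b. b \<in> Basis \<Longrightarrow> integrable lborel (g b)"
 shows integrable_lborel_prod: "integrable lborel (\<lambda>x. \<Prod>b\<in>Basis. g b (x \<bullet> b))"
  and integral_lborel_prod:
   "(LINT x|lborel. (\<Prod>b\<in>Basis. g b (x \<bullet> b))) = (\<Prod>b\<in>Basis. (LINT y|lborel. g b y))"
proof -
 interpret product_sigma_finite "\<lambda>_::'a. lborel::real measure" ..
 have [measurable]: "b \<in> Basis \<Longrightarrow> g b \<in> borel_measurable borel" for b
  using g[of b] by auto
 have eq: "(\<Prod>b\<in>Basis. g b ((\<Sum>c\<in>Basis. f c *\<^sub>R c) \<bullet> b)) = (\<Prod>b\<in>Basis. g b (f b))" for f :: "'a \<Rightarrow> real"
  by (intro prod.cong refl) (simp add: inner_sum_left inner_Basis if_distrib cong: if_cong)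
 have [measurable]: "(\<lambda>f. \<Sum>b\<in>Basis. f b *\<^sub>R b) \<in> measurable (\<Pi>\<^sub>M b\<in>(Basis::'a set). lborel) borel"
  by measurable
 have [measurable]: "(\<lambda>x::'a. \<Prod>b\<in>Basis. g b (x \<bullet> b)) \<in> borel_measurable borel"
  by measurable
 show "integrable lborel (\<lambda>x. \<Prod>b\<in>Basis. g b (x \<bullet> b))"
  by (subst lborel_eq, subst integrable_distr_eq, measurable)
   (use product_integrable_prod[OF finite_Basis g] in \<open>simp add: eq\<close>)
 show "(LINT x|lborel. (\<Prod>b\<in>Basis. g b (x \<bullet> b))) = (\<Prod>b\<in>Basis. (LINT y|lborel. g b y))"
  by (subst lborel_eq, subst integral_distr, measurable)
   (use product_integral_prod[OF finite_Basis g] in \<open>simp add: eq\<close>)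
qed

lemma integrable_pair_mult:
 fixes f :: "'a::euclidean_space \<Rightarrow> 'c::{real_normed_field, banach, second_countable_topology}" and g :: "'b::euclidean_space \<Rightarrow> 'c"
 assumes f: "integrable lborel f" and g: "integrable lborel g"
 shows "integrable (lborel \<Otimes>\<^sub>M lborel) (\<lambda>(x, y). f x * g y)"
proof -
 have [measurable]: "f \<in> borel_measurable borel" "g \<in> borel_measurable borel" using f g by auto
 show ?thesis
  by (rule lborel_pair.Fubini_integrable)
   (use f g in \<open>auto simp: norm_mult intro!: integrable_mult_left integrable_mult_right\<close>)
qed

text \<open>Fatou's lemma in the form that removes a regularisation. It is used for the damping in
  Plancherel's inequality, for the time scale of the kernel and for the time cutoff.\<close>

lemma nn_integral_limit_le:
 fixes u :: "nat \<Rightarrow> 'a \<Rightarrow> ennreal"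
 assumes "\<And>n. u n \<in> borel_measurable M" "AE x in M. (\<lambda>n. u n x) \<longlonglongrightarrow> v x"
  and "\<And>n. (\<integral>\<^sup>+x. u n x \<partial>M) \<le> C"
 shows "(\<integral>\<^sup>+x. v x \<partial>M) \<le> C"
proof -
 have "(\<integral>\<^sup>+x. v x \<partial>M) = (\<integral>\<^sup>+x. liminf (\<lambda>n. u n x) \<partial>M)"
  by (intro nn_integral_cong_AE) (use assms(2) in \<open>auto intro!: lim_imp_Liminf[symmetric]\<close>)
 also have "\<dots> \<le> liminf (\<lambda>n. \<integral>\<^sup>+x. u n x \<partial>M)"
  by (intro nn_integral_liminf assms)
 also have "\<dots> \<le> C"
  by (rule Liminf_le) (use assms(3) in auto)
 finally show ?thesis .
qed

section \<open>One-dimensional kernels\<close>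

lemma measurable_cis [measurable]: "cis \<in> borel_measurable borel"
 by (intro borel_measurable_continuous_onI continuous_intros)

lemma measurable_cnj [measurable]: "cnj \<in> borel_measurable borel"
 by (intro borel_measurable_continuous_onI continuous_intros)

lemma nn_integral_arctan: "(\<integral>\<^sup>+x. ennreal (1 / (1 + x\<^sup>2)) \<partial>lborel) = ennreal pi"
proof -
 have half: "(\<integral>\<^sup>+x. ennreal (1 / (1 + x\<^sup>2)) * indicator {0..} x \<partial>lborel) = ennreal (pi / 2 - arctan 0)"
  by (rule nn_integral_FTC_atLeast)
   (auto intro!: derivative_eq_intros tendsto_arctan_at_top simp: inverse_eq_divide)
 have "(\<integral>\<^sup>+x. ennreal (1 / (1 + x\<^sup>2)) * indicator {..0} x \<partial>lborel) =
   (\<integral>\<^sup>+x. ennreal (1 / (1 + x\<^sup>2)) * indicator {0..} (0 - x) \<partial>lborel)"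
  by (intro nn_integral_cong) (auto split: split_indicator)
 also have "\<dots> = (\<integral>\<^sup>+x. ennreal (1 / (1 + x\<^sup>2)) * indicator {0..} x \<partial>lborel)"
  using nn_integral_lborel_translate(2)[of "\<lambda>x. ennreal (1 / (1 + x\<^sup>2)) * indicator {0..} x" "0::real"]
  by simp
 finally have "(\<integral>\<^sup>+x. ennreal (1 / (1 + x\<^sup>2)) * indicator {0..} x + ennreal (1 / (1 + x\<^sup>2)) * indicator {..0} x \<partial>lborel) = ennreal (pi / 2) + ennreal (pi / 2)"
  by (subst nn_integral_add) (auto simp: half)
 moreover have "AE x in lborel. ennreal (1 / (1 + x\<^sup>2)) * indicator {0..} x + ennreal (1 / (1 + x\<^sup>2)) * indicator {..0} x = ennreal (1 / (1 + x\<^sup>2))"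
  using AE_lborel_singleton[of "0::real"] by eventually_elim (auto split: split_indicator)
 ultimately show ?thesis
  by (subst (asm) nn_integral_cong_AE) (auto simp flip: ennreal_plus)
qed

text \<open>This integral is the source of the factor \<eta>/|\<xi>| in the slab estimate; with c =
  0 and q = 1 it also gives the mass of the Poisson kernel.\<close>

lemma nn_integral_lorentz:
 assumes "\<eta> > 0" "q > 0"
 shows "(\<integral>\<^sup>+s. ennreal (\<eta>\<^sup>2 / (\<eta>\<^sup>2 + (c + q * s)\<^sup>2)) \<partial>lborel) = ennreal (pi * \<eta> / q)"
proof -
 have "ennreal pi = ennreal \<bar>q / \<eta>\<bar> * (\<integral>\<^sup>+s. ennreal (1 / (1 + (c / \<eta> + q / \<eta> * s)\<^sup>2)) \<partial>lborel)"
  using nn_integral_real_affine[of "\<lambda>x. ennreal (1 / (1 + x\<^sup>2))" "q / \<eta>" "c / \<eta>"] assms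
  by (simp add: nn_integral_arctan)
 moreover have "1 / (1 + (c / \<eta> + q / \<eta> * s)\<^sup>2) = \<eta>\<^sup>2 / (\<eta>\<^sup>2 + (c + q * s)\<^sup>2)" for s
 proof -
  have "1 + (c / \<eta> + q / \<eta> * s)\<^sup>2 = (\<eta>\<^sup>2 + (c + q * s)\<^sup>2) / \<eta>\<^sup>2"
   using assms by (simp add: field_simps power2_eq_square)
  then show ?thesis by simp
 qed
 ultimately have "ennreal (\<eta> / q) * ennreal pi = ennreal (\<eta> / q) * ennreal (q / \<eta>) * (\<integral>\<^sup>+s. ennreal (\<eta>\<^sup>2 / (\<eta>\<^sup>2 + (c + q * s)\<^sup>2)) \<partial>lborel)"
  using assms by (simp add: mult.assoc)
 also have "ennreal (\<eta> / q) * ennreal (q / \<eta>) = 1"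
  using assms by (simp flip: ennreal_mult)
 finally show ?thesis using assms by (simp add: mult.commute flip: ennreal_mult)
qed

text \<open>The Laplace kernel. Integrating along a characteristic against it is the transport
  resolvent at level \<eta>.\<close>

definition half_exp :: "real \<Rightarrow> real \<Rightarrow> real"
 where "half_exp \<eta> r = (if 0 < r then exp (- (\<eta> * r)) else 0)"

lemma half_exp_measurable [measurable]: "half_exp \<eta> \<in> borel_measurable borel"
 unfolding half_exp_def by measurable

lemma half_exp_nonneg: "0 \<le> half_exp \<eta> r"
 by (simp add: half_exp_def)

lemma half_exp_has_integral:
 assumes "\<eta> > 0"
 shows "has_bochner_integral lborel (half_exp \<eta>) (1 / \<eta>)"
proof -
 have "(\<integral>\<^sup>+x. ennreal (exp (- (\<eta> * x))) * indicator {0..} x \<partial>lborel) = ennreal (0 - (- (1 / \<eta>) * exp (- (\<eta> * 0))))"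
 proof (rule nn_integral_FTC_atLeast)
  have "((\<lambda>x. exp (- (\<eta> * x))) \<longlongrightarrow> 0) at_top"
   using assms by (intro filterlim_compose[OF exp_at_bot] filterlim_uminus_at_bot_at_top[THEN filterlim_compose] filterlim_tendsto_pos_mult_at_top[OF tendsto_const] filterlim_ident)
  from tendsto_mult_left[OF this, of "- (1 / \<eta>)"]
  show "((\<lambda>x. - (1 / \<eta>) * exp (- (\<eta> * x))) \<longlongrightarrow> 0) at_top" by simp
 qed (use assms in \<open>auto intro!: derivative_eq_intros\<close>)
 moreover have "AE x in lborel. ennreal (exp (- (\<eta> * x))) * indicator {0..} x = ennreal (half_exp \<eta> x)"
  using AE_lborel_singleton[of "0::real"]
  by eventually_elim (auto simp: half_exp_def split: split_indicator)
 ultimately have "(\<integral>\<^sup>+x. ennreal (half_exp \<eta> x) \<partial>lborel) = ennreal (1 / \<eta>)"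
  by (subst (asm) nn_integral_cong_AE) auto
 then show ?thesis
  using assms by (intro has_bochner_integral_nn_integral) (auto simp: half_exp_nonneg)
qed

lemmas half_exp_integrable = half_exp_has_integral[THEN integrable.intros]
lemmas half_exp_integral = half_exp_has_integral[THEN has_bochner_integral_integral_eq]

lemma half_exp_cis_integrable:
 assumes "\<eta> > 0" shows "integrable lborel (\<lambda>r. complex_of_real (half_exp \<eta> r) * cis (- (r * y)))"
 by (rule Bochner_Integration.integrable_bound[OF half_exp_integrable[OF assms]])
  (auto simp: norm_mult half_exp_nonneg)

text \<open>The antiderivative - exp(-r z) / z vanishes at infinity because Re z = \<eta> > 0; its
  value at 0 is the resolvent symbol.\<close>

lemma half_exp_cis_integral:
 assumes "\<eta> > 0"
 shows "(LINT r|lborel. complex_of_real (half_exp \<eta> r) * cis (- (r * y))) = 1 / (complex_of_real \<eta> + \<i> * complex_of_real y)"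
proof -
 define z where "z = complex_of_real \<eta> + \<i> * complex_of_real y"
 have z: "z \<noteq> 0" "Re z = \<eta>" using assms by (auto simp: z_def complex_eq_iff)
 have e: "exp (- (of_real r * z)) = complex_of_real (exp (- (\<eta> * r))) * cis (- (r * y))" for r
  by (simp add: z_def cis_conv_exp exp_of_real[symmetric] exp_add[symmetric] algebra_simps)
 have ind: "complex_of_real (half_exp \<eta> r) * cis (- (r * y)) = indicator {0<..} r *\<^sub>R exp (- (of_real r * z))" for r
  by (auto simp: e half_exp_def)
 have "(LBINT r=0..\<infinity>. exp (- (of_real r * z))) = 0 - (- (1 / z))"
 proof (rule interval_integral_FTC_integrable)
  fix x :: real
  show "((\<lambda>r. - (1 / z) * exp (- (of_real r * z))) has_vector_derivative exp (- (of_real x * z))) (at x)"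
   using z by (auto intro!: derivative_eq_intros has_vector_derivative_real_field simp: field_simps)
  show "isCont (\<lambda>x. exp (- (complex_of_real x * z))) x" by (intro continuous_intros)
  show "set_integrable lborel (einterval 0 \<infinity>) (\<lambda>x. exp (- (complex_of_real x * z)))"
   unfolding set_integrable_def using half_exp_cis_integrable[OF assms, of y]
   by (simp add: ind einterval_eq zero_ereal_def)
  have "((\<lambda>r. - (1 / z) * exp (- (of_real r * z))) \<longlongrightarrow> - (1 / z) * exp (- (of_real 0 * z))) (at_right 0)"
   by (intro tendsto_intros)
  then show "(((\<lambda>r. - (1 / z) * exp (- (of_real r * z))) \<circ> real_of_ereal) \<longlongrightarrow> - (1 / z)) (at_right 0)"
   unfolding zero_ereal_def ereal_tendsto_simps by simp
  have "((\<lambda>r. exp (- (complex_of_real r * z))) \<longlongrightarrow> 0) at_top"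
  proof (rule tendsto_norm_zero_cancel)
   have "((\<lambda>x. exp (- (\<eta> * x))) \<longlongrightarrow> 0) at_top"
    using assms by (intro filterlim_compose[OF exp_at_bot] filterlim_uminus_at_bot_at_top[THEN filterlim_compose] filterlim_tendsto_pos_mult_at_top[OF tendsto_const] filterlim_ident)
   then show "((\<lambda>r. norm (exp (- (complex_of_real r * z)))) \<longlongrightarrow> 0) at_top"
    by (simp add: z mult.commute)
  qed
  from tendsto_mult_left[OF this, of "- (1 / z)"]
  show "(((\<lambda>r. - (1 / z) * exp (- (of_real r * z))) \<circ> real_of_ereal) \<longlongrightarrow> 0) (at_left \<infinity>)"
   unfolding ereal_tendsto_simps by simp
 qed simp
 then show ?thesis
  unfolding ind z_def[symmetric]
  by (simp add: interval_lebesgue_integral_def set_lebesgue_integral_def einterval_eq zero_ereal_def)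
qed

lemma
 assumes "\<eta> > 0"
 shows exp_abs_integrable: "integrable lborel (\<lambda>r. exp (- (\<eta> * \<bar>r\<bar>)))"
  and exp_abs_cis_integral: "(LINT r|lborel. complex_of_real (exp (- (\<eta> * \<bar>r\<bar>))) * cis (- (r * y))) =
   complex_of_real (2 * \<eta> / (\<eta>\<^sup>2 + y\<^sup>2))"
proof -
 \<comment> \<open>At r = 0 the right-hand side is 0 while the left-hand side is 1, so the identity
   holds only almost everywhere.\<close>
 have AE: "AE r in lborel. exp (- (\<eta> * \<bar>r\<bar>)) = half_exp \<eta> r + half_exp \<eta> (0 - r)"
  using AE_lborel_singleton[of "0::real"] by eventually_elim (auto simp: half_exp_def)
 have "integrable lborel (\<lambda>r. half_exp \<eta> r + half_exp \<eta> (0 - r))"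
  using half_exp_integrable[OF assms] integrable_lborel_translate(2)[OF half_exp_integrable[OF assms], of 0] by auto
 then show "integrable lborel (\<lambda>r. exp (- (\<eta> * \<bar>r\<bar>)))"
  by (rule integrable_cong_AE_imp) (use AE in auto)
 let ?h = "\<lambda>y r. complex_of_real (half_exp \<eta> r) * cis (- (r * y))"
 note hi = half_exp_cis_integrable[OF assms]
 have hi': "integrable lborel (\<lambda>r. ?h (- y) (0 - r))"
  using integrable_lborel_translate(2)[OF hi[of "-y"], of 0] .
 have "(LINT r|lborel. complex_of_real (exp (- (\<eta> * \<bar>r\<bar>))) * cis (- (r * y))) = (LINT r|lborel. ?h y r + ?h (- y) (0 - r))"
  by (rule integral_cong_AE) (use AE in \<open>auto simp: distrib_right\<close>)
 also have "\<dots> = (LINT r|lborel. ?h y r) + (LINT r|lborel. ?h (- y) (0 - r))"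
  by (intro Bochner_Integration.integral_add hi hi')
 also have "(LINT r|lborel. ?h (- y) (0 - r)) = (LINT r|lborel. ?h (- y) r)"
  by (rule integral_lborel_translate(2)) measurable
 also have "(LINT r|lborel. ?h y r) + (LINT r|lborel. ?h (- y) r) =
   1 / (complex_of_real \<eta> + \<i> * complex_of_real y) + 1 / (complex_of_real \<eta> - \<i> * complex_of_real y)"
  unfolding half_exp_cis_integral[OF assms] by simp
 also have "\<dots> = complex_of_real (2 * \<eta> / (\<eta>\<^sup>2 + y\<^sup>2))"
 proof -
  have "complex_of_real \<eta> + \<i> * complex_of_real y \<noteq> 0" "complex_of_real \<eta> - \<i> * complex_of_real y \<noteq> 0"
   using assms by (auto simp: complex_eq_iff)
  moreover have "(complex_of_real \<eta> + \<i> * complex_of_real y) * (complex_of_real \<eta> - \<i> * complex_of_real y) = complex_of_real (\<eta>\<^sup>2 + y\<^sup>2)"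
   by (simp add: algebra_simps power2_eq_square)
  ultimately show ?thesis
   by (simp add: add_frac_eq)
 qed
 finally show "(LINT r|lborel. complex_of_real (exp (- (\<eta> * \<bar>r\<bar>))) * cis (- (r * y))) =
   complex_of_real (2 * \<eta> / (\<eta>\<^sup>2 + y\<^sup>2))" .
qed

section \<open>Fourier transform and Plancherel inequalities\<close>

text \<open>Unlike \<open>fourier\<close> it integrates over \<open>lborel\<close>, where joint
  measurability and Fubini are directly available; \<open>fourier_eq_ft\<close> relates the
  two.\<close>

definition ft :: "('a::euclidean_space \<Rightarrow> complex) \<Rightarrow> 'a \<Rightarrow> complex"
 where "ft g \<xi> = (LINT x|lborel. cis (- (x \<bullet> \<xi>)) * g x)"

lemma ft_integrable:
 assumes "integrable lborel g" shows "integrable lborel (\<lambda>x. cis (- (x \<bullet> \<xi>)) * g x)"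
 by (rule Bochner_Integration.integrable_bound[OF assms]) (use assms in \<open>auto simp: norm_mult\<close>)

lemma ft_measurable [measurable (raw)]:
 fixes g :: "'b \<Rightarrow> 'a::euclidean_space \<Rightarrow> complex"
 assumes [measurable]: "(\<lambda>(z, x). g z x) \<in> borel_measurable (M \<Otimes>\<^sub>M borel)" "\<xi> \<in> borel_measurable M"
 shows "(\<lambda>z. ft (g z) (\<xi> z)) \<in> borel_measurable M"
 unfolding ft_def by measurable

lemma ft_bound:
 assumes "integrable lborel g" shows "norm (ft g \<xi>) \<le> (LINT x|lborel. norm (g x))"
 unfolding ft_def
 by (rule Bochner_Integration.integral_norm_bound_integral)
  (use assms ft_integrable[OF assms] in \<open>auto simp: norm_mult\<close>)

definition decay :: "real \<Rightarrow> 'a::euclidean_space \<Rightarrow> real"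
 where "decay \<epsilon> \<xi> = (\<Prod>b\<in>Basis. exp (- (\<epsilon> * \<bar>\<xi> \<bullet> b\<bar>)))"

text \<open>The Fourier transform of \<open>decay\<close>: a product of one-dimensional Poisson
  kernels of mass 2 pi each. Its positivity reduces Plancherel's upper bound to a Schur
  test.\<close>

definition poisson :: "real \<Rightarrow> 'a::euclidean_space \<Rightarrow> real"
 where "poisson \<epsilon> x = (\<Prod>b\<in>Basis. 2 * \<epsilon> / (\<epsilon>\<^sup>2 + (x \<bullet> b)\<^sup>2))"

lemma decay_measurable [measurable]: "decay \<epsilon> \<in> borel_measurable borel"
 unfolding decay_def by measurable

lemma poisson_measurable [measurable]: "poisson \<epsilon> \<in> borel_measurable borel"
 unfolding poisson_def by measurable

lemma decay_nonneg: "0 \<le> decay \<epsilon> \<xi>"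
 by (simp add: decay_def prod_nonneg)

lemma decay_le_1: "\<epsilon> \<ge> 0 \<Longrightarrow> decay \<epsilon> \<xi> \<le> 1"
 unfolding decay_def by (intro prod_le_1) auto

lemma poisson_nonneg: "\<epsilon> \<ge> 0 \<Longrightarrow> 0 \<le> poisson \<epsilon> x"
 unfolding poisson_def by (intro prod_nonneg) auto

lemma decay_integrable: "\<epsilon> > 0 \<Longrightarrow> integrable lborel (decay \<epsilon>)"
 unfolding decay_def by (intro integrable_lborel_prod exp_abs_integrable)

lemma cis_sum: "finite A \<Longrightarrow> cis (\<Sum>a\<in>A. f a) = (\<Prod>a\<in>A. cis (f a))"
 by (induction A rule: finite_induct) (auto simp: cis_mult[symmetric])

lemma cis_inner: "cis (- (x \<bullet> \<xi>)) = (\<Prod>b\<in>Basis. cis (- ((x \<bullet> b) * (\<xi> \<bullet> b))))"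
 by (subst euclidean_inner) (simp add: cis_sum flip: sum_negf)

text \<open>The rates may differ between coordinates because the smoothing kernel \<open>ker\<close>
  will use one rate in time and another one in space.\<close>

lemma integral_prod_exp_cis:
 fixes \<xi> :: "'a::euclidean_space"
 assumes "\<And>b. b \<in> Basis \<Longrightarrow> l b > 0"
 shows "(LINT x|lborel. cis (- (x \<bullet> \<xi>)) * complex_of_real (\<Prod>b\<in>Basis. exp (- (l b * \<bar>x \<bullet> b\<bar>)))) =
  complex_of_real (\<Prod>b\<in>Basis. 2 * l b / ((l b)\<^sup>2 + (\<xi> \<bullet> b)\<^sup>2))"
proof -
 let ?g = "\<lambda>b r. complex_of_real (exp (- (l b * \<bar>r\<bar>))) * cis (- (r * (\<xi> \<bullet> b)))"
 have "(LINT x|lborel. cis (- (x \<bullet> \<xi>)) * complex_of_real (\<Prod>b\<in>Basis. exp (- (l b * \<bar>x \<bullet> b\<bar>)))) =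
   (LINT x|lborel. (\<Prod>b\<in>Basis. ?g b (x \<bullet> b)))"
  by (simp add: cis_inner prod.distrib mult.commute)
 also have "\<dots> = (\<Prod>b\<in>Basis. (LINT r|lborel. ?g b r))"
 proof (rule integral_lborel_prod)
  fix b :: 'a assume "b \<in> Basis"
  show "integrable lborel (?g b)"
   by (rule Bochner_Integration.integrable_bound[OF exp_abs_integrable[OF assms[OF \<open>b \<in> Basis\<close>]]])
    (auto simp: norm_mult)
 qed
 finally show ?thesis using exp_abs_cis_integral[OF assms] by simp
qed

lemma decay_cis_integral:
 fixes x :: "'a::euclidean_space"
 assumes "\<epsilon> > 0"
 shows "(LINT \<xi>|lborel. cis (- (\<xi> \<bullet> x)) * complex_of_real (decay \<epsilon> \<xi>)) = complex_of_real (poisson \<epsilon> x)"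
 unfolding decay_def poisson_def using assms by (rule integral_prod_exp_cis)

lemma nn_integral_poisson:
 assumes "\<epsilon> > 0"
 shows "(\<integral>\<^sup>+x. ennreal (poisson \<epsilon> x) \<partial>(lborel :: 'a::euclidean_space measure)) = ennreal ((2 * pi) ^ DIM('a))"
proof -
 have 1: "(\<integral>\<^sup>+r. ennreal (2 * \<epsilon> / (\<epsilon>\<^sup>2 + r\<^sup>2)) \<partial>lborel) = ennreal (2 * pi)"
 proof -
  have eq: "2 * \<epsilon> / (\<epsilon>\<^sup>2 + r\<^sup>2) = (2 / \<epsilon>) * (\<epsilon>\<^sup>2 / (\<epsilon>\<^sup>2 + (0 + 1 * r)\<^sup>2))" for r
   using assms by (simp add: power2_eq_square)
  have "(\<integral>\<^sup>+r. ennreal (2 * \<epsilon> / (\<epsilon>\<^sup>2 + r\<^sup>2)) \<partial>lborel) =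
   (\<integral>\<^sup>+r. ennreal (2 / \<epsilon>) * ennreal (\<epsilon>\<^sup>2 / (\<epsilon>\<^sup>2 + (0 + 1 * r)\<^sup>2)) \<partial>lborel)"
   unfolding eq using assms by (intro nn_integral_cong ennreal_mult) auto
  also have "\<dots> = ennreal (2 / \<epsilon>) * (\<integral>\<^sup>+r. ennreal (\<epsilon>\<^sup>2 / (\<epsilon>\<^sup>2 + (0 + 1 * r)\<^sup>2)) \<partial>lborel)"
   by (rule nn_integral_cmult) measurable
  also have "\<dots> = ennreal (2 / \<epsilon>) * ennreal (pi * \<epsilon>)"
   using nn_integral_lorentz[OF assms, of 1 0] by simp
  finally show ?thesis using assms by (simp flip: ennreal_mult)
 qed
 have "(\<integral>\<^sup>+x. ennreal (poisson \<epsilon> x) \<partial>(lborel :: 'a measure)) =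
  (\<integral>\<^sup>+x. (\<Prod>b\<in>Basis. ennreal (2 * \<epsilon> / (\<epsilon>\<^sup>2 + (x \<bullet> b)\<^sup>2))) \<partial>(lborel :: 'a measure))"
  unfolding poisson_def using assms by (intro nn_integral_cong prod_ennreal[symmetric]) auto
 also have "\<dots> = (\<Prod>b\<in>(Basis::'a set). (\<integral>\<^sup>+r. ennreal (2 * \<epsilon> / (\<epsilon>\<^sup>2 + r\<^sup>2)) \<partial>lborel))"
  by (rule nn_integral_lborel_prod[where f = "\<lambda>_ r. 2 * \<epsilon> / (\<epsilon>\<^sup>2 + r\<^sup>2)"]) (use assms in auto)
 also have "\<dots> = ennreal ((2 * pi) ^ DIM('a))"
  by (simp add: 1 ennreal_power)
 finally show ?thesis .
qed

lemma poisson_integrable: "\<epsilon> > 0 \<Longrightarrow> integrable lborel (poisson \<epsilon> :: 'a::euclidean_space \<Rightarrow> real)"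
 and poisson_integral: "\<epsilon> > 0 \<Longrightarrow> (LINT x|lborel. poisson \<epsilon> (x::'a)) = (2 * pi) ^ DIM('a)"
proof -
 assume "\<epsilon> > 0"
 then have "has_bochner_integral lborel (poisson \<epsilon> :: 'a \<Rightarrow> real) ((2 * pi) ^ DIM('a))"
  using nn_integral_poisson[OF \<open>\<epsilon> > 0\<close>, where 'a = 'a]
  by (intro has_bochner_integral_nn_integral) (auto intro!: AE_I2 poisson_nonneg)
 then show "integrable lborel (poisson \<epsilon> :: 'a \<Rightarrow> real)" "(LINT x|lborel. poisson \<epsilon> (x::'a)) = (2 * pi) ^ DIM('a)"
  by (auto simp: has_bochner_integral_iff)
qed

text \<open>The squared modulus is written as a product of two integrals and the frequency is
  integrated first. The factor \<open>decay\<close> makes everything absolutely convergent, which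
  justifies both exchanges.\<close>

lemma poisson_identity:
 fixes g :: "'a::euclidean_space \<Rightarrow> complex"
 assumes g: "integrable lborel g" and \<epsilon>: "\<epsilon> > 0"
 shows "(LINT \<xi>|lborel. complex_of_real (decay \<epsilon> \<xi> * (norm (ft g \<xi>))\<^sup>2)) =
  (LINT x|lborel. g x * (LINT y|lborel. cnj (g y) * complex_of_real (poisson \<epsilon> (x - y))))"
proof -
 have [measurable]: "g \<in> borel_measurable borel" using g by auto
 let ?G = "\<lambda>\<xi>. complex_of_real (decay \<epsilon> \<xi>)"
 have G: "integrable lborel ?G" using decay_integrable[OF \<epsilon>] by auto
 have cg: "integrable lborel (\<lambda>y. cnj (g y))" using g by (simp add: integrable_cnj)
 have cft: "cnj (ft g \<xi>) = (LINT y|lborel. cis (y \<bullet> \<xi>) * cnj (g y))" for \<xi>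
  unfolding ft_def by (subst Bochner_Integration.integral_cnj[symmetric]) (simp add: cis_cnj)
 have "(LINT \<xi>|lborel. complex_of_real (decay \<epsilon> \<xi> * (norm (ft g \<xi>))\<^sup>2)) =
   (LINT \<xi>|lborel. (LINT x|lborel. ?G \<xi> * (cis (- (x \<bullet> \<xi>)) * g x) * cnj (ft g \<xi>)))"
 proof (intro Bochner_Integration.integral_cong refl)
  fix \<xi> :: 'a
  have "(LINT x|lborel. ?G \<xi> * (cis (- (x \<bullet> \<xi>)) * g x) * cnj (ft g \<xi>)) = ?G \<xi> * ft g \<xi> * cnj (ft g \<xi>)"
   by (simp add: ft_def)
  then show "complex_of_real (decay \<epsilon> \<xi> * (norm (ft g \<xi>))\<^sup>2) = (LINT x|lborel. ?G \<xi> * (cis (- (x \<bullet> \<xi>)) * g x) * cnj (ft g \<xi>))"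
   by (simp only: of_real_mult complex_norm_square mult.assoc)
 qed
 also have "\<dots> = (LINT x|lborel. (LINT \<xi>|lborel. ?G \<xi> * (cis (- (x \<bullet> \<xi>)) * g x) * cnj (ft g \<xi>)))"
 proof (rule lborel_pair.Fubini_integral[symmetric])
  have "integrable (lborel \<Otimes>\<^sub>M lborel) (\<lambda>(\<xi>, x). (LINT x|lborel. norm (g x)) *\<^sub>R (?G \<xi> * g x))"
   using integrable_scaleR_right[OF integrable_pair_mult[OF G g], of "LINT x|lborel. norm (g x)"] by (simp add: case_prod_beta')
  then show "integrable (lborel \<Otimes>\<^sub>M lborel) (\<lambda>(\<xi>, x). ?G \<xi> * (cis (- (x \<bullet> \<xi>)) * g x) * cnj (ft g \<xi>))"
  proof (rule Bochner_Integration.integrable_bound)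
   show "AE p in lborel \<Otimes>\<^sub>M lborel. norm (case p of (\<xi>, x) \<Rightarrow> ?G \<xi> * (cis (- (x \<bullet> \<xi>)) * g x) * cnj (ft g \<xi>)) \<le>
    norm (case p of (\<xi>, x) \<Rightarrow> (LINT x|lborel. norm (g x)) *\<^sub>R (?G \<xi> * g x))"
   proof (rule AE_I2)
    fix p :: "'a \<times> 'a"
    obtain \<xi> x where p: "p = (\<xi>, x)" by (cases p)
    have "norm (?G \<xi> * (cis (- (x \<bullet> \<xi>)) * g x) * cnj (ft g \<xi>)) = norm (ft g \<xi>) * norm (?G \<xi> * g x)"
     by (simp add: norm_mult)
    also have "\<dots> \<le> (LINT x|lborel. norm (g x)) * norm (?G \<xi> * g x)"
     by (intro mult_right_mono ft_bound[OF g]) simp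
    also have "\<dots> \<le> norm ((LINT x|lborel. norm (g x)) *\<^sub>R (?G \<xi> * g x))"
     by (simp add: mult_right_mono)
    finally show "norm (case p of (\<xi>, x) \<Rightarrow> ?G \<xi> * (cis (- (x \<bullet> \<xi>)) * g x) * cnj (ft g \<xi>)) \<le>
     norm (case p of (\<xi>, x) \<Rightarrow> (LINT x|lborel. norm (g x)) *\<^sub>R (?G \<xi> * g x))"
     unfolding p by simp
   qed
  qed measurable
 qed
 also have "\<dots> = (LINT x|lborel. g x * (LINT \<xi>|lborel. (LINT y|lborel. ?G \<xi> * cis (- (x \<bullet> \<xi>)) * (cis (y \<bullet> \<xi>) * cnj (g y)))))"
 proof (intro Bochner_Integration.integral_cong refl)
  fix x :: 'a
  have "(LINT \<xi>|lborel. ?G \<xi> * (cis (- (x \<bullet> \<xi>)) * g x) * cnj (ft g \<xi>)) =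
   (LINT \<xi>|lborel. g x * (?G \<xi> * cis (- (x \<bullet> \<xi>)) * cnj (ft g \<xi>)))"
   by (intro Bochner_Integration.integral_cong refl) simp
  then show "(LINT \<xi>|lborel. ?G \<xi> * (cis (- (x \<bullet> \<xi>)) * g x) * cnj (ft g \<xi>)) =
   g x * (LINT \<xi>|lborel. (LINT y|lborel. ?G \<xi> * cis (- (x \<bullet> \<xi>)) * (cis (y \<bullet> \<xi>) * cnj (g y))))"
   by (simp add: cft)
 qed
 also have "\<dots> = (LINT x|lborel. g x * (LINT y|lborel. (LINT \<xi>|lborel. ?G \<xi> * cis (- (x \<bullet> \<xi>)) * (cis (y \<bullet> \<xi>) * cnj (g y)))))"
 proof (rule Bochner_Integration.integral_cong[OF refl], rule arg_cong2[where f = "(*)", OF refl],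
   rule lborel_pair.Fubini_integral[symmetric])
  fix x :: 'a
  show "integrable (lborel \<Otimes>\<^sub>M lborel) (\<lambda>(\<xi>, y). ?G \<xi> * cis (- (x \<bullet> \<xi>)) * (cis (y \<bullet> \<xi>) * cnj (g y)))"
   by (rule Bochner_Integration.integrable_bound[OF integrable_pair_mult[OF G g]])
    (auto simp: norm_mult)
 qed
 also have "\<dots> = (LINT x|lborel. g x * (LINT y|lborel. cnj (g y) * complex_of_real (poisson \<epsilon> (x - y))))"
 proof (rule Bochner_Integration.integral_cong[OF refl], rule arg_cong2[where f = "(*)", OF refl],
   rule Bochner_Integration.integral_cong[OF refl])
  fix x y :: 'a
  have "(LINT \<xi>|lborel. ?G \<xi> * cis (- (x \<bullet> \<xi>)) * (cis (y \<bullet> \<xi>) * cnj (g y))) =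
   (LINT \<xi>|lborel. cnj (g y) * (cis (- (\<xi> \<bullet> (x - y))) * ?G \<xi>))"
   by (intro Bochner_Integration.integral_cong refl)
    (simp add: mult.assoc cis_mult mult.left_commute mult.commute[of _ "cnj _"] inner_commute inner_diff_right)
  then show "(LINT \<xi>|lborel. ?G \<xi> * cis (- (x \<bullet> \<xi>)) * (cis (y \<bullet> \<xi>) * cnj (g y))) = cnj (g y) * complex_of_real (poisson \<epsilon> (x - y))"
   by (simp add: decay_cis_integral[OF \<epsilon>])
 qed
 finally show ?thesis .
qed

section \<open>Plancherel inequalities by Poisson regularisation\<close>

lemma nn_integral_decay_ft:
 fixes g :: "'a::euclidean_space \<Rightarrow> complex"
 assumes g: "integrable lborel g" and \<epsilon>: "\<epsilon> > 0"
 shows "(\<integral>\<^sup>+\<xi>. ennreal (decay \<epsilon> \<xi> * (norm (ft g \<xi>))\<^sup>2) \<partial>lborel) =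
  ennreal (norm (LINT x|lborel. g x * (LINT y|lborel. cnj (g y) * complex_of_real (poisson \<epsilon> (x - y)))))"
proof -
 have [measurable]: "g \<in> borel_measurable borel" using g by auto
 have int: "integrable lborel (\<lambda>\<xi>. decay \<epsilon> \<xi> * (norm (ft g \<xi>))\<^sup>2)"
 proof (rule Bochner_Integration.integrable_bound)
  show "integrable lborel (\<lambda>\<xi>::'a. decay \<epsilon> \<xi> * (LINT x|lborel. norm (g x))\<^sup>2)"
   using decay_integrable[OF \<epsilon>] by auto
 qed (auto simp: decay_nonneg intro!: mult_left_mono power_mono ft_bound[OF g])
 have "(\<integral>\<^sup>+\<xi>. ennreal (decay \<epsilon> \<xi> * (norm (ft g \<xi>))\<^sup>2) \<partial>lborel) =
   ennreal (LINT \<xi>|lborel. decay \<epsilon> \<xi> * (norm (ft g \<xi>))\<^sup>2)"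
  by (rule nn_integral_eq_integral[OF int]) (auto simp: decay_nonneg)
 also have "(LINT \<xi>|lborel. decay \<epsilon> \<xi> * (norm (ft g \<xi>))\<^sup>2) = norm (complex_of_real (LINT \<xi>|lborel. decay \<epsilon> \<xi> * (norm (ft g \<xi>))\<^sup>2))"
  unfolding norm_of_real by (intro abs_of_nonneg[symmetric] integral_nonneg_AE) (auto simp: decay_nonneg)
 finally show ?thesis
  by (simp only: poisson_identity[OF assms, symmetric] integral_complex_of_real)
qed

lemma integrable_Icc [simp]: "integrable lborel (indicat_real {a..b::real})"
 by (intro integrable_real_indicator) (auto simp: emeasure_lborel_Icc_eq)

text \<open>Schur test for the positive kernel \<open>poisson\<close>: |g(x)| |g(y)| is at most half
  the sum of the squares, and integrating out the other variable gives the mass (2 pi)^n. The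
  damping then tends to 1. The bound is informative only when g is square integrable, otherwise the
  right-hand side is infinite.\<close>

theorem plancherel_le:
 fixes g :: "'a::euclidean_space \<Rightarrow> complex"
 assumes g: "integrable lborel g"
 shows "(\<integral>\<^sup>+\<xi>. ennreal ((norm (ft g \<xi>))\<^sup>2) \<partial>lborel) \<le>
  ennreal ((2 * pi) ^ DIM('a)) * (\<integral>\<^sup>+x. ennreal ((norm (g x))\<^sup>2) \<partial>lborel)"
proof (rule nn_integral_limit_le)
 have [measurable]: "g \<in> borel_measurable borel" using g by auto
 let ?e = "\<lambda>n. 1 / real (Suc n)"
 let ?u = "\<lambda>n \<xi>. ennreal (decay (?e n) \<xi> * (norm (ft g \<xi>))\<^sup>2)"
 let ?S = "\<integral>\<^sup>+x. ennreal ((norm (g x))\<^sup>2) \<partial>lborel"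
 show "?u n \<in> borel_measurable lborel" for n by measurable
 show "AE \<xi> in lborel. (\<lambda>n. ?u n \<xi>) \<longlonglongrightarrow> ennreal ((norm (ft g \<xi>))\<^sup>2)"
 proof (rule AE_I2)
  fix \<xi> :: 'a
  have "(\<lambda>n. decay (?e n) \<xi> * (norm (ft g \<xi>))\<^sup>2) \<longlonglongrightarrow> (\<Prod>b\<in>(Basis::'a set). exp (- (0 * \<bar>\<xi> \<bullet> b\<bar>))) * (norm (ft g \<xi>))\<^sup>2"
   unfolding decay_def by (intro tendsto_intros LIMSEQ_Suc[OF lim_1_over_n])
  then show "(\<lambda>n. ?u n \<xi>) \<longlonglongrightarrow> ennreal ((norm (ft g \<xi>))\<^sup>2)"
   by (intro tendsto_ennrealI) simp
 qed
 fix n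
 define \<epsilon> where "\<epsilon> = ?e n"
 have e: "\<epsilon> > 0" by (simp add: \<epsilon>_def)
 let ?P = "\<lambda>x. ennreal (poisson \<epsilon> x)"
 \<comment> \<open>If the integrand is not integrable, the Bochner integral has the default value 0
   and the bound is trivial.\<close>
 have "norm (LINT x|lborel. g x * (LINT y|lborel. cnj (g y) * complex_of_real (poisson \<epsilon> (x - y)))) \<le>
  (\<integral>\<^sup>+x. norm (g x * (LINT y|lborel. cnj (g y) * complex_of_real (poisson \<epsilon> (x - y)))) \<partial>lborel)"
  by (cases "integrable lborel (\<lambda>x. g x * (LINT y|lborel. cnj (g y) * complex_of_real (poisson \<epsilon> (x - y))))")
   (auto intro: integral_norm_bound_ennreal simp: not_integrable_integral_eq)
 also have "\<dots> \<le> (\<integral>\<^sup>+x. (\<integral>\<^sup>+y. ennreal ((1/2) * ((norm (g x))\<^sup>2 + (norm (g y))\<^sup>2)) * ?P (x - y) \<partial>lborel) \<partial>lborel)"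
 proof (intro nn_integral_mono)
  fix x :: 'a
  have "ennreal (norm (LINT y|lborel. cnj (g y) * complex_of_real (poisson \<epsilon> (x - y)))) \<le>
   (\<integral>\<^sup>+y. norm (cnj (g y) * complex_of_real (poisson \<epsilon> (x - y))) \<partial>lborel)"
   by (cases "integrable lborel (\<lambda>y. cnj (g y) * complex_of_real (poisson \<epsilon> (x - y)))")
    (auto intro: integral_norm_bound_ennreal simp: not_integrable_integral_eq)
  then have "ennreal (norm (g x * (LINT y|lborel. cnj (g y) * complex_of_real (poisson \<epsilon> (x - y))))) \<le>
   ennreal (norm (g x)) * (\<integral>\<^sup>+y. norm (cnj (g y) * complex_of_real (poisson \<epsilon> (x - y))) \<partial>lborel)"
   by (auto simp: norm_mult ennreal_mult intro!: mult_left_mono)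
  also have "\<dots> = (\<integral>\<^sup>+y. ennreal (norm (g x)) * norm (cnj (g y) * complex_of_real (poisson \<epsilon> (x - y))) \<partial>lborel)"
   by (rule nn_integral_cmult[symmetric]) measurable
  also have "\<dots> \<le> (\<integral>\<^sup>+y. ennreal ((1/2) * ((norm (g x))\<^sup>2 + (norm (g y))\<^sup>2)) * ?P (x - y) \<partial>lborel)"
  proof (intro nn_integral_mono)
   fix y :: 'a
   have "norm (g x) * norm (g y) \<le> (1/2) * ((norm (g x))\<^sup>2 + (norm (g y))\<^sup>2)"
    using sum_squares_bound[of "norm (g x)" "norm (g y)"] by simp
   then have "norm (g x) * norm (g y) * poisson \<epsilon> (x - y) \<le> (1/2) * ((norm (g x))\<^sup>2 + (norm (g y))\<^sup>2) * poisson \<epsilon> (x - y)"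
    by (intro mult_right_mono poisson_nonneg) (use e in auto)
   then show "ennreal (norm (g x)) * norm (cnj (g y) * complex_of_real (poisson \<epsilon> (x - y))) \<le> ennreal ((1/2) * ((norm (g x))\<^sup>2 + (norm (g y))\<^sup>2)) * ?P (x - y)"
    using poisson_nonneg[OF less_imp_le[OF e], of "x - y"]
    by (simp add: norm_mult mult.assoc flip: ennreal_mult)
  qed
  finally show "ennreal (norm (g x * (LINT y|lborel. cnj (g y) * complex_of_real (poisson \<epsilon> (x - y))))) \<le> (\<integral>\<^sup>+y. ennreal ((1/2) * ((norm (g x))\<^sup>2 + (norm (g y))\<^sup>2)) * ?P (x - y) \<partial>lborel)" .
 qed
 also have "\<dots> = (\<integral>\<^sup>+x. (\<integral>\<^sup>+y. ennreal ((norm (g x))\<^sup>2 / 2) * ?P (x - y) + ennreal ((norm (g y))\<^sup>2 / 2) * ?P (x - y) \<partial>lborel) \<partial>lborel)"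
 proof (intro nn_integral_cong)
  fix x y :: 'a
  have "ennreal ((1/2) * ((norm (g x))\<^sup>2 + (norm (g y))\<^sup>2)) = ennreal ((norm (g x))\<^sup>2 / 2) + ennreal ((norm (g y))\<^sup>2 / 2)"
   by (subst ennreal_plus[symmetric]) (auto simp: field_simps)
  then show "ennreal ((1/2) * ((norm (g x))\<^sup>2 + (norm (g y))\<^sup>2)) * ?P (x - y) =
   ennreal ((norm (g x))\<^sup>2 / 2) * ?P (x - y) + ennreal ((norm (g y))\<^sup>2 / 2) * ?P (x - y)"
   by (simp only: distrib_right)
 qed
 also have "\<dots> = (\<integral>\<^sup>+x. (\<integral>\<^sup>+y. ennreal ((norm (g x))\<^sup>2 / 2) * ?P (x - y) \<partial>lborel) \<partial>lborel) +
  (\<integral>\<^sup>+x. (\<integral>\<^sup>+y. ennreal ((norm (g y))\<^sup>2 / 2) * ?P (x - y) \<partial>lborel) \<partial>lborel)"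
  by (simp add: nn_integral_add)
 also have "(\<integral>\<^sup>+x. (\<integral>\<^sup>+y. ennreal ((norm (g y))\<^sup>2 / 2) * ?P (x - y) \<partial>lborel) \<partial>lborel) =
   (\<integral>\<^sup>+y. (\<integral>\<^sup>+x. ennreal ((norm (g y))\<^sup>2 / 2) * ?P (x - y) \<partial>lborel) \<partial>lborel)"
  by (rule lborel_pair.Fubini') measurable
 also have "(\<integral>\<^sup>+x. (\<integral>\<^sup>+y. ennreal ((norm (g x))\<^sup>2 / 2) * ?P (x - y) \<partial>lborel) \<partial>lborel) = (\<integral>\<^sup>+x. ennreal ((norm (g x))\<^sup>2 / 2) * ennreal ((2 * pi) ^ DIM('a)) \<partial>lborel)"
  by (simp add: nn_integral_cmult nn_integral_lborel_translate(2)[of ?P] nn_integral_poisson[OF e])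
 also have "(\<integral>\<^sup>+y. (\<integral>\<^sup>+x. ennreal ((norm (g y))\<^sup>2 / 2) * ?P (x - y) \<partial>lborel) \<partial>lborel) = (\<integral>\<^sup>+x. ennreal ((norm (g x))\<^sup>2 / 2) * ennreal ((2 * pi) ^ DIM('a)) \<partial>lborel)"
  by (simp add: nn_integral_cmult nn_integral_lborel_translate(3)[of ?P] nn_integral_poisson[OF e])
 also have "(\<integral>\<^sup>+x. ennreal ((norm (g x))\<^sup>2 / 2) * ennreal ((2 * pi) ^ DIM('a)) \<partial>lborel) + (\<integral>\<^sup>+x. ennreal ((norm (g x))\<^sup>2 / 2) * ennreal ((2 * pi) ^ DIM('a)) \<partial>lborel) =
   (\<integral>\<^sup>+x. ennreal ((norm (g x))\<^sup>2 / 2) * ennreal ((2 * pi) ^ DIM('a)) + ennreal ((norm (g x))\<^sup>2 / 2) * ennreal ((2 * pi) ^ DIM('a)) \<partial>lborel)"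
  by (rule nn_integral_add[symmetric]) measurable
 also have "\<dots> = (\<integral>\<^sup>+x. ennreal ((2 * pi) ^ DIM('a)) * ennreal ((norm (g x))\<^sup>2) \<partial>lborel)"
  by (intro nn_integral_cong) (simp flip: ennreal_mult ennreal_plus)
 also have "\<dots> = ennreal ((2 * pi) ^ DIM('a)) * ?S"
  by (rule nn_integral_cmult) measurable
 finally show "(\<integral>\<^sup>+\<xi>. ?u n \<xi> \<partial>lborel) \<le> ennreal ((2 * pi) ^ DIM('a)) * ?S"
  unfolding \<epsilon>_def[symmetric] nn_integral_decay_ft[OF g e] .
qed

text \<open>Measurability gives continuous functions converging off a negligible set. They are
  projected to the ball of radius B and cut off in time, after which dominated convergence
  applies.\<close>

lemma continuous_L1_approximation:
 fixes g :: "real \<Rightarrow> complex"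
 assumes [measurable]: "g \<in> borel_measurable borel" and B: "\<And>x. norm (g x) \<le> B"
  and supp: "\<And>x. x \<notin> {0..T} \<Longrightarrow> g x = 0" and e: "e > 0"
 obtains h where "continuous_on UNIV h" "\<And>x. norm (h x) \<le> B" "\<And>x. x \<notin> {-1..T+1} \<Longrightarrow> h x = 0"
  "(LINT x|lborel. norm (h x - g x)) < e"
proof -
 have "g measurable_on UNIV"
  by (intro lebesgue_measurable_imp_measurable_on) (auto intro: measurable_completion)
 then obtain N h0 where N: "negligible N" and h0: "\<And>n. continuous_on UNIV (h0 n)"
  and lim: "\<And>x. x \<notin> N \<Longrightarrow> (\<lambda>n. h0 n x) \<longlonglongrightarrow> g x"
  unfolding measurable_on_def by force
 have B0: "B \<ge> 0" using B[of 0] norm_ge_zero order_trans by blast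
 \<comment> \<open>The projection onto the ball enforces the bound B, is continuous, and fixes all
   values of g.\<close>
 define pr where "pr = closest_point (cball (0::complex) B)"
 have pr: "continuous_on UNIV pr" "\<And>z. norm (pr z) \<le> B" "\<And>x. pr (g x) = g x"
  unfolding pr_def using B0 B closest_point_in_set[of "cball (0::complex) B"]
  by (auto intro!: continuous_on_closest_point closest_point_self)
 \<comment> \<open>A trapezoid equal to 1 on [0,T], where g may be nonzero, and 0 outside
   [-1,T+1].\<close>
 define tn where "tn x = max 0 (min 1 (min (x + 1) (T + 1 - x)))" for x
 have tn: "0 \<le> tn x" "tn x \<le> 1" "x \<notin> {-1..T+1} \<Longrightarrow> tn x = 0" "x \<in> {0..T} \<Longrightarrow> tn x = 1" for x
  by (auto simp: tn_def)
 have tnc: "continuous_on UNIV tn" unfolding tn_def by (intro continuous_intros)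
 define h where "h n x = tn x *\<^sub>R pr (h0 n x)" for n x
 have hc: "continuous_on UNIV (h n)" for n
  unfolding h_def using continuous_on_compose2[OF pr(1) h0[of n]] tnc by (intro continuous_intros) auto
 have hB: "norm (h n x) \<le> B" for n x
  unfolding h_def using mult_mono[OF tn(2)[of x] pr(2)[of "h0 n x"]] tn(1)[of x] by simp
 have h0': "x \<notin> {-1..T+1} \<Longrightarrow> h n x = 0" for n x
  unfolding h_def by (simp add: tn(3))
 have hm [measurable]: "h n \<in> borel_measurable borel" for n
  by (intro borel_measurable_continuous_onI hc)
 have "(\<lambda>n. LINT x|lborel. norm (h n x - g x)) \<longlonglongrightarrow> (LINT x|(lborel::real measure). 0)"
 proof (rule integral_dominated_convergence[where w = "\<lambda>x. indicator {-1..T+1} x * (2 * B)"])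
  have "AE x in lborel. x \<notin> N"
  proof -
   obtain N' where "N' \<in> null_sets lborel" "N \<subseteq> N'"
    using N unfolding negligible_iff_null_sets null_sets_completion_iff2 by blast
   then show ?thesis using AE_not_in[of N' lborel] by (auto elim!: eventually_mono)
  qed
  then show "AE x in lborel. (\<lambda>n. norm (h n x - g x)) \<longlonglongrightarrow> 0"
  proof eventually_elim
   case (elim x)
   have "isCont pr (g x)" using pr(1) by (simp add: continuous_on_eq_continuous_at)
   then have "(\<lambda>n. h n x) \<longlonglongrightarrow> tn x *\<^sub>R pr (g x)"
    unfolding h_def by (intro tendsto_intros isCont_tendsto_compose[OF _ lim[OF elim]])
   moreover have "tn x *\<^sub>R pr (g x) = g x"
    using tn(4)[of x] supp[of x] by (cases "x \<in> {0..T}") (use pr(3)[of x] in auto)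
   ultimately show ?case by (simp add: LIM_zero tendsto_norm_zero)
  qed
  show "integrable lborel (\<lambda>x. indicator {-1..T+1} x * (2 * B))" by simp
  show "AE x in lborel. norm (norm (h n x - g x)) \<le> indicator {-1..T+1} x * (2 * B)" for n
  proof (rule AE_I2)
   fix x
   have "norm (h n x - g x) \<le> 2 * B" using norm_triangle_ineq4[of "h n x" "g x"] hB[of n x] B[of x] by simp
   then show "norm (norm (h n x - g x)) \<le> indicator {-1..T+1} x * (2 * B)"
    using h0'[of x n] supp[of x] by (cases "x \<in> {-1..T+1}") auto
  qed
 qed measurable
 then have "\<forall>\<^sub>F n in sequentially. (LINT x|lborel. norm (h n x - g x)) < e"
  using e by (auto elim!: order_tendstoD)
 then obtain n where "(LINT x|lborel. norm (h n x - g x)) < e"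
  using eventually_happens by force
 then show thesis using that[of "h n"] hc hB h0' by blast
qed

text \<open>A three-epsilon argument: translation preserves the L^1 distance to the continuous
  approximant, and for the approximant the claim is dominated convergence.\<close>

lemma L1_translation_continuous:
 fixes g :: "real \<Rightarrow> complex"
 assumes [measurable]: "g \<in> borel_measurable borel" and B: "\<And>x. norm (g x) \<le> B"
  and supp: "\<And>x. x \<notin> {0..T} \<Longrightarrow> g x = 0" and d: "d \<longlonglongrightarrow> 0"
 shows "(\<lambda>n. LINT x|lborel. norm (g (x - d n) - g x)) \<longlonglongrightarrow> 0"
proof (rule LIMSEQ_I)
 fix e :: real assume e: "e > 0"
 have B0: "B \<ge> 0" using B[of 0] norm_ge_zero order_trans by blast
 obtain h where h: "continuous_on UNIV h" "\<And>x. norm (h x) \<le> B" "\<And>x. x \<notin> {-1..T+1} \<Longrightarrow> h x = 0"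
  "(LINT x|lborel. norm (h x - g x)) < e / 3"
  by (rule continuous_L1_approximation[of g B T "e/3"]) (use assms e in auto)
 have [measurable]: "h \<in> borel_measurable borel" by (intro borel_measurable_continuous_onI h)
 have gi: "integrable lborel g"
 proof (rule Bochner_Integration.integrable_bound)
  show "integrable lborel (\<lambda>x. indicator {0..T} x * B)" by simp
  show "AE x in lborel. norm (g x) \<le> norm (indicator {0..T} x * B)"
   by (rule AE_I2) (use B supp B0 in \<open>auto split: split_indicator\<close>)
 qed measurable
 have hi: "integrable lborel h"
 proof (rule Bochner_Integration.integrable_bound)
  show "integrable lborel (\<lambda>x. indicator {-1..T+1} x * B)" by simp
  show "AE x in lborel. norm (h x) \<le> norm (indicator {-1..T+1} x * B)"
   by (rule AE_I2) (use h B0 in \<open>auto split: split_indicator\<close>)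
 qed measurable
  \<comment> \<open>A convergent sequence of shifts is bounded, so all translates live in one
    interval, which supplies the dominating function.\<close>
  obtain K0 where K0: "\<And>n. \<bar>d n\<bar> \<le> K0" using d by (metis Bseq_def convergentI convergent_imp_Bseq real_norm_def)
  let ?K = "max K0 0"
 have "(\<lambda>n. LINT x|lborel. norm (h (x - d n) - h x)) \<longlonglongrightarrow> (LINT x|(lborel::real measure). 0)"
 proof (rule integral_dominated_convergence[where w = "\<lambda>x. indicator {-1-?K..T+1+?K} x * (2 * B)"])
  show "AE x in lborel. norm (norm (h (x - d n) - h x)) \<le> indicator {-1-?K..T+1+?K} x * (2 * B)" for n
  proof (rule AE_I2)
   fix x
   have "norm (h (x - d n) - h x) \<le> 2 * B" using norm_triangle_ineq4[of "h (x - d n)" "h x"] h(2)[of x] h(2)[of "x - d n"] by simp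
   moreover have "x \<notin> {-1-?K..T+1+?K} \<Longrightarrow> h (x - d n) = 0 \<and> h x = 0"
    using K0[of n] by (auto intro!: h(3))
   ultimately show "norm (norm (h (x - d n) - h x)) \<le> indicator {-1-?K..T+1+?K} x * (2 * B)"
    by (cases "x \<in> {-1-?K..T+1+?K}") auto
  qed
  show "integrable lborel (\<lambda>x. indicator {-1-?K..T+1+?K} x * (2 * B))" by simp
  show "AE x in lborel. (\<lambda>n. norm (h (x - d n) - h x)) \<longlonglongrightarrow> 0"
  proof (rule AE_I2)
   fix x
   have "(\<lambda>n. x - d n) \<longlonglongrightarrow> x - 0" by (intro tendsto_intros d)
   moreover have "isCont h x" using h(1) by (simp add: continuous_on_eq_continuous_at)
   ultimately have "(\<lambda>n. h (x - d n)) \<longlonglongrightarrow> h x" using isCont_tendsto_compose by fastforce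
   then show "(\<lambda>n. norm (h (x - d n) - h x)) \<longlonglongrightarrow> 0" by (simp add: LIM_zero tendsto_norm_zero)
  qed
 qed measurable
 then have "\<forall>\<^sub>F n in sequentially. (LINT x|lborel. norm (h (x - d n) - h x)) < e / 3"
  by (rule order_tendstoD) (use e in simp)
 then obtain n0 where n0: "\<And>n. n \<ge> n0 \<Longrightarrow> (LINT x|lborel. norm (h (x - d n) - h x)) < e / 3"
  by (auto simp: eventually_sequentially)
 show "\<exists>n0. \<forall>n\<ge>n0. norm ((LINT x|lborel. norm (g (x - d n) - g x)) - 0) < e"
 proof (intro exI allI impI)
  fix n assume "n0 \<le> n"
  have i1: "integrable lborel (\<lambda>x. norm (h x - g x))" using hi gi by auto
  have i2: "integrable lborel (\<lambda>x. norm (h (x - d n) - g (x - d n)))"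
   using integrable_lborel_translate(3)[OF i1, of "d n"] .
  have i3: "integrable lborel (\<lambda>x. norm (h (x - d n) - h x))"
   using integrable_lborel_translate(3)[OF hi, of "d n"] hi by auto
  have "(LINT x|lborel. norm (g (x - d n) - g x)) \<le> (LINT x|lborel. norm (h (x - d n) - g (x - d n)) + norm (h (x - d n) - h x) + norm (h x - g x))"
  proof (rule integral_mono)
   show "integrable lborel (\<lambda>x. norm (g (x - d n) - g x))"
    using integrable_lborel_translate(3)[OF gi, of "d n"] gi by auto
   fix x
   have "g (x - d n) - g x = - (h (x - d n) - g (x - d n)) + (h (x - d n) - h x) + (h x - g x)" by simp
   then show "norm (g (x - d n) - g x) \<le> norm (h (x - d n) - g (x - d n)) + norm (h (x - d n) - h x) + norm (h x - g x)"
    by (metis norm_minus_cancel norm_triangle_mono norm_triangle_ineq order_refl)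
  qed (use i1 i2 i3 in auto)
  also have "\<dots> = (LINT x|lborel. norm (h x - g x)) + (LINT x|lborel. norm (h (x - d n) - h x)) + (LINT x|lborel. norm (h x - g x))"
   using i1 i2 i3 integral_lborel_translate(3)[of "\<lambda>x. norm (h x - g x)" "d n"] by simp
  also have "\<dots> < e" using h(4) n0[OF \<open>n0 \<le> n\<close>] by simp
  finally show "norm ((LINT x|lborel. norm (g (x - d n) - g x)) - 0) < e" by simp
 qed
qed

text \<open>The converse inequality is required in the time variable only, to return from \<tau> to
  t. The Poisson kernels are an approximate identity: after rescaling, the error is at most B times
  the integral of P(z) times the L^1 distance between g and its translate by \<epsilon> z, which
  tends to 0.\<close>

theorem plancherel_ge:
 fixes g :: "real \<Rightarrow> complex"
 assumes [measurable]: "g \<in> borel_measurable borel" and B: "\<And>x. norm (g x) \<le> B"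
  and supp: "\<And>x. x \<notin> {0..T} \<Longrightarrow> g x = 0"
 shows "ennreal (2 * pi) * (\<integral>\<^sup>+x. ennreal ((norm (g x))\<^sup>2) \<partial>lborel) \<le> (\<integral>\<^sup>+\<xi>. ennreal ((norm (ft g \<xi>))\<^sup>2) \<partial>lborel)"
proof -
 let ?e = "\<lambda>n. 1 / real (Suc n)"
 have B0: "B \<ge> 0" using B[of 0] norm_ge_zero order_trans by blast
 have gi: "integrable lborel g"
 proof (rule Bochner_Integration.integrable_bound)
  show "integrable lborel (\<lambda>x. indicator {0..T} x * B)" by simp
  show "AE x in lborel. norm (g x) \<le> norm (indicator {0..T} x * B)"
   by (rule AE_I2) (use B supp B0 in \<open>auto split: split_indicator\<close>)
 qed measurable
 have g2: "integrable lborel (\<lambda>x. (norm (g x))\<^sup>2)"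
 proof (rule Bochner_Integration.integrable_bound)
  show "integrable lborel (\<lambda>x. B * norm (g x))" using gi by simp
  show "AE x in lborel. norm ((norm (g x))\<^sup>2) \<le> norm (B * norm (g x))"
   by (rule AE_I2) (use B B0 in \<open>auto simp: power2_eq_square intro!: mult_right_mono\<close>)
 qed measurable
 let ?P = "poisson 1 :: real \<Rightarrow> real"
 let ?J = "\<lambda>n. LINT x|lborel. g x * (LINT y|lborel. cnj (g y) * complex_of_real (poisson (?e n) (x - y)))"
 let ?L = "LINT x|lborel. (norm (g x))\<^sup>2"
 let ?w = "\<lambda>n z. LINT x|lborel. norm (g (x - ?e n * z) - g x)"
 have pi: "integrable lborel ?P" and pI: "(LINT z|lborel. ?P z) = 2 * pi"
  using poisson_integrable[of 1, where 'a = real] poisson_integral[of 1, where 'a = real] by auto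
 have P0: "0 \<le> ?P z" for z by (rule poisson_nonneg) simp
 have wb: "?w n z \<le> 2 * (LINT x|lborel. norm (g x))" for n z
 proof -
  have "?w n z \<le> (LINT x|lborel. norm (g (x - ?e n * z)) + norm (g x))"
   using gi integrable_lborel_translate(3)[OF gi, of "?e n * z"]
   by (intro integral_mono) (auto intro: norm_triangle_ineq4)
  also have "\<dots> = 2 * (LINT x|lborel. norm (g x))"
   using gi integrable_lborel_translate(3)[OF gi, of "?e n * z"] integral_lborel_translate(3)[of "\<lambda>x. norm (g x)" "?e n * z"]
   by simp
  finally show ?thesis .
 qed
 have J: "norm (?J n - complex_of_real (2 * pi * ?L)) \<le> (LINT z|lborel. B * (?P z * ?w n z))" for n
 proof -
  define \<epsilon> where "\<epsilon> = ?e n"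
  have e: "\<epsilon> > 0" by (simp add: \<epsilon>_def)
  \<comment> \<open>The substitution y = x - \<epsilon> z turns the kernel of width \<epsilon> into
    the fixed kernel of width 1 and moves \<epsilon> into the translation.\<close>
  have scale: "\<epsilon> * poisson \<epsilon> (\<epsilon> * z) = ?P z" for z :: real
  proof -
   have "\<epsilon>\<^sup>2 + (\<epsilon> * z)\<^sup>2 = \<epsilon>\<^sup>2 * (1 + z\<^sup>2)" by (simp add: power_mult_distrib distrib_left)
   then have "\<epsilon> * poisson \<epsilon> (\<epsilon> * z) = (2 * (\<epsilon> * \<epsilon>)) / (\<epsilon>\<^sup>2 * (1 + z\<^sup>2))"
    by (simp add: poisson_def)
   also have "\<dots> = ?P z" using e by (simp add: poisson_def power2_eq_square)
   finally show ?thesis .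
  qed
  have in1: "(LINT y|lborel. cnj (g y) * complex_of_real (poisson \<epsilon> (x - y))) = (LINT z|lborel. cnj (g (x - \<epsilon> * z)) * complex_of_real (?P z))" for x
  proof -
   have "(LINT y|lborel. cnj (g y) * complex_of_real (poisson \<epsilon> (x - y))) =
     \<bar>- \<epsilon>\<bar> *\<^sub>R (LINT z|lborel. cnj (g (x + - \<epsilon> * z)) * complex_of_real (poisson \<epsilon> (x - (x + - \<epsilon> * z))))"
    by (rule lborel_integral_real_affine) (use e in auto)
   also have "\<dots> = (LINT z|lborel. \<epsilon> *\<^sub>R (cnj (g (x - \<epsilon> * z)) * complex_of_real (poisson \<epsilon> (\<epsilon> * z))))"
    using e by simp
   also have "\<dots> = (LINT z|lborel. cnj (g (x - \<epsilon> * z)) * complex_of_real (?P z))"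
    by (intro Bochner_Integration.integral_cong refl) (simp add: scaleR_conv_of_real flip: scale)
   finally show ?thesis .
  qed
  have i1: "integrable (lborel \<Otimes>\<^sub>M lborel) (\<lambda>(x, z). g x * (cnj (g (x - \<epsilon> * z)) * complex_of_real (?P z)))"
  proof (rule Bochner_Integration.integrable_bound)
   show "integrable (lborel \<Otimes>\<^sub>M lborel) (\<lambda>(x, z). complex_of_real B * (g x * complex_of_real (?P z)))"
    using integrable_pair_mult[OF gi, of "\<lambda>z. complex_of_real (?P z)"] pi by (simp add: case_prod_beta')
   show "AE p in lborel \<Otimes>\<^sub>M lborel. norm (case p of (x, z) \<Rightarrow> g x * (cnj (g (x - \<epsilon> * z)) * complex_of_real (?P z))) \<le>
     norm (case p of (x, z) \<Rightarrow> complex_of_real B * (g x * complex_of_real (?P z)))"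
    by (rule AE_I2) (use B B0 in \<open>auto simp: norm_mult mult.left_commute[of B] intro!: mult_left_mono mult_right_mono\<close>)
  qed measurable
  have "?J n = (LINT x|lborel. (LINT z|lborel. g x * (cnj (g (x - \<epsilon> * z)) * complex_of_real (?P z))))"
   unfolding \<epsilon>_def[symmetric] in1 by simp
  also have "\<dots> = (LINT z|lborel. (LINT x|lborel. g x * (cnj (g (x - \<epsilon> * z)) * complex_of_real (?P z))))"
   by (rule lborel_pair.Fubini_integral[symmetric, OF i1])
  finally have Jn: "?J n = (LINT z|lborel. (LINT x|lborel. g x * (cnj (g (x - \<epsilon> * z)) * complex_of_real (?P z))))" .
  have Ln: "complex_of_real (2 * pi * ?L) = (LINT z|lborel. complex_of_real (?P z) * complex_of_real ?L)"
   using pi by (simp add: pI flip: of_real_mult)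
  have Ji: "integrable lborel (\<lambda>z. (LINT x|lborel. g x * (cnj (g (x - \<epsilon> * z)) * complex_of_real (?P z))))"
   using lborel_pair.integrable_snd[OF i1] by simp
  have Li: "integrable lborel (\<lambda>z. complex_of_real (?P z) * complex_of_real ?L)" using pi by simp
  have "?J n - complex_of_real (2 * pi * ?L) = (LINT z|lborel. (LINT x|lborel. g x * (cnj (g (x - \<epsilon> * z)) * complex_of_real (?P z))) - complex_of_real (?P z) * complex_of_real ?L)"
   unfolding Jn Ln using Bochner_Integration.integral_diff[OF Ji Li] by simp
  also have "norm \<dots> \<le> (LINT z|lborel. B * (?P z * ?w n z))"
  proof (rule Bochner_Integration.integral_norm_bound_integral)
   show "integrable lborel (\<lambda>z. B * (?P z * ?w n z))"
   proof (rule integrable_mult_right, rule Bochner_Integration.integrable_bound)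
    show "integrable lborel (\<lambda>z. ?P z * (2 * (LINT x|lborel. norm (g x))))" using pi by simp
    show "AE z in lborel. norm (?P z * ?w n z) \<le> norm (?P z * (2 * (LINT x|lborel. norm (g x))))"
     by (rule AE_I2) (use wb[of n] P0 in \<open>auto simp: abs_mult intro!: mult_left_mono order_trans[OF _ abs_ge_self]\<close>)
   qed measurable
   show "integrable lborel (\<lambda>z. (LINT x|lborel. g x * (cnj (g (x - \<epsilon> * z)) * complex_of_real (?P z))) - complex_of_real (?P z) * complex_of_real ?L)"
    using Ji Li by simp
   fix z :: real
   have t: "integrable lborel (\<lambda>x. g x * cnj (g (x - \<epsilon> * z)))"
   proof (rule Bochner_Integration.integrable_bound)
    show "integrable lborel (\<lambda>x. B * norm (g x))" using gi by simp
    show "AE x in lborel. norm (g x * cnj (g (x - \<epsilon> * z))) \<le> norm (B * norm (g x))"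
     by (rule AE_I2) (use B B0 in \<open>auto simp: norm_mult mult.commute[of B] intro!: mult_left_mono\<close>)
   qed measurable
   have t2: "integrable lborel (\<lambda>x. g x * cnj (g x))"
   proof (rule Bochner_Integration.integrable_bound[OF g2])
    show "AE x in lborel. norm (g x * cnj (g x)) \<le> norm ((norm (g x))\<^sup>2)"
     by (rule AE_I2) (auto simp: norm_mult power2_eq_square)
   qed measurable
   have L: "complex_of_real ?L = (LINT x|lborel. g x * cnj (g x))"
    by (simp add: complex_norm_square[symmetric] del: of_real_power)
   have "(LINT x|lborel. g x * (cnj (g (x - \<epsilon> * z)) * complex_of_real (?P z))) =
    (LINT x|lborel. complex_of_real (?P z) * (g x * cnj (g (x - \<epsilon> * z))))"
    by (intro Bochner_Integration.integral_cong refl) simp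
   also have "\<dots> = complex_of_real (?P z) * (LINT x|lborel. g x * cnj (g (x - \<epsilon> * z)))"
    by (rule integral_mult_right_zero)
   finally have eq: "(LINT x|lborel. g x * (cnj (g (x - \<epsilon> * z)) * complex_of_real (?P z))) - complex_of_real (?P z) * complex_of_real ?L =
    complex_of_real (?P z) * (LINT x|lborel. g x * cnj (g (x - \<epsilon> * z)) - g x * cnj (g x))"
    unfolding L Bochner_Integration.integral_diff[OF t t2] by (simp only: right_diff_distrib)
   have "norm (complex_of_real (?P z) * (LINT x|lborel. g x * cnj (g (x - \<epsilon> * z)) - g x * cnj (g x))) = ?P z * norm (LINT x|lborel. g x * cnj (g (x - \<epsilon> * z)) - g x * cnj (g x))"
    using poisson_nonneg[of 1 z] by (simp add: norm_mult)
   also have "\<dots> \<le> ?P z * (LINT x|lborel. B * norm (g (x - \<epsilon> * z) - g x))"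
   proof (intro mult_left_mono Bochner_Integration.integral_norm_bound_integral)
    show "integrable lborel (\<lambda>x. B * norm (g (x - \<epsilon> * z) - g x))"
     using gi integrable_lborel_translate(3)[OF gi, of "\<epsilon> * z"] by simp
    show "norm (g x * cnj (g (x - \<epsilon> * z)) - g x * cnj (g x)) \<le> B * norm (g (x - \<epsilon> * z) - g x)" for x
    proof -
     have "norm (g x * cnj (g (x - \<epsilon> * z)) - g x * cnj (g x)) = norm (g x) * norm (g (x - \<epsilon> * z) - g x)"
      by (simp flip: right_diff_distrib complex_cnj_diff add: norm_mult)
     then show ?thesis using B by (simp add: mult_right_mono)
    qed
   qed (use t t2 poisson_nonneg[of 1 z] in auto)
   also have "\<dots> = B * (?P z * ?w n z)"
    by (simp add: \<epsilon>_def)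
   finally show "norm ((LINT x|lborel. g x * (cnj (g (x - \<epsilon> * z)) * complex_of_real (?P z))) - complex_of_real (?P z) * complex_of_real ?L) \<le> B * (?P z * ?w n z)"
    unfolding eq .
  qed
  finally show ?thesis .
 qed
 \<comment> \<open>Dominated convergence in z: the translation error is at most twice the L^1 norm
   of g, and the Poisson kernel is integrable.\<close>
 have lim0: "(\<lambda>n. LINT z|lborel. B * (?P z * ?w n z)) \<longlonglongrightarrow> (LINT z|(lborel::real measure). 0)"
 proof (rule integral_dominated_convergence[where w = "\<lambda>z. B * (?P z * (2 * (LINT x|lborel. norm (g x))))"])
  show "integrable lborel (\<lambda>z. B * (?P z * (2 * (LINT x|lborel. norm (g x)))))" using pi by simp
  show "AE z in lborel. norm (B * (?P z * ?w n z)) \<le> B * (?P z * (2 * (LINT x|lborel. norm (g x))))" for n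
   by (rule AE_I2) (use wb[of n] B0 P0 in \<open>auto simp: abs_mult intro!: mult_left_mono\<close>)
  show "AE z in lborel. (\<lambda>n. B * (?P z * ?w n z)) \<longlonglongrightarrow> 0"
  proof (rule AE_I2)
   fix z
   have "(\<lambda>n. ?e n * z) \<longlonglongrightarrow> 0 * z" by (intro tendsto_intros LIMSEQ_Suc[OF lim_1_over_n])
   then have "(\<lambda>n. ?w n z) \<longlonglongrightarrow> 0"
    using L1_translation_continuous[of g B T "\<lambda>n. ?e n * z"] assms by simp
   then show "(\<lambda>n. B * (?P z * ?w n z)) \<longlonglongrightarrow> 0"
    by (intro tendsto_mult_right_zero)
  qed
 qed measurable
 have "?J \<longlonglongrightarrow> complex_of_real (2 * pi * ?L)"
  by (rule LIM_zero_cancel, rule Lim_null_comparison[OF _ lim0[simplified]]) (use J in \<open>auto intro!: always_eventually\<close>)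
 then have limJ: "(\<lambda>n. ennreal (norm (?J n))) \<longlonglongrightarrow> ennreal (norm (complex_of_real (2 * pi * ?L)))"
  by (intro tendsto_ennrealI tendsto_norm)
 have bndJ: "ennreal (norm (?J n)) \<le> (\<integral>\<^sup>+\<xi>. ennreal ((norm (ft g \<xi>))\<^sup>2) \<partial>lborel)" for n
 proof -
  have "ennreal (norm (?J n)) = (\<integral>\<^sup>+\<xi>. ennreal (decay (?e n) \<xi> * (norm (ft g \<xi>))\<^sup>2) \<partial>lborel)"
   by (rule nn_integral_decay_ft[symmetric, OF gi]) simp
  also have "\<dots> \<le> (\<integral>\<^sup>+\<xi>. ennreal ((norm (ft g \<xi>))\<^sup>2) \<partial>lborel)"
   by (intro nn_integral_mono ennreal_leI mult_left_le_one_le decay_nonneg decay_le_1) auto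
  finally show ?thesis .
 qed
 have "ennreal (norm (complex_of_real (2 * pi * ?L))) \<le> (\<integral>\<^sup>+\<xi>. ennreal ((norm (ft g \<xi>))\<^sup>2) \<partial>lborel)"
  by (rule LIMSEQ_le_const2[OF limJ]) (use bndJ in blast)
 moreover have "norm (complex_of_real (2 * pi * ?L)) = 2 * pi * ?L"
  unfolding norm_of_real by (intro abs_of_nonneg mult_nonneg_nonneg integral_nonneg_AE) auto
 moreover have "(\<integral>\<^sup>+x. ennreal ((norm (g x))\<^sup>2) \<partial>lborel) = ennreal ?L"
  by (rule nn_integral_eq_integral[OF g2]) auto
 ultimately show ?thesis by (simp add: ennreal_mult[symmetric] integral_nonneg_AE del: of_real_mult)
qed

section \<open>Distributional Fourier transforms\<close>

lemma schwartz_borel: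
 assumes "schwartz \<phi>" shows "\<phi> \<in> borel_measurable borel"
proof -
 have "iterated_partial [] \<phi> differentiable_on UNIV"
  using assms unfolding schwartz_def smooth_def by blast
 then show ?thesis
  by (intro borel_measurable_continuous_onI differentiable_imp_continuous_on) simp
qed

text \<open>The product of the factors 1 + (x . b)^2 is at most (1 + |x|^2)^DIM, which decay of
  order 2 DIM absorbs. Hence a Schwartz function is dominated by a multiple of
  \<open>poisson 1\<close>, already known to be integrable.\<close>

lemma schwartz_integrable:
 fixes \<phi> :: "'a::euclidean_space \<Rightarrow> complex"
 assumes "schwartz \<phi>" shows "integrable lborel \<phi>"
proof -
 let ?d = "DIM('a)"
 have dec: "\<exists>C. \<forall>x. norm x ^ k * norm (\<phi> x) \<le> C" for k
  using assms unfolding schwartz_def by (metis iterated_partial.simps(1) lists.Nil)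
 obtain A where A: "\<And>x. norm (\<phi> x) \<le> A" using dec[of 0] by auto
 obtain B where B: "\<And>x. norm x ^ (2 * ?d) * norm (\<phi> x) \<le> B" using dec by blast
 have "norm (\<phi> x) \<le> 2 ^ ?d * (A + B) * poisson 1 x" for x
 proof -
  have "(1 + (norm x)\<^sup>2) ^ ?d \<le> (2 * max 1 ((norm x)\<^sup>2)) ^ ?d"
   by (intro power_mono) auto
  also have "\<dots> = 2 ^ ?d * max 1 ((norm x)\<^sup>2) ^ ?d" by (simp add: power_mult_distrib)
  also have "\<dots> \<le> 2 ^ ?d * (1 + norm x ^ (2 * ?d))"
   by (intro mult_left_mono) (auto simp: max_def power_mult)
  finally have "(1 + (norm x)\<^sup>2) ^ ?d * norm (\<phi> x) \<le> 2 ^ ?d * (1 + norm x ^ (2 * ?d)) * norm (\<phi> x)"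
   by (intro mult_right_mono) auto
  also have "\<dots> = 2 ^ ?d * (norm (\<phi> x) + norm x ^ (2 * ?d) * norm (\<phi> x))" by (simp add: algebra_simps)
  also have "\<dots> \<le> 2 ^ ?d * (A + B)" using A[of x] B[of x] by (intro mult_left_mono add_mono) auto
  finally have 1: "(1 + (norm x)\<^sup>2) ^ ?d * norm (\<phi> x) \<le> 2 ^ ?d * (A + B)" .
  have "(\<Prod>b\<in>(Basis::'a set). 1 + (x \<bullet> b)\<^sup>2) \<le> (\<Prod>b\<in>(Basis::'a set). 1 + (norm x)\<^sup>2)"
   by (intro prod_mono) (auto intro!: power_mono[OF Basis_le_norm, THEN order_trans[rotated], of _ x] simp: abs_le_square_iff[symmetric] Basis_le_norm)
  then have "(\<Prod>b\<in>(Basis::'a set). 1 + (x \<bullet> b)\<^sup>2) * norm (\<phi> x) \<le> 2 ^ ?d * (A + B)"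
   by (intro order_trans[OF mult_right_mono 1]) auto
  moreover have pos: "(\<Prod>b\<in>(Basis::'a set). 1 + (x \<bullet> b)\<^sup>2) > 0"
   by (intro prod_pos) (simp add: add_pos_nonneg)
  ultimately have "norm (\<phi> x) \<le> 2 ^ ?d * (A + B) / (\<Prod>b\<in>(Basis::'a set). 1 + (x \<bullet> b)\<^sup>2)"
   by (simp add: field_simps)
  also have "\<dots> \<le> 2 ^ ?d * (A + B) * poisson 1 x"
  proof -
   have "1 / (\<Prod>b\<in>(Basis::'a set). 1 + (x \<bullet> b)\<^sup>2) = (\<Prod>b\<in>(Basis::'a set). 1 / (1 + (x \<bullet> b)\<^sup>2))"
    by (simp add: prod_dividef)
   also have "\<dots> \<le> poisson 1 x"
    unfolding poisson_def by (intro prod_mono) (auto simp: divide_right_mono)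
   finally have "1 / (\<Prod>b\<in>(Basis::'a set). 1 + (x \<bullet> b)\<^sup>2) \<le> poisson 1 x" .
   moreover have "0 \<le> 2 ^ ?d * (A + B)"
   proof -
    have "0 \<le> A" using A[of 0] norm_ge_zero order_trans by blast
    moreover have "0 \<le> B" using B[of 0] by (auto intro: order_trans[rotated])
    ultimately show ?thesis by simp
   qed
   ultimately show ?thesis using mult_left_mono by fastforce
  qed
  finally show ?thesis .
 qed
 note bd = this
 show ?thesis
 proof (rule Bochner_Integration.integrable_bound)
  show "integrable lborel (\<lambda>x::'a. 2 ^ ?d * (A + B) * poisson 1 x)"
   using poisson_integrable[of 1, where 'a = 'a] by simp
  show "AE x in lborel. norm (\<phi> x) \<le> norm (2 ^ ?d * (A + B) * poisson 1 x)"
   by (rule AE_I2) (use bd in \<open>auto intro: order_trans[OF _ abs_ge_self]\<close>)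
 qed (use schwartz_borel[OF assms] in simp)
qed

lemma fourier_eq_ft:
 assumes [measurable]: "\<phi> \<in> borel_measurable borel"
 shows "fourier \<phi> \<xi> = ft \<phi> \<xi>"
proof -
 have "exp (- \<i> * complex_of_real r) = cis (- r)" for r by (simp add: cis_conv_exp)
 then show ?thesis
  unfolding fourier_def ft_def by (simp add: integral_completion)
qed

lemma ft_multiplication:
 fixes w \<phi> :: "'a::euclidean_space \<Rightarrow> complex"
 assumes w: "integrable lborel w" and p: "integrable lborel \<phi>"
 shows "(LINT x|lborel. w x * ft \<phi> x) = (LINT \<xi>|lborel. ft w \<xi> * \<phi> \<xi>)"
  and "integrable lborel (\<lambda>x. w x * ft \<phi> x)" and "integrable lborel (\<lambda>\<xi>. ft w \<xi> * \<phi> \<xi>)"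
proof -
 have [measurable]: "w \<in> borel_measurable borel" "\<phi> \<in> borel_measurable borel" using w p by auto
 have i: "integrable (lborel \<Otimes>\<^sub>M lborel) (\<lambda>(x, \<xi>). w x * (cis (- (\<xi> \<bullet> x)) * \<phi> \<xi>))"
  by (rule Bochner_Integration.integrable_bound[OF integrable_pair_mult[OF w p]])
   (auto simp: norm_mult)
 have "(LINT x|lborel. w x * ft \<phi> x) = (LINT x|lborel. (LINT \<xi>|lborel. w x * (cis (- (\<xi> \<bullet> x)) * \<phi> \<xi>)))"
  by (simp add: ft_def)
 also have "\<dots> = (LINT \<xi>|lborel. (LINT x|lborel. w x * (cis (- (\<xi> \<bullet> x)) * \<phi> \<xi>)))"
  by (rule lborel_pair.Fubini_integral[symmetric, OF i])
 also have "\<dots> = (LINT \<xi>|lborel. (LINT x|lborel. (cis (- (x \<bullet> \<xi>)) * w x) * \<phi> \<xi>))"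
  by (simp add: inner_commute mult_ac)
 also have "\<dots> = (LINT \<xi>|lborel. ft w \<xi> * \<phi> \<xi>)"
  by (simp add: ft_def)
 finally show "(LINT x|lborel. w x * ft \<phi> x) = (LINT \<xi>|lborel. ft w \<xi> * \<phi> \<xi>)" .
 show "integrable lborel (\<lambda>x. w x * ft \<phi> x)"
  using integrable_mult_left[of "LINT x|lborel. norm (\<phi> x)" lborel "\<lambda>x. complex_of_real (norm (w x))"] w
  by (rule_tac Bochner_Integration.integrable_bound[where f = "\<lambda>x. norm (w x) * (LINT x|lborel. norm (\<phi> x))"])
   (auto simp: norm_mult intro!: AE_I2 mult_left_mono ft_bound[OF p])
 show "integrable lborel (\<lambda>\<xi>. ft w \<xi> * \<phi> \<xi>)"
  using p
  by (rule_tac Bochner_Integration.integrable_bound[where f = "\<lambda>x. (LINT x|lborel. norm (w x)) * norm (\<phi> x)"])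
   (auto simp: norm_mult intro!: AE_I2 mult_right_mono ft_bound[OF w])
qed

text \<open>The given function need not be Borel; agreement almost everywhere with an integrable
  Borel function is enough, because the tempered definition only sees integrals.\<close>

lemma has_fourier_transform_ft:
 fixes u w :: "'a::euclidean_space \<Rightarrow> real"
 assumes w: "integrable lborel w" and AE: "AE x in lborel. u x = w x"
 shows "has_fourier_transform u (ft (\<lambda>x. complex_of_real (w x)))"
 unfolding has_fourier_transform_def
proof (intro allI impI)
 fix \<phi> :: "'a \<Rightarrow> complex" assume "schwartz \<phi>"
 then have p [measurable]: "\<phi> \<in> borel_measurable borel" and pi: "integrable lborel \<phi>"
  using schwartz_borel schwartz_integrable by auto
 have [measurable]: "w \<in> borel_measurable borel" using w by auto
 let ?w = "\<lambda>x. complex_of_real (w x)"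
 have wi: "integrable lborel ?w" using w by simp
 note m = ft_multiplication[OF wi pi]
 have 1: "integrable lebesgue (\<lambda>x. ?w x * fourier \<phi> x)"
  using m(2) by (simp add: fourier_eq_ft[OF p] integrable_completion)
 have 2: "integrable lebesgue (\<lambda>\<xi>. ft ?w \<xi> * \<phi> \<xi>)"
  using m(3) by (simp add: integrable_completion)
 have ae: "AE x in lebesgue. ?w x * fourier \<phi> x = complex_of_real (u x) * fourier \<phi> x"
  using AE_completion[OF AE] by eventually_elim simp
 have ms: "(\<lambda>x. complex_of_real (u x) * fourier \<phi> x) \<in> borel_measurable lebesgue"
  by (rule borel_measurable_AE[OF borel_measurable_integrable[OF 1] ae])
 have 3: "integrable lebesgue (\<lambda>x. complex_of_real (u x) * fourier \<phi> x)"
  by (rule integrable_cong_AE_imp[OF 1 ms]) (use ae in \<open>auto elim: eventually_mono\<close>)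
 have "(LINT x|lebesgue. complex_of_real (u x) * fourier \<phi> x) = (LINT x|lebesgue. ?w x * fourier \<phi> x)"
  by (rule integral_cong_AE[OF ms borel_measurable_integrable[OF 1]]) (use ae in \<open>auto elim: eventually_mono\<close>)
 also have "\<dots> = (LINT \<xi>|lebesgue. ft ?w \<xi> * \<phi> \<xi>)"
  by (simp add: fourier_eq_ft[OF p] integral_completion m(1))
 finally show "integrable lebesgue (\<lambda>x. complex_of_real (u x) * fourier \<phi> x) \<and>
   integrable lebesgue (\<lambda>\<xi>. ft ?w \<xi> * \<phi> \<xi>) \<and>
   (LINT x|lebesgue. complex_of_real (u x) * fourier \<phi> x) = (LINT \<xi>|lebesgue. ft ?w \<xi> * \<phi> \<xi>)"
  using 2 3 by simp
qed

lemma enn2real_inj_finite: "a \<noteq> \<infinity> \<Longrightarrow> b \<noteq> \<infinity> \<Longrightarrow> enn2real a = enn2real b \<Longrightarrow> a = b"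
 by (cases a rule: ennreal_cases; cases b rule: ennreal_cases) auto

text \<open>The positive and negative parts are densities of two measures that agree, with finite
  values, on the boxes. Boxes are stable under intersection and generate the Borel sets, so the
  measures and then the densities coincide.\<close>

lemma AE_zero_of_box_integrals:
 fixes f :: "'a::euclidean_space \<Rightarrow> real"
 assumes f [measurable]: "f \<in> borel_measurable borel"
  and int: "\<And>p q. integrable lborel (\<lambda>x. indicator (box p q) x * f x)"
  and zero: "\<And>p q. (LINT x|lborel. indicator (box p q) x * f x) = 0"
 shows "AE x in lborel. f x = 0"
proof -
 let ?M = "density lborel (\<lambda>x. ennreal (f x))" and ?N = "density lborel (\<lambda>x. ennreal (- f x))"
 have box: "emeasure ?M (box p q) = emeasure ?N (box p q)" "emeasure ?M (box p q) \<noteq> \<infinity>" for p q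
 proof -
  let ?g = "\<lambda>x. indicator (box p q) x * f x"
  have M: "emeasure ?M (box p q) = (\<integral>\<^sup>+x. ennreal (?g x) \<partial>lborel)"
   by (subst emeasure_density) (auto intro!: nn_integral_cong split: split_indicator)
  have N: "emeasure ?N (box p q) = (\<integral>\<^sup>+x. ennreal (- ?g x) \<partial>lborel)"
   by (subst emeasure_density) (auto intro!: nn_integral_cong split: split_indicator)
  \<comment> \<open>Finiteness permits passing from a vanishing difference to equality of the two
    extended integrals.\<close>
  have fin: "(\<integral>\<^sup>+x. ennreal (?g x) \<partial>lborel) \<noteq> \<infinity>" "(\<integral>\<^sup>+x. ennreal (- ?g x) \<partial>lborel) \<noteq> \<infinity>"
   using int[of p q] by (auto simp: real_integrable_def)
  then show "emeasure ?M (box p q) \<noteq> \<infinity>" using M by simp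
  have "enn2real (\<integral>\<^sup>+x. ennreal (?g x) \<partial>lborel) = enn2real (\<integral>\<^sup>+x. ennreal (- ?g x) \<partial>lborel)"
   using zero[of p q] unfolding real_lebesgue_integral_def[OF int] by simp
  then show "emeasure ?M (box p q) = emeasure ?N (box p q)"
   unfolding M N by (rule enn2real_inj_finite[OF fin])
 qed
 have "?M = ?N"
 proof (rule measure_eqI_generator_eq)
  let ?E = "range (\<lambda>(a, b). box a b::'a set)"
  show "Int_stable ?E" by (auto simp: Int_stable_def box_Int_box)
  show "?E \<subseteq> Pow UNIV" "sets ?M = sigma_sets UNIV ?E" "sets ?N = sigma_sets UNIV ?E"
   by (simp_all add: borel_eq_box)
  let ?A = "\<lambda>n::nat. box (- (real n *\<^sub>R One)) (real n *\<^sub>R One) :: 'a set"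
  show "range ?A \<subseteq> ?E" "(\<Union>i. ?A i) = UNIV" unfolding UN_box_eq_UNIV by auto
  show "emeasure ?M (?A i) \<noteq> \<infinity>" for i by (rule box)
  show "emeasure ?M X = emeasure ?N X" if "X \<in> ?E" for X using that box by auto
 qed
 then have "AE x in lborel. ennreal (f x) = ennreal (- f x)"
  by (intro sigma_finite_measure.density_unique[OF sigma_finite_lborel]) auto
 then show ?thesis
 proof eventually_elim
  case (elim x)
  \<comment> \<open>\<open>ennreal\<close> sends negative numbers to 0, so equality only says that
    the positive parts of f x and - f x agree; this forces f x = 0.\<close>
  then have "max 0 (f x) = max 0 (- f x)"
   by (metis ennreal_inj max.cobounded1 ennreal_max_0)
  then show ?case by (auto simp: max_def split: if_splits)
 qed
qed

lemma box_bump_limit: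
 "(\<lambda>k. box_bump (real (Suc k)) a c x) \<longlonglongrightarrow> (if a < x \<and> x < c then 1 else 0)"
proof (cases "a < x \<and> x < c")
 case True
 have f: "(\<lambda>k. flat (real (Suc k) * y)) \<longlonglongrightarrow> 1" if "y > 0" for y
 proof -
  have "(\<lambda>k. exp (- (1 / real (Suc k) * (1 / y)))) \<longlonglongrightarrow> exp (- (0 * (1 / y)))"
   by (intro tendsto_intros LIMSEQ_Suc[OF lim_1_over_n])
  moreover have "flat (real (Suc k) * y) = exp (- (1 / real (Suc k) * (1 / y)))" for k
   using that by (simp add: flat_def del: of_nat_Suc)
  ultimately show ?thesis by simp
 qed
 have "(\<lambda>k. flat (real (Suc k) * (x - a)) * flat (real (Suc k) * (c - x))) \<longlonglongrightarrow> 1 * 1"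
  by (intro tendsto_mult f) (use True in auto)
 then show ?thesis using True by (simp add: box_bump_def del: of_nat_Suc)
next
 case False
 then have "box_bump (real (Suc k)) a c x = 0" for k by (intro box_bump_eq_0) auto
 then show ?thesis unfolding if_not_P[OF False] by (simp del: of_nat_Suc)
qed

text \<open>Two uses: uniqueness of the tempered Fourier transform, and measurability of an
  arbitrary transform of a member of \<open>Hs\<close>, which \<open>has_fourier_transform\<close>
  contains only implicitly. Dividing by a bump that is bounded below on a box recovers H on that
  box; increasing bumps then test H against box indicators.\<close>

lemma schwartz_integrals:
 fixes H :: "'a::euclidean_space \<Rightarrow> complex"
 assumes int: "\<And>\<phi>. schwartz \<phi> \<Longrightarrow> integrable lebesgue (\<lambda>x. H x * \<phi> x)"
 shows "H \<in> borel_measurable lebesgue"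
  and "(\<And>\<phi>. schwartz \<phi> \<Longrightarrow> (LINT x|lebesgue. H x * \<phi> x) = 0) \<Longrightarrow> AE x in lborel. H x = 0"
proof -
 define bmp where "bmp k p q z = (\<Prod>b\<in>Basis. box_bump (real (Suc k)) (p \<bullet> b) (q \<bullet> b) (z \<bullet> b))"
  for k and p q z :: 'a
 have bs: "schwartz (\<lambda>z. complex_of_real (bmp k p q z))" and bc: "continuous_on A (bmp k p q)" for k p q A
 proof -
  obtain G where G: "compact_tensor G p q"
   "tensor G (\<lambda>_. 0) = (\<lambda>z. \<Prod>b\<in>Basis. box_bump (real (Suc k)) (p \<bullet> b) (q \<bullet> b) (z \<bullet> b))"
   using box_bump_tensor[of "real (Suc k)" p q] by auto
  have "tensor G (\<lambda>_. 0) = bmp k p q" unfolding G(2) by (simp add: bmp_def fun_eq_iff)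
  then show "schwartz (\<lambda>z. complex_of_real (bmp k p q z))" "continuous_on A (bmp k p q)"
   using compact_tensor.schwartz[OF G(1), of "\<lambda>_. 0"] compact_tensor.continuous[OF G(1), of A "\<lambda>_. 0"] by auto
 qed
 have [measurable]: "bmp k p q \<in> borel_measurable borel" for k p q
  by (intro borel_measurable_continuous_onI bc)
 have b01: "0 \<le> bmp k p q z" "bmp k p q z \<le> 1" for k p q z
  unfolding bmp_def by (auto intro!: prod_nonneg prod_le_1 box_bump_bounds)
 have bsupp: "bmp k p q z = 0" if z: "z \<notin> box p q" for k p q z
 proof -
  obtain b where "b \<in> Basis" "z \<bullet> b \<le> p \<bullet> b \<or> q \<bullet> b \<le> z \<bullet> b" using z by (auto simp: mem_box not_less)
  then show ?thesis
   unfolding bmp_def by (intro prod_zero bexI[of _ b] box_bump_eq_0) auto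
 qed
 have blim: "(\<lambda>k. bmp k p q z) \<longlonglongrightarrow> indicator (box p q) z" for p q z
 proof -
  have "(\<lambda>k. bmp k p q z) \<longlonglongrightarrow> (\<Prod>b\<in>Basis. if p \<bullet> b < z \<bullet> b \<and> z \<bullet> b < q \<bullet> b then 1 else 0)"
   unfolding bmp_def by (intro tendsto_prod box_bump_limit)
  also have "(\<Prod>b\<in>Basis. if p \<bullet> b < z \<bullet> b \<and> z \<bullet> b < q \<bullet> b then 1 else 0) = (indicator (box p q) z :: real)"
   by (auto simp: indicator_def mem_box intro!: prod_zero)
  finally show ?thesis .
 qed
 have loc: "integrable lebesgue (\<lambda>x. indicator (box p q) x *\<^sub>R H x)" for p q
 proof -
  \<comment> \<open>The bump lives on a box enlarged by 1 on every side, so it is positive on the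
    compact box and attains a positive minimum there.\<close>
  let ?b = "bmp 0 (p - One) (q + One)"
  have sub: "cbox p q \<subseteq> box (p - One) (q + One)" by (auto simp: mem_box inner_simps) (smt (verit))+
  have pos: "?b z > 0" if "z \<in> cbox p q" for z
   unfolding bmp_def using subsetD[OF sub that] by (intro prod_pos box_bump_pos ballI) (auto simp: mem_box)
  obtain c where c: "c > 0" "\<And>z. z \<in> cbox p q \<Longrightarrow> c \<le> ?b z"
  proof (cases "cbox p q = {}")
   case True then show thesis by (intro that[of 1]) auto
  next
   case False
   obtain z0 where "z0 \<in> cbox p q" "\<And>z. z \<in> cbox p q \<Longrightarrow> ?b z0 \<le> ?b z"
    using continuous_attains_inf[OF compact_cbox False bc] by blast
   then show thesis using pos by (intro that[of "?b z0"]) auto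
  qed
  note i = int[OF bs[of 0 "p - One" "q + One"]]
  have "integrable lebesgue (\<lambda>x. (indicator (box p q) x / ?b x) *\<^sub>R (H x * complex_of_real (?b x)))"
  proof (rule Bochner_Integration.integrable_bound)
   show "integrable lebesgue (\<lambda>x. (1 / c) *\<^sub>R (H x * complex_of_real (?b x)))" using i by simp
   have "(\<lambda>x. indicator (box p q) x / ?b x) \<in> borel_measurable lebesgue"
    by (intro measurable_completion) measurable
   then show "(\<lambda>x. (indicator (box p q) x / ?b x) *\<^sub>R (H x * complex_of_real (?b x))) \<in> borel_measurable lebesgue"
    using borel_measurable_integrable[OF i] by (intro borel_measurable_scaleR)
   show "AE x in lebesgue. norm ((indicator (box p q) x / ?b x) *\<^sub>R (H x * complex_of_real (?b x))) \<le> norm ((1 / c) *\<^sub>R (H x * complex_of_real (?b x)))"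
   proof (rule AE_I2)
    fix x
    have "\<bar>indicator (box p q) x / ?b x\<bar> \<le> 1 / c"
     using c box_subset_cbox[of p q] pos[of x] by (auto simp: indicator_def intro!: divide_left_mono)
    then show "norm ((indicator (box p q) x / ?b x) *\<^sub>R (H x * complex_of_real (?b x))) \<le> norm ((1 / c) *\<^sub>R (H x * complex_of_real (?b x)))"
     using c(1) unfolding norm_scaleR by (intro mult_right_mono) auto
   qed
  qed
  moreover have "(indicator (box p q) x / ?b x) *\<^sub>R (H x * complex_of_real (?b x)) = indicator (box p q) x *\<^sub>R H x" for x
   using pos[of x] box_subset_cbox[of p q] by (auto simp: indicator_def scaleR_conv_of_real)
  ultimately show ?thesis by simp
 qed
 show Hm: "H \<in> borel_measurable lebesgue"
 proof (rule borel_measurable_LIMSEQ_metric)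
  let ?A = "\<lambda>n::nat. box (- (real n *\<^sub>R One)) (real n *\<^sub>R One) :: 'a set"
  show "(\<lambda>x. indicator (?A n) x *\<^sub>R H x) \<in> borel_measurable lebesgue" for n
   using loc by (rule borel_measurable_integrable)
  fix x :: 'a
  obtain n0 where n0: "x \<in> ?A n0" using UN_box_eq_UNIV by blast
  have "x \<in> ?A n" if "n \<ge> n0" for n
  proof -
   have "real n0 \<le> real n" using that by simp
   moreover have "\<forall>b\<in>Basis. - real n0 < x \<bullet> b \<and> x \<bullet> b < real n0" using n0 by (simp add: mem_box)
   ultimately have "- real n < x \<bullet> b \<and> x \<bullet> b < real n" if "b \<in> Basis" for b
    using that by (meson le_less_trans less_le_trans neg_le_iff_le)
   then show ?thesis by (simp add: mem_box)
  qed
  then show "(\<lambda>n. indicator (?A n) x *\<^sub>R H x) \<longlonglongrightarrow> H x"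
   by (intro tendsto_eventually) (auto simp: eventually_sequentially intro!: exI[of _ n0])
 qed
 assume zero: "\<And>\<phi>. schwartz \<phi> \<Longrightarrow> (LINT x|lebesgue. H x * \<phi> x) = 0"
 have boxzero: "(LINT x|lebesgue. indicator (box p q) x *\<^sub>R H x) = 0" for p q
 proof -
  have "(\<lambda>k. LINT x|lebesgue. H x * complex_of_real (bmp k p q x)) \<longlonglongrightarrow> (LINT x|lebesgue. indicator (box p q) x *\<^sub>R H x)"
  proof (rule integral_dominated_convergence[where w = "\<lambda>x. norm (indicator (box p q) x *\<^sub>R H x)"])
   show "AE x in lebesgue. (\<lambda>k. H x * complex_of_real (bmp k p q x)) \<longlonglongrightarrow> indicator (box p q) x *\<^sub>R H x"
   proof (rule AE_I2)
    fix x
    have "(\<lambda>k. H x * complex_of_real (bmp k p q x)) \<longlonglongrightarrow> H x * complex_of_real (indicator (box p q) x)"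
     by (intro tendsto_intros blim)
    then show "(\<lambda>k. H x * complex_of_real (bmp k p q x)) \<longlonglongrightarrow> indicator (box p q) x *\<^sub>R H x"
     by (simp add: scaleR_conv_of_real mult.commute)
   qed
   show "AE x in lebesgue. norm (H x * complex_of_real (bmp k p q x)) \<le> norm (indicator (box p q) x *\<^sub>R H x)" for k
    by (rule AE_I2) (use b01 bsupp in \<open>auto simp: norm_mult indicator_def intro!: mult_left_le\<close>)
  qed (use integrable_norm[OF loc[of p q]] borel_measurable_integrable[OF loc[of p q]] borel_measurable_integrable[OF int[OF bs]] in auto)
  then show ?thesis using zero[OF bs] by (simp add: LIMSEQ_const_iff)
 qed
 \<comment> \<open>A bounded linear functional L treats the real and the imaginary part at
   once.\<close>
 have key: "AE x in lborel. L (H x) = 0" if L: "bounded_linear L" for L :: "complex \<Rightarrow> real"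
 proof -
  have "(\<lambda>x. L (H x)) \<in> borel_measurable lebesgue"
   by (rule measurable_compose[OF Hm borel_measurable_continuous_onI[OF linear_continuous_on[OF L]]])
  then obtain f where f [measurable]: "f \<in> borel_measurable borel" and fe: "AE x in lborel. L (H x) = f x"
   using completion_ex_borel_measurable_real[of "\<lambda>x. L (H x)" lborel] by auto
  have e: "AE x in lebesgue. L (indicator (box p q) x *\<^sub>R H x) = indicator (box p q) x * f x" for p q
   using AE_completion[OF fe] by eventually_elim (simp add: linear_simps(5)[OF L])
  have i: "integrable lebesgue (\<lambda>x. L (indicator (box p q) x *\<^sub>R H x))" for p q
   by (rule integrable_bounded_linear[OF L loc])
  have m: "(\<lambda>x. indicator (box p q) x * f x) \<in> borel_measurable lborel" for p q by measurable
  have "integrable lebesgue (\<lambda>x. indicator (box p q) x * f x)" for p q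
   by (rule integrable_cong_AE_imp[OF i[of p q]]) (use e[of p q] in \<open>auto intro!: measurable_completion[OF m] elim: eventually_mono\<close>)
  then have 1: "integrable lborel (\<lambda>x. indicator (box p q) x * f x)" for p q
   using m by (simp add: integrable_completion)
  have "(LINT x|lborel. indicator (box p q) x * f x) = (LINT x|lebesgue. indicator (box p q) x * f x)" for p q
   using m by (simp add: integral_completion)
  also have "\<dots> p q = (LINT x|lebesgue. L (indicator (box p q) x *\<^sub>R H x))" for p q
   by (rule integral_cong_AE) (use e[of p q] i[of p q] in \<open>auto intro!: measurable_completion[OF m] borel_measurable_integrable elim: eventually_mono\<close>)
  also have "\<dots> p q = 0" for p q
   using integral_bounded_linear[OF L loc[of p q]] boxzero[of p q] by (simp add: linear_simps(3)[OF L])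
  finally have "AE x in lborel. f x = 0"
   by (intro AE_zero_of_box_integrals f 1)
  with fe show ?thesis by eventually_elim simp
 qed
 show "AE x in lborel. H x = 0"
  using key[OF bounded_linear_Re] key[OF bounded_linear_Im] by eventually_elim (simp add: complex_eq_iff)
qed

lemma has_fourier_transform_unique:
 assumes "has_fourier_transform g G" "has_fourier_transform g G'"
 shows "AE \<xi> in lborel. G \<xi> = G' \<xi>"
proof -
 have "AE \<xi> in lborel. G \<xi> - G' \<xi> = 0"
  by (rule schwartz_integrals(2))
   (use assms in \<open>auto simp: has_fourier_transform_def left_diff_distrib\<close>)
 then show ?thesis by eventually_elim simp
qed

lemma has_fourier_transform_diff:
 assumes "has_fourier_transform g G" "has_fourier_transform h H"
 shows "has_fourier_transform (\<lambda>x. g x - h x) (\<lambda>\<xi>. G \<xi> - H \<xi>)"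
 using assms by (auto simp: has_fourier_transform_def left_diff_distrib)

lemma fourier_transform_eq:
 assumes "has_fourier_transform g G"
 shows "AE \<xi> in lborel. fourier_transform g \<xi> = G \<xi>"
 unfolding fourier_transform_def
 by (rule has_fourier_transform_unique[OF someI[of "has_fourier_transform g", OF assms] assms])

section \<open>Lipschitz test functions in the kinetic equation\<close>

text \<open>Dividing by s and letting s tend to 0 from the right removes the quadratic term. In this
  way the derivative of a mollified function is bounded through increments of the Lipschitz function
  underneath, which need not be differentiable.\<close>

lemma frechet_derivative_estimate:
 fixes g :: "'a::real_normed_vector \<Rightarrow> real"
 assumes "g differentiable (at z)" "s0 > 0"
  and est: "\<And>s. 0 < s \<Longrightarrow> s \<le> s0 \<Longrightarrow> \<bar>g (z + s *\<^sub>R b) - g z - s * q\<bar> \<le> c * s + K * s\<^sup>2"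
 shows "\<bar>frechet_derivative g (at z) b - q\<bar> \<le> c"
proof -
 let ?D = "frechet_derivative g (at z)"
 have D: "(g has_derivative ?D) (at z)" using assms(1) frechet_derivative_works by blast
 have "((\<lambda>s. g (z + s *\<^sub>R b)) has_derivative (\<lambda>s. ?D (s *\<^sub>R b))) (at 0)"
  by (rule has_derivative_compose[of "\<lambda>s. z + s *\<^sub>R b", where g = g])
   (auto intro!: derivative_eq_intros simp: D)
 moreover have "(\<lambda>s. ?D (s *\<^sub>R b)) = (\<lambda>s. ?D b * s)"
  using linear_frechet_derivative[OF assms(1)] by (simp add: linear_scale mult.commute)
 ultimately have "((\<lambda>s. g (z + s *\<^sub>R b)) has_real_derivative ?D b) (at 0)"
  by (simp add: has_field_derivative_def)
 then have "((\<lambda>s. (g (z + s *\<^sub>R b) - g z) / s) \<longlongrightarrow> ?D b) (at_right 0)"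
  by (simp add: has_field_derivative_iff filterlim_at_split)
 then have "((\<lambda>s. \<bar>(g (z + s *\<^sub>R b) - g z) / s - q\<bar>) \<longlongrightarrow> \<bar>?D b - q\<bar>) (at_right 0)"
  by (intro tendsto_intros)
 moreover have "((\<lambda>s. c + K * s) \<longlongrightarrow> c + K * 0) (at_right 0)" by (intro tendsto_intros)
 moreover have "\<forall>\<^sub>F s in at_right 0. \<bar>(g (z + s *\<^sub>R b) - g z) / s - q\<bar> \<le> c + K * s"
 proof -
  have "\<forall>\<^sub>F s in at_right 0. s \<in> {0<..<s0}" using assms(2) eventually_at_right_less[of 0]
   by (auto simp: eventually_at_right_field)
  then show ?thesis
  proof eventually_elim
   case (elim s)
   then have "\<bar>(g (z + s *\<^sub>R b) - g z) / s - q\<bar> = \<bar>g (z + s *\<^sub>R b) - g z - s * q\<bar> / s"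
   proof -
    have "(g (z + s *\<^sub>R b) - g z) / s - q = (g (z + s *\<^sub>R b) - g z - s * q) / s"
     using elim by (simp add: diff_divide_distrib)
    then show ?thesis using elim by (simp add: abs_divide)
   qed
   also have "\<dots> \<le> (c * s + K * s\<^sup>2) / s" using est[of s] elim by (intro divide_right_mono) auto
   also have "\<dots> = c + K * s" using elim by (simp add: field_simps power2_eq_square)
   finally show ?case .
  qed
 qed
 ultimately show ?thesis
  using tendsto_le[of "at_right (0::real)" "\<lambda>s. c + K * s" "c + K * 0"] by auto
qed

lemma mult_lipschitz:
 fixes u v u' v' :: real
 assumes "\<bar>u - u'\<bar> \<le> p" "\<bar>v - v'\<bar> \<le> q" "\<bar>u\<bar> \<le> U" "\<bar>v'\<bar> \<le> V"
 shows "\<bar>u * v - u' * v'\<bar> \<le> U * q + p * V"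
proof -
 have "\<bar>u * v - u' * v'\<bar> = \<bar>u * (v - v') + (u - u') * v'\<bar>" by (simp add: algebra_simps)
 also have "\<dots> \<le> \<bar>u\<bar> * \<bar>v - v'\<bar> + \<bar>u - u'\<bar> * \<bar>v'\<bar>"
  using abs_triangle_ineq[of "u * (v - v')" "(u - u') * v'"] by (simp add: abs_mult)
 also have "\<dots> \<le> U * q + p * V"
  using assms by (intro add_mono mult_mono) auto
 finally show ?thesis .
qed

definition clamp1 :: "real \<Rightarrow> real" where "clamp1 r = max 0 (min 1 r)"

lemma clamp1: "0 \<le> clamp1 r" "clamp1 r \<le> 1" "\<bar>clamp1 r - clamp1 r'\<bar> \<le> \<bar>r - r'\<bar>"
 "r \<le> 0 \<Longrightarrow> clamp1 r = 0" "1 \<le> r \<Longrightarrow> clamp1 r = 1"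
 by (auto simp: clamp1_def)

lemma continuous_clamp1: "continuous_on A clamp1"
 unfolding clamp1_def[abs_def] by (intro continuous_intros)

text \<open>It vanishes within \<alpha> of both ends, so that a mollification of width \<alpha>/2
  keeps the support inside ]0,T[, and it equals 1 from distance 2 \<alpha> on.\<close>

definition time_cutoff :: "real \<Rightarrow> real \<Rightarrow> real \<Rightarrow> real"
 where "time_cutoff \<alpha> T t = clamp1 ((t - \<alpha>) / \<alpha>) * clamp1 ((T - \<alpha> - t) / \<alpha>)"

lemma time_cutoff_bounds: "0 \<le> time_cutoff \<alpha> T t" "time_cutoff \<alpha> T t \<le> 1"
 by (auto simp: time_cutoff_def clamp1 mult_le_one)

lemma time_cutoff_eq_0: "\<alpha> > 0 \<Longrightarrow> t \<notin> {\<alpha>..T-\<alpha>} \<Longrightarrow> time_cutoff \<alpha> T t = 0"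
 unfolding time_cutoff_def by (auto simp: not_le intro!: clamp1(4) divide_nonpos_pos)

lemma time_cutoff_eq_1: "\<alpha> > 0 \<Longrightarrow> t \<in> {2*\<alpha>..T-2*\<alpha>} \<Longrightarrow> time_cutoff \<alpha> T t = 1"
 unfolding time_cutoff_def by (subst (1 2) clamp1(5)) (auto simp: field_simps)

lemma time_cutoff_lipschitz:
 assumes "\<alpha> > 0" shows "\<bar>time_cutoff \<alpha> T t - time_cutoff \<alpha> T t'\<bar> \<le> 2 / \<alpha> * \<bar>t - t'\<bar>"
proof -
 have d: "\<bar>(t - \<alpha>) / \<alpha> - (t' - \<alpha>) / \<alpha>\<bar> = \<bar>t - t'\<bar> / \<alpha>" "\<bar>(T - \<alpha> - t) / \<alpha> - (T - \<alpha> - t') / \<alpha>\<bar> = \<bar>t - t'\<bar> / \<alpha>"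
  using assms by (simp_all add: diff_divide_distrib[symmetric] abs_minus_commute)
 have "\<bar>time_cutoff \<alpha> T t - time_cutoff \<alpha> T t'\<bar> \<le> 1 * (\<bar>t - t'\<bar> / \<alpha>) + (\<bar>t - t'\<bar> / \<alpha>) * 1"
  unfolding time_cutoff_def
  by (rule mult_lipschitz) (use clamp1(3)[of "(t - \<alpha>) / \<alpha>" "(t' - \<alpha>) / \<alpha>"]
   clamp1(3)[of "(T - \<alpha> - t) / \<alpha>" "(T - \<alpha> - t') / \<alpha>"] clamp1(1,2) in \<open>simp_all add: d\<close>)
 then show ?thesis by simp
qed

text \<open>Under time shifts of at most \<alpha> the cutoff changes only when t lies within 3
  \<alpha> of an end of [0,T]. The slope 2/\<alpha> is thus charged to two intervals of length 3
  \<alpha>.\<close>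

lemma time_cutoff_locally_constant:
 assumes "\<alpha> > 0" "6 * \<alpha> \<le> T" "t \<in> {3*\<alpha>..T-3*\<alpha>} \<or> t < 0 \<or> T < t" "\<bar>t' - t\<bar> \<le> \<alpha>"
 shows "time_cutoff \<alpha> T t' = time_cutoff \<alpha> T t"
proof (cases "t \<in> {3*\<alpha>..T-3*\<alpha>}")
 case True then show ?thesis using assms by (subst (1 2) time_cutoff_eq_1) auto
next
 case False
 then have "t \<notin> {\<alpha>..T-\<alpha>}" "t' \<notin> {\<alpha>..T-\<alpha>} \<or> t' = \<alpha> \<or> t' = T - \<alpha>" using assms by auto
 moreover have "time_cutoff \<alpha> T \<alpha> = 0" "time_cutoff \<alpha> T (T - \<alpha>) = 0"
  by (simp_all add: time_cutoff_def clamp1_def)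
 ultimately show ?thesis using time_cutoff_eq_0[OF assms(1)] by metis
qed

lemma continuous_time_cutoff: "\<alpha> > 0 \<Longrightarrow> continuous_on A (time_cutoff \<alpha> T)"
 unfolding time_cutoff_def[abs_def]
 by (intro continuous_intros continuous_on_compose2[OF continuous_clamp1]) auto

definition space_cutoff :: "nat \<Rightarrow> 'a::real_normed_vector \<Rightarrow> real"
 where "space_cutoff N y = clamp1 (2 - norm y / real (Suc N))"

lemma space_cutoff_bounds: "0 \<le> space_cutoff N y" "space_cutoff N y \<le> 1"
 by (auto simp: space_cutoff_def clamp1)

lemma space_cutoff_lipschitz: "\<bar>space_cutoff N y - space_cutoff N y'\<bar> \<le> norm (y - y') / real (Suc N)"
proof -
 have "\<bar>space_cutoff N y - space_cutoff N y'\<bar> \<le> \<bar>norm y - norm y'\<bar> / real (Suc N)"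
  unfolding space_cutoff_def using clamp1(3)[of "2 - norm y / real (Suc N)" "2 - norm y' / real (Suc N)"]
  by (simp add: diff_divide_distrib[symmetric] abs_minus_commute del: of_nat_Suc)
 also have "\<dots> \<le> norm (y - y') / real (Suc N)"
  by (intro divide_right_mono norm_triangle_ineq3) auto
 finally show ?thesis .
qed

lemma space_cutoff_eq_0: "norm y > 2 * real (Suc N) \<Longrightarrow> space_cutoff N y = 0"
 unfolding space_cutoff_def by (intro clamp1(4)) (simp add: field_simps del: of_nat_Suc)

lemma space_cutoff_limit: "(\<lambda>N. space_cutoff N y) \<longlonglongrightarrow> 1"
proof -
 have "(\<lambda>N. 2 - norm y * (1 / real (Suc N))) \<longlonglongrightarrow> 2 - norm y * 0"
  by (intro tendsto_intros LIMSEQ_Suc[OF lim_1_over_n])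
 then have "(\<lambda>N. clamp1 (2 - norm y * (1 / real (Suc N)))) \<longlonglongrightarrow> clamp1 2"
  using continuous_clamp1[of UNIV] by (intro isCont_tendsto_compose[of _ clamp1]) (auto simp: continuous_on_eq_continuous_at)
 then show ?thesis by (simp add: space_cutoff_def clamp1_def[of 2])
qed

lemma continuous_space_cutoff: "continuous_on A (space_cutoff N)"
 unfolding space_cutoff_def[abs_def]
 by (intro continuous_on_compose2[OF continuous_clamp1] continuous_intros) auto

lemma mollified_bound:
 fixes \<rho> :: "'a::euclidean_space \<Rightarrow> real"
 assumes \<rho>: "\<And>z. 0 \<le> \<rho> z" "\<And>z. e < norm z \<Longrightarrow> \<rho> z = 0" "integrable lborel \<rho>" "(LINT z|lborel. \<rho> z) = 1"
  and i: "integrable lborel (\<lambda>y. \<rho> y * h y)" and b: "\<And>y. norm y \<le> e \<Longrightarrow> \<bar>h y\<bar> \<le> c"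
 shows "\<bar>LINT y|lborel. \<rho> y * h y\<bar> \<le> c"
proof -
 have "norm (LINT y|lborel. \<rho> y * h y) \<le> (LINT y|lborel. \<rho> y * c)"
 proof (rule Bochner_Integration.integral_norm_bound_integral[OF i])
  show "integrable lborel (\<lambda>y. \<rho> y * c)" using \<rho>(3) by simp
  show "norm (\<rho> y * h y) \<le> \<rho> y * c" for y
   using \<rho>(1)[of y] \<rho>(2)[of y] b[of y] by (cases "norm y \<le> e") (auto simp: abs_mult mult_left_mono)
 qed
 then show ?thesis using \<rho>(4) by simp
qed

lemma borel_measurable_fst [measurable]:
  "fst \<in> measurable (borel :: ('a::topological_space \<times> 'b::topological_space) measure) borel"
 and borel_measurable_snd [measurable]:
  "snd \<in> measurable (borel :: ('a::topological_space \<times> 'b::topological_space) measure) borel"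
 by (intro borel_measurable_continuous_onI continuous_intros)+

text \<open>The hypotheses in normalised form: f is a representative bounded at every point and
  supported in times in ]0,T[ and velocities of norm at most R. \<open>f_slice\<close> is the
  integrated trace of the L^1 bound uniform in time.\<close>

locale kinetic =
 fixes a :: "real^'n \<Rightarrow> real^'n" and f :: "real \<times> (real^'n) \<times> (real^'n) \<Rightarrow> real"
  and m :: "'n \<Rightarrow> (real \<times> (real^'n) \<times> (real^'n)) signed_measure" and T R C La :: real
 assumes T: "T > 0" and R: "R \<ge> 0" and La: "La \<ge> 0"
  and a_lip: "\<And>v w. norm (a v - a w) \<le> La * norm (v - w)"
  and f_int: "integrable lborel f" and f_le_1: "\<And>z. \<bar>f z\<bar> \<le> 1"
  and f_supp: "\<And>t x v. t \<notin> {0<..<T} \<or> R < norm v \<Longrightarrow> f (t, x, v) = 0"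
  and f_slice: "\<And>p q. 0 \<le> p \<Longrightarrow> p \<le> q \<Longrightarrow> q \<le> T \<Longrightarrow>
   (LINT z|lborel. \<bar>f z\<bar> * indicator {p..q} (fst z)) \<le> C * (q - p)"
  and weak_eq: "\<And>\<phi>. test_function ({0<..<T} \<times> UNIV) \<phi> \<Longrightarrow>
   (LINT z|lborel. f z * (partial (1, 0, 0) \<phi> z + (\<Sum>i\<in>UNIV. a (snd (snd z)) $ i * partial (0, axis i 1, 0) \<phi> z)))
   = (\<Sum>i\<in>UNIV. signed_integral (m i) (partial (0, 0, axis i 1) \<phi>))"
  and fin: "\<And>i. finite_signed_measure (m i)"
begin

definition mass :: real
 where "mass = (\<Sum>i\<in>UNIV. measure (fst (m i)) UNIV + measure (snd (m i)) UNIV)"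

lemma mass_nonneg: "mass \<ge> 0"
 by (simp add: mass_def sum_nonneg)

lemma a_continuous: "continuous_on A a"
 by (rule lipschitz_on_continuous_on[of La]) (use a_lip La in \<open>auto simp: lipschitz_on_def dist_norm\<close>)

lemma a_measurable [measurable]: "a \<in> borel_measurable borel"
 by (intro borel_measurable_continuous_onI a_continuous)

lemma f_measurable [measurable]: "f \<in> borel_measurable borel"
 using f_int by auto

lemma C_nonneg: "C \<ge> 0"
proof -
 have "0 \<le> (LINT z|lborel. \<bar>f z\<bar> * indicator {0..T} (fst z))" by (intro integral_nonneg_AE) auto
 also have "\<dots> \<le> C * (T - 0)" by (rule f_slice) (use T in auto)
 finally show ?thesis using T by (simp add: zero_le_mult_iff)
qed

lemma f_abs_integral: "(LINT z|lborel. \<bar>f z\<bar>) \<le> C * T"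
proof -
 have "(LINT z|lborel. \<bar>f z\<bar>) = (LINT z|lborel. \<bar>f z\<bar> * indicator {0..T} (fst z))"
 proof (intro Bochner_Integration.integral_cong refl)
  fix z
  show "\<bar>f z\<bar> = \<bar>f z\<bar> * indicator {0..T} (fst z)"
   using f_supp[of "fst z" "snd (snd z)" "fst (snd z)"] by (cases "fst z \<in> {0..T}") auto
 qed
 also have "\<dots> \<le> C * (T - 0)" by (rule f_slice) (use T in auto)
 finally show ?thesis by simp
qed

text \<open>The radius R + 1 leaves room for velocity averages and mollifications of radius at most
  1.\<close>

definition velocity_bound :: real
 where "velocity_bound = norm (a 0) + La * (R + 1)"

lemma velocity_bound: "norm v \<le> R + 1 \<Longrightarrow> norm (a v) \<le> velocity_bound" "0 \<le> velocity_bound"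
proof -
 assume "norm v \<le> R + 1"
 then have "La * norm (v - 0) \<le> La * (R + 1)" using La by (intro mult_left_mono) auto
 then show "norm (a v) \<le> velocity_bound"
  using norm_triangle_sub[of "a v" "a 0"] a_lip[of v 0] by (simp add: velocity_bound_def)
qed (use R La in \<open>simp add: velocity_bound_def\<close>)

text \<open>Here d is minus the transport derivative of \<phi>, expressed by a quadratic remainder
  along forward characteristics. B and \<Lambda> are the quantitative data; K only has to be finite
  and disappears from \<open>lipschitz_test_bound\<close>.\<close>

definition admissible :: "real \<Rightarrow> real \<Rightarrow> real \<Rightarrow> (real \<times> (real^'n) \<times> (real^'n) \<Rightarrow> real) \<Rightarrow> (real \<times> (real^'n) \<times> (real^'n) \<Rightarrow> real) \<Rightarrow> bool"
 where "admissible B \<Lambda> K \<phi> d \<longleftrightarrow> (\<forall>z. \<bar>\<phi> z\<bar> \<le> B) \<and> (\<forall>z. \<bar>d z\<bar> \<le> K) \<and>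
  (\<forall>t x v w. \<bar>\<phi> (t, x, v) - \<phi> (t, x, w)\<bar> \<le> \<Lambda> * norm (v - w)) \<and>
  (\<forall>z z'. \<bar>\<phi> z - \<phi> z'\<bar> \<le> K * norm (z - z')) \<and> (\<forall>z z'. \<bar>d z - d z'\<bar> \<le> K * norm (z - z')) \<and>
  (\<forall>t x v s. norm v \<le> R + 1 \<longrightarrow> 0 \<le> s \<longrightarrow> s \<le> 1 \<longrightarrow>
   \<bar>\<phi> (t + s, x + s *\<^sub>R a v, v) - \<phi> (t, x, v) + s * d (t, x, v)\<bar> \<le> K * s\<^sup>2)"

lemma signed_integral_bound:
 assumes [measurable]: "g \<in> borel_measurable borel" and g: "\<And>z. \<bar>g z\<bar> \<le> c"
 shows "\<bar>signed_integral (m i) g\<bar> \<le> (measure (fst (m i)) UNIV + measure (snd (m i)) UNIV) * c"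
proof -
 have *: "\<bar>integral\<^sup>L \<mu> g\<bar> \<le> measure \<mu> UNIV * c" if \<mu>: "finite_measure \<mu>" "sets \<mu> = sets borel" for \<mu>
 proof -
  interpret finite_measure \<mu> by (rule \<mu>)
  have sp: "space \<mu> = UNIV" using sets_eq_imp_space_eq[OF \<mu>(2)] by simp
  have gm: "g \<in> borel_measurable \<mu>" using \<mu>(2) assms(1) measurable_cong_sets by blast
  have "integrable \<mu> g" by (rule integrable_const_bound[of _ c]) (use g gm in auto)
  then have "norm (integral\<^sup>L \<mu> g) \<le> (LINT z|\<mu>. c)"
   by (rule Bochner_Integration.integral_norm_bound_integral) (use g in auto)
  then show ?thesis by (simp add: sp)
 qed
 have "finite_measure (fst (m i))" "sets (fst (m i)) = sets borel" "finite_measure (snd (m i))" "sets (snd (m i)) = sets borel"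
  using fin[of i] by (auto simp: finite_signed_measure_def)
 then have "\<bar>integral\<^sup>L (fst (m i)) g\<bar> \<le> measure (fst (m i)) UNIV * c" "\<bar>integral\<^sup>L (snd (m i)) g\<bar> \<le> measure (snd (m i)) UNIV * c"
  using * by blast+
 then show ?thesis unfolding signed_integral_def distrib_right
  by (intro order_trans[OF abs_triangle_ineq4] add_mono)
qed

lemma transport_direction:
 fixes \<phi> :: "real \<times> (real^'n) \<times> (real^'n) \<Rightarrow> real"
 assumes "\<phi> differentiable (at z)"
 shows "partial (1, 0, 0) \<phi> z + (\<Sum>i\<in>UNIV. (v :: real^'n) $ i * partial (0, axis i 1, 0) \<phi> z) =
  frechet_derivative \<phi> (at z) (1, v, 0)"
proof -
 let ?D = "frechet_derivative \<phi> (at z)"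
 have lin: "linear ?D" by (rule linear_frechet_derivative[OF assms])
 have "(1, v, 0) = (1, 0, 0) + (\<Sum>i\<in>UNIV. v $ i *\<^sub>R (0::real, axis i 1, 0::real^'n))"
 proof -
  have "(\<Sum>i\<in>UNIV. v $ i *\<^sub>R (0::real, axis i (1::real), 0::real^'n)) = (0, \<Sum>i\<in>UNIV. v $ i *\<^sub>R axis i 1, 0)"
   by (simp add: prod_eq_iff fst_sum snd_sum)
  also have "(\<Sum>i\<in>UNIV. v $ i *\<^sub>R axis i (1::real)) = v"
   using basis_expansion[of v] by (simp add: scalar_mult_eq_scaleR)
  finally show ?thesis by simp
 qed
 then have "?D (1, v, 0) = ?D ((1, 0, 0) + (\<Sum>i\<in>UNIV. v $ i *\<^sub>R (0::real, axis i 1, 0::real^'n)))"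
  by (rule arg_cong)
 also have "\<dots> = ?D (1, 0, 0) + ?D (\<Sum>i\<in>UNIV. v $ i *\<^sub>R (0::real, axis i 1, 0::real^'n))"
  by (rule linear_add[OF lin])
 also have "?D (\<Sum>i\<in>UNIV. v $ i *\<^sub>R (0::real, axis i 1, 0::real^'n)) = (\<Sum>i\<in>UNIV. ?D (v $ i *\<^sub>R (0, axis i 1, 0)))"
  by (rule linear_sum[OF lin])
 also have "\<dots> = (\<Sum>i\<in>UNIV. v $ i *\<^sub>R ?D (0, axis i 1, 0))"
  by (intro sum.cong refl linear_scale[OF lin])
 finally have "?D (1, v, 0) = ?D (1, 0, 0) + (\<Sum>i\<in>UNIV. v $ i *\<^sub>R ?D (0, axis i 1, 0))" .
 then show ?thesis by (simp add: partial_def)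
qed

text \<open>The equation is tested with a mollification of \<phi> times time and space cutoffs. The
  mollifier has width at most 1/N and the space cutoff slope 1/N, so all commutators with the
  Lipschitz field and all errors carrying K are of order 1/N and are collected in D. What remains is
  the velocity slope \<Lambda> against the mass of m, and the slope of the time cutoff against
  f.\<close>

lemma cutoff_bound:
 fixes N :: nat
 assumes adm: "admissible B \<Lambda> K \<phi> d" and \<alpha>: "0 < \<alpha>" "6 * \<alpha> \<le> T"
 defines "D \<equiv> ((2 / \<alpha> + 1) * B + K) * La + ((2 / \<alpha> + 1) * K + K) + B * velocity_bound"
 shows "\<bar>LINT z|lborel. time_cutoff \<alpha> T (fst z) * space_cutoff N (snd z) * f z * d z\<bar>
  \<le> mass * (\<Lambda> + B / Suc N) + 12 * C * B + D / Suc N * (C * T)"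
proof -
 define N' where "N' = real (Suc N)"
 have N': "N' \<ge> 1" by (simp add: N'_def)
 let ?\<omega> = "\<lambda>z. time_cutoff \<alpha> T (fst z) * space_cutoff N (snd z)"
 let ?\<psi> = "\<lambda>z. ?\<omega> z * \<phi> z"
 let ?A = velocity_bound
 have \<phi>B: "\<bar>\<phi> z\<bar> \<le> B" and dK: "\<bar>d z\<bar> \<le> K" and \<phi>v: "\<bar>\<phi> (t, x, v) - \<phi> (t, x, w)\<bar> \<le> \<Lambda> * norm (v - w)"
  and \<phi>K: "\<bar>\<phi> z - \<phi> z'\<bar> \<le> K * norm (z - z')" and dL: "\<bar>d z - d z'\<bar> \<le> K * norm (z - z')"
  and quad: "norm v \<le> R + 1 \<Longrightarrow> 0 \<le> s \<Longrightarrow> s \<le> 1 \<Longrightarrow>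
   \<bar>\<phi> (t + s, x + s *\<^sub>R a v, v) - \<phi> (t, x, v) + s * d (t, x, v)\<bar> \<le> K * s\<^sup>2" for z z' t x v w s
  using adm unfolding admissible_def by blast+
 have B0: "B \<ge> 0" using \<phi>B[of undefined] by linarith
 have K0: "K \<ge> 0" using dK[of undefined] by linarith
 have cont: "continuous_on A \<phi>" "continuous_on A d" for A
  by (rule lipschitz_on_continuous_on[of K]; use K0 \<phi>K dL in \<open>auto simp: lipschitz_on_def dist_norm\<close>)+
 have [measurable]: "\<phi> \<in> borel_measurable borel" "d \<in> borel_measurable borel"
  by (intro borel_measurable_continuous_onI cont)+
 have \<omega>c: "continuous_on A ?\<omega>" for A
  by (intro continuous_intros continuous_on_compose2[OF continuous_time_cutoff[OF \<alpha>(1)]] continuous_on_compose2[OF continuous_space_cutoff]) auto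
 have \<psi>c: "continuous_on A ?\<psi>" for A by (intro continuous_on_mult \<omega>c cont)
 have [measurable]: "time_cutoff \<alpha> T \<in> borel_measurable borel" "space_cutoff N \<in> borel_measurable (borel :: ((real^'n) \<times> (real^'n)) measure)"
  by (intro borel_measurable_continuous_onI continuous_time_cutoff continuous_space_cutoff \<alpha>)+
 have \<omega>01: "0 \<le> ?\<omega> z" "?\<omega> z \<le> 1" for z
  by (simp_all add: mult_le_one time_cutoff_bounds space_cutoff_bounds)
 have \<omega>L: "\<bar>?\<omega> z - ?\<omega> z'\<bar> \<le> (2 / \<alpha> + 1) * norm (z - z')" for z z'
 proof -
  have "\<bar>?\<omega> z - ?\<omega> z'\<bar> \<le> 1 * (norm (snd z - snd z') / real (Suc N)) + (2 / \<alpha> * \<bar>fst z - fst z'\<bar>) * 1"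
   by (rule mult_lipschitz[OF time_cutoff_lipschitz space_cutoff_lipschitz]) (use \<alpha> in \<open>simp_all add: abs_of_nonneg time_cutoff_bounds space_cutoff_bounds\<close>)
  also have "norm (snd z - snd z') / real (Suc N) \<le> norm (z - z') / 1"
   by (rule frac_le) (use dist_snd_le[of z z'] in \<open>auto simp: dist_norm\<close>)
  also have "2 / \<alpha> * \<bar>fst z - fst z'\<bar> \<le> 2 / \<alpha> * norm (z - z')"
   using dist_fst_le[of z z'] \<alpha> by (intro mult_left_mono) (auto simp: dist_norm)
  finally show ?thesis by (simp add: algebra_simps)
 qed
 have \<psi>L: "\<bar>?\<psi> z - ?\<psi> z'\<bar> \<le> ((2 / \<alpha> + 1) * B + K) * norm (z - z')" for z z'
  using mult_lipschitz[OF \<omega>L[of z z'] \<phi>K[of z z'], of 1 B] \<omega>01[of z] \<phi>B[of z'] by (simp add: algebra_simps)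
 have \<omega>dL: "\<bar>?\<omega> z * d z - ?\<omega> z' * d z'\<bar> \<le> ((2 / \<alpha> + 1) * K + K) * norm (z - z')" for z z'
  using mult_lipschitz[OF \<omega>L[of z z'] dL[of z z'], of 1 K] \<omega>01[of z] dK[of z'] by (simp add: algebra_simps)
 \<comment> \<open>At most 1/N' so that mollification errors vanish with N, and at most \<alpha>/2
   so that the support stays inside ]0,T[; since N' \<ge> 1 the velocity shift is also at most
   1.\<close>
 define e where "e = min (1 / N') (\<alpha> / 2)"
 have e: "e > 0" "e \<le> 1 / N'" "e \<le> \<alpha> / 2" "e \<le> 1"
  using \<alpha> N' by (auto simp: e_def min_le_iff_disj)
 obtain \<rho> :: "real \<times> (real^'n) \<times> (real^'n) \<Rightarrow> real" where \<rho>: "\<And>z. 0 \<le> \<rho> z" "\<And>z. e < norm z \<Longrightarrow> \<rho> z = 0"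
  "integrable lborel \<rho>" "(LINT z|lborel. \<rho> z) = 1"
  "\<And>\<psi>. integrable lborel \<psi> \<Longrightarrow> smooth (\<lambda>z. LINT y|lborel. \<rho> (z - y) * \<psi> y)"
  "\<And>z \<psi>. integrable lborel \<psi> \<Longrightarrow> integrable lborel (\<lambda>y. \<rho> (z - y) * \<psi> y)"
  by (rule mollifier_exists[OF e(1)]) (rule that, assumption+)
 have [measurable]: "\<rho> \<in> borel_measurable borel" using \<rho>(3) by auto
 let ?S = "{\<alpha>..T-\<alpha>} \<times> cball 0 (2 * N')"
 have \<psi>0: "?\<psi> z = 0" if "z \<notin> ?S" for z
  using that time_cutoff_eq_0[OF \<alpha>(1), of "fst z" T] space_cutoff_eq_0[of N "snd z"]
  by (cases z) (auto simp: N'_def)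
 have \<psi>i: "integrable lborel ?\<psi>"
 proof -
  have "integrable lborel (\<lambda>z. indicator ?S z *\<^sub>R ?\<psi> z)"
   by (intro borel_integrable_compact compact_Times compact_cball compact_Icc \<psi>c)
  moreover have "(\<lambda>z. indicator ?S z *\<^sub>R ?\<psi> z) = ?\<psi>"
   by (rule ext) (use \<psi>0 in \<open>auto simp: indicator_def\<close>)
  ultimately show ?thesis by (simp only:)
 qed
 define \<Phi> where "\<Phi> z = (LINT y|lborel. \<rho> (z - y) * ?\<psi> y)" for z
 have sm: "smooth \<Phi>" unfolding \<Phi>_def[abs_def] by (rule \<rho>(5)[OF \<psi>i])
 have alt: "\<Phi> z = (LINT y|lborel. \<rho> y * ?\<psi> (z - y))" for z
 proof -
  have "(\<lambda>y. ?\<psi> (z - y)) \<in> borel_measurable borel"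
   by (intro borel_measurable_continuous_onI continuous_on_compose2[OF \<psi>c] continuous_intros) auto
  then have "(\<lambda>y. \<rho> y * ?\<psi> (z - y)) \<in> borel_measurable borel"
   by (rule borel_measurable_times[OF \<open>\<rho> \<in> borel_measurable borel\<close>])
  from integral_lborel_translate(2)[OF this, of z] show ?thesis unfolding \<Phi>_def by simp
 qed
 have alti: "integrable lborel (\<lambda>y. \<rho> y * ?\<psi> (z - y))" for z
  using integrable_lborel_translate(2)[OF \<rho>(6)[OF \<psi>i, of z], of z] by simp
 \<comment> \<open>An increment of \<Phi> is an average of increments of the unmollified function at
   points within e, so bounds need only be proved for the latter.\<close>
 have moll: "\<bar>\<Phi> z' - \<Phi> z - q\<bar> \<le> c"
  if "\<And>y. norm y \<le> e \<Longrightarrow> \<bar>?\<psi> (z' - y) - ?\<psi> (z - y) - q\<bar> \<le> c" for z z' q c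
 proof -
  have "\<Phi> z' - \<Phi> z - q = (LINT y|lborel. \<rho> y * ?\<psi> (z' - y) - \<rho> y * ?\<psi> (z - y) - \<rho> y * q)"
   unfolding alt using \<rho>(3,4) alti[of z] alti[of z'] by simp
  also have "\<dots> = (LINT y|lborel. \<rho> y * (?\<psi> (z' - y) - ?\<psi> (z - y) - q))"
   by (simp add: right_diff_distrib)
  finally have eq: "\<Phi> z' - \<Phi> z - q = (LINT y|lborel. \<rho> y * (?\<psi> (z' - y) - ?\<psi> (z - y) - q))" .
  have "integrable lborel (\<lambda>y. \<rho> y * ?\<psi> (z' - y) - \<rho> y * ?\<psi> (z - y) - \<rho> y * q)"
   using \<rho>(3) alti[of z] alti[of z'] by simp
  then have i: "integrable lborel (\<lambda>y. \<rho> y * (?\<psi> (z' - y) - ?\<psi> (z - y) - q))"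
   by (simp add: right_diff_distrib)
  show ?thesis unfolding eq
   by (rule mollified_bound[of \<rho> e, OF _ _ \<rho>(3,4) i]) (rule \<rho>(1), erule \<rho>(2), erule that)
 qed
 have diff: "\<Phi> differentiable (at z)" for z
 proof -
  have "iterated_partial [] \<Phi> differentiable_on UNIV" using sm unfolding smooth_def by blast
  then show ?thesis unfolding differentiable_on_def iterated_partial.simps by (rule bspec) simp
 qed
 have pm: "partial b \<Phi> \<in> borel_measurable borel" if "b \<in> Basis" for b
 proof -
  have "[b] \<in> lists Basis" using that by simp
  with sm have "iterated_partial [b] \<Phi> differentiable_on UNIV" unfolding smooth_def by (rule bspec)
  then show ?thesis unfolding iterated_partial.simps
   by (intro borel_measurable_continuous_onI differentiable_imp_continuous_on)
 qed
 have pm1 [measurable]: "partial (1, 0, 0) \<Phi> \<in> borel_measurable borel"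
  by (rule pm) (simp add: Basis_prod_def zero_prod_def)
 have pm2 [measurable]: "partial (0, axis i 1, 0) \<Phi> \<in> borel_measurable borel" for i
  by (rule pm) (auto simp: Basis_prod_def image_iff axis_in_Basis_iff)
 have pm3: "partial (0, 0, axis i 1) \<Phi> \<in> borel_measurable borel" for i
  by (rule pm) (auto simp: Basis_prod_def image_iff axis_in_Basis_iff)
 \<comment> \<open>The time cutoff does not depend on the velocity; the slope \<Lambda> comes from
   \<phi>, and B / N' from the space cutoff, which also cuts off velocities.\<close>
 have pv: "\<bar>partial (0, 0, axis i 1) \<Phi> z\<bar> \<le> \<Lambda> + B / N'" for i z
 proof -
  have "\<bar>frechet_derivative \<Phi> (at z) (0, 0, axis i 1) - 0\<bar> \<le> \<Lambda> + B / N'"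
  proof (rule frechet_derivative_estimate[OF diff, of 1 _ _ _ _ 0])
   fix s :: real assume s: "0 < s" "s \<le> 1"
   let ?b = "(0::real, 0::real^'n, axis i (1::real))"
   show "\<bar>\<Phi> (z + s *\<^sub>R ?b) - \<Phi> z - s * 0\<bar> \<le> (\<Lambda> + B / N') * s + 0 * s\<^sup>2"
   proof (rule moll)
    fix y
    obtain t x v where W: "z - y = (t, x, v)" by (cases "z - y") auto
    have W': "z + s *\<^sub>R ?b - y = (t, x, v + s *\<^sub>R axis i 1)"
     using W by (simp add: prod_eq_iff)
    have "\<bar>?\<psi> (t, x, v + s *\<^sub>R axis i 1) - ?\<psi> (t, x, v)\<bar> \<le> 1 * (\<Lambda> * s) + (s / N') * B"
    proof (rule mult_lipschitz)
     have "space_cutoff N (x, v + s *\<^sub>R axis i 1) - space_cutoff N (x, v) \<le> s / N' \<and>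
      space_cutoff N (x, v) - space_cutoff N (x, v + s *\<^sub>R axis i 1) \<le> s / N'"
      using space_cutoff_lipschitz[of N "(x, v + s *\<^sub>R axis i 1)" "(x, v)"] s
      by (simp add: norm_Pair N'_def abs_le_iff)
     then have "\<bar>space_cutoff N (x, v + s *\<^sub>R axis i 1) - space_cutoff N (x, v)\<bar> \<le> s / N'" by linarith
     then show "\<bar>?\<omega> (t, x, v + s *\<^sub>R axis i 1) - ?\<omega> (t, x, v)\<bar> \<le> s / N'"
      using mult_left_le_one_le[OF abs_ge_zero time_cutoff_bounds(1)[of \<alpha> T t] time_cutoff_bounds(2)[of \<alpha> T t], of "space_cutoff N (x, v + s *\<^sub>R axis i 1) - space_cutoff N (x, v)"]
      unfolding fst_conv snd_conv right_diff_distrib[symmetric] abs_mult abs_of_nonneg[OF time_cutoff_bounds(1)]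
      by linarith
     show "\<bar>\<phi> (t, x, v + s *\<^sub>R axis i 1) - \<phi> (t, x, v)\<bar> \<le> \<Lambda> * s"
      using \<phi>v[of t x "v + s *\<^sub>R axis i 1" v] s by simp
    qed (use \<omega>01[of "(t, x, v + s *\<^sub>R axis i 1)"] \<phi>B in auto)
    then show "\<bar>?\<psi> (z + s *\<^sub>R ?b - y) - ?\<psi> (z - y) - s * 0\<bar> \<le> (\<Lambda> + B / N') * s + 0 * s\<^sup>2"
     unfolding W W' by (simp add: algebra_simps)
   qed
  qed simp
  then show ?thesis by (simp add: partial_def)
 qed
 \<comment> \<open>The times at which the cutoff may vary under shifts of at most \<alpha>.\<close>
 let ?bad = "\<lambda>t::real. if t \<in> {0..3*\<alpha>} \<or> t \<in> {T-3*\<alpha>..T} then 2 / \<alpha> else 0"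
 let ?k = "((2 / \<alpha> + 1) * B + K) * (La * e) + ((2 / \<alpha> + 1) * K + K) * e + B * (?A / N')"
 have tr: "\<bar>frechet_derivative \<Phi> (at z) (1, a (snd (snd z)), 0) - (- (?\<omega> z * d z))\<bar> \<le> ?k + B * ?bad (fst z)"
  if z: "norm (snd (snd z)) \<le> R" for z
 proof (rule frechet_derivative_estimate[OF diff, of "min 1 (\<alpha>/2)" _ _ _ _ "K + K * (2 / \<alpha> + ?A)"])
  \<comment> \<open>The bound s \<le> \<alpha>/2 together with e \<le> \<alpha>/2 keeps the total
    time shift within \<alpha>; s \<le> 1 is the range of the quadratic remainder.\<close>
  show "0 < min 1 (\<alpha> / 2)" using \<alpha> by simp
  fix s :: real assume s: "0 < s" "s \<le> min 1 (\<alpha> / 2)"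
  let ?b = "(1::real, a (snd (snd z)), 0::real^'n)"
  show "\<bar>\<Phi> (z + s *\<^sub>R ?b) - \<Phi> z - s * - (?\<omega> z * d z)\<bar> \<le> (?k + B * ?bad (fst z)) * s + (K + K * (2 / \<alpha> + ?A)) * s\<^sup>2"
  proof (rule moll)
   fix y :: "real \<times> (real^'n) \<times> (real^'n)" assume y: "norm y \<le> e"
   obtain t x v where W: "z - y = (t, x, v)" by (cases "z - y") auto
   have W': "z + s *\<^sub>R ?b - y = (t + s, x + s *\<^sub>R a (snd (snd z)), v)"
    using W by (simp add: prod_eq_iff)
   have yt: "\<bar>fst y\<bar> \<le> e" using dist_fst_le[of y 0] y by simp
   have yv: "norm (snd (snd y)) \<le> e" using dist_snd_le[of y 0] dist_snd_le[of "snd y" 0] y by simp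
   have vz: "snd (snd z) - v = snd (snd y)" and tz: "fst z - t = fst y" using W by (auto simp: prod_eq_iff)
   have vR: "norm v \<le> R + 1"
    using norm_triangle_ineq4[of "snd (snd z)" "snd (snd y)"] z yv e(4) vz[symmetric] by (simp add: algebra_simps)
   let ?W1 = "(t + s, x + s *\<^sub>R a v, v)"
   \<comment> \<open>The derivative at z is taken in the direction given by the velocity of z,
     whereas the remainder estimate for \<phi> holds along the direction at the shifted velocity v.
     This commutator is of size e s because \<open>a\<close> is Lipschitz.\<close>
   define p1 where "p1 = ?\<psi> (t + s, x + s *\<^sub>R a (snd (snd z)), v) - ?\<psi> ?W1"
   define \<omega>1 where "\<omega>1 = ?\<omega> ?W1"
   define \<omega>0 where "\<omega>0 = ?\<omega> (t, x, v)"
   define \<phi>1 where "\<phi>1 = \<phi> ?W1"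
   define \<phi>0 where "\<phi>0 = \<phi> (t, x, v)"
   define d0 where "d0 = d (t, x, v)"
   define p5 where "p5 = \<omega>0 * d0 - ?\<omega> z * d z"
   define \<delta> where "\<delta> = ?bad (fst z) + ?A / N'"
   have b1: "\<bar>p1\<bar> \<le> ((2 / \<alpha> + 1) * B + K) * (La * e) * s"
   proof -
    have "norm ((t + s, x + s *\<^sub>R a (snd (snd z)), v) - ?W1) = s * norm (a (snd (snd z)) - a v)"
     using s by (simp add: norm_Pair scaleR_diff_right[symmetric])
    also have "\<dots> \<le> s * (La * e)"
     using a_lip[of "snd (snd z)" v] yv La s vz by (intro mult_left_mono order_trans[OF a_lip]) auto
    finally have "((2 / \<alpha> + 1) * B + K) * norm ((t + s, x + s *\<^sub>R a (snd (snd z)), v) - ?W1) \<le> ((2 / \<alpha> + 1) * B + K) * (s * (La * e))"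
     using \<alpha> B0 K0 by (intro mult_left_mono) auto
    then show ?thesis unfolding p1_def using \<psi>L[of "(t + s, x + s *\<^sub>R a (snd (snd z)), v)" ?W1]
     by (simp add: ac_simps)
   qed
   have b2: "\<bar>\<phi>1 - \<phi>0 + s * d0\<bar> \<le> K * s\<^sup>2"
    unfolding \<phi>1_def \<phi>0_def d0_def using quad[OF vR, of s t x] s by simp
   have b3: "\<bar>\<omega>1 - \<omega>0\<bar> \<le> s * \<delta>"
   proof -
    have "\<bar>\<omega>1 - \<omega>0\<bar> \<le> 1 * (s * (?A / N')) + (s * ?bad (fst z)) * 1"
     unfolding \<omega>1_def \<omega>0_def fst_conv snd_conv
    proof (rule mult_lipschitz)
     show "\<bar>time_cutoff \<alpha> T (t + s) - time_cutoff \<alpha> T t\<bar> \<le> s * ?bad (fst z)"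
     proof (cases "fst z \<in> {0..3*\<alpha>} \<or> fst z \<in> {T-3*\<alpha>..T}")
      case True then show ?thesis using time_cutoff_lipschitz[OF \<alpha>(1), of T "t + s" t] s by (simp add: mult.commute)
     next
      case False
      have "time_cutoff \<alpha> T (t + s) = time_cutoff \<alpha> T (fst z)" "time_cutoff \<alpha> T t = time_cutoff \<alpha> T (fst z)"
       by (rule time_cutoff_locally_constant; use False \<alpha> yt tz e s in \<open>auto simp: abs_le_iff\<close>)+
      then show ?thesis using s \<alpha> by simp
     qed
     show "\<bar>space_cutoff N (x + s *\<^sub>R a v, v) - space_cutoff N (x, v)\<bar> \<le> s * (?A / N')"
     proof -
      have "\<bar>space_cutoff N (x + s *\<^sub>R a v, v) - space_cutoff N (x, v)\<bar> \<le> s * norm (a v) / N'"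
       using space_cutoff_lipschitz[of N "(x + s *\<^sub>R a v, v)" "(x, v)"] s by (simp add: norm_Pair N'_def)
      also have "\<dots> \<le> s * ?A / N'" using velocity_bound(1)[OF vR] s N' by (intro divide_right_mono mult_left_mono) auto
      finally show ?thesis by simp
     qed
    qed (simp_all add: abs_of_nonneg time_cutoff_bounds space_cutoff_bounds)
    then show ?thesis by (simp add: \<delta>_def algebra_simps)
   qed
   have d0K: "\<bar>d0\<bar> \<le> K" and \<phi>0B: "\<bar>\<phi>0\<bar> \<le> B" and \<omega>1b: "0 \<le> \<omega>1" "\<omega>1 \<le> 1"
    unfolding d0_def \<phi>0_def \<omega>1_def using dK \<phi>B \<omega>01 by auto
   have \<delta>0: "0 \<le> \<delta>" "\<delta> \<le> 2 / \<alpha> + ?A"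
   proof -
    have "?A / N' \<le> ?A / 1" using velocity_bound(2) N' by (intro divide_left_mono) auto
    moreover have "?A / N' \<ge> 0" using velocity_bound(2) N' by simp
    moreover have "0 \<le> ?bad (fst z)" "?bad (fst z) \<le> 2 / \<alpha>" using \<alpha> by auto
    ultimately show "0 \<le> \<delta>" "\<delta> \<le> 2 / \<alpha> + ?A" unfolding \<delta>_def by linarith+
   qed
   have b5: "\<bar>p5\<bar> \<le> ((2 / \<alpha> + 1) * K + K) * e"
   proof -
    have "norm ((t, x, v) - z) \<le> e" using W y by (metis diff_diff_eq2 diff_0 minus_diff_eq norm_minus_cancel add_diff_cancel_left' diff_add_cancel)
    then have "((2 / \<alpha> + 1) * K + K) * norm ((t, x, v) - z) \<le> ((2 / \<alpha> + 1) * K + K) * e"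
     using \<alpha> K0 by (intro mult_left_mono) auto
    then show ?thesis unfolding p5_def \<omega>0_def d0_def using \<omega>dL[of "(t, x, v)" z] by linarith
   qed
   \<comment> \<open>An exact decomposition: direction commutator, transport remainder of \<phi>,
     increment of the cutoffs against \<phi>, its product with the transport increment, and
     displacement of the point where the cutoff times d is evaluated.\<close>
   have "?\<psi> (z + s *\<^sub>R ?b - y) - ?\<psi> (z - y) - s * - (?\<omega> z * d z) =
     p1 + \<omega>1 * (\<phi>1 - \<phi>0 + s * d0) + (\<omega>1 - \<omega>0) * \<phi>0 - s * d0 * (\<omega>1 - \<omega>0) - s * p5"
    unfolding W W' p1_def \<omega>1_def[symmetric] \<omega>0_def[symmetric] \<phi>1_def[symmetric] \<phi>0_def[symmetric] p5_def
    by (simp add: algebra_simps)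
   moreover have "\<bar>p1 + \<omega>1 * (\<phi>1 - \<phi>0 + s * d0) + (\<omega>1 - \<omega>0) * \<phi>0 - s * d0 * (\<omega>1 - \<omega>0) - s * p5\<bar> \<le>
     ((2 / \<alpha> + 1) * B + K) * (La * e) * s + K * s\<^sup>2 + s * \<delta> * B + K * (2 / \<alpha> + ?A) * s\<^sup>2 + s * (((2 / \<alpha> + 1) * K + K) * e)"
   proof -
    have "\<bar>\<omega>1 * (\<phi>1 - \<phi>0 + s * d0)\<bar> \<le> 1 * (K * s\<^sup>2)"
     unfolding abs_mult using \<omega>1b b2 by (intro mult_mono) auto
    moreover have "\<bar>(\<omega>1 - \<omega>0) * \<phi>0\<bar> \<le> s * \<delta> * B"
     unfolding abs_mult using b3 \<phi>0B s \<delta>0 by (intro mult_mono) auto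
    moreover have "\<bar>s * d0 * (\<omega>1 - \<omega>0)\<bar> \<le> K * (2 / \<alpha> + ?A) * s\<^sup>2"
    proof -
     have "\<bar>s * d0 * (\<omega>1 - \<omega>0)\<bar> \<le> (s * K) * (s * \<delta>)"
      unfolding abs_mult using b3 d0K s K0 by (intro mult_mono) auto
     also have "\<dots> \<le> (s * K) * (s * (2 / \<alpha> + ?A))" using s K0 \<delta>0 by (intro mult_left_mono) auto
     finally show ?thesis by (simp add: power2_eq_square ac_simps)
    qed
    moreover have "\<bar>s * p5\<bar> \<le> s * (((2 / \<alpha> + 1) * K + K) * e)"
     unfolding abs_mult using b5 s by simp
    ultimately show ?thesis using b1 by linarith
   qed
   ultimately show "\<bar>?\<psi> (z + s *\<^sub>R ?b - y) - ?\<psi> (z - y) - s * - (?\<omega> z * d z)\<bar> \<le> (?k + B * ?bad (fst z)) * s + (K + K * (2 / \<alpha> + ?A)) * s\<^sup>2"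
    unfolding \<delta>_def by (simp only: distrib_left distrib_right mult.assoc mult.commute mult.left_commute add.assoc add.commute add.left_commute)
  qed
 qed
 have tf: "test_function ({0<..<T} \<times> UNIV) \<Phi>"
  unfolding test_function_def
 proof (intro conjI exI[of _ "{\<alpha>/2..T-\<alpha>/2} \<times> cball 0 (2 * N' + 1)"] allI impI sm)
  show "compact ({\<alpha>/2..T-\<alpha>/2} \<times> cball (0 :: (real^'n) \<times> (real^'n)) (2 * N' + 1))"
   by (intro compact_Times compact_cball compact_Icc)
  show "{\<alpha>/2..T-\<alpha>/2} \<times> cball 0 (2 * N' + 1) \<subseteq> {0<..<T} \<times> (UNIV :: ((real^'n) \<times> (real^'n)) set)"
   using \<alpha> by auto
  fix z :: "real \<times> (real^'n) \<times> (real^'n)" assume z: "z \<notin> {\<alpha>/2..T-\<alpha>/2} \<times> cball 0 (2 * N' + 1)"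
  have "\<rho> (z - y) * ?\<psi> y = 0" for y
  proof (cases "e < norm (z - y)")
   case False
   have 1: "\<bar>fst z - fst y\<bar> \<le> e" "norm (snd z - snd y) \<le> e"
    using dist_fst_le[of z y] dist_snd_le[of z y] False by (auto simp: dist_norm)
   have 2: "norm (snd z) \<le> norm (snd y) + e" using norm_triangle_sub[of "snd z" "snd y"] 1 by simp
   have "y \<notin> ?S"
   proof
    assume "y \<in> ?S"
    then have "fst y \<in> {\<alpha>..T-\<alpha>}" "norm (snd y) \<le> 2 * N'" by (auto simp: mem_Times_iff)
    then have "fst z \<in> {\<alpha>/2..T-\<alpha>/2}" "norm (snd z) \<le> 2 * N' + 1" using 1 2 e by auto
    then show False using z by (auto simp: mem_Times_iff)
   qed
   then show ?thesis using \<psi>0 by simp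
  qed (simp add: \<rho>)
  then have "(\<lambda>y. \<rho> (z - y) * ?\<psi> y) = (\<lambda>_. 0)" by (rule ext)
  then show "\<Phi> z = 0" unfolding \<Phi>_def by (simp only: Bochner_Integration.integral_zero)
 qed
 let ?G = "\<lambda>z. partial (1, 0, 0) \<Phi> z + (\<Sum>i\<in>UNIV. a (snd (snd z)) $ i * partial (0, axis i 1, 0) \<Phi> z)"
 have "(\<lambda>z. a (snd (snd z)) $ i) \<in> borel_measurable (borel :: (real \<times> (real^'n) \<times> (real^'n)) measure)" for i
  by (intro borel_measurable_continuous_onI continuous_on_component continuous_on_compose2[OF a_continuous[of UNIV]] continuous_intros) auto
 then have [measurable]: "?G \<in> borel_measurable borel"
  by (intro borel_measurable_add borel_measurable_sum borel_measurable_times pm1 pm2)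
 have Geq: "?G z = frechet_derivative \<Phi> (at z) (1, a (snd (snd z)), 0)" for z
  by (rule transport_direction[OF diff])
 let ?c = "\<lambda>z. ?k + B * ?bad (fst z)"
 \<comment> \<open>Where |v| > R the function f vanishes, so the transport estimate at velocities up
   to R covers the whole integral.\<close>
 have ptw: "\<bar>f z * ?G z + ?\<omega> z * f z * d z\<bar> \<le> \<bar>f z\<bar> * ?c z" for z
 proof (cases "norm (snd (snd z)) \<le> R")
  case True
  have "f z * ?G z + ?\<omega> z * f z * d z = f z * (?G z - (- (?\<omega> z * d z)))" by (simp add: algebra_simps)
  then show ?thesis using tr[OF True] unfolding Geq by (simp add: abs_mult mult_left_mono)
 next
  case False then have "f z = 0" using f_supp[of "fst z" "snd (snd z)" "fst (snd z)"] by simp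
  then show ?thesis by simp
 qed
 have bi: "integrable lborel (\<lambda>z. \<bar>f z\<bar> * indicator {p..q} (fst z))" for p q :: real
 proof (rule Bochner_Integration.integrable_bound[OF f_int])
  show "(\<lambda>z. \<bar>f z\<bar> * indicator {p..q} (fst z)) \<in> borel_measurable lborel"
   using measurable_compose[OF borel_measurable_fst, of "indicat_real {p..q}" borel] by simp
 qed (auto simp: indicator_def)
 have ci: "integrable lborel (\<lambda>z. \<bar>f z\<bar> * ?c z)"
 proof (rule Bochner_Integration.integrable_bound)
  show "integrable lborel (\<lambda>z. f z * (\<bar>?k\<bar> + \<bar>B\<bar> * (2 / \<alpha>)))" using f_int by simp
  show "AE z in lborel. norm (\<bar>f z\<bar> * ?c z) \<le> norm (f z * (\<bar>?k\<bar> + \<bar>B\<bar> * (2 / \<alpha>)))"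
  proof (rule AE_I2)
   fix z :: "real \<times> (real^'n) \<times> (real^'n)"
   have "\<bar>?c z\<bar> \<le> \<bar>?k\<bar> + \<bar>B\<bar> * (2 / \<alpha>)"
    using \<alpha> by (intro order_trans[OF abs_triangle_ineq] add_left_mono) (auto simp: abs_mult)
   then have "\<bar>f z\<bar> * \<bar>?c z\<bar> \<le> \<bar>f z\<bar> * (\<bar>?k\<bar> + \<bar>B\<bar> * (2 / \<alpha>))"
    by (rule mult_left_mono) simp
   also have "\<dots> = \<bar>f z\<bar> * \<bar>\<bar>?k\<bar> + \<bar>B\<bar> * (2 / \<alpha>)\<bar>"
    by (subst abs_of_nonneg[of "\<bar>?k\<bar> + \<bar>B\<bar> * (2 / \<alpha>)"]) (use \<alpha> in auto)
   finally show "norm (\<bar>f z\<bar> * ?c z) \<le> norm (f z * (\<bar>?k\<bar> + \<bar>B\<bar> * (2 / \<alpha>)))"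
    by (simp only: real_norm_def abs_mult[of "\<bar>f z\<bar>"] abs_mult[of "f z"] abs_abs)
  qed
 qed measurable
 have \<omega>fi: "integrable lborel (\<lambda>z. ?\<omega> z * f z * d z)"
 proof (rule Bochner_Integration.integrable_bound)
  show "integrable lborel (\<lambda>z. f z * K)" using f_int by simp
  show "AE z in lborel. norm (?\<omega> z * f z * d z) \<le> norm (f z * K)"
  proof (rule AE_I2)
   fix z
   have "\<bar>?\<omega> z\<bar> * \<bar>f z\<bar> * \<bar>d z\<bar> \<le> 1 * \<bar>f z\<bar> * K" using \<omega>01[of z] dK[of z] by (intro mult_mono) auto
   then show "norm (?\<omega> z * f z * d z) \<le> norm (f z * K)" using K0 by (simp add: abs_mult)
  qed
 qed measurable
 have sumi: "integrable lborel (\<lambda>z. f z * ?G z + ?\<omega> z * f z * d z)"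
 proof (rule Bochner_Integration.integrable_bound[OF ci])
  show "AE z in lborel. norm (f z * ?G z + ?\<omega> z * f z * d z) \<le> norm (\<bar>f z\<bar> * ?c z)"
   unfolding real_norm_def by (intro AE_I2 order_trans[OF ptw abs_ge_self])
 qed (use borel_measurable_integrable[OF \<omega>fi] in measurable)
 have Gi: "integrable lborel (\<lambda>z. f z * ?G z)"
  using Bochner_Integration.integrable_diff[OF sumi \<omega>fi] by simp
 have r1: "\<bar>LINT z|lborel. f z * ?G z\<bar> \<le> mass * (\<Lambda> + B / N')"
 proof -
  have "(LINT z|lborel. f z * ?G z) = (\<Sum>i\<in>UNIV. signed_integral (m i) (partial (0, 0, axis i 1) \<Phi>))"
   by (rule weak_eq[OF tf])
  also have "\<bar>\<dots>\<bar> \<le> (\<Sum>i\<in>UNIV. (measure (fst (m i)) UNIV + measure (snd (m i)) UNIV) * (\<Lambda> + B / N'))"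
   by (rule order_trans[OF sum_abs sum_mono]) (rule signed_integral_bound[OF pm3 pv])
  also have "\<dots> = mass * (\<Lambda> + B / N')" by (simp add: mass_def sum_distrib_right)
  finally show ?thesis .
 qed
 have r2: "(LINT z|lborel. \<bar>f z\<bar> * ?c z) \<le> D / N' * (C * T) + 12 * C * B"
 proof -
  have c0: "?k \<le> D / N'"
  proof -
   have "((2 / \<alpha> + 1) * B + K) * (La * e) \<le> ((2 / \<alpha> + 1) * B + K) * (La * (1 / N'))"
    using \<alpha> B0 K0 La e by (intro mult_left_mono) auto
   moreover have "((2 / \<alpha> + 1) * K + K) * e \<le> ((2 / \<alpha> + 1) * K + K) * (1 / N')"
    using \<alpha> K0 e by (intro mult_left_mono) auto
   moreover have "((2 / \<alpha> + 1) * B + K) * (La * (1 / N')) + ((2 / \<alpha> + 1) * K + K) * (1 / N') + B * (?A / N') = D / N'"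
    by (simp add: D_def add_divide_distrib)
   ultimately show ?thesis by linarith
  qed
  \<comment> \<open>Each end of the time interval contributes B (2/\<alpha>) times C (3 \<alpha>),
    that is 6 C B; this explains 12 C B and its independence of \<alpha>.\<close>
  have "(LINT z|lborel. \<bar>f z\<bar> * ?c z) \<le> (LINT z|lborel. (D / N') * \<bar>f z\<bar> + (B * (2 / \<alpha>)) * (\<bar>f z\<bar> * indicator {0..3*\<alpha>} (fst z)) + (B * (2 / \<alpha>)) * (\<bar>f z\<bar> * indicator {T-3*\<alpha>..T} (fst z)))"
  proof (rule integral_mono[OF ci])
   show "integrable lborel (\<lambda>z. (D / N') * \<bar>f z\<bar> + (B * (2 / \<alpha>)) * (\<bar>f z\<bar> * indicator {0..3*\<alpha>} (fst z)) + (B * (2 / \<alpha>)) * (\<bar>f z\<bar> * indicator {T-3*\<alpha>..T} (fst z)))"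
    by (intro Bochner_Integration.integrable_add integrable_mult_right bi integrable_abs f_int)
   fix z :: "real \<times> (real^'n) \<times> (real^'n)"
   have "?c z \<le> D / N' + (B * (2 / \<alpha>)) * indicator {0..3*\<alpha>} (fst z) + (B * (2 / \<alpha>)) * indicator {T-3*\<alpha>..T} (fst z)"
   proof -
    have "0 \<le> B * (2 / \<alpha>)" using B0 \<alpha> by simp
    then have "B * ?bad (fst z) \<le> (B * (2 / \<alpha>)) * indicator {0..3*\<alpha>} (fst z) + (B * (2 / \<alpha>)) * indicator {T-3*\<alpha>..T} (fst z)"
     by (auto simp: indicator_def)
    then show ?thesis using c0 by linarith
   qed
   then have "\<bar>f z\<bar> * ?c z \<le> \<bar>f z\<bar> * (D / N' + (B * (2 / \<alpha>)) * indicator {0..3*\<alpha>} (fst z) + (B * (2 / \<alpha>)) * indicator {T-3*\<alpha>..T} (fst z))"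
    by (rule mult_left_mono) simp
   then show "\<bar>f z\<bar> * ?c z \<le> (D / N') * \<bar>f z\<bar> + (B * (2 / \<alpha>)) * (\<bar>f z\<bar> * indicator {0..3*\<alpha>} (fst z)) + (B * (2 / \<alpha>)) * (\<bar>f z\<bar> * indicator {T-3*\<alpha>..T} (fst z))"
    by (simp add: distrib_left mult.left_commute mult.commute)
  qed
  also have "\<dots> = (D / N') * (LINT z|lborel. \<bar>f z\<bar>) + (B * (2 / \<alpha>)) * (LINT z|lborel. \<bar>f z\<bar> * indicator {0..3*\<alpha>} (fst z)) + (B * (2 / \<alpha>)) * (LINT z|lborel. \<bar>f z\<bar> * indicator {T-3*\<alpha>..T} (fst z))"
   using f_int bi by simp
  also have "\<dots> \<le> (D / N') * (C * T) + (B * (2 / \<alpha>)) * (C * (3 * \<alpha> - 0)) + (B * (2 / \<alpha>)) * (C * (T - (T - 3 * \<alpha>)))"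
  proof (intro add_mono mult_left_mono f_abs_integral f_slice)
   show "0 \<le> D / N'" unfolding D_def using \<alpha> B0 K0 La velocity_bound(2) N' by simp
  qed (use \<alpha> B0 in auto)
  also have "\<dots> = D / N' * (C * T) + 12 * C * B" using \<alpha> by (simp add: field_simps)
  finally show ?thesis .
 qed
 have "(LINT z|lborel. ?\<omega> z * f z * d z) = (LINT z|lborel. f z * ?G z + ?\<omega> z * f z * d z) - (LINT z|lborel. f z * ?G z)"
  using Bochner_Integration.integral_add[OF Gi \<omega>fi] by simp
 moreover have "\<bar>LINT z|lborel. f z * ?G z + ?\<omega> z * f z * d z\<bar> \<le> (LINT z|lborel. \<bar>f z\<bar> * ?c z)"
  using Bochner_Integration.integral_norm_bound_integral[OF sumi ci] ptw by simp
 ultimately show ?thesis using r1 r2 unfolding N'_def by linarith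
qed

text \<open>Letting N tend to infinity removes the space cutoff by dominated convergence and, with
  it, every term containing K.\<close>

theorem lipschitz_test_bound:
 assumes adm: "admissible B \<Lambda> K \<phi> d" and \<alpha>: "0 < \<alpha>" "6 * \<alpha> \<le> T"
 shows "\<bar>LINT z|lborel. time_cutoff \<alpha> T (fst z) * f z * d z\<bar> \<le> mass * \<Lambda> + 12 * C * B"
proof -
 define D where "D = ((2 / \<alpha> + 1) * B + K) * La + ((2 / \<alpha> + 1) * K + K) + B * velocity_bound"
 let ?I = "\<lambda>N. LINT z|lborel. time_cutoff \<alpha> T (fst z) * space_cutoff N (snd z) * f z * d z"
 have dK: "\<bar>d z\<bar> \<le> K" and dL: "\<bar>d z - d z'\<bar> \<le> K * norm (z - z')" for z z'
  using adm unfolding admissible_def by blast+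
 have K0: "K \<ge> 0" using dK[of undefined] by linarith
 have "continuous_on UNIV d"
  by (rule lipschitz_on_continuous_on[of K]) (use K0 dL in \<open>auto simp: lipschitz_on_def dist_norm\<close>)
 then have [measurable]: "d \<in> borel_measurable borel" by (rule borel_measurable_continuous_onI)
 have [measurable]: "(\<lambda>z. time_cutoff \<alpha> T (fst z)) \<in> borel_measurable (borel :: (real \<times> (real^'n) \<times> (real^'n)) measure)"
  "(\<lambda>z. space_cutoff N (snd z)) \<in> borel_measurable (borel :: (real \<times> (real^'n) \<times> (real^'n)) measure)" for N
  by (intro borel_measurable_continuous_onI continuous_on_compose2[OF continuous_time_cutoff[OF \<alpha>(1), of UNIV]]
    continuous_on_compose2[OF continuous_space_cutoff[of UNIV]] continuous_intros; simp)+
 have "?I \<longlonglongrightarrow> (LINT z|lborel. time_cutoff \<alpha> T (fst z) * f z * d z)"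
 proof (rule integral_dominated_convergence[where w = "\<lambda>z. \<bar>f z\<bar> * K"])
  show "integrable lborel (\<lambda>z. \<bar>f z\<bar> * K)" using f_int by simp
  show "AE z in lborel. norm (time_cutoff \<alpha> T (fst z) * space_cutoff N (snd z) * f z * d z) \<le> \<bar>f z\<bar> * K" for N
  proof (rule AE_I2)
   fix z
   have "\<bar>time_cutoff \<alpha> T (fst z) * space_cutoff N (snd z)\<bar> * \<bar>f z\<bar> * \<bar>d z\<bar> \<le> 1 * \<bar>f z\<bar> * K"
    using time_cutoff_bounds[of \<alpha> T "fst z"] space_cutoff_bounds[of N "snd z"] dK[of z]
    by (intro mult_mono) (auto simp: abs_mult mult_le_one)
   then show "norm (time_cutoff \<alpha> T (fst z) * space_cutoff N (snd z) * f z * d z) \<le> \<bar>f z\<bar> * K"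
    by (simp add: abs_mult)
  qed
  show "AE z in lborel. (\<lambda>N. time_cutoff \<alpha> T (fst z) * space_cutoff N (snd z) * f z * d z) \<longlonglongrightarrow> time_cutoff \<alpha> T (fst z) * f z * d z"
  proof (rule AE_I2)
   fix z
   have "(\<lambda>N. time_cutoff \<alpha> T (fst z) * space_cutoff N (snd z) * f z * d z) \<longlonglongrightarrow> time_cutoff \<alpha> T (fst z) * 1 * f z * d z"
    by (intro tendsto_intros space_cutoff_limit)
   then show "(\<lambda>N. time_cutoff \<alpha> T (fst z) * space_cutoff N (snd z) * f z * d z) \<longlonglongrightarrow> time_cutoff \<alpha> T (fst z) * f z * d z" by simp
  qed
 qed measurable
 then have l: "(\<lambda>N. \<bar>?I N\<bar>) \<longlonglongrightarrow> \<bar>LINT z|lborel. time_cutoff \<alpha> T (fst z) * f z * d z\<bar>" by (rule tendsto_rabs)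
 have "(\<lambda>N. mass * (\<Lambda> + B * (1 / Suc N)) + 12 * C * B + D * (1 / Suc N) * (C * T)) \<longlonglongrightarrow> mass * (\<Lambda> + B * 0) + 12 * C * B + D * 0 * (C * T)"
  by (intro tendsto_intros LIMSEQ_Suc[OF lim_1_over_n])
 then show ?thesis
  using LIMSEQ_le[OF l, of _ "mass * \<Lambda> + 12 * C * B"] cutoff_bound[OF adm \<alpha>] unfolding D_def by simp
qed

end

declare borel_measurable_fst [measurable del] borel_measurable_snd [measurable del]

section \<open>The smoothing kernel\<close>

lemma integral_mult_bounded:
 fixes u h :: "'a \<Rightarrow> real"
 assumes u: "integrable M u" and [measurable]: "h \<in> borel_measurable M" and h: "\<And>x. \<bar>h x\<bar> \<le> C"
 shows "integrable M (\<lambda>x. u x * h x)" and "\<bar>LINT x|M. u x * h x\<bar> \<le> C * (LINT x|M. \<bar>u x\<bar>)"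
proof -
 have bd: "\<bar>u x * h x\<bar> \<le> C * \<bar>u x\<bar>" for x
  unfolding abs_mult using mult_left_mono[OF h[of x], of "\<bar>u x\<bar>"] by (simp add: mult.commute)
 have Ci: "integrable M (\<lambda>x. C * \<bar>u x\<bar>)" using u by simp
 show i: "integrable M (\<lambda>x. u x * h x)"
  by (rule Bochner_Integration.integrable_bound[OF Ci])
   (use u bd in \<open>auto intro!: AE_I2 intro: order_trans[OF bd abs_ge_self]\<close>)
 show "\<bar>LINT x|M. u x * h x\<bar> \<le> C * (LINT x|M. \<bar>u x\<bar>)"
 proof -
  have "norm (LINT x|M. u x * h x) \<le> (LINT x|M. norm (u x * h x))" by (rule integral_norm_bound)
  also have "\<dots> \<le> (LINT x|M. C * \<bar>u x\<bar>)"
   by (intro integral_mono Ci) (use i bd in auto)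
  finally show ?thesis by simp
 qed
qed

locale exp_kernel =
 fixes lam :: "'x::euclidean_space \<Rightarrow> real"
 assumes lam_pos: "\<And>b. b \<in> Basis \<Longrightarrow> lam b > 0"
begin

text \<open>The weighted l^1 norm for which \<open>ker\<close> is a multiple of exp(- ell).
  Displacements are measured in it, so the time rate is felt only by displacements in time.\<close>

definition ell :: "'x \<Rightarrow> real"
 where "ell x = (\<Sum>b\<in>Basis. lam b * \<bar>x \<bullet> b\<bar>)"

definition ker :: "'x \<Rightarrow> real"
 where "ker x = (\<Prod>b\<in>Basis. lam b / 2 * exp (- (lam b * \<bar>x \<bullet> b\<bar>)))"

definition ker_hat :: "'x \<Rightarrow> real"
 where "ker_hat \<xi> = (\<Prod>b\<in>Basis. (lam b)\<^sup>2 / ((lam b)\<^sup>2 + (\<xi> \<bullet> b)\<^sup>2))"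

lemma ell_nonneg: "0 \<le> ell x"
 unfolding ell_def by (intro sum_nonneg mult_nonneg_nonneg) (auto intro: less_imp_le lam_pos)

lemma ell_scale: "ell (r *\<^sub>R x) = \<bar>r\<bar> * ell x"
 by (simp add: ell_def sum_distrib_left abs_mult mult.left_commute)

lemma ell_triangle: "ell (x + y) \<le> ell x + ell y"
proof -
 have "ell (x + y) \<le> (\<Sum>b\<in>Basis. lam b * \<bar>x \<bullet> b\<bar> + lam b * \<bar>y \<bullet> b\<bar>)"
  unfolding ell_def
  by (intro sum_mono) (simp add: inner_add_left mult_left_mono[OF abs_triangle_ineq less_imp_le[OF lam_pos]] flip: distrib_left)
 then show ?thesis by (simp add: ell_def sum.distrib)
qed

lemma ell_le_norm: "ell x \<le> (\<Sum>b\<in>Basis. lam b) * norm x"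
 unfolding ell_def sum_distrib_right
 by (intro sum_mono mult_left_mono Basis_le_norm less_imp_le[OF lam_pos])

lemma ker_eq: "ker x = (\<Prod>b\<in>Basis. lam b / 2) * exp (- ell x)"
 unfolding ker_def ell_def sum_negf[symmetric] exp_sum[OF finite_Basis] prod.distrib ..

lemma ker_nonneg: "0 \<le> ker x"
 unfolding ker_def by (intro prod_nonneg mult_nonneg_nonneg) (auto intro: less_imp_le lam_pos)

lemma ker_measurable [measurable]: "ker \<in> borel_measurable borel"
 unfolding ker_def by measurable

lemma ker_le: "\<bar>ker x\<bar> \<le> (\<Prod>b\<in>(Basis :: 'x set). lam b / 2)"
proof -
 have "(\<Prod>b\<in>(Basis :: 'x set). lam b / 2) \<ge> 0" by (intro prod_nonneg) (auto intro: less_imp_le lam_pos)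
 then have "ker x \<le> (\<Prod>b\<in>(Basis :: 'x set). lam b / 2)"
  unfolding ker_eq by (rule mult_right_le_one_le) (auto simp: ell_nonneg)
 then show ?thesis by (simp only: abs_of_nonneg[OF ker_nonneg])
qed

lemma ker_integrable: "integrable lborel ker"
 unfolding ker_def by (intro integrable_lborel_prod integrable_mult_right exp_abs_integrable lam_pos)

lemma ker_ft: "ft (\<lambda>x. complex_of_real (ker x)) \<xi> = complex_of_real (ker_hat \<xi>)"
proof -
 let ?A = "\<Prod>b\<in>(Basis :: 'x set). lam b / 2"
 have "ft (\<lambda>x. complex_of_real (ker x)) \<xi> = (LINT x|lborel. complex_of_real ?A * (cis (- (x \<bullet> \<xi>)) * complex_of_real (\<Prod>b\<in>Basis. exp (- (lam b * \<bar>x \<bullet> b\<bar>)))))"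
  unfolding ft_def ker_def prod.distrib of_real_mult
  by (intro Bochner_Integration.integral_cong refl) (simp only: mult.left_commute)
 also have "\<dots> = complex_of_real ?A * complex_of_real (\<Prod>b\<in>Basis. 2 * lam b / ((lam b)\<^sup>2 + (\<xi> \<bullet> b)\<^sup>2))"
  using integral_prod_exp_cis[of lam \<xi>] lam_pos by simp
 also have "\<dots> = complex_of_real (ker_hat \<xi>)"
  unfolding of_real_mult[symmetric] prod.distrib[symmetric] ker_hat_def
  by (intro arg_cong[of _ _ complex_of_real] prod.cong refl) (simp add: power2_eq_square)
 finally show ?thesis .
qed

lemma ker_integral: "(LINT x|lborel. ker x) = 1"
proof -
 have "complex_of_real (LINT x|lborel. ker x) = ft (\<lambda>x. complex_of_real (ker x)) 0"
  by (simp add: ft_def)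
 also have "\<dots> = 1"
 proof -
  have "ker_hat 0 = (\<Prod>b\<in>(Basis :: 'x set). 1)"
   unfolding ker_hat_def by (intro prod.cong refl) (use lam_pos in force)
  then show ?thesis unfolding ker_ft by simp
 qed
 finally show ?thesis by (simp only: of_real_eq_1_iff)
qed

text \<open>The exponential of a norm varies in proportion to itself: for \<open>ell h\<close> at
  most 1 the change is at most 2 \<open>ell h\<close> times \<open>ker x\<close> pointwise. For
  larger h the two total masses already suffice.\<close>

lemma ker_shift:
 shows "integrable lborel (\<lambda>x. \<bar>ker (x + h) - ker x\<bar>)"
  and "(LINT x|lborel. \<bar>ker (x + h) - ker x\<bar>) \<le> 2 * ell h"
proof -
 have i: "integrable lborel (\<lambda>x. ker (x + h))"
  using integrable_lborel_translate(1)[OF ker_integrable, of h] by (simp add: add.commute)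
 show j: "integrable lborel (\<lambda>x. \<bar>ker (x + h) - ker x\<bar>)" using i ker_integrable by simp
 show "(LINT x|lborel. \<bar>ker (x + h) - ker x\<bar>) \<le> 2 * ell h"
 proof (cases "ell h \<le> 1")
  case True
  have "\<bar>ker (x + h) - ker x\<bar> \<le> 2 * ell h * ker x" for x
  proof -
   have A: "(\<Prod>b\<in>(Basis :: 'x set). lam b / 2) \<ge> 0" by (intro prod_nonneg) (auto intro: less_imp_le lam_pos)
   have 1: "ell (x + h) \<le> ell x + ell h" "ell x \<le> ell (x + h) + ell h"
    using ell_triangle[of x h] ell_triangle[of "x + h" "- h"] ell_scale[of "-1" h] by auto
   have up: "exp (- ell (x + h)) \<le> exp (- ell x) * exp (ell h)"
    using 1 by (simp flip: exp_add)
   have lo: "exp (- ell x) * exp (- ell h) \<le> exp (- ell (x + h))"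
    using 1 by (simp flip: exp_add)
   have e1: "exp (ell h) \<le> 1 + 2 * ell h"
    using exp_bound[OF ell_nonneg True] ell_nonneg[of h] True
     mult_left_mono[OF True ell_nonneg[of h]] by (simp add: power2_eq_square)
   have e2: "1 - 2 * ell h \<le> exp (- ell h)"
    using exp_ge_add_one_self[of "- ell h"] ell_nonneg[of h] by linarith
   have "exp (- ell (x + h)) - exp (- ell x) \<le> 2 * ell h * exp (- ell x)"
    using up mult_left_mono[OF e1, of "exp (- ell x)"] by (simp add: algebra_simps)
   moreover have "exp (- ell x) - exp (- ell (x + h)) \<le> 2 * ell h * exp (- ell x)"
    using lo mult_left_mono[OF e2, of "exp (- ell x)"] by (simp add: algebra_simps)
   ultimately have "\<bar>exp (- ell (x + h)) - exp (- ell x)\<bar> \<le> 2 * ell h * exp (- ell x)" by linarith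
   from mult_left_mono[OF this A] show ?thesis
    unfolding ker_eq using A by (simp add: abs_mult abs_of_nonneg flip: right_diff_distrib) (simp add: mult_ac)
  qed
  then have "(LINT x|lborel. \<bar>ker (x + h) - ker x\<bar>) \<le> (LINT x|lborel. 2 * ell h * ker x)"
   using ker_integrable by (intro integral_mono j) auto
  then show ?thesis using ker_integral by simp
 next
  case False
  have "(LINT x|lborel. \<bar>ker (x + h) - ker x\<bar>) \<le> (LINT x|lborel. ker (h + x) + ker x)"
   using i ker_integrable
   by (intro integral_mono j) (auto simp: add.commute intro!: order_trans[OF abs_triangle_ineq4] simp: ker_nonneg)
  also have "\<dots> = 2"
   using i ker_integrable ker_integral integral_lborel_translate(1)[of ker h] by (simp add: add.commute)
  finally show ?thesis using False by simp
 qed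
qed

end

text \<open>Half of the exponential absorbs the factor r, since (\<eta>/2) r \<le> exp((\<eta>/2)
  r); this gives 4/\<eta>^2 without an integration by parts.\<close>

lemma half_exp_moment:
 assumes "\<eta> > 0"
 shows "integrable lborel (\<lambda>r. half_exp \<eta> r * \<bar>r\<bar>)" "(LINT r|lborel. half_exp \<eta> r * \<bar>r\<bar>) \<le> 4 / \<eta>\<^sup>2"
proof -
 have bd: "half_exp \<eta> r * \<bar>r\<bar> \<le> 2 / \<eta> * half_exp (\<eta> / 2) r" for r
 proof (cases "r > 0")
  case True
  have "\<eta> / 2 * r \<le> exp (\<eta> / 2 * r)" using exp_ge_add_one_self[of "\<eta> / 2 * r"] by linarith
  then have "r \<le> 2 / \<eta> * exp (\<eta> / 2 * r)" using assms by (simp add: field_simps)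
  then have "exp (- (\<eta> * r)) * r \<le> exp (- (\<eta> * r)) * (2 / \<eta> * exp (\<eta> / 2 * r))" by (rule mult_left_mono) simp
  also have "\<dots> = 2 / \<eta> * exp (- (\<eta> / 2 * r))" by (simp add: field_simps flip: exp_add)
  finally show ?thesis using True by (simp add: half_exp_def)
 qed (simp add: half_exp_def)
 have i: "integrable lborel (\<lambda>r. 2 / \<eta> * half_exp (\<eta> / 2) r)"
  using half_exp_integrable[of "\<eta> / 2"] assms by simp
 show j: "integrable lborel (\<lambda>r. half_exp \<eta> r * \<bar>r\<bar>)"
  by (rule Bochner_Integration.integrable_bound[OF i])
   (use bd assms in \<open>auto intro!: AE_I2 simp: half_exp_nonneg abs_mult\<close>)
 have "(LINT r|lborel. half_exp \<eta> r * \<bar>r\<bar>) \<le> (LINT r|lborel. 2 / \<eta> * half_exp (\<eta> / 2) r)"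
  by (intro integral_mono i j bd)
 also have "\<dots> = 4 / \<eta>\<^sup>2" using half_exp_integral[of "\<eta> / 2"] assms by (simp add: power2_eq_square)
 finally show "(LINT r|lborel. half_exp \<eta> r * \<bar>r\<bar>) \<le> 4 / \<eta>\<^sup>2" .
qed

section \<open>Smoothing along characteristics\<close>

text \<open>The direction of the characteristic at velocity v is b v, and c is the kernel of the
  velocity average. The Schur bound c1 and the L^1 modulus c2 enter the estimates; c0 only secures
  integrability. P is the Lipschitz constant of b measured in \<open>ell\<close>.\<close>

locale averaging = exp_kernel lam for lam :: "'x::euclidean_space \<Rightarrow> real" +
 fixes b :: "'v::euclidean_space \<Rightarrow> 'x" and g :: "'x \<Rightarrow> 'v \<Rightarrow> real" and c :: "'v \<Rightarrow> 'v \<Rightarrow> real"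
  and \<eta> R P c0 c1 c2 :: real
 assumes \<eta>: "\<eta> > 0" and P: "P \<ge> 0" and b_meas [measurable]: "b \<in> borel_measurable borel"
  and b_lip: "\<And>v w. ell (b v - b w) \<le> P * norm (v - w)"
  and g_meas: "case_prod g \<in> borel_measurable (borel \<Otimes>\<^sub>M borel)"
  and g_int: "integrable (lborel \<Otimes>\<^sub>M lborel) (case_prod g)"
  and g_le_1: "\<And>X w. \<bar>g X w\<bar> \<le> 1" and g_supp: "\<And>X w. R < norm w \<Longrightarrow> g X w = 0"
  and c_meas: "case_prod c \<in> borel_measurable (borel \<Otimes>\<^sub>M borel)"
  and c_le: "\<And>v w. \<bar>c v w\<bar> \<le> c0"
  and c_int1: "\<And>v. integrable lborel (c v)" "\<And>v. (LINT w|lborel. \<bar>c v w\<bar>) \<le> c1"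
  and c_int2: "\<And>w. integrable lborel (\<lambda>v. c v w)" "\<And>w. (LINT v|lborel. \<bar>c v w\<bar>) \<le> c1"
  and c_lip: "\<And>w w'. (LINT v|lborel. \<bar>c v w - c v w'\<bar>) \<le> c2 * norm (w - w')"
begin

lemma g_measurable [measurable (raw)]:
 "p \<in> borel_measurable M \<Longrightarrow> q \<in> borel_measurable M \<Longrightarrow> (\<lambda>z. g (p z) (q z)) \<in> borel_measurable M"
 using measurable_compose[OF measurable_Pair g_meas, of p M q] by simp

lemma c_measurable [measurable (raw)]:
 "p \<in> borel_measurable M \<Longrightarrow> q \<in> borel_measurable M \<Longrightarrow> (\<lambda>z. c (p z) (q z)) \<in> borel_measurable M"
 using measurable_compose[OF measurable_Pair c_meas, of p M q] by simp

lemma c1_nonneg: "c1 \<ge> 0"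
proof -
 have "0 \<le> (LINT w|lborel. \<bar>c 0 w\<bar>)" by simp
 then show ?thesis using c_int1(2)[of 0] by linarith
qed

text \<open>The kernel carried along the characteristic of w and averaged with the probability
  density \<eta> exp(-\<eta> r). Its transform is \<open>ker_hat\<close> times the resolvent symbol,
  so that of \<open>kap\<close> is \<open>ker_hat\<close> times one minus this symbol.\<close>

definition tail :: "'v \<Rightarrow> 'x \<Rightarrow> real"
 where "tail w Y = (LINT r|lborel. \<eta> * half_exp \<eta> r * ker (Y - r *\<^sub>R b w))"

definition kap :: "'v \<Rightarrow> 'x \<Rightarrow> real"
 where "kap w Y = ker Y - tail w Y"

lemma tail_measurable [measurable (raw)]:
 assumes [measurable]: "p \<in> borel_measurable M" "q \<in> borel_measurable M"
 shows "(\<lambda>z. tail (p z) (q z)) \<in> borel_measurable M"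
 unfolding tail_def by measurable

lemma kap_measurable [measurable (raw)]:
 assumes [measurable]: "p \<in> borel_measurable M" "q \<in> borel_measurable M"
 shows "(\<lambda>z. kap (p z) (q z)) \<in> borel_measurable M"
 unfolding kap_def by measurable

lemma tail_nonneg: "0 \<le> tail w Y"
 unfolding tail_def using \<eta> by (intro integral_nonneg_AE AE_I2 mult_nonneg_nonneg ker_nonneg half_exp_nonneg) auto

lemma eta_half_exp: "integrable lborel (\<lambda>r. \<eta> * half_exp \<eta> r)" "(LINT r|lborel. \<eta> * half_exp \<eta> r) = 1"
 using half_exp_integrable[OF \<eta>] half_exp_integral[OF \<eta>] \<eta> by auto

lemma tail_pair: "integrable (lborel \<Otimes>\<^sub>M lborel) (\<lambda>(Y, r). \<eta> * half_exp \<eta> r * ker (Y - r *\<^sub>R b w))"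
proof -
 have "integrable (lborel \<Otimes>\<^sub>M lborel) (\<lambda>(r, Y). \<eta> * half_exp \<eta> r * ker (Y - r *\<^sub>R b w))"
 proof (rule lborel_pair.Fubini_integrable)
  have "(LINT Y|lborel. norm (\<eta> * half_exp \<eta> r * ker (Y - r *\<^sub>R b w))) = \<eta> * half_exp \<eta> r" for r
   using integral_lborel_translate(3)[of ker "r *\<^sub>R b w"] \<eta> half_exp_nonneg[of \<eta> r]
   by (simp add: abs_mult ker_nonneg ker_integral)
  then show "integrable lborel (\<lambda>r. LINT Y|lborel. norm (case (r, Y) of (r, Y) \<Rightarrow> \<eta> * half_exp \<eta> r * ker (Y - r *\<^sub>R b w)))"
   using eta_half_exp(1) by simp
  show "AE r in lborel. integrable lborel (\<lambda>Y. case (r, Y) of (r, Y) \<Rightarrow> \<eta> * half_exp \<eta> r * ker (Y - r *\<^sub>R b w))"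
   using integrable_lborel_translate(3)[OF ker_integrable] by simp
 qed measurable
 from lborel_pair.integrable_product_swap[OF this] show ?thesis by (simp add: case_prod_beta')
qed

lemma tail_integrable: "integrable lborel (tail w)"
 unfolding tail_def[abs_def] using lborel_pair.integrable_fst[OF tail_pair[of w]] by simp

lemma tail_integral_mult:
 assumes [measurable]: "h \<in> borel_measurable borel" and h: "\<And>x. norm (h x :: 'c::{real_normed_field, banach, second_countable_topology}) \<le> C"
 shows "(LINT Y|lborel. of_real (tail w Y) * h Y) = (LINT r|lborel. of_real (\<eta> * half_exp \<eta> r) * (LINT Y|lborel. of_real (ker (Y - r *\<^sub>R b w)) * h Y))"
proof -
 have "integrable (lborel \<Otimes>\<^sub>M lborel) (\<lambda>p. C * norm (case p of (Y, r) \<Rightarrow> \<eta> * half_exp \<eta> r * ker (Y - r *\<^sub>R b w)))"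
  using tail_pair[of w] by simp
 then have i: "integrable (lborel \<Otimes>\<^sub>M lborel) (\<lambda>(Y, r). of_real (\<eta> * half_exp \<eta> r * ker (Y - r *\<^sub>R b w)) * h Y)"
 proof (rule Bochner_Integration.integrable_bound)
  show "AE p in lborel \<Otimes>\<^sub>M lborel. norm (case p of (Y, r) \<Rightarrow> of_real (\<eta> * half_exp \<eta> r * ker (Y - r *\<^sub>R b w)) * h Y) \<le>
    norm (C * norm (case p of (Y, r) \<Rightarrow> \<eta> * half_exp \<eta> r * ker (Y - r *\<^sub>R b w)))"
  proof (rule AE_I2)
   fix p :: "'x \<times> real"
   obtain Y r where p: "p = (Y, r)" by (cases p)
   let ?q = "\<eta> * half_exp \<eta> r * ker (Y - r *\<^sub>R b w)"
   have "norm (of_real ?q * h Y) \<le> \<bar>?q\<bar> * C"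
    unfolding norm_mult norm_of_real by (intro mult_left_mono h) simp
   also have "\<dots> \<le> \<bar>C * \<bar>?q\<bar>\<bar>" by (simp add: mult.commute)
   finally show "norm (case p of (Y, r) \<Rightarrow> of_real (\<eta> * half_exp \<eta> r * ker (Y - r *\<^sub>R b w)) * h Y) \<le>
    norm (C * norm (case p of (Y, r) \<Rightarrow> \<eta> * half_exp \<eta> r * ker (Y - r *\<^sub>R b w)))"
    unfolding p by simp
  qed
 qed measurable
 have "(LINT Y|lborel. of_real (tail w Y) * h Y) = (LINT Y|lborel. (LINT r|lborel. of_real (\<eta> * half_exp \<eta> r * ker (Y - r *\<^sub>R b w)) * h Y))"
 proof (intro Bochner_Integration.integral_cong refl)
  fix Y
  have "integrable lborel (\<lambda>r. \<eta> * half_exp \<eta> r * ker (Y - r *\<^sub>R b w))"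
   by (rule integral_mult_bounded(1)[OF eta_half_exp(1) _ ker_le]) measurable
  note eq = integral_bounded_linear[OF bounded_linear_of_real this]
  show "of_real (tail w Y) * h Y = (LINT r|lborel. of_real (\<eta> * half_exp \<eta> r * ker (Y - r *\<^sub>R b w)) * h Y)"
   unfolding tail_def integral_mult_left_zero eq ..
 qed
 also have "\<dots> = (LINT r|lborel. (LINT Y|lborel. of_real (\<eta> * half_exp \<eta> r * ker (Y - r *\<^sub>R b w)) * h Y))"
  by (rule lborel_pair.Fubini_integral[OF i, symmetric])
 also have "\<dots> = (LINT r|lborel. of_real (\<eta> * half_exp \<eta> r) * (LINT Y|lborel. of_real (ker (Y - r *\<^sub>R b w)) * h Y))"
  by (intro Bochner_Integration.integral_cong refl) (simp add: mult.assoc)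
 finally show ?thesis .
qed

lemma tail_integral: "(LINT Y|lborel. tail w Y) = 1"
 using tail_integral_mult[of "\<lambda>_. 1 :: real" 1 w] eta_half_exp(2)
  integral_lborel_translate(3)[of ker] by (simp add: ker_integral)

lemma kap_integrable: "integrable lborel (kap w)"
 unfolding kap_def[abs_def] by (intro Bochner_Integration.integrable_diff ker_integrable tail_integrable)

lemma kap_abs_integral: "(LINT Y|lborel. \<bar>kap w Y\<bar>) \<le> 2"
proof -
 have "(LINT Y|lborel. \<bar>kap w Y\<bar>) \<le> (LINT Y|lborel. ker Y + tail w Y)"
  using ker_integrable tail_integrable kap_integrable ker_nonneg tail_nonneg
  by (intro integral_mono) (auto simp: kap_def abs_le_iff add_increasing add_increasing2)
 then show ?thesis using ker_integrable tail_integrable by (simp add: ker_integral tail_integral)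
qed

definition damp :: "'x \<Rightarrow> 'v \<Rightarrow> complex"
 where "damp \<xi> w = 1 - complex_of_real \<eta> / (complex_of_real \<eta> + \<i> * complex_of_real (\<xi> \<bullet> b w))"

lemma kap_ft: "ft (\<lambda>Y. complex_of_real (kap w Y)) \<xi> = complex_of_real (ker_hat \<xi>) * damp \<xi> w"
proof -
 have k: "integrable lborel (\<lambda>Y. complex_of_real (ker Y))" using ker_integrable by simp
 have t: "integrable lborel (\<lambda>Y. complex_of_real (tail w Y))" using tail_integrable by simp
 have "ft (\<lambda>Y. complex_of_real (kap w Y)) \<xi> = ft (\<lambda>Y. complex_of_real (ker Y)) \<xi> - ft (\<lambda>Y. complex_of_real (tail w Y)) \<xi>"
  unfolding ft_def kap_def of_real_diff right_diff_distrib
  by (rule Bochner_Integration.integral_diff; intro ft_integrable k t)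
 also have "ft (\<lambda>Y. complex_of_real (tail w Y)) \<xi> =
   (LINT r|lborel. complex_of_real (\<eta> * half_exp \<eta> r) * (LINT Y|lborel. complex_of_real (ker (Y - r *\<^sub>R b w)) * cis (- (Y \<bullet> \<xi>))))"
  unfolding ft_def using tail_integral_mult[of "\<lambda>Y. cis (- (Y \<bullet> \<xi>))" 1 w] by (simp add: mult.commute)
 also have "\<dots> = (LINT r|lborel. complex_of_real \<eta> * complex_of_real (ker_hat \<xi>) * (complex_of_real (half_exp \<eta> r) * cis (- (r * (\<xi> \<bullet> b w)))))"
 proof (intro Bochner_Integration.integral_cong refl)
  fix r
  have "(LINT Y|lborel. complex_of_real (ker (Y - r *\<^sub>R b w)) * cis (- (Y \<bullet> \<xi>))) =
   (LINT Y|lborel. complex_of_real (ker (Y - r *\<^sub>R b w)) * cis (- ((Y - r *\<^sub>R b w) \<bullet> \<xi>)) * cis (- (r * (\<xi> \<bullet> b w))))"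
  proof (intro Bochner_Integration.integral_cong refl)
   fix Y
   have e: "- (Y \<bullet> \<xi>) = - ((Y - r *\<^sub>R b w) \<bullet> \<xi>) + - (r * (\<xi> \<bullet> b w))"
    by (simp add: inner_diff_left inner_commute[of \<xi> "b w"])
   show "complex_of_real (ker (Y - r *\<^sub>R b w)) * cis (- (Y \<bullet> \<xi>)) =
     complex_of_real (ker (Y - r *\<^sub>R b w)) * cis (- ((Y - r *\<^sub>R b w) \<bullet> \<xi>)) * cis (- (r * (\<xi> \<bullet> b w)))"
    unfolding mult.assoc cis_mult e ..
  qed
  also have "\<dots> = (LINT Y|lborel. complex_of_real (ker Y) * cis (- (Y \<bullet> \<xi>)) * cis (- (r * (\<xi> \<bullet> b w))))"
   by (rule integral_lborel_translate(3)) measurable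
  also have "\<dots> = complex_of_real (ker_hat \<xi>) * cis (- (r * (\<xi> \<bullet> b w)))"
   unfolding ker_ft[symmetric] ft_def by (simp add: mult.commute)
  finally show "complex_of_real (\<eta> * half_exp \<eta> r) * (LINT Y|lborel. complex_of_real (ker (Y - r *\<^sub>R b w)) * cis (- (Y \<bullet> \<xi>))) =
    complex_of_real \<eta> * complex_of_real (ker_hat \<xi>) * (complex_of_real (half_exp \<eta> r) * cis (- (r * (\<xi> \<bullet> b w))))" by simp
 qed
 also have "\<dots> = complex_of_real \<eta> * complex_of_real (ker_hat \<xi>) * (1 / (complex_of_real \<eta> + \<i> * complex_of_real (\<xi> \<bullet> b w)))"
  unfolding integral_mult_right_zero half_exp_cis_integral[OF \<eta>] ..
 finally show ?thesis by (simp add: ker_ft damp_def algebra_simps)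
qed

text \<open>The map S from g to \<open>ff\<close> is damping with smoothing (\<open>gg\<close>)
  followed by the velocity average. The next functions apply the adjoint to \<open>ff\<close>:
  \<open>Phi\<close> undoes the average and \<open>dd\<close> the convolution. \<open>phi\<close> is
  the resolvent integral of \<open>Psi\<close> along forward characteristics, which makes
  \<open>dd\<close> minus its transport derivative.\<close>

definition gg :: "'x \<Rightarrow> 'v \<Rightarrow> real" where "gg X w = (LINT Y|lborel. kap w Y * g (X - Y) w)"
definition ff :: "'x \<Rightarrow> 'v \<Rightarrow> real" where "ff X v = (LINT w|lborel. c v w * gg X w)"
definition Phi :: "'x \<Rightarrow> 'v \<Rightarrow> real" where "Phi X w = (LINT v|lborel. c v w * ff X v)"
definition Psi :: "'x \<Rightarrow> 'v \<Rightarrow> real" where "Psi Y w = (LINT X|lborel. ker X * Phi (X + Y) w)"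
definition phi :: "'x \<Rightarrow> 'v \<Rightarrow> real" where "phi Y w = (LINT r|lborel. half_exp \<eta> r * Psi (Y + r *\<^sub>R b w) w)"
definition dd :: "'x \<Rightarrow> 'v \<Rightarrow> real" where "dd Y w = Psi Y w - \<eta> * phi Y w"

lemma gg_measurable [measurable (raw)]:
 assumes [measurable]: "p \<in> borel_measurable M" "q \<in> borel_measurable M"
 shows "(\<lambda>z. gg (p z) (q z)) \<in> borel_measurable M"
 unfolding gg_def by measurable

lemma ff_measurable [measurable (raw)]:
 assumes [measurable]: "p \<in> borel_measurable M" "q \<in> borel_measurable M"
 shows "(\<lambda>z. ff (p z) (q z)) \<in> borel_measurable M"
 unfolding ff_def by measurable

lemma Phi_measurable [measurable (raw)]:
 assumes [measurable]: "p \<in> borel_measurable M" "q \<in> borel_measurable M"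
 shows "(\<lambda>z. Phi (p z) (q z)) \<in> borel_measurable M"
 unfolding Phi_def by measurable

lemma Psi_measurable [measurable (raw)]:
 assumes [measurable]: "p \<in> borel_measurable M" "q \<in> borel_measurable M"
 shows "(\<lambda>z. Psi (p z) (q z)) \<in> borel_measurable M"
 unfolding Psi_def by measurable

lemma phi_measurable [measurable (raw)]:
 assumes [measurable]: "p \<in> borel_measurable M" "q \<in> borel_measurable M"
 shows "(\<lambda>z. phi (p z) (q z)) \<in> borel_measurable M"
 unfolding phi_def by measurable

lemma gg_le: "\<bar>gg X w\<bar> \<le> 2"
proof -
 have "\<bar>gg X w\<bar> \<le> 1 * (LINT Y|lborel. \<bar>kap w Y\<bar>)"
  unfolding gg_def by (rule integral_mult_bounded(2)[OF kap_integrable]) (auto simp: g_le_1)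
 then show ?thesis using kap_abs_integral[of w] by simp
qed

lemma gg_supp: "R < norm w \<Longrightarrow> gg X w = 0"
 by (simp add: gg_def g_supp)

lemma ff_le: "\<bar>ff X v\<bar> \<le> 2 * c1"
proof -
 have "\<bar>ff X v\<bar> \<le> 2 * (LINT w|lborel. \<bar>c v w\<bar>)"
  unfolding ff_def by (rule integral_mult_bounded(2)[OF c_int1(1)]) (auto simp: gg_le)
 then show ?thesis using c_int1(2)[of v] by simp
qed

text \<open>The L^1 norm of \<open>kap\<close> is at most 2, g is bounded by 1, and each of the two
  velocity averages costs a factor c1.\<close>

definition CP :: real where "CP = 2 * c1 * c1"

lemma CP_nonneg: "CP \<ge> 0" using c1_nonneg by (simp add: CP_def)

lemma Phi_le: "\<bar>Phi X w\<bar> \<le> CP"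
proof -
 have "\<bar>Phi X w\<bar> \<le> 2 * c1 * (LINT v|lborel. \<bar>c v w\<bar>)"
  unfolding Phi_def by (rule integral_mult_bounded(2)[OF c_int2(1)]) (auto simp: ff_le)
 also have "\<dots> \<le> 2 * c1 * c1" using c_int2(2)[of w] c1_nonneg by (intro mult_left_mono) auto
 finally show ?thesis by (simp add: CP_def)
qed

text \<open>The variable w enters through the weight c alone, so velocity regularity is created by
  the averaging and no regularity of g is involved.\<close>

lemma Phi_lip: "\<bar>Phi X w - Phi X w'\<bar> \<le> 2 * c1 * c2 * norm (w - w')"
proof -
 have i: "integrable lborel (\<lambda>v. c v w * ff X v)" for w
  by (rule integral_mult_bounded(1)[OF c_int2(1) _ ff_le]) measurable
 have eq: "Phi X w - Phi X w' = (LINT v|lborel. (c v w - c v w') * ff X v)"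
  unfolding Phi_def left_diff_distrib by (rule Bochner_Integration.integral_diff[OF i i, symmetric])
 have "\<bar>Phi X w - Phi X w'\<bar> = \<bar>(LINT v|lborel. (c v w - c v w') * ff X v)\<bar>" unfolding eq ..
 also have "\<dots> \<le> 2 * c1 * (LINT v|lborel. \<bar>c v w - c v w'\<bar>)"
  by (rule integral_mult_bounded(2)) (auto simp: ff_le c_int2)
 also have "\<dots> \<le> 2 * c1 * (c2 * norm (w - w'))" using c_lip[of w w'] c1_nonneg by (intro mult_left_mono) auto
 finally show ?thesis by (simp add: mult.assoc)
qed

lemma Psi_alt: "Psi Y w = (LINT X|lborel. ker (X - Y) * Phi X w)"
 using integral_lborel_translate(3)[of "\<lambda>X. ker X * Phi (X + Y) w" Y] by (simp add: Psi_def)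

lemma Psi_le: "\<bar>Psi Y w\<bar> \<le> CP"
proof -
 have "\<bar>Psi Y w\<bar> \<le> CP * (LINT X|lborel. \<bar>ker X\<bar>)"
  unfolding Psi_def by (rule integral_mult_bounded(2)[OF ker_integrable _ Phi_le]) measurable
 then show ?thesis by (simp add: ker_nonneg ker_integral)
qed

lemma Psi_lip: "\<bar>Psi Y w - Psi Y w'\<bar> \<le> 2 * c1 * c2 * norm (w - w')"
proof -
 have i: "integrable lborel (\<lambda>X. ker X * Phi (X + Y) w)" for w
  by (rule integral_mult_bounded(1)[OF ker_integrable _ Phi_le]) measurable
 have eq: "Psi Y w - Psi Y w' = (LINT X|lborel. ker X * (Phi (X + Y) w - Phi (X + Y) w'))"
  unfolding Psi_def right_diff_distrib by (rule Bochner_Integration.integral_diff[OF i i, symmetric])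
 have "\<bar>Psi Y w - Psi Y w'\<bar> = \<bar>(LINT X|lborel. ker X * (Phi (X + Y) w - Phi (X + Y) w'))\<bar>" unfolding eq ..
 also have "\<dots> \<le> 2 * c1 * c2 * norm (w - w') * (LINT X|lborel. \<bar>ker X\<bar>)"
  by (rule integral_mult_bounded(2)[OF ker_integrable _ Phi_lip]) measurable
 finally show ?thesis by (simp add: ker_nonneg ker_integral)
qed

text \<open>Regularity in position is created by the kernel: the shift is moved onto
  \<open>ker\<close>, whose L^1 modulus is known.\<close>

lemma Psi_shift: "\<bar>Psi (Y + h) w - Psi Y w\<bar> \<le> 2 * ell h * CP"
proof -
 have i: "integrable lborel (\<lambda>X. ker (X - Y) * Phi X w)" for Y
  by (rule integral_mult_bounded(1)[OF integrable_lborel_translate(3)[OF ker_integrable] _ Phi_le]) measurable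
 have eq: "Psi (Y + h) w - Psi Y w = (LINT X|lborel. (ker (X - (Y + h)) - ker (X - Y)) * Phi X w)"
  unfolding Psi_alt left_diff_distrib by (rule Bochner_Integration.integral_diff[OF i i, symmetric])
 have "\<bar>Psi (Y + h) w - Psi Y w\<bar> = \<bar>(LINT X|lborel. (ker (X - (Y + h)) - ker (X - Y)) * Phi X w)\<bar>" unfolding eq ..
 also have "\<dots> \<le> CP * (LINT X|lborel. \<bar>ker (X - (Y + h)) - ker (X - Y)\<bar>)"
  by (rule integral_mult_bounded(2)[OF _ _ Phi_le])
   (auto intro!: Bochner_Integration.integrable_diff integrable_lborel_translate(3)[OF ker_integrable])
 also have "(LINT X|lborel. \<bar>ker (X - (Y + h)) - ker (X - Y)\<bar>) = (LINT X|lborel. \<bar>ker (X + - h) - ker X\<bar>)"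
  using integral_lborel_translate(3)[of "\<lambda>X. \<bar>ker (X + - h) - ker X\<bar>" Y] by (simp add: algebra_simps)
 also have "CP * \<dots> \<le> CP * (2 * ell (- h))"
  by (intro mult_left_mono ker_shift CP_nonneg)
 also have "ell (- h) = ell h" using ell_scale[of "-1" h] by simp
 finally show ?thesis by (simp add: mult.commute)
qed

lemma phi_integrable: "integrable lborel (\<lambda>r. half_exp \<eta> r * Psi (Y + r *\<^sub>R b w) w)"
 by (rule integral_mult_bounded(1)[OF half_exp_integrable[OF \<eta>] _ Psi_le]) measurable

lemma phi_le: "\<bar>phi Y w\<bar> \<le> CP / \<eta>"
proof -
 have "\<bar>phi Y w\<bar> \<le> CP * (LINT r|lborel. \<bar>half_exp \<eta> r\<bar>)"
  unfolding phi_def by (rule integral_mult_bounded(2)[OF half_exp_integrable[OF \<eta>] _ Psi_le]) measurable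
 then show ?thesis by (simp add: half_exp_nonneg half_exp_integral[OF \<eta>])
qed

lemma phi_shift: "\<bar>phi (Y + h) w - phi Y w\<bar> \<le> 2 * ell h * CP / \<eta>"
proof -
 have eq: "phi (Y + h) w - phi Y w = (LINT r|lborel. half_exp \<eta> r * (Psi (Y + r *\<^sub>R b w + h) w - Psi (Y + r *\<^sub>R b w) w))"
  unfolding phi_def right_diff_distrib
  by (subst Bochner_Integration.integral_diff[OF phi_integrable[of "Y + h" w] phi_integrable[of Y w], symmetric]) (simp add: add_ac)
 have "\<bar>phi (Y + h) w - phi Y w\<bar> = \<bar>(LINT r|lborel. half_exp \<eta> r * (Psi (Y + r *\<^sub>R b w + h) w - Psi (Y + r *\<^sub>R b w) w))\<bar>" unfolding eq ..
 also have "\<dots> \<le> 2 * ell h * CP * (LINT r|lborel. \<bar>half_exp \<eta> r\<bar>)"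
  by (rule integral_mult_bounded(2)[OF half_exp_integrable[OF \<eta>] _ Psi_shift]) measurable
 finally show ?thesis by (simp add: half_exp_nonneg half_exp_integral[OF \<eta>])
qed

text \<open>The first term is the displacement of the characteristic with w, that is 2 P CP times
  the first moment bound 4/\<eta>^2; the second is the variation of the weight times the mass
  1/\<eta>.\<close>

definition Lam :: real where "Lam = 8 * P * CP / \<eta>\<^sup>2 + 2 * c1 * c2 / \<eta>"

lemma phi_lip: "\<bar>phi Y w - phi Y w'\<bar> \<le> Lam * norm (w - w')"
proof -
 let ?n = "norm (w - w')"
 have bd: "\<bar>Psi (Y + r *\<^sub>R b w) w - Psi (Y + r *\<^sub>R b w') w'\<bar> \<le> 2 * P * CP * ?n * \<bar>r\<bar> + 2 * c1 * c2 * ?n" for r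
 proof -
  have "\<bar>Psi (Y + r *\<^sub>R b w) w - Psi (Y + r *\<^sub>R b w') w\<bar> \<le> 2 * ell (r *\<^sub>R (b w - b w')) * CP"
   using Psi_shift[of "Y + r *\<^sub>R b w'" "r *\<^sub>R (b w - b w')" w] by (simp add: algebra_simps)
  also have "\<dots> \<le> 2 * (\<bar>r\<bar> * (P * ?n)) * CP"
   unfolding ell_scale using b_lip[of w w'] CP_nonneg by (intro mult_right_mono mult_left_mono) auto
  finally show ?thesis using Psi_lip[of "Y + r *\<^sub>R b w'" w w'] by (simp add: algebra_simps)
 qed
 have eq: "phi Y w - phi Y w' = (LINT r|lborel. half_exp \<eta> r * Psi (Y + r *\<^sub>R b w) w - half_exp \<eta> r * Psi (Y + r *\<^sub>R b w') w')"
  unfolding phi_def by (rule Bochner_Integration.integral_diff[OF phi_integrable phi_integrable, symmetric])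
 have "\<bar>phi Y w - phi Y w'\<bar> = \<bar>(LINT r|lborel. half_exp \<eta> r * Psi (Y + r *\<^sub>R b w) w - half_exp \<eta> r * Psi (Y + r *\<^sub>R b w') w')\<bar>" unfolding eq ..
 also have "\<dots> \<le> (LINT r|lborel. 2 * P * CP * ?n * (half_exp \<eta> r * \<bar>r\<bar>) + 2 * c1 * c2 * ?n * half_exp \<eta> r)"
 proof (rule order_trans[OF integral_abs_bound integral_mono])
  show "integrable lborel (\<lambda>r. 2 * P * CP * ?n * (half_exp \<eta> r * \<bar>r\<bar>) + 2 * c1 * c2 * ?n * half_exp \<eta> r)"
   by (intro Bochner_Integration.integrable_add integrable_mult_right half_exp_moment(1) half_exp_integrable \<eta>)
  fix r
  have "\<bar>half_exp \<eta> r * Psi (Y + r *\<^sub>R b w) w - half_exp \<eta> r * Psi (Y + r *\<^sub>R b w') w'\<bar> =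
    half_exp \<eta> r * \<bar>Psi (Y + r *\<^sub>R b w) w - Psi (Y + r *\<^sub>R b w') w'\<bar>"
   by (simp add: abs_mult half_exp_nonneg flip: right_diff_distrib)
  also have "\<dots> \<le> half_exp \<eta> r * (2 * P * CP * ?n * \<bar>r\<bar> + 2 * c1 * c2 * ?n)"
   by (intro mult_left_mono bd half_exp_nonneg)
  finally show "\<bar>half_exp \<eta> r * Psi (Y + r *\<^sub>R b w) w - half_exp \<eta> r * Psi (Y + r *\<^sub>R b w') w'\<bar> \<le>
   2 * P * CP * ?n * (half_exp \<eta> r * \<bar>r\<bar>) + 2 * c1 * c2 * ?n * half_exp \<eta> r" by (simp add: algebra_simps)
 qed (intro integrable_abs Bochner_Integration.integrable_diff phi_integrable)
 also have "\<dots> = 2 * P * CP * ?n * (LINT r|lborel. half_exp \<eta> r * \<bar>r\<bar>) + 2 * c1 * c2 * ?n * (1 / \<eta>)"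
  using half_exp_moment(1)[OF \<eta>] half_exp_integrable[OF \<eta>] by (simp add: half_exp_integral[OF \<eta>])
 also have "\<dots> \<le> 2 * P * CP * ?n * (4 / \<eta>\<^sup>2) + 2 * c1 * c2 * ?n * (1 / \<eta>)"
  using P CP_nonneg by (intro add_right_mono mult_left_mono half_exp_moment(2)[OF \<eta>]) auto
 finally show ?thesis by (simp add: Lam_def algebra_simps)
qed

end

section \<open>The increment of the test function along characteristics\<close>

lemma exp_minus_one_bounds:
 fixes y :: real assumes "y \<ge> 0"
 shows "exp y - 1 \<le> y * exp y" "0 \<le> exp y - 1 - y" "exp y - 1 - y \<le> y\<^sup>2 * exp y"
proof -
 have "1 - y \<le> exp (- y)" using exp_ge_add_one_self[of "- y"] by simp
 from mult_right_mono[OF this, of "exp y"] show 1: "exp y - 1 \<le> y * exp y"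
  by (simp add: algebra_simps exp_minus)
 show "0 \<le> exp y - 1 - y" using exp_ge_add_one_self[of y] by linarith
 have "exp y - 1 - y \<le> y * (exp y - 1)" using 1 by (simp add: algebra_simps)
 also have "\<dots> \<le> y * (y * exp y)" using 1 assms by (intro mult_left_mono)
 finally show "exp y - 1 - y \<le> y\<^sup>2 * exp y" by (simp add: power2_eq_square mult.assoc)
qed

context averaging
begin

text \<open>It contains \<open>ell (b 0)\<close> and thus the time rate of the kernel. This is
  harmless, since it will enter \<open>admissible\<close> only through K.\<close>

definition KQ :: real
 where "KQ = CP / \<eta> * (\<eta>\<^sup>2 * exp \<eta>) + (2 * (ell (b 0) + P * (R + 1)) * CP + \<eta> * exp \<eta> * CP)"

text \<open>Variation of constants: moving by s along the characteristic multiplies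
  \<open>phi\<close> by exp(\<eta> s) and removes the contribution of \<open>Psi\<close> on ]0,s].
  As \<open>Psi\<close> is Lipschitz in position, it may be frozen at Y with an error of order s on
  an interval of length s.\<close>

lemma phi_quad:
 assumes w: "norm w \<le> R + 1" and s: "0 \<le> s" "s \<le> 1"
 shows "\<bar>phi (Y + s *\<^sub>R b w) w - phi Y w + s * dd Y w\<bar> \<le> KQ * s\<^sup>2"
proof -
 let ?E = "exp (\<eta> * s)" and ?Bb = "ell (b 0) + P * (R + 1)"
 let ?I = "\<lambda>r. indicator {0<..s} r :: real"
 let ?p = "\<lambda>r. Psi (Y + r *\<^sub>R b w) w"
 have Bb: "ell (b w) \<le> ?Bb"
 proof -
  have "ell (b w) \<le> ell (b 0) + ell (b w - b 0)" using ell_triangle[of "b 0" "b w - b 0"] by simp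
  also have "ell (b w - b 0) \<le> P * (R + 1)" using b_lip[of w 0] mult_left_mono[OF w P] by simp
  finally show ?thesis by simp
 qed
 have E: "?E - 1 \<le> s * (\<eta> * exp \<eta>)" "\<bar>?E - 1 - \<eta> * s\<bar> \<le> \<eta>\<^sup>2 * exp \<eta> * s\<^sup>2"
 proof -
  have y: "\<eta> * s \<ge> 0" and ee: "?E \<le> exp \<eta>" using \<eta> s by (auto intro: mult_left_le)
  have "?E - 1 \<le> \<eta> * s * ?E" by (rule exp_minus_one_bounds(1)[OF y])
  also have "\<dots> \<le> \<eta> * s * exp \<eta>" using y ee by (intro mult_left_mono)
  finally show "?E - 1 \<le> s * (\<eta> * exp \<eta>)" by (simp add: mult_ac)
  have "?E - 1 - \<eta> * s \<le> (\<eta> * s)\<^sup>2 * ?E" by (rule exp_minus_one_bounds(3)[OF y])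
  also have "\<dots> \<le> (\<eta> * s)\<^sup>2 * exp \<eta>" using ee by (intro mult_left_mono) auto
  finally show "\<bar>?E - 1 - \<eta> * s\<bar> \<le> \<eta>\<^sup>2 * exp \<eta> * s\<^sup>2"
   using exp_minus_one_bounds(2)[OF y] by (simp add: power_mult_distrib mult_ac)
 qed
 have Ii: "integrable lborel ?I" and IL: "(LINT r|lborel. ?I r) = s"
  using s by (auto intro!: integrable_real_indicator)
 have hp: "integrable lborel (\<lambda>r. half_exp \<eta> r * ?p r)" by (rule phi_integrable)
 have Ihp: "integrable lborel (\<lambda>r. half_exp \<eta> r * ?p r * ?I r)"
  by (rule integral_mult_bounded(1)[OF hp, of _ 1]) (auto simp: indicator_def)
 \<comment> \<open>The substitution r \<mapsto> r - s turns the shifted integral into the original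
   one times exp(\<eta> s), up to the initial segment.\<close>
 have "phi (Y + s *\<^sub>R b w) w = (LINT r|lborel. half_exp \<eta> ((s + r) - s) * ?p (s + r))"
  unfolding phi_def by (intro Bochner_Integration.integral_cong refl) (simp add: scaleR_add_left add_ac)
 also have "\<dots> = (LINT r|lborel. half_exp \<eta> (r - s) * ?p r)"
  by (rule integral_lborel_translate(1)) measurable
 also have "\<dots> = (LINT r|lborel. ?E * (half_exp \<eta> r * ?p r) - ?E * (half_exp \<eta> r * ?p r * ?I r))"
  by (intro Bochner_Integration.integral_cong refl)
   (use s in \<open>auto simp: half_exp_def indicator_def algebra_simps exp_minus exp_diff exp_add divide_simps\<close>)
 also have "\<dots> = ?E * phi Y w - ?E * (LINT r|lborel. half_exp \<eta> r * ?p r * ?I r)"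
  using hp Ihp by (simp add: phi_def)
 finally have ph: "phi (Y + s *\<^sub>R b w) w = ?E * phi Y w - ?E * (LINT r|lborel. half_exp \<eta> r * ?p r * ?I r)" .
 have di: "integrable lborel (\<lambda>r. ?I r * Psi Y w - ?E * (half_exp \<eta> r * ?p r * ?I r))"
  using Ii Ihp by simp
 have J: "s * Psi Y w - ?E * (LINT r|lborel. half_exp \<eta> r * ?p r * ?I r) = (LINT r|lborel. ?I r * Psi Y w - ?E * (half_exp \<eta> r * ?p r * ?I r))"
  using Ii Ihp IL by simp
 have Jb: "\<bar>s * Psi Y w - ?E * (LINT r|lborel. half_exp \<eta> r * ?p r * ?I r)\<bar> \<le> (2 * ?Bb * CP + \<eta> * exp \<eta> * CP) * s\<^sup>2"
  unfolding J
 proof (rule order_trans[OF integral_abs_bound])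
  have "(LINT r|lborel. \<bar>?I r * Psi Y w - ?E * (half_exp \<eta> r * ?p r * ?I r)\<bar>) \<le> (LINT r|lborel. ?I r * (s * (2 * ?Bb * CP + \<eta> * exp \<eta> * CP)))"
  proof (rule integral_mono)
   show "integrable lborel (\<lambda>r. \<bar>?I r * Psi Y w - ?E * (half_exp \<eta> r * ?p r * ?I r)\<bar>)" using di by simp
   show "integrable lborel (\<lambda>r. ?I r * (s * (2 * ?Bb * CP + \<eta> * exp \<eta> * CP)))" using Ii by simp
   fix r
   show "\<bar>?I r * Psi Y w - ?E * (half_exp \<eta> r * ?p r * ?I r)\<bar> \<le> ?I r * (s * (2 * ?Bb * CP + \<eta> * exp \<eta> * CP))"
   proof (cases "r \<in> {0<..s}")
    case True
    \<comment> \<open>On the initial segment this is exp(\<eta> (s - r)), which lies between 1 and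
      exp(\<eta> s).\<close>
    define q where "q = ?E * half_exp \<eta> r"
    have q: "1 \<le> q" "q \<le> ?E"
    proof -
     have qe: "q = exp (\<eta> * (s - r))" using True by (simp add: q_def half_exp_def right_diff_distrib exp_diff exp_minus divide_inverse)
     show "1 \<le> q" unfolding qe using True \<eta> by simp
     show "q \<le> ?E" unfolding qe using True \<eta> by simp
    qed
    have "\<bar>Psi Y w - q * ?p r\<bar> = \<bar>- (?p r - Psi Y w) - (q - 1) * ?p r\<bar>" by (simp add: algebra_simps)
    also have "\<dots> \<le> \<bar>?p r - Psi Y w\<bar> + \<bar>(q - 1) * ?p r\<bar>" by linarith
    also have "\<bar>?p r - Psi Y w\<bar> \<le> 2 * ell (r *\<^sub>R b w) * CP" by (rule Psi_shift)
    also have "2 * ell (r *\<^sub>R b w) * CP \<le> 2 * (s * ?Bb) * CP"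
     unfolding ell_scale using True Bb CP_nonneg ell_nonneg[of "b w"] by (intro mult_right_mono mult_left_mono mult_mono) auto
    also have "\<bar>(q - 1) * ?p r\<bar> \<le> (s * (\<eta> * exp \<eta>)) * CP"
     unfolding abs_mult using q E(1) Psi_le CP_nonneg \<eta> s by (intro mult_mono) auto
    finally show ?thesis using True by (simp add: q_def algebra_simps)
   qed simp
  qed
  also have "\<dots> = (2 * ?Bb * CP + \<eta> * exp \<eta> * CP) * s\<^sup>2" using IL by (simp add: power2_eq_square)
  finally show "(LINT r|lborel. \<bar>?I r * Psi Y w - ?E * (half_exp \<eta> r * ?p r * ?I r)\<bar>) \<le> (2 * ?Bb * CP + \<eta> * exp \<eta> * CP) * s\<^sup>2" .
 qed
 have "\<bar>(?E - 1 - \<eta> * s) * phi Y w\<bar> \<le> (\<eta>\<^sup>2 * exp \<eta> * s\<^sup>2) * (CP / \<eta>)"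
  unfolding abs_mult using E(2) phi_le by (intro mult_mono) auto
 moreover have "phi (Y + s *\<^sub>R b w) w - phi Y w + s * dd Y w = (?E - 1 - \<eta> * s) * phi Y w + (s * Psi Y w - ?E * (LINT r|lborel. half_exp \<eta> r * ?p r * ?I r))"
  unfolding ph dd_def by (simp add: algebra_simps)
 moreover have "KQ * s\<^sup>2 = (\<eta>\<^sup>2 * exp \<eta> * s\<^sup>2) * (CP / \<eta>) + (2 * ?Bb * CP + \<eta> * exp \<eta> * CP) * s\<^sup>2"
  by (simp add: KQ_def algebra_simps)
 ultimately show ?thesis using Jb by linarith
qed

lemma dd_le: "\<bar>dd Y w\<bar> \<le> 2 * CP"
proof -
 have "\<bar>\<eta> * phi Y w\<bar> \<le> CP" using mult_left_mono[OF phi_le[of Y w], of \<eta>] \<eta> by (simp add: abs_mult)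
 then show ?thesis using Psi_le[of Y w] by (simp add: dd_def)
qed

lemma dd_shift: "\<bar>dd (Y + h) w - dd Y w\<bar> \<le> 4 * ell h * CP"
proof -
 have "\<eta> * \<bar>phi (Y + h) w - phi Y w\<bar> \<le> 2 * ell h * CP"
  using mult_left_mono[OF phi_shift[of Y h w], of \<eta>] \<eta> by simp
 then have "\<bar>\<eta> * phi (Y + h) w - \<eta> * phi Y w\<bar> \<le> 2 * ell h * CP"
  using \<eta> by (simp add: abs_mult flip: right_diff_distrib)
 then show ?thesis using Psi_shift[of Y h w] by (simp add: dd_def)
qed

lemma dd_lip: "\<bar>dd Y w - dd Y w'\<bar> \<le> (2 * c1 * c2 + \<eta> * Lam) * norm (w - w')"
proof -
 have "\<eta> * \<bar>phi Y w - phi Y w'\<bar> \<le> \<eta> * (Lam * norm (w - w'))"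
  using phi_lip \<eta> by (intro mult_left_mono) auto
 then have "\<bar>\<eta> * phi Y w - \<eta> * phi Y w'\<bar> \<le> \<eta> * Lam * norm (w - w')"
  using \<eta> by (simp add: abs_mult mult.assoc flip: right_diff_distrib)
 moreover have "dd Y w - dd Y w' = (Psi Y w - Psi Y w') - (\<eta> * phi Y w - \<eta> * phi Y w')" by (simp add: dd_def)
 ultimately show ?thesis using Psi_lip[of Y w w'] by (simp only: distrib_right)
qed

lemma dd_measurable [measurable (raw)]:
 assumes [measurable]: "p \<in> borel_measurable M" "q \<in> borel_measurable M"
 shows "(\<lambda>z. dd (p z) (q z)) \<in> borel_measurable M"
 unfolding dd_def by measurable

text \<open>The correlation with \<open>kap\<close> is the adjoint of the convolution with it. Its
  tail part averages \<open>Psi\<close> over forward characteristics, which is \<eta> times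
  \<open>phi\<close>.\<close>

lemma dd_alt: "(LINT X|lborel. kap w (X - Y) * Phi X w) = dd Y w"
proof -
 have "(LINT X|lborel. kap w (X - Y) * Phi X w) = (LINT X|lborel. kap w X * Phi (X + Y) w)"
  using integral_lborel_translate(3)[of "\<lambda>X. kap w X * Phi (X + Y) w" Y] by simp
 also have "\<dots> = (LINT X|lborel. ker X * Phi (X + Y) w - tail w X * Phi (X + Y) w)"
  by (simp add: kap_def left_diff_distrib)
 also have "\<dots> = Psi Y w - (LINT X|lborel. tail w X * Phi (X + Y) w)"
 proof -
  have "integrable lborel (\<lambda>X. ker X * Phi (X + Y) w)" "integrable lborel (\<lambda>X. tail w X * Phi (X + Y) w)"
   by (rule integral_mult_bounded(1)[OF ker_integrable _ Phi_le], measurable)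
    (rule integral_mult_bounded(1)[OF tail_integrable _ Phi_le], measurable)
  then show ?thesis unfolding Psi_def by (rule Bochner_Integration.integral_diff)
 qed
 also have "(LINT X|lborel. tail w X * Phi (X + Y) w) = (LINT r|lborel. \<eta> * half_exp \<eta> r * (LINT X|lborel. ker (X - r *\<^sub>R b w) * Phi (X + Y) w))"
  using tail_integral_mult[of "\<lambda>X. Phi (X + Y) w" CP w] Phi_le by simp
 also have "\<dots> = (LINT r|lborel. \<eta> * (half_exp \<eta> r * Psi (Y + r *\<^sub>R b w) w))"
 proof (intro Bochner_Integration.integral_cong refl)
  fix r
  have "(LINT X|lborel. ker (X - r *\<^sub>R b w) * Phi (X + Y) w) = Psi (Y + r *\<^sub>R b w) w"
   using integral_lborel_translate(3)[of "\<lambda>X. ker X * Phi (X + (Y + r *\<^sub>R b w)) w" "r *\<^sub>R b w"]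
   by (simp add: Psi_def algebra_simps)
  then show "\<eta> * half_exp \<eta> r * (LINT X|lborel. ker (X - r *\<^sub>R b w) * Phi (X + Y) w) = \<eta> * (half_exp \<eta> r * Psi (Y + r *\<^sub>R b w) w)" by simp
 qed
 also have "\<dots> = \<eta> * phi Y w" by (simp add: phi_def)
 finally show ?thesis by (simp add: dd_def)
qed

section \<open>The energy identity\<close>

lemma g_slice_integrable: "AE w in lborel. integrable lborel (\<lambda>X. g X w)"
 using lborel_pair.AE_integrable_snd[OF g_int] .

lemma conv_pair_integrable:
 assumes "integrable lborel (\<lambda>X. g X w)"
 shows "integrable (lborel \<Otimes>\<^sub>M lborel) (\<lambda>(X, Y). kap w Y * g (X - Y) w)"
proof -
 have "integrable (lborel \<Otimes>\<^sub>M lborel) (\<lambda>(Y, X). kap w Y * g (X - Y) w)"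
 proof (rule lborel_pair.Fubini_integrable)
  have "(LINT X|lborel. norm (kap w Y * g (X - Y) w)) = \<bar>kap w Y\<bar> * (LINT X|lborel. \<bar>g X w\<bar>)" for Y
   using integral_lborel_translate(3)[of "\<lambda>X. \<bar>g X w\<bar>" Y] by (simp add: abs_mult)
  then show "integrable lborel (\<lambda>Y. LINT X|lborel. norm (case (Y, X) of (Y, X) \<Rightarrow> kap w Y * g (X - Y) w))"
   using kap_integrable[of w] by simp
  show "AE Y in lborel. integrable lborel (\<lambda>X. case (Y, X) of (Y, X) \<Rightarrow> kap w Y * g (X - Y) w)"
   using integrable_lborel_translate(3)[OF assms] by simp
 qed measurable
 from lborel_pair.integrable_product_swap[OF this] show ?thesis by (simp add: case_prod_beta')
qed

lemma gg_slice:
 assumes "integrable lborel (\<lambda>X. g X w)"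
 shows "integrable lborel (\<lambda>X. gg X w)" "(LINT X|lborel. \<bar>gg X w\<bar>) \<le> 2 * (LINT X|lborel. \<bar>g X w\<bar>)"
proof -
 note i = conv_pair_integrable[OF assms]
 show gi: "integrable lborel (\<lambda>X. gg X w)"
  unfolding gg_def using lborel_pair.integrable_fst[OF i] by simp
 have i': "integrable (lborel \<Otimes>\<^sub>M lborel) (\<lambda>(X, Y). \<bar>kap w Y * g (X - Y) w\<bar>)"
  using integrable_norm[OF i] by (simp add: case_prod_beta')
 have "(LINT X|lborel. \<bar>gg X w\<bar>) \<le> (LINT X|lborel. (LINT Y|lborel. \<bar>kap w Y * g (X - Y) w\<bar>))"
 proof (rule integral_mono)
  show "integrable lborel (\<lambda>X. \<bar>gg X w\<bar>)" using gi by simp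
  show "integrable lborel (\<lambda>X. LINT Y|lborel. \<bar>kap w Y * g (X - Y) w\<bar>)" using lborel_pair.integrable_fst[OF i'] by simp
  show "\<bar>gg X w\<bar> \<le> (LINT Y|lborel. \<bar>kap w Y * g (X - Y) w\<bar>)" for X
   unfolding gg_def by (rule integral_abs_bound)
 qed
 also have "\<dots> = (LINT Y|lborel. (LINT X|lborel. \<bar>kap w Y * g (X - Y) w\<bar>))"
  by (rule lborel_pair.Fubini_integral[symmetric, OF i'])
 also have "\<dots> = (LINT Y|lborel. \<bar>kap w Y\<bar> * (LINT X|lborel. \<bar>g X w\<bar>))"
  by (intro Bochner_Integration.integral_cong refl)
   (use integral_lborel_translate(3)[of "\<lambda>X. \<bar>g X w\<bar>"] in \<open>simp add: abs_mult\<close>)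
 also have "\<dots> = (LINT Y|lborel. \<bar>kap w Y\<bar>) * (LINT X|lborel. \<bar>g X w\<bar>)" by simp
 also have "\<dots> \<le> 2 * (LINT X|lborel. \<bar>g X w\<bar>)" by (intro mult_right_mono kap_abs_integral) simp
 finally show "(LINT X|lborel. \<bar>gg X w\<bar>) \<le> 2 * (LINT X|lborel. \<bar>g X w\<bar>)" .
qed

lemma gg_integrable: "integrable (lborel \<Otimes>\<^sub>M lborel) (\<lambda>(X, w). gg X w)"
proof -
 have "integrable (lborel \<Otimes>\<^sub>M lborel) (\<lambda>(w, X). gg X w)"
 proof (rule lborel_pair.Fubini_integrable)
  have gs: "integrable (lborel \<Otimes>\<^sub>M lborel) (\<lambda>(w, X). \<bar>g X w\<bar>)"
   using lborel_pair.integrable_product_swap[OF integrable_norm[OF g_int]] by (simp add: case_prod_beta')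
  show "integrable lborel (\<lambda>w. LINT X|lborel. norm (case (w, X) of (w, X) \<Rightarrow> gg X w))"
  proof (rule Bochner_Integration.integrable_bound)
   show "integrable lborel (\<lambda>w. 2 * (LINT X|lborel. \<bar>g X w\<bar>))"
    using lborel_pair.integrable_fst[OF gs] by simp
   show "AE w in lborel. norm (LINT X|lborel. norm (case (w, X) of (w, X) \<Rightarrow> gg X w)) \<le> norm (2 * (LINT X|lborel. \<bar>g X w\<bar>))"
    using g_slice_integrable by eventually_elim (use gg_slice(2) in auto)
  qed measurable
  show "AE w in lborel. integrable lborel (\<lambda>X. case (w, X) of (w, X) \<Rightarrow> gg X w)"
   using g_slice_integrable by eventually_elim (use gg_slice(1) in auto)
 qed measurable
 from lborel_pair.integrable_product_swap[OF this] show ?thesis by (simp add: case_prod_beta')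
qed

lemma gg_velocity_integrable: "integrable lborel (\<lambda>w. gg X w)"
proof (rule Bochner_Integration.integrable_bound)
 show "integrable lborel (\<lambda>w::'v. indicator (cball 0 R) w * (2::real))"
  by (intro integrable_mult_left integrable_real_indicator) (auto intro: emeasure_bounded_finite[unfolded infinity_ennreal_def])
 show "AE w in lborel. norm (gg X w) \<le> norm (indicator (cball 0 R) w * (2::real))"
  by (rule AE_I2) (use gg_le gg_supp in \<open>auto simp: indicator_def not_le\<close>)
qed measurable

lemma velocity_pair_integrable:
 assumes u: "integrable lborel (u :: 'v \<Rightarrow> real)"
 shows "integrable (lborel \<Otimes>\<^sub>M lborel) (\<lambda>(v, w). c v w * u w)"
proof -
 have [measurable]: "u \<in> borel_measurable borel" using u by auto
 have "integrable (lborel \<Otimes>\<^sub>M lborel) (\<lambda>(w, v). c v w * u w)"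
 proof (rule lborel_pair.Fubini_integrable)
  show "integrable lborel (\<lambda>w. LINT v|lborel. norm (case (w, v) of (w, v) \<Rightarrow> c v w * u w))"
  proof (rule Bochner_Integration.integrable_bound)
   show "integrable lborel (\<lambda>w. c1 * \<bar>u w\<bar>)" using u by simp
   show "AE w in lborel. norm (LINT v|lborel. norm (case (w, v) of (w, v) \<Rightarrow> c v w * u w)) \<le> norm (c1 * \<bar>u w\<bar>)"
    by (rule AE_I2) (use c_int2(2) c1_nonneg in \<open>auto simp: abs_mult intro!: mult_right_mono\<close>)
  qed measurable
  show "AE w in lborel. integrable lborel (\<lambda>v. case (w, v) of (w, v) \<Rightarrow> c v w * u w)"
   using c_int2(1) by simp
 qed measurable
 from lborel_pair.integrable_product_swap[OF this] show ?thesis by (simp add: case_prod_beta')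
qed

lemma ff_square_slice: "(LINT v|lborel. (ff X v)\<^sup>2) = (LINT w|lborel. gg X w * Phi X w)"
proof -
 have i: "integrable (lborel \<Otimes>\<^sub>M lborel) (\<lambda>(v, w). ff X v * (c v w * gg X w))"
  using integral_mult_bounded(1)[OF velocity_pair_integrable[OF gg_velocity_integrable[of X]], of "\<lambda>p. ff X (fst p)" "2 * c1"] ff_le
  by (simp add: case_prod_beta' mult.commute)
 have "(LINT v|lborel. (ff X v)\<^sup>2) = (LINT v|lborel. (LINT w|lborel. ff X v * (c v w * gg X w)))"
  by (simp add: power2_eq_square ff_def)
 also have "\<dots> = (LINT w|lborel. (LINT v|lborel. ff X v * (c v w * gg X w)))"
  by (rule lborel_pair.Fubini_integral[symmetric, OF i])
 also have "\<dots> = (LINT w|lborel. (LINT v|lborel. gg X w * (c v w * ff X v)))"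
  by (simp add: mult_ac)
 also have "\<dots> = (LINT w|lborel. gg X w * Phi X w)"
  by (simp add: Phi_def)
 finally show ?thesis .
qed

lemma ff_velocity_integrable: "integrable lborel (\<lambda>v. (ff X v)\<^sup>2)"
proof (rule Bochner_Integration.integrable_bound)
 have "integrable lborel (\<lambda>v. ff X v)"
  unfolding ff_def using lborel_pair.integrable_fst[OF velocity_pair_integrable[OF gg_velocity_integrable[of X]]] by simp
 then show "integrable lborel (\<lambda>v. (2 * c1) * \<bar>ff X v\<bar>)" by simp
 show "AE v in lborel. norm ((ff X v)\<^sup>2) \<le> norm ((2 * c1) * \<bar>ff X v\<bar>)"
 proof (rule AE_I2)
  fix v
  have "\<bar>ff X v\<bar> * \<bar>ff X v\<bar> \<le> 2 * c1 * \<bar>ff X v\<bar>" by (rule mult_right_mono[OF ff_le]) simp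
  then show "norm ((ff X v)\<^sup>2) \<le> norm ((2 * c1) * \<bar>ff X v\<bar>)"
   using c1_nonneg by (simp add: power2_eq_square abs_mult)
 qed
qed measurable

lemma g_dd_slice:
 assumes "integrable lborel (\<lambda>X. g X w)"
 shows "(LINT X|lborel. gg X w * Phi X w) = (LINT Y|lborel. g Y w * dd Y w)"
proof -
 have i0: "integrable (lborel \<Otimes>\<^sub>M lborel) (\<lambda>(Y, X). g Y w * kap w (X - Y))"
 proof (rule lborel_pair.Fubini_integrable)
  have "(LINT X|lborel. norm (g Y w * kap w (X - Y))) = \<bar>g Y w\<bar> * (LINT X|lborel. \<bar>kap w X\<bar>)" for Y
   using integral_lborel_translate(3)[of "\<lambda>X. \<bar>kap w X\<bar>" Y] by (simp add: abs_mult)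
  then show "integrable lborel (\<lambda>Y. LINT X|lborel. norm (case (Y, X) of (Y, X) \<Rightarrow> g Y w * kap w (X - Y)))"
   using assms by simp
  show "AE Y in lborel. integrable lborel (\<lambda>X. case (Y, X) of (Y, X) \<Rightarrow> g Y w * kap w (X - Y))"
   using integrable_lborel_translate(3)[OF kap_integrable] by simp
 qed measurable
 have i: "integrable (lborel \<Otimes>\<^sub>M lborel) (\<lambda>(Y, X). g Y w * kap w (X - Y) * Phi X w)"
  using integral_mult_bounded(1)[OF i0, of "\<lambda>p. Phi (snd p) w" CP] Phi_le by (simp add: case_prod_beta')
 have "(LINT X|lborel. gg X w * Phi X w) = (LINT X|lborel. (LINT Y|lborel. g Y w * kap w (X - Y) * Phi X w))"
 proof (intro Bochner_Integration.integral_cong refl)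
  fix X
  have "gg X w = (LINT Y|lborel. kap w (X - Y) * g Y w)"
   unfolding gg_def using integral_lborel_translate(2)[of "\<lambda>Y. kap w (X - Y) * g Y w" X] by simp
  then show "gg X w * Phi X w = (LINT Y|lborel. g Y w * kap w (X - Y) * Phi X w)" by (simp add: mult.commute)
 qed
 also have "\<dots> = (LINT Y|lborel. (LINT X|lborel. g Y w * kap w (X - Y) * Phi X w))"
  by (rule lborel_pair.Fubini_integral[OF i])
 also have "\<dots> = (LINT Y|lborel. g Y w * dd Y w)"
  unfolding mult.assoc integral_mult_right_zero dd_alt ..
 finally show ?thesis .
qed

text \<open>The adjoint is applied one variable at a time: the velocity average at fixed position by
  \<open>ff_square_slice\<close>, the convolution at fixed velocity by \<open>g_dd_slice\<close>.
  The right-hand side is g tested with a transport derivative, the only quantity the kinetic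
  equation can control.\<close>

theorem energy_identity:
 "(\<integral>\<^sup>+v. (\<integral>\<^sup>+X. ennreal ((ff X v)\<^sup>2) \<partial>lborel) \<partial>lborel) = ennreal (LINT (X, w)|(lborel \<Otimes>\<^sub>M lborel). g X w * dd X w)"
proof -
 have gP: "integrable (lborel \<Otimes>\<^sub>M lborel) (\<lambda>(X, w). gg X w * Phi X w)"
  using integral_mult_bounded(1)[OF gg_integrable, of "\<lambda>p. Phi (fst p) (snd p)" CP] Phi_le by (simp add: case_prod_beta')
 have gd: "integrable (lborel \<Otimes>\<^sub>M lborel) (\<lambda>(X, w). g X w * dd X w)"
  using integral_mult_bounded(1)[OF g_int, of "\<lambda>p. dd (fst p) (snd p)" "2 * CP"] dd_le by (simp add: case_prod_beta')
 have fi: "integrable lborel (\<lambda>X. LINT v|lborel. (ff X v)\<^sup>2)"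
  unfolding ff_square_slice using lborel_pair.integrable_fst[OF gP] by simp
 have "(\<integral>\<^sup>+v. (\<integral>\<^sup>+X. ennreal ((ff X v)\<^sup>2) \<partial>lborel) \<partial>lborel) = (\<integral>\<^sup>+X. (\<integral>\<^sup>+v. ennreal ((ff X v)\<^sup>2) \<partial>lborel) \<partial>lborel)"
  by (rule lborel_pair.Fubini') measurable
 also have "\<dots> = (\<integral>\<^sup>+X. ennreal (LINT v|lborel. (ff X v)\<^sup>2) \<partial>lborel)"
  by (intro nn_integral_cong nn_integral_eq_integral ff_velocity_integrable) auto
 also have "\<dots> = ennreal (LINT X|lborel. (LINT v|lborel. (ff X v)\<^sup>2))"
  by (rule nn_integral_eq_integral[OF fi]) auto
 also have "(LINT X|lborel. (LINT v|lborel. (ff X v)\<^sup>2)) = (LINT X|lborel. (LINT w|lborel. gg X w * Phi X w))"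
  by (simp only: ff_square_slice)
 also have "\<dots> = (LINT w|lborel. (LINT X|lborel. gg X w * Phi X w))"
  by (rule lborel_pair.Fubini_integral[symmetric, OF gP])
 also have "\<dots> = (LINT w|lborel. (LINT Y|lborel. g Y w * dd Y w))"
 proof (rule integral_cong_AE)
  show "AE w in lborel. (LINT X|lborel. gg X w * Phi X w) = (LINT Y|lborel. g Y w * dd Y w)"
   using g_slice_integrable by eventually_elim (rule g_dd_slice)
 qed measurable
 also have "\<dots> = (LINT (X, w)|(lborel \<Otimes>\<^sub>M lborel). g X w * dd X w)"
  by (rule lborel_pair.integral_snd[OF gd])
 finally show ?thesis .
qed

section \<open>The averaging construction in Fourier variables\<close>

definition ghat :: "'x \<Rightarrow> 'v \<Rightarrow> complex"
 where "ghat \<xi> w = ft (\<lambda>X. complex_of_real (g X w)) \<xi>"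

text \<open>The transform of \<open>ff\<close> with the factor \<open>ker_hat\<close> taken out: a
  velocity average of \<open>ghat\<close> damped near the zero set of the symbol.\<close>

definition HH :: "'x \<Rightarrow> 'v \<Rightarrow> complex"
 where "HH \<xi> v = (LINT w|lborel. complex_of_real (c v w) * (damp \<xi> w * ghat \<xi> w))"

lemma ghat_measurable [measurable (raw)]:
 assumes [measurable]: "p \<in> borel_measurable M" "q \<in> borel_measurable M"
 shows "(\<lambda>z. ghat (p z) (q z)) \<in> borel_measurable M"
 unfolding ghat_def by measurable

lemma gg_ft:
 assumes "integrable lborel (\<lambda>X. g X w)"
 shows "ft (\<lambda>X. complex_of_real (gg X w)) \<xi> = complex_of_real (ker_hat \<xi>) * (damp \<xi> w * ghat \<xi> w)"
proof -
 note i = conv_pair_integrable[OF assms]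
 have i2: "integrable (lborel \<Otimes>\<^sub>M lborel) (\<lambda>(X, Y). cis (- (X \<bullet> \<xi>)) * complex_of_real (kap w Y * g (X - Y) w))"
  by (rule Bochner_Integration.integrable_bound[OF i]) (auto simp: norm_mult)
 have "ft (\<lambda>X. complex_of_real (gg X w)) \<xi> = (LINT X|lborel. (LINT Y|lborel. cis (- (X \<bullet> \<xi>)) * complex_of_real (kap w Y * g (X - Y) w)))"
  unfolding ft_def gg_def integral_mult_right_zero integral_complex_of_real ..
 also have "\<dots> = (LINT Y|lborel. (LINT X|lborel. cis (- (X \<bullet> \<xi>)) * complex_of_real (kap w Y * g (X - Y) w)))"
  by (rule lborel_pair.Fubini_integral[symmetric, OF i2])
 also have "\<dots> = (LINT Y|lborel. cis (- (Y \<bullet> \<xi>)) * complex_of_real (kap w Y) * ghat \<xi> w)"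
 proof (intro Bochner_Integration.integral_cong refl)
  fix Y
  have "(LINT X|lborel. cis (- (X \<bullet> \<xi>)) * complex_of_real (kap w Y * g (X - Y) w)) =
   (LINT X|lborel. cis (- (Y \<bullet> \<xi>)) * complex_of_real (kap w Y) * (cis (- ((X - Y) \<bullet> \<xi>)) * complex_of_real (g (X - Y) w)))"
  proof (intro Bochner_Integration.integral_cong refl)
   fix X
   have e: "cis (- (X \<bullet> \<xi>)) = cis (- (Y \<bullet> \<xi>)) * cis (- ((X - Y) \<bullet> \<xi>))" unfolding cis_mult by (simp add: inner_diff_left)
   show "cis (- (X \<bullet> \<xi>)) * complex_of_real (kap w Y * g (X - Y) w) =
    cis (- (Y \<bullet> \<xi>)) * complex_of_real (kap w Y) * (cis (- ((X - Y) \<bullet> \<xi>)) * complex_of_real (g (X - Y) w))"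
    unfolding e of_real_mult by (simp only: mult_ac)
  qed
  also have "\<dots> = cis (- (Y \<bullet> \<xi>)) * complex_of_real (kap w Y) * (LINT X|lborel. cis (- ((X - Y) \<bullet> \<xi>)) * complex_of_real (g (X - Y) w))"
   by (rule integral_mult_right_zero)
  also have "(LINT X|lborel. cis (- ((X - Y) \<bullet> \<xi>)) * complex_of_real (g (X - Y) w)) = ghat \<xi> w"
   unfolding ghat_def ft_def by (rule integral_lborel_translate(3)) measurable
  finally show "(LINT X|lborel. cis (- (X \<bullet> \<xi>)) * complex_of_real (kap w Y * g (X - Y) w)) = cis (- (Y \<bullet> \<xi>)) * complex_of_real (kap w Y) * ghat \<xi> w" .
 qed
 also have "\<dots> = ft (\<lambda>Y. complex_of_real (kap w Y)) \<xi> * ghat \<xi> w"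
  unfolding integral_mult_left_zero ft_def ..
 finally show ?thesis by (simp add: kap_ft mult.assoc)
qed

lemma damp_measurable [measurable (raw)]:
 assumes [measurable]: "p \<in> borel_measurable M" "q \<in> borel_measurable M"
 shows "(\<lambda>z. damp (p z) (q z)) \<in> borel_measurable M"
 unfolding damp_def by measurable

lemma HH_measurable [measurable (raw)]:
 assumes [measurable]: "p \<in> borel_measurable M" "q \<in> borel_measurable M"
 shows "(\<lambda>z. HH (p z) (q z)) \<in> borel_measurable M"
 unfolding HH_def by measurable

lemma ff_pair_integrable: "integrable (lborel \<Otimes>\<^sub>M lborel) (\<lambda>(X, w). c v w * gg X w)"
 using integral_mult_bounded(1)[OF gg_integrable, of "\<lambda>p. c v (snd p)" c0] c_le by (simp add: case_prod_beta' mult.commute)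

lemma ff_integrable: "integrable lborel (\<lambda>X. ff X v)"
 unfolding ff_def using lborel_pair.integrable_fst[OF ff_pair_integrable[of v]] by simp

lemma ff_ft: "ft (\<lambda>X. complex_of_real (ff X v)) \<xi> = complex_of_real (ker_hat \<xi>) * HH \<xi> v"
proof -
 have i2: "integrable (lborel \<Otimes>\<^sub>M lborel) (\<lambda>(X, w). cis (- (X \<bullet> \<xi>)) * complex_of_real (c v w * gg X w))"
  by (rule Bochner_Integration.integrable_bound[OF ff_pair_integrable[of v]]) (auto simp: norm_mult)
 have "ft (\<lambda>X. complex_of_real (ff X v)) \<xi> = (LINT X|lborel. (LINT w|lborel. cis (- (X \<bullet> \<xi>)) * complex_of_real (c v w * gg X w)))"
  unfolding ft_def ff_def integral_mult_right_zero integral_complex_of_real ..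
 also have "\<dots> = (LINT w|lborel. (LINT X|lborel. cis (- (X \<bullet> \<xi>)) * complex_of_real (c v w * gg X w)))"
  by (rule lborel_pair.Fubini_integral[symmetric, OF i2])
 also have "\<dots> = (LINT w|lborel. (LINT X|lborel. complex_of_real (c v w) * (cis (- (X \<bullet> \<xi>)) * complex_of_real (gg X w))))"
  by (simp only: of_real_mult mult.left_commute)
 also have "\<dots> = (LINT w|lborel. complex_of_real (c v w) * ft (\<lambda>X. complex_of_real (gg X w)) \<xi>)"
  unfolding integral_mult_right_zero ft_def ..
 also have "\<dots> = (LINT w|lborel. complex_of_real (ker_hat \<xi>) * (complex_of_real (c v w) * (damp \<xi> w * ghat \<xi> w)))"
 proof (rule integral_cong_AE)
  show "AE w in lborel. complex_of_real (c v w) * ft (\<lambda>X. complex_of_real (gg X w)) \<xi> =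
   complex_of_real (ker_hat \<xi>) * (complex_of_real (c v w) * (damp \<xi> w * ghat \<xi> w))"
   using g_slice_integrable by eventually_elim (simp add: gg_ft)
 qed measurable
 also have "\<dots> = complex_of_real (ker_hat \<xi>) * HH \<xi> v"
  unfolding HH_def by (rule integral_mult_right_zero)
 finally show ?thesis .
qed

theorem fourier_energy_bound:
 "(\<integral>\<^sup>+v. (\<integral>\<^sup>+\<xi>. ennreal ((norm (complex_of_real (ker_hat \<xi>) * HH \<xi> v))\<^sup>2) \<partial>lborel) \<partial>lborel)
  \<le> ennreal ((2 * pi) ^ DIM('x)) * ennreal (LINT (X, w)|(lborel \<Otimes>\<^sub>M lborel). g X w * dd X w)"
proof -
 have "(\<integral>\<^sup>+v. (\<integral>\<^sup>+\<xi>. ennreal ((norm (complex_of_real (ker_hat \<xi>) * HH \<xi> v))\<^sup>2) \<partial>lborel) \<partial>lborel) \<le>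
  (\<integral>\<^sup>+v. ennreal ((2 * pi) ^ DIM('x)) * (\<integral>\<^sup>+X. ennreal ((ff X v)\<^sup>2) \<partial>lborel) \<partial>lborel)"
 proof (rule nn_integral_mono)
  fix v
  have "integrable lborel (\<lambda>X. complex_of_real (ff X v))" using ff_integrable by simp
  from plancherel_le[OF this]
  show "(\<integral>\<^sup>+\<xi>. ennreal ((norm (complex_of_real (ker_hat \<xi>) * HH \<xi> v))\<^sup>2) \<partial>lborel) \<le> ennreal ((2 * pi) ^ DIM('x)) * (\<integral>\<^sup>+X. ennreal ((ff X v)\<^sup>2) \<partial>lborel)"
   unfolding ff_ft by simp
 qed
 also have "\<dots> = ennreal ((2 * pi) ^ DIM('x)) * (\<integral>\<^sup>+v. (\<integral>\<^sup>+X. ennreal ((ff X v)\<^sup>2) \<partial>lborel) \<partial>lborel)"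
  by (rule nn_integral_cmult) measurable
 finally show ?thesis unfolding energy_identity .
qed

end

section \<open>Velocity weights\<close>

definition tent :: "real \<Rightarrow> 'v::euclidean_space \<Rightarrow> real"
 where "tent \<delta> z = max 0 (1 - norm z / \<delta>)"

definition tent_mass :: "'v::euclidean_space itself \<Rightarrow> real \<Rightarrow> real"
 where "tent_mass _ \<delta> = (LINT z|lborel. tent \<delta> (z :: 'v))"

text \<open>A normalised tent is Lipschitz with support in a ball of radius \<delta>; the bounds
  demanded by \<open>averaging\<close> then follow from volumes of balls.\<close>

definition rho :: "real \<Rightarrow> 'v::euclidean_space \<Rightarrow> 'v \<Rightarrow> real"
 where "rho \<delta> v w = tent \<delta> (v - w) / tent_mass TYPE('v) \<delta>"

lemma tent_bounds: "0 \<le> tent \<delta> z" "\<delta> > 0 \<Longrightarrow> tent \<delta> z \<le> 1"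
 by (auto simp: tent_def)

lemma tent_eq_0: "\<delta> > 0 \<Longrightarrow> \<delta> \<le> norm z \<Longrightarrow> tent \<delta> z = 0"
 by (simp add: tent_def)

lemma tent_lipschitz: "\<delta> > 0 \<Longrightarrow> \<bar>tent \<delta> y - tent \<delta> z\<bar> \<le> norm (y - z) / \<delta>"
proof -
 assume "\<delta> > 0"
 have "\<bar>tent \<delta> y - tent \<delta> z\<bar> \<le> \<bar>norm y / \<delta> - norm z / \<delta>\<bar>" by (auto simp: tent_def)
 also have "\<dots> = \<bar>norm y - norm z\<bar> / \<delta>" using \<open>\<delta> > 0\<close> by (simp add: diff_divide_distrib[symmetric])
 also have "\<dots> \<le> norm (y - z) / \<delta>" using \<open>\<delta> > 0\<close> by (intro divide_right_mono norm_triangle_ineq3) auto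
 finally show ?thesis .
qed

lemma tent_measurable [measurable]: "tent \<delta> \<in> borel_measurable borel"
 unfolding tent_def[abs_def] by measurable

lemma rho_measurable [measurable (raw)]:
 assumes [measurable]: "p \<in> borel_measurable M" "q \<in> borel_measurable M"
 shows "(\<lambda>z. rho \<delta> (p z) (q z)) \<in> borel_measurable M"
 unfolding rho_def by measurable

lemma integrable_cball [simp]: "integrable lborel (indicat_real (cball (c::'v::euclidean_space) r))"
 by (intro integrable_real_indicator) (auto intro: emeasure_bounded_finite[unfolded infinity_ennreal_def])

lemma tent_integrable:
 assumes "\<delta> > 0" shows "integrable lborel (tent \<delta> :: 'v::euclidean_space \<Rightarrow> real)"
proof (rule Bochner_Integration.integrable_bound)
 show "integrable lborel (indicat_real (cball (0::'v) \<delta>))" by simp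
 show "AE z in lborel. norm (tent \<delta> z) \<le> norm (indicat_real (cball (0::'v) \<delta>) z)"
  by (rule AE_I2) (use assms in \<open>auto simp: indicator_def tent_bounds tent_eq_0\<close>)
qed measurable

lemma measure_cball: "r \<ge> 0 \<Longrightarrow> measure lborel (cball (c::'v::euclidean_space) r) = unit_ball_vol (real DIM('v)) * r ^ DIM('v)"
 using emeasure_cball[of r c] by (simp add: measure_def)

text \<open>The tent is at least 1/2 on the ball of half the radius, which costs 2^DIM for the
  volume and 2 for the height.\<close>

lemma tent_mass_lower:
 assumes "\<delta> > 0"
 shows "unit_ball_vol (real DIM('v)) * \<delta> ^ DIM('v) \<le> 2 ^ (DIM('v) + 1) * tent_mass TYPE('v::euclidean_space) \<delta>"
  and "tent_mass TYPE('v) \<delta> > 0"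
proof -
 have "(LINT z|lborel. indicat_real (cball (0::'v) (\<delta>/2)) z * (1/2)) \<le> tent_mass TYPE('v) \<delta>"
  unfolding tent_mass_def
 proof (rule integral_mono)
  show "indicat_real (cball (0::'v) (\<delta>/2)) z * (1/2) \<le> tent \<delta> z" for z :: 'v
   using assms tent_bounds(1)[of \<delta> z] by (cases "norm z \<le> \<delta> / 2") (auto simp: tent_def field_simps)
 qed (use assms tent_integrable in auto)
 moreover have "(LINT z|lborel. indicat_real (cball (0::'v) (\<delta>/2)) z * (1/2)) = unit_ball_vol (real DIM('v)) * \<delta> ^ DIM('v) / 2 ^ (DIM('v) + 1)"
  using measure_cball[of "\<delta>/2" "0::'v"] assms by (simp add: power_divide)
 ultimately have "unit_ball_vol (real DIM('v)) * \<delta> ^ DIM('v) / 2 ^ (DIM('v) + 1) \<le> tent_mass TYPE('v) \<delta>"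
  by linarith
 then have "unit_ball_vol (real DIM('v)) * \<delta> ^ DIM('v) \<le> tent_mass TYPE('v) \<delta> * 2 ^ (DIM('v) + 1)"
  by (subst (asm) pos_divide_le_eq) simp_all
 then show 1: "unit_ball_vol (real DIM('v)) * \<delta> ^ DIM('v) \<le> 2 ^ (DIM('v) + 1) * tent_mass TYPE('v) \<delta>"
  by (simp only: mult.commute)
 have "0 < unit_ball_vol (real DIM('v)) * \<delta> ^ DIM('v)" using assms by simp
 with 1 have "0 < 2 ^ (DIM('v) + 1) * tent_mass TYPE('v) \<delta>" by linarith
 then show "tent_mass TYPE('v) \<delta> > 0" by (simp add: zero_less_mult_iff)
qed

context
 fixes \<delta> :: real
 assumes \<delta>: "\<delta> > 0"
begin

lemma rho_nonneg: "0 \<le> rho \<delta> v w"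
 unfolding rho_def using tent_bounds tent_mass_lower(2)[OF \<delta>] by (intro divide_nonneg_pos) auto

lemma rho_le:
 fixes v w :: "'v::euclidean_space"
 shows "rho \<delta> v w \<le> 1 / tent_mass TYPE('v) \<delta>"
 unfolding rho_def using tent_bounds(2)[OF \<delta>] tent_mass_lower(2)[OF \<delta>, where 'v = 'v] by (intro divide_right_mono) auto

lemma rho_eq_0: "\<delta> \<le> norm (v - w) \<Longrightarrow> rho \<delta> v w = 0"
 by (simp add: rho_def tent_eq_0[OF \<delta>])

lemma rho_integral:
 fixes v w :: "'v::euclidean_space"
 shows "integrable lborel (rho \<delta> v)" "integrable lborel (\<lambda>v. rho \<delta> v w)"
  and "(LINT w|lborel. rho \<delta> v w) = 1" "(LINT v|lborel. rho \<delta> v w) = 1"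
proof -
 note m = tent_mass_lower(2)[OF \<delta>, where 'v = 'v]
 show "integrable lborel (rho \<delta> v)" unfolding rho_def[abs_def]
  by (intro integrable_divide integrable_lborel_translate(2)[OF tent_integrable[OF \<delta>]])
 show "integrable lborel (\<lambda>v. rho \<delta> v w)" unfolding rho_def[abs_def]
  by (intro integrable_divide integrable_lborel_translate(3)[OF tent_integrable[OF \<delta>]])
 show "(LINT w|lborel. rho \<delta> v w) = 1"
  using integral_lborel_translate(2)[of "tent \<delta>" v] m unfolding rho_def integral_divide_zero by (simp add: tent_mass_def)
 show "(LINT v|lborel. rho \<delta> v w) = 1"
  using integral_lborel_translate(3)[of "tent \<delta>" w] m unfolding rho_def integral_divide_zero by (simp add: tent_mass_def)
qed

text \<open>The increment is at most |w - w'|/\<delta> over the mass and lives on two balls of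
  radius \<delta>. Volume over mass is at most 2^(DIM+1), and the two balls give the further factor
  2.\<close>

lemma rho_lipschitz:
 fixes w w' :: "'v::euclidean_space"
 shows "(LINT v|lborel. \<bar>rho \<delta> v w - rho \<delta> v w'\<bar>) \<le> 2 ^ (DIM('v) + 2) / \<delta> * norm (w - w')"
proof -
 let ?m = "tent_mass TYPE('v) \<delta>" and ?V = "unit_ball_vol (real DIM('v)) * \<delta> ^ DIM('v)"
 have m: "?m > 0" by (rule tent_mass_lower(2)[OF \<delta>])
 let ?k = "norm (w - w') / (\<delta> * ?m)"
 have "(LINT v|lborel. \<bar>rho \<delta> v w - rho \<delta> v w'\<bar>) \<le> (LINT v|lborel. ?k * indicat_real (cball w \<delta>) v + ?k * indicat_real (cball w' \<delta>) v)"
 proof (rule integral_mono)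
  show "integrable lborel (\<lambda>v. \<bar>rho \<delta> v w - rho \<delta> v w'\<bar>)" by (intro integrable_abs Bochner_Integration.integrable_diff rho_integral(2))
  show "integrable lborel (\<lambda>v. ?k * indicat_real (cball w \<delta>) v + ?k * indicat_real (cball w' \<delta>) v)" by simp
  fix v
  have k0: "?k \<ge> 0" using m \<delta> by simp
  have d: "\<bar>rho \<delta> v w - rho \<delta> v w'\<bar> \<le> ?k"
  proof -
   have "\<bar>rho \<delta> v w - rho \<delta> v w'\<bar> = \<bar>tent \<delta> (v - w) - tent \<delta> (v - w')\<bar> / ?m"
    using m by (simp add: rho_def diff_divide_distrib[symmetric])
   also have "\<dots> \<le> (norm ((v - w) - (v - w')) / \<delta>) / ?m"
    using m by (intro divide_right_mono tent_lipschitz[OF \<delta>]) auto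
   finally show ?thesis by (simp add: norm_minus_commute)
  qed
  show "\<bar>rho \<delta> v w - rho \<delta> v w'\<bar> \<le> ?k * indicat_real (cball w \<delta>) v + ?k * indicat_real (cball w' \<delta>) v"
  proof (cases "v \<in> cball w \<delta> \<or> v \<in> cball w' \<delta>")
   case True then show ?thesis using d k0 by (auto simp: indicator_def)
  next
   case False
   then have "rho \<delta> v w = 0" "rho \<delta> v w' = 0"
    by (auto intro!: rho_eq_0 simp: dist_norm norm_minus_commute not_le less_imp_le)
   then show ?thesis
    by (simp only: diff_self abs_zero) (intro add_nonneg_nonneg mult_nonneg_nonneg k0; simp)
  qed
 qed
 also have "\<dots> = 2 * ?k * ?V"
  using measure_cball[of \<delta> w] measure_cball[of \<delta> w'] \<delta> by simp
 also have "\<dots> \<le> 2 * ?k * (2 ^ (DIM('v) + 1) * ?m)"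
  using m \<delta> by (intro mult_left_mono tent_mass_lower(1)[OF \<delta>]) auto
 also have "\<dots> = 2 ^ (DIM('v) + 2) / \<delta> * norm (w - w')" using m \<delta> by (simp add: field_simps)
 finally show ?thesis .
qed

text \<open>The factor h will be 1 or a difference quotient of \<open>a\<close>. Its slope
  H/\<delta> is of the order of the slope of \<open>rho\<close>, so multiplication by h changes only
  the constants.\<close>

lemma weight_properties:
 fixes h :: "'v::euclidean_space \<Rightarrow> 'v \<Rightarrow> real"
 assumes hm: "case_prod h \<in> borel_measurable (borel \<Otimes>\<^sub>M borel)" and h: "\<And>v w. \<bar>h v w\<bar> \<le> H"
  and hl: "\<And>v w w'. \<bar>h v w - h v w'\<bar> \<le> H / \<delta> * norm (w - w')"
 defines "c \<equiv> \<lambda>v w. rho \<delta> v w * h v w"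
 shows "case_prod c \<in> borel_measurable (borel \<Otimes>\<^sub>M borel)" "\<And>v w. \<bar>c v w\<bar> \<le> H / tent_mass TYPE('v) \<delta>"
  "\<And>v. integrable lborel (c v)" "\<And>v. (LINT w|lborel. \<bar>c v w\<bar>) \<le> H"
  "\<And>w. integrable lborel (\<lambda>v. c v w)" "\<And>w. (LINT v|lborel. \<bar>c v w\<bar>) \<le> H"
  "\<And>w w'. (LINT v|lborel. \<bar>c v w - c v w'\<bar>) \<le> H * (2 ^ (DIM('v) + 2) + 1) / \<delta> * norm (w - w')"
proof -
 have H: "H \<ge> 0" using h[of 0 0] by linarith
 have hmr [measurable]: "(\<lambda>z. h (p z) (q z)) \<in> borel_measurable M"
  if "p \<in> borel_measurable M" "q \<in> borel_measurable M" for p q and M :: "'z measure"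
  using measurable_compose[OF measurable_Pair[OF that] hm] by simp
 have hm1: "h v \<in> borel_measurable lborel" and hm2: "(\<lambda>v. h v w) \<in> borel_measurable lborel" for v w
  using measurable_compose[OF measurable_Pair[of "\<lambda>_. v" lborel borel "\<lambda>x. x" borel] hm]
   measurable_compose[OF measurable_Pair[of "\<lambda>x. x" lborel borel "\<lambda>_. w" borel] hm] by auto
 have rhoP: "(\<lambda>p. rho \<delta> (fst p) (snd p)) \<in> borel_measurable (borel \<Otimes>\<^sub>M (borel :: 'v measure))" by measurable
 show "case_prod c \<in> borel_measurable (borel \<Otimes>\<^sub>M borel)"
  unfolding c_def using borel_measurable_times[OF rhoP hm] by (simp add: case_prod_beta')
 show "\<bar>c v w\<bar> \<le> H / tent_mass TYPE('v) \<delta>" for v w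
  using mult_mono[OF rho_le[of v w] h[of v w]] rho_nonneg[of v w] tent_mass_lower(2)[OF \<delta>, where 'v = 'v]
  by (simp add: c_def abs_mult)
 show 1: "integrable lborel (c v)" for v
  unfolding c_def by (rule integral_mult_bounded(1)[OF rho_integral(1) hm1 h])
 show 2: "integrable lborel (\<lambda>v. c v w)" for w
  unfolding c_def by (rule integral_mult_bounded(1)[OF rho_integral(2) hm2 h])
 have cb: "\<bar>c v w\<bar> \<le> rho \<delta> v w * H" for v w
  unfolding c_def abs_mult abs_of_nonneg[OF rho_nonneg] by (intro mult_left_mono h rho_nonneg)
 have "(LINT w|lborel. \<bar>c v w\<bar>) \<le> (LINT w|lborel. rho \<delta> v w * H)" for v
  by (intro integral_mono cb integrable_abs 1 integrable_mult_left rho_integral)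
 then show "(LINT w|lborel. \<bar>c v w\<bar>) \<le> H" for v by (simp add: rho_integral(3))
 have "(LINT v|lborel. \<bar>c v w\<bar>) \<le> (LINT v|lborel. rho \<delta> v w * H)" for w
  by (intro integral_mono cb integrable_abs 2 integrable_mult_left rho_integral)
 then show "(LINT v|lborel. \<bar>c v w\<bar>) \<le> H" for w by (simp add: rho_integral(4))
 fix w w' :: 'v
 have ri: "integrable lborel (\<lambda>v. \<bar>rho \<delta> v w - rho \<delta> v w'\<bar>)" by (intro integrable_abs Bochner_Integration.integrable_diff rho_integral(2))
 have "(LINT v|lborel. \<bar>c v w - c v w'\<bar>) \<le> (LINT v|lborel. rho \<delta> v w * (H / \<delta> * norm (w - w')) + \<bar>rho \<delta> v w - rho \<delta> v w'\<bar> * H)"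
 proof (rule integral_mono)
  show "integrable lborel (\<lambda>v. \<bar>c v w - c v w'\<bar>)" using 2 by auto
  show "integrable lborel (\<lambda>v. rho \<delta> v w * (H / \<delta> * norm (w - w')) + \<bar>rho \<delta> v w - rho \<delta> v w'\<bar> * H)"
   by (intro Bochner_Integration.integrable_add integrable_mult_left rho_integral ri)
  show "\<bar>c v w - c v w'\<bar> \<le> rho \<delta> v w * (H / \<delta> * norm (w - w')) + \<bar>rho \<delta> v w - rho \<delta> v w'\<bar> * H" for v
   unfolding c_def by (rule mult_lipschitz[OF order_refl hl _ h]) (simp add: rho_nonneg)
 qed
 also have "\<dots> = H / \<delta> * norm (w - w') + (LINT v|lborel. \<bar>rho \<delta> v w - rho \<delta> v w'\<bar>) * H"
  using rho_integral(2)[of w] ri by (subst Bochner_Integration.integral_add) (auto simp: rho_integral(4))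
 also have "\<dots> \<le> H / \<delta> * norm (w - w') + (2 ^ (DIM('v) + 2) / \<delta> * norm (w - w')) * H"
  by (intro add_left_mono mult_right_mono rho_lipschitz H)
 also have "\<dots> = H * (2 ^ (DIM('v) + 2) + 1) / \<delta> * norm (w - w')" by (simp add: add_divide_distrib algebra_simps)
 finally show "(LINT v|lborel. \<bar>c v w - c v w'\<bar>) \<le> H * (2 ^ (DIM('v) + 2) + 1) / \<delta> * norm (w - w')" .
qed

end

text \<open>Stated for extended integrals, with an upper bound for one factor, so that no
  integrability of the product or of q has to be checked. The weighted arithmetic-geometric
  inequality is optimised over its parameter.\<close>

lemma cauchy_schwarz_le:
 fixes p q :: "'a \<Rightarrow> complex"
 assumes [measurable]: "p \<in> borel_measurable M" "q \<in> borel_measurable M" and a: "a > 0"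
  and p: "(\<integral>\<^sup>+x. ennreal ((norm (p x))\<^sup>2) \<partial>M) \<le> ennreal a"
 shows "ennreal ((norm (LINT x|M. p x * q x))\<^sup>2) \<le> ennreal a * (\<integral>\<^sup>+x. ennreal ((norm (q x))\<^sup>2) \<partial>M)"
proof (cases "(\<integral>\<^sup>+x. ennreal ((norm (q x))\<^sup>2) \<partial>M)" rule: ennreal_cases)
 case top
 then show ?thesis using a by (simp add: ennreal_mult_top)
next
 case (real \<beta>)
 let ?z = "norm (LINT x|M. p x * q x)"
 \<comment> \<open>The parameter t is free; t = sqrt(\<beta>/a) is optimal if \<beta> > 0, and t
   proportional to the left side forces it to vanish if \<beta> = 0.\<close>
 have t: "2 * ?z \<le> t * a + \<beta> / t" if "t > 0" for t
 proof -
  have "ennreal ?z \<le> (\<integral>\<^sup>+x. ennreal (norm (p x * q x)) \<partial>M)"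
   by (cases "integrable M (\<lambda>x. p x * q x)")
    (auto intro: integral_norm_bound_ennreal simp: not_integrable_integral_eq)
  also have "\<dots> \<le> (\<integral>\<^sup>+x. ennreal (t / 2) * ennreal ((norm (p x))\<^sup>2) + ennreal (1 / (2 * t)) * ennreal ((norm (q x))\<^sup>2) \<partial>M)"
  proof (rule nn_integral_mono)
   fix x
   have "0 \<le> (t * norm (p x) - norm (q x))\<^sup>2" by simp
   then have "2 * t * (norm (p x) * norm (q x)) \<le> t\<^sup>2 * (norm (p x))\<^sup>2 + (norm (q x))\<^sup>2"
    by (simp add: power2_diff power_mult_distrib)
   then have "norm (p x) * norm (q x) \<le> t / 2 * (norm (p x))\<^sup>2 + 1 / (2 * t) * (norm (q x))\<^sup>2"
    using that by (simp add: field_simps power2_eq_square)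
   then show "ennreal (norm (p x * q x)) \<le> ennreal (t / 2) * ennreal ((norm (p x))\<^sup>2) + ennreal (1 / (2 * t)) * ennreal ((norm (q x))\<^sup>2)"
    using that by (simp add: norm_mult ennreal_leI flip: ennreal_mult ennreal_plus)
  qed
  also have "\<dots> = ennreal (t / 2) * (\<integral>\<^sup>+x. ennreal ((norm (p x))\<^sup>2) \<partial>M) + ennreal (1 / (2 * t)) * ennreal \<beta>"
   using real by (simp add: nn_integral_add nn_integral_cmult)
  also have "\<dots> \<le> ennreal (t / 2) * ennreal a + ennreal (1 / (2 * t)) * ennreal \<beta>"
   by (intro add_right_mono mult_left_mono p) auto
  also have "\<dots> = ennreal (t / 2 * a + 1 / (2 * t) * \<beta>)"
   using that a real by (simp flip: ennreal_mult ennreal_plus)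
  finally have "?z \<le> t / 2 * a + 1 / (2 * t) * \<beta>"
   by (subst (asm) ennreal_le_iff) (use that a real in auto)
  then show ?thesis by (simp add: field_simps)
 qed
 have "?z\<^sup>2 \<le> a * \<beta>"
 proof (cases "\<beta> = 0")
  case True
  have "?z = 0"
  proof (rule ccontr)
   assume "?z \<noteq> 0"
   then have "?z > 0" by simp
   then show False using t[of "?z / a"] a True by simp
  qed
  then show ?thesis using True by simp
 next
  case False
  then have b: "\<beta> > 0" using real by simp
  let ?t = "sqrt (\<beta> / a)"
  have tp: "?t > 0" using a b by simp
  have "?t * a = sqrt (a * \<beta>)" "\<beta> / ?t = sqrt (a * \<beta>)"
   using a b by (auto simp: real_sqrt_divide real_sqrt_mult field_simps)
  then have "?z \<le> sqrt (a * \<beta>)" using t[OF tp] by simp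
  then show ?thesis using a b by (metis norm_ge_zero power_mono real_sqrt_pow2 less_imp_le mult_pos_pos)
 qed
 then show ?thesis unfolding real(2) using a real by (simp add: ennreal_leI flip: ennreal_mult)
qed

section \<open>Slab estimate\<close>

text \<open>Instead of rotating coordinates, the integral is averaged over its translates by s e,
  with s in [0,A] and e the unit vector along \<xi>. Translates stay in the ball of radius 2A, and
  for fixed w the integral in s is the full Lorentz integral, of size \<eta>/|\<xi>|.\<close>

lemma slab_estimate:
 fixes \<xi> :: "'v::euclidean_space"
 assumes \<xi>: "\<xi> \<noteq> 0" and \<eta>: "\<eta> > 0" and A: "A > 0"
 shows "(\<integral>\<^sup>+w. indicator (cball 0 A) w * ennreal (\<eta>\<^sup>2 / (\<eta>\<^sup>2 + (\<tau> + \<xi> \<bullet> w)\<^sup>2)) \<partial>lborel)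
  \<le> ennreal (measure lborel (cball (0::'v) (2 * A)) / A * pi * \<eta> / norm \<xi>)"
proof -
 define e where "e = \<xi> /\<^sub>R norm \<xi>"
 let ?h = "\<lambda>r. ennreal (\<eta>\<^sup>2 / (\<eta>\<^sup>2 + r\<^sup>2))"
 let ?\<psi> = "\<lambda>w. indicator (cball 0 A) w * ?h (\<tau> + \<xi> \<bullet> w)"
 have ne: "norm e = 1" using \<xi> by (simp add: e_def)
 have xe: "\<xi> \<bullet> e = norm \<xi>" using \<xi> by (simp add: e_def dot_square_norm power2_eq_square)
 have cb [measurable]: "cball (0::'v) A \<in> sets borel" "cball (0::'v) (2 * A) \<in> sets borel" by simp_all
 have \<psi>m: "?\<psi> \<in> borel_measurable borel" by measurable
 have pm: "(\<lambda>p. indicator (cball (0::'v) (2 * A)) (fst p) * ?h ((\<tau> + \<xi> \<bullet> fst p) + norm \<xi> * snd p)) \<in> borel_measurable (lborel \<Otimes>\<^sub>M lborel)"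
 proof -
  have "(\<lambda>p. indicator (cball (0::'v) (2 * A)) (fst p) :: ennreal) \<in> borel_measurable (lborel \<Otimes>\<^sub>M (lborel::real measure))"
   by (rule measurable_compose[OF measurable_fst]) simp
  moreover have "(\<lambda>p. ?h ((\<tau> + \<xi> \<bullet> fst p) + norm \<xi> * snd p)) \<in> borel_measurable (lborel \<Otimes>\<^sub>M (lborel::real measure))"
  proof -
   have [measurable]: "fst \<in> borel_measurable (lborel \<Otimes>\<^sub>M (lborel::real measure))" "snd \<in> borel_measurable ((lborel::'v measure) \<Otimes>\<^sub>M (lborel::real measure))"
    using measurable_fst[of "lborel::'v measure" "lborel::real measure"] measurable_snd[of "lborel::'v measure" "lborel::real measure"] by simp_all
   show ?thesis by measurable
  qed
  ultimately show ?thesis by (rule borel_measurable_times_ennreal)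
 qed
 have "ennreal A * (\<integral>\<^sup>+w. ?\<psi> w \<partial>lborel) = (\<integral>\<^sup>+s. (\<integral>\<^sup>+w. ?\<psi> w \<partial>lborel) * indicator {0..A} s \<partial>lborel)"
  using A by (subst nn_integral_cmult_indicator) (auto simp: mult.commute)
 also have "\<dots> = (\<integral>\<^sup>+s. (\<integral>\<^sup>+w. ?\<psi> (s *\<^sub>R e + w) \<partial>lborel) * indicator {0..A} s \<partial>lborel)"
  unfolding nn_integral_lborel_translate(1)[OF \<psi>m] ..
 also have "\<dots> \<le> (\<integral>\<^sup>+s. (\<integral>\<^sup>+w. indicator (cball 0 (2 * A)) w * ?h ((\<tau> + \<xi> \<bullet> w) + norm \<xi> * s) \<partial>lborel) \<partial>lborel)"
 proof (intro nn_integral_mono)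
  fix s :: real
  show "(\<integral>\<^sup>+w. ?\<psi> (s *\<^sub>R e + w) \<partial>lborel) * indicator {0..A} s \<le> (\<integral>\<^sup>+w. indicator (cball 0 (2 * A)) w * ?h ((\<tau> + \<xi> \<bullet> w) + norm \<xi> * s) \<partial>lborel)"
  proof (cases "s \<in> {0..A}")
   case True
   have "(\<integral>\<^sup>+w. ?\<psi> (s *\<^sub>R e + w) \<partial>lborel) \<le> (\<integral>\<^sup>+w. indicator (cball 0 (2 * A)) w * ?h ((\<tau> + \<xi> \<bullet> w) + norm \<xi> * s) \<partial>lborel)"
   proof (intro nn_integral_mono mult_mono)
    fix w
    have "norm w \<le> norm (s *\<^sub>R e + w) + norm (s *\<^sub>R e)" using norm_triangle_ineq4[of "s *\<^sub>R e + w" "s *\<^sub>R e"] by simp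
    moreover have "norm (s *\<^sub>R e) \<le> A" using True unfolding norm_scaleR ne by simp
    ultimately show "indicator (cball 0 A) (s *\<^sub>R e + w) \<le> (indicator (cball 0 (2 * A)) w :: ennreal)"
     by (auto simp: indicator_def)
    show "?h (\<tau> + \<xi> \<bullet> (s *\<^sub>R e + w)) \<le> ?h ((\<tau> + \<xi> \<bullet> w) + norm \<xi> * s)"
     unfolding inner_add_right inner_scaleR_right xe by (simp add: add_ac mult.commute)
   qed auto
   then show ?thesis using True by simp
  qed simp
 qed
 also have "\<dots> = (\<integral>\<^sup>+w. (\<integral>\<^sup>+s. indicator (cball 0 (2 * A)) w * ?h ((\<tau> + \<xi> \<bullet> w) + norm \<xi> * s) \<partial>lborel) \<partial>lborel)"
  by (rule lborel_pair.Fubini') (use pm in \<open>simp add: case_prod_beta\<close>)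
 also have "\<dots> = (\<integral>\<^sup>+w. indicator (cball (0::'v) (2 * A)) w * ennreal (pi * \<eta> / norm \<xi>) \<partial>lborel)"
 proof (intro nn_integral_cong)
  fix w
  show "(\<integral>\<^sup>+s. indicator (cball 0 (2 * A)) w * ?h ((\<tau> + \<xi> \<bullet> w) + norm \<xi> * s) \<partial>lborel) = indicator (cball 0 (2 * A)) w * ennreal (pi * \<eta> / norm \<xi>)"
   using nn_integral_lorentz[of \<eta> "norm \<xi>" "\<tau> + \<xi> \<bullet> w"] \<xi> \<eta> by (subst nn_integral_cmult) auto
 qed
 also have "\<dots> = ennreal (measure lborel (cball (0::'v) (2 * A))) * ennreal (pi * \<eta> / norm \<xi>)"
 proof -
  have "emeasure lborel (cball (0::'v) (2 * A)) = ennreal (measure lborel (cball (0::'v) (2 * A)))"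
   using emeasure_bounded_finite[of "cball (0::'v) (2*A)"] by (intro emeasure_eq_ennreal_measure) auto
  then show ?thesis by (simp add: nn_integral_multc)
 qed
 finally have 1: "ennreal A * (\<integral>\<^sup>+w. ?\<psi> w \<partial>lborel) \<le> ennreal (measure lborel (cball (0::'v) (2 * A)) * (pi * \<eta> / norm \<xi>))"
  using \<eta> by (simp flip: ennreal_mult)
 have "(\<integral>\<^sup>+w. ?\<psi> w \<partial>lborel) = ennreal (1 / A) * (ennreal A * (\<integral>\<^sup>+w. ?\<psi> w \<partial>lborel))"
  using A by (simp flip: mult.assoc ennreal_mult)
 also have "\<dots> \<le> ennreal (1 / A) * ennreal (measure lborel (cball (0::'v) (2 * A)) * (pi * \<eta> / norm \<xi>))"
  by (intro mult_left_mono 1) auto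
 also have "\<dots> = ennreal (measure lborel (cball (0::'v) (2 * A)) / A * pi * \<eta> / norm \<xi>)"
  using A \<eta> by (simp flip: ennreal_mult)
 finally show ?thesis .
qed

section \<open>The multi-scale estimate\<close>

text \<open>For the direction (1, a(v)) this is i times the transport symbol. \<open>res\<close> is
  then the resolvent symbol, a smooth substitute for the indicator of |D| < \<eta>.\<close>

definition freq :: "('v::euclidean_space \<Rightarrow> 'x::euclidean_space) \<Rightarrow> 'x \<Rightarrow> 'v \<Rightarrow> complex"
 where "freq b \<xi> w = \<i> * complex_of_real (\<xi> \<bullet> b w)"

definition res :: "('v::euclidean_space \<Rightarrow> 'x::euclidean_space) \<Rightarrow> real \<Rightarrow> 'x \<Rightarrow> 'v \<Rightarrow> complex"
 where "res b \<eta> \<xi> w = complex_of_real \<eta> / (complex_of_real \<eta> + freq b \<xi> w)"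

lemma res_nz: "\<eta> > 0 \<Longrightarrow> complex_of_real \<eta> + freq b \<xi> w \<noteq> 0"
 by (auto simp: freq_def complex_eq_iff)

lemma norm_res: "\<eta> > 0 \<Longrightarrow> (norm (res b \<eta> \<xi> w))\<^sup>2 = \<eta>\<^sup>2 / (\<eta>\<^sup>2 + (\<xi> \<bullet> b w)\<^sup>2)"
 by (simp add: res_def freq_def norm_divide power_divide cmod_power2)

lemma norm_res_le: "\<eta> > 0 \<Longrightarrow> norm (res b \<eta> \<xi> w) \<le> 1"
proof -
 assume "\<eta> > 0"
 then have "(norm (res b \<eta> \<xi> w))\<^sup>2 \<le> 1\<^sup>2"
  unfolding norm_res[OF \<open>\<eta> > 0\<close>] by (simp add: divide_le_eq_1 add_pos_nonneg)
 then show ?thesis by (rule power2_le_imp_le) simp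
qed

text \<open>The band \<open>res (2 \<eta>) - res \<eta>\<close> gains a full power of \<open>D / \<eta>\<close>; this is what makes the
 Cauchy-Schwarz weight \<open>1 + D / \<eta>\<close> affordable.\<close>

lemma res_band:
 assumes "\<eta> > 0"
 shows "(1 + freq b \<xi> w / complex_of_real \<eta>) * (res b (2 * \<eta>) \<xi> w - res b \<eta> \<xi> w) = 1 - res b (2 * \<eta>) \<xi> w"
  and "res b \<eta> \<xi> w * (1 + freq b \<xi> w / complex_of_real \<eta>) = 1"
proof -
 note nz = res_nz[OF assms, of b \<xi> w] res_nz[of "2 * \<eta>" b \<xi> w]
 have e: "complex_of_real \<eta> \<noteq> 0" using assms by simp
 have n2: "complex_of_real (2 * \<eta>) + freq b \<xi> w \<noteq> 0" using assms by (intro nz) simp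
 show 2: "res b \<eta> \<xi> w * (1 + freq b \<xi> w / complex_of_real \<eta>) = 1"
 proof -
  have "1 + freq b \<xi> w / complex_of_real \<eta> = (complex_of_real \<eta> + freq b \<xi> w) / complex_of_real \<eta>"
   using e by (simp add: add_divide_distrib)
  then show ?thesis using nz(1) e unfolding res_def by simp
 qed
 have "(1 + freq b \<xi> w / complex_of_real \<eta>) * res b (2 * \<eta>) \<xi> w = 2 * (complex_of_real \<eta> + freq b \<xi> w) / (complex_of_real (2 * \<eta>) + freq b \<xi> w)"
 proof -
  have "1 + freq b \<xi> w / complex_of_real \<eta> = (complex_of_real \<eta> + freq b \<xi> w) / complex_of_real \<eta>"
   using e by (simp add: add_divide_distrib)
  then show ?thesis using e n2 unfolding res_def by simp
 qed
 moreover have "1 - res b (2 * \<eta>) \<xi> w = freq b \<xi> w / (complex_of_real (2 * \<eta>) + freq b \<xi> w)"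
  using n2 by (simp add: res_def field_simps)
 moreover have "2 * (complex_of_real \<eta> + freq b \<xi> w) / (complex_of_real (2 * \<eta>) + freq b \<xi> w) - 1 = freq b \<xi> w / (complex_of_real (2 * \<eta>) + freq b \<xi> w)"
  using n2 by (simp add: field_simps)
 ultimately show "(1 + freq b \<xi> w / complex_of_real \<eta>) * (res b (2 * \<eta>) \<xi> w - res b \<eta> \<xi> w) = 1 - res b (2 * \<eta>) \<xi> w"
  using 2 by (simp add: right_diff_distrib mult.commute)
qed

definition vavg :: "('v::euclidean_space \<Rightarrow> 'v \<Rightarrow> real) \<Rightarrow> ('v \<Rightarrow> complex) \<Rightarrow> 'v \<Rightarrow> complex"
 where "vavg c u v = (LINT w|lborel. complex_of_real (c v w) * u w)"

locale kinetic_averaging = kinetic a f m T R C La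
 for a :: "real^'n \<Rightarrow> real^'n" and f m T R C La +
 fixes Jm :: real
 assumes Jm: "Jm > 0"
  and change: "\<And>\<psi>. \<psi> \<in> borel_measurable borel \<Longrightarrow>
   (\<integral>\<^sup>+v. \<psi> (a v) \<partial>lborel) \<le> ennreal Jm * (\<integral>\<^sup>+w. \<psi> w \<partial>lborel)"
begin

definition bb :: "real^'n \<Rightarrow> real \<times> (real^'n)" where "bb v = (1, a v)"

text \<open>The clamp is inactive on the support of \<open>rho\<close>, where |v - w| < \<delta>.
  Elsewhere it keeps the quotient bounded, as \<open>weight_properties\<close> demands for all pairs
  of velocities.\<close>

definition diff_quot :: "'n \<Rightarrow> real \<Rightarrow> real^'n \<Rightarrow> real^'n \<Rightarrow> real"
 where "diff_quot i \<delta> v w = max (- La) (min La ((a v $ i - a w $ i) / \<delta>))"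

text \<open>The factor 1 gives it the shape \<open>rho\<close> times h that it shares with
  \<open>wt\<close>, so one energy estimate serves both.\<close>

definition wt0 :: "real \<Rightarrow> real^'n \<Rightarrow> real^'n \<Rightarrow> real" where "wt0 \<delta> v w = rho \<delta> v w * 1"
definition wt :: "'n \<Rightarrow> real \<Rightarrow> real^'n \<Rightarrow> real^'n \<Rightarrow> real" where "wt i \<delta> v w = rho \<delta> v w * diff_quot i \<delta> v w"

lemma bb_measurable [measurable]: "bb \<in> borel_measurable borel"
 unfolding bb_def[abs_def] by (intro borel_measurable_continuous_onI continuous_intros a_continuous)

lemma a_component_measurable [measurable]: "(\<lambda>v. a v $ i) \<in> borel_measurable borel"
 by (intro borel_measurable_continuous_onI continuous_on_component a_continuous)

lemma diff_quot_measurable [measurable (raw)]: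
 assumes [measurable]: "p \<in> borel_measurable M" "q \<in> borel_measurable M"
 shows "(\<lambda>z. diff_quot i \<delta> (p z) (q z)) \<in> borel_measurable M"
 unfolding diff_quot_def
 using measurable_compose[OF assms(1) a_component_measurable[of i]] measurable_compose[OF assms(2) a_component_measurable[of i]]
 by simp

lemma a_component_lip: "\<bar>a v $ i - a w $ i\<bar> \<le> La * norm (v - w)"
 using component_le_norm_cart[of "a v - a w" i] a_lip[of v w] by simp

lemma diff_quot_bound: "\<bar>diff_quot i \<delta> v w\<bar> \<le> La"
 using La by (auto simp: diff_quot_def)

lemma diff_quot_lip: "\<delta> > 0 \<Longrightarrow> \<bar>diff_quot i \<delta> v w - diff_quot i \<delta> v w'\<bar> \<le> La / \<delta> * norm (w - w')"
proof -
 assume d: "\<delta> > 0"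
 have "\<bar>diff_quot i \<delta> v w - diff_quot i \<delta> v w'\<bar> \<le> \<bar>(a v $ i - a w $ i) / \<delta> - (a v $ i - a w' $ i) / \<delta>\<bar>"
  by (auto simp: diff_quot_def)
 also have "\<dots> = \<bar>a w $ i - a w' $ i\<bar> / \<delta>" using d by (simp add: diff_divide_distrib[symmetric] abs_minus_commute)
 also have "\<dots> \<le> La * norm (w - w') / \<delta>" using d by (intro divide_right_mono a_component_lip) auto
 finally show ?thesis by simp
qed

lemma wt_eq: "\<delta> > 0 \<Longrightarrow> \<delta> * wt i \<delta> v w = rho \<delta> v w * (a v $ i - a w $ i)"
proof (cases "\<delta> \<le> norm (v - w)")
 case True
 then show "\<delta> > 0 \<Longrightarrow> ?thesis" by (simp add: wt_def rho_eq_0)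
next
 case False
 assume d: "\<delta> > 0"
 have "\<bar>a v $ i - a w $ i\<bar> \<le> La * \<delta>"
  using a_component_lip[of v i w] mult_left_mono[of "norm (v - w)" \<delta> La] False La by simp
 then have "\<bar>(a v $ i - a w $ i) / \<delta>\<bar> \<le> La" using d by (simp add: pos_divide_le_eq)
 then have "diff_quot i \<delta> v w = (a v $ i - a w $ i) / \<delta>" unfolding diff_quot_def by linarith
 then show ?thesis using d by (simp add: wt_def)
qed

text \<open>A common bound for h = 1 and for the difference quotients.\<close>

definition Hc :: real where "Hc = 1 + La"

lemma diff_quot_weight:
 assumes "\<delta> > 0"
 shows "case_prod (diff_quot i \<delta>) \<in> borel_measurable (borel \<Otimes>\<^sub>M borel)" "\<bar>diff_quot i \<delta> v w\<bar> \<le> Hc"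
  "\<bar>diff_quot i \<delta> v w - diff_quot i \<delta> v w'\<bar> \<le> Hc / \<delta> * norm (w - w')"
proof -
 show "case_prod (diff_quot i \<delta>) \<in> borel_measurable (borel \<Otimes>\<^sub>M borel)"
  using diff_quot_measurable[of fst "borel \<Otimes>\<^sub>M borel" snd i \<delta>] by (simp add: case_prod_beta')
 show "\<bar>diff_quot i \<delta> v w\<bar> \<le> Hc" using diff_quot_bound[of i \<delta> v w] by (simp add: Hc_def)
 have "La / \<delta> * norm (w - w') \<le> Hc / \<delta> * norm (w - w')"
  using assms by (intro mult_right_mono divide_right_mono) (auto simp: Hc_def)
 then show "\<bar>diff_quot i \<delta> v w - diff_quot i \<delta> v w'\<bar> \<le> Hc / \<delta> * norm (w - w')"
  using diff_quot_lip[OF assms, of i v w w'] by linarith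
qed

lemma one_weight:
 assumes "\<delta> > 0"
 shows "case_prod (\<lambda>v w::real^'n. 1::real) \<in> borel_measurable (borel \<Otimes>\<^sub>M borel)" "\<bar>1::real\<bar> \<le> Hc"
  "\<bar>1 - 1 :: real\<bar> \<le> Hc / \<delta> * norm (w - w' :: real^'n)"
 using La assms by (auto simp: Hc_def)

definition slab :: real
 where "slab = Jm * (measure lborel (cball (0::real^'n) (2 * (velocity_bound + 1))) / (velocity_bound + 1) * pi)"

lemma slab_pos: "slab > 0"
proof -
 have "velocity_bound + 1 > 0" using velocity_bound(2) by linarith
 then show ?thesis unfolding slab_def using Jm measure_cball[of "2 * (velocity_bound + 1)" "0::real^'n"] by simp
qed

lemma res_measurable [measurable]: "res bb \<eta> \<xi> \<in> borel_measurable borel"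
 unfolding res_def[abs_def] freq_def by measurable

text \<open>The squared modulus of \<open>res\<close> is exactly the Lorentz profile in \<tau> +
  \<xi> . a(v). The change of variables replaces a(v) by a free variable in a fixed ball at the
  price of \<open>Jm\<close>.\<close>

lemma slab_bound:
 assumes "snd \<xi> \<noteq> 0" "\<eta> > 0"
 shows "(\<integral>\<^sup>+v. ennreal ((norm (indicator (cball 0 (R + 1)) v * res bb \<eta> \<xi> v))\<^sup>2) \<partial>lborel) \<le> ennreal (slab * \<eta> / norm (snd \<xi>))"
proof -
 let ?A = "velocity_bound + 1"
 have A: "?A > 0" using velocity_bound(2) by linarith
 let ?\<psi> = "\<lambda>w. indicator (cball 0 ?A) w * ennreal (\<eta>\<^sup>2 / (\<eta>\<^sup>2 + (fst \<xi> + snd \<xi> \<bullet> w)\<^sup>2))"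
 have "(\<integral>\<^sup>+v. ennreal ((norm (indicator (cball 0 (R + 1)) v * res bb \<eta> \<xi> v))\<^sup>2) \<partial>lborel) \<le> (\<integral>\<^sup>+v. ?\<psi> (a v) \<partial>lborel)"
 proof (intro nn_integral_mono)
  fix v
  show "ennreal ((norm (indicator (cball 0 (R + 1)) v * res bb \<eta> \<xi> v))\<^sup>2) \<le> ?\<psi> (a v)"
  proof (cases "norm v \<le> R + 1")
   case True
   have "\<xi> \<bullet> bb v = fst \<xi> + snd \<xi> \<bullet> a v" by (simp add: bb_def inner_prod_def)
   moreover have "norm (a v) \<le> ?A" using velocity_bound(1)[OF True] by simp
   ultimately show ?thesis using True norm_res[OF assms(2), of bb \<xi> v] by simp
  qed simp
 qed
 also have "\<dots> \<le> ennreal Jm * (\<integral>\<^sup>+w. ?\<psi> w \<partial>lborel)"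
 proof (rule change)
  have [measurable]: "cball (0::real^'n) ?A \<in> sets borel" by simp
  show "?\<psi> \<in> borel_measurable borel" by measurable
 qed
 also have "\<dots> \<le> ennreal Jm * ennreal (measure lborel (cball (0::real^'n) (2 * ?A)) / ?A * pi * \<eta> / norm (snd \<xi>))"
  by (intro mult_left_mono slab_estimate assms A) auto
 also have "\<dots> = ennreal (slab * \<eta> / norm (snd \<xi>))"
  using Jm A assms by (simp add: slab_def mult.assoc flip: ennreal_mult)
 finally show ?thesis .
qed

text \<open>The squared L^2 norm in velocity of a damped average. Integrated over frequencies with
  the weight \<open>kh\<close>^2, it is what testing the equation controls.\<close>

definition NN :: "(real^'n \<Rightarrow> real^'n \<Rightarrow> real) \<Rightarrow> real \<Rightarrow> real \<times> (real^'n) \<Rightarrow> (real^'n \<Rightarrow> complex) \<Rightarrow> ennreal"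
 where "NN c \<eta> \<xi> u = (\<integral>\<^sup>+v. ennreal ((norm (vavg c (\<lambda>w. (1 - res bb \<eta> \<xi> w) * u w) v))\<^sup>2) \<partial>lborel)"

text \<open>Splitting off the first term costs 2; the sum over the components costs 2 times
  CARD('n), times 32 from the coefficient 4 and from (x + y)^2 \<le> 2 (x^2 + y^2).\<close>

definition band_const :: real where "band_const = 64 * real CARD('n) + 2"

context
 fixes u :: "real^'n \<Rightarrow> complex"
 assumes u: "integrable lborel u" and u_supp: "\<And>w. R < norm w \<Longrightarrow> u w = 0"
begin

lemma u_meas [measurable]: "u \<in> borel_measurable borel" using u by auto

lemma res_u_integrable: "\<eta> > 0 \<Longrightarrow> integrable lborel (\<lambda>w. res bb \<eta> \<xi> w * u w)"
 by (rule Bochner_Integration.integrable_bound[OF u])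
  (auto simp: norm_mult intro!: AE_I2 mult_left_le_one_le norm_res_le)

lemma damped_integrable: "\<eta> > 0 \<Longrightarrow> integrable lborel (\<lambda>w. (1 - res bb \<eta> \<xi> w) * u w)"
 using u res_u_integrable by (simp add: left_diff_distrib)

lemma weighted_integrable:
 assumes q: "integrable lborel q" and d: "\<delta> > 0" and hm: "case_prod h \<in> borel_measurable (borel \<Otimes>\<^sub>M borel)" and h: "\<And>v w. \<bar>h v w\<bar> \<le> Hc"
  and hl: "\<And>v w w'. \<bar>h v w - h v w'\<bar> \<le> Hc / \<delta> * norm (w - w')"
 shows "integrable lborel (\<lambda>w::real^'n. complex_of_real (rho \<delta> v w * h v w) * q w)"
proof -
 note w = weight_properties[OF d hm h hl]
 have [measurable]: "q \<in> borel_measurable borel" using q by auto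
 have [measurable]: "(\<lambda>w. rho \<delta> v w * h v w) \<in> borel_measurable borel" using w(3)[of v] by auto
 show ?thesis
 proof (rule Bochner_Integration.integrable_bound)
  show "integrable lborel (\<lambda>w. Hc / tent_mass TYPE(real^'n) \<delta> * norm (q w))" using q by simp
  show "AE w in lborel. norm (complex_of_real (rho \<delta> v w * h v w) * q w) \<le> norm (Hc / tent_mass TYPE(real^'n) \<delta> * norm (q w))"
  proof (rule AE_I2)
   fix w
   have "norm (complex_of_real (rho \<delta> v w * h v w) * q w) \<le> Hc / tent_mass TYPE(real^'n) \<delta> * norm (q w)"
    unfolding norm_mult[of "complex_of_real _"] norm_of_real by (intro mult_right_mono w(2)) simp
   also have "\<dots> \<le> norm (Hc / tent_mass TYPE(real^'n) \<delta> * norm (q w))" by (simp only: real_norm_def abs_ge_self)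
   finally show "norm (complex_of_real (rho \<delta> v w * h v w) * q w) \<le> norm (Hc / tent_mass TYPE(real^'n) \<delta> * norm (q w))" .
  qed
 qed measurable
qed

lemma wt0_integrable: "integrable lborel q \<Longrightarrow> \<delta> > 0 \<Longrightarrow> integrable lborel (\<lambda>w::real^'n. complex_of_real (wt0 \<delta> v w) * q w)"
 unfolding wt0_def by (rule weighted_integrable[OF _ _ one_weight])

lemma wt_integrable: "integrable lborel q \<Longrightarrow> \<delta> > 0 \<Longrightarrow> integrable lborel (\<lambda>w::real^'n. complex_of_real (wt i \<delta> v w) * q w)"
 unfolding wt_def by (rule weighted_integrable[OF _ _ diff_quot_weight])

text \<open>The weight has mass 1 in v, so averaging over velocity balls can be inserted into a
  velocity integral at no cost.\<close>

lemma vavg_wt0_integral: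
 assumes q: "integrable lborel q" and d: "\<delta> > 0"
 shows "(LINT v|lborel. vavg (wt0 \<delta>) q v) = (LINT w|lborel. q w)"
proof -
 have [measurable]: "q \<in> borel_measurable borel" using q by auto
 have [measurable]: "(\<lambda>p. wt0 \<delta> (snd p) (fst p)) \<in> borel_measurable (borel \<Otimes>\<^sub>M borel)" unfolding wt0_def by measurable
 have i: "integrable (lborel \<Otimes>\<^sub>M lborel) (\<lambda>(w, v). complex_of_real (wt0 \<delta> v w) * q w)"
 proof (rule lborel_pair.Fubini_integrable)
  have "(LINT v|lborel. norm (complex_of_real (wt0 \<delta> v w) * q w)) = norm (q w)" for w
   using rho_integral(4)[OF d, of w] by (simp add: norm_mult wt0_def abs_of_nonneg[OF rho_nonneg[OF d]])
  then show "integrable lborel (\<lambda>w. LINT v|lborel. norm (case (w, v) of (w, v) \<Rightarrow> complex_of_real (wt0 \<delta> v w) * q w))" using q by simp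
  show "AE w in lborel. integrable lborel (\<lambda>v. case (w, v) of (w, v) \<Rightarrow> complex_of_real (wt0 \<delta> v w) * q w)"
   using rho_integral(2)[OF d] by (auto simp: wt0_def intro!: AE_I2 integrable_mult_left integrable_of_real)
 qed measurable
 have "(LINT v|lborel. vavg (wt0 \<delta>) q v) = (LINT w|lborel. (LINT v|lborel. complex_of_real (wt0 \<delta> v w) * q w))"
  unfolding vavg_def using lborel_pair.Fubini_integral[OF i] by simp
 also have "\<dots> = (LINT w|lborel. q w)"
  by (simp add: wt0_def rho_integral(4)[OF d])
 finally show ?thesis .
qed

lemma vavg_supp:
 assumes "0 < \<delta>" "\<delta> \<le> 1" "R + 1 < norm v" "\<And>w. R < norm w \<Longrightarrow> q w = 0"
 shows "vavg (wt0 \<delta>) q v = 0"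
proof -
 have z: "complex_of_real (wt0 \<delta> v w) * q w = 0" for w
 proof (cases "R < norm w")
  case False
  then have "\<delta> \<le> norm (v - w)" using assms(2,3) norm_triangle_sub[of v w] by linarith
  then show ?thesis using assms(1) by (simp add: wt0_def rho_eq_0)
 qed (simp add: assms)
 show ?thesis unfolding vavg_def z by simp
qed

lemma vavg_measurable [measurable]:
 assumes [measurable]: "q \<in> borel_measurable borel"
 shows "vavg (wt0 \<delta>) q \<in> borel_measurable borel" "vavg (wt i \<delta>) q \<in> borel_measurable borel"
 unfolding vavg_def[abs_def] wt0_def wt_def by measurable

lemma low_part:
 assumes "snd \<xi> \<noteq> 0" "\<eta> > 0"
 shows "ennreal ((norm (LINT w|lborel. res bb \<eta> \<xi> w * u w))\<^sup>2) \<le> ennreal (slab * \<eta> / norm (snd \<xi>)) * (\<integral>\<^sup>+w. ennreal ((norm (u w))\<^sup>2) \<partial>lborel)"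
proof -
 have eq: "(LINT w|lborel. res bb \<eta> \<xi> w * u w) = (LINT w|lborel. (indicator (cball 0 (R + 1)) w * res bb \<eta> \<xi> w) * u w)"
  by (intro Bochner_Integration.integral_cong refl) (use u_supp in \<open>force simp: indicator_def\<close>)
 have pos: "slab * \<eta> / norm (snd \<xi>) > 0" using slab_pos assms by simp
 have [measurable]: "cball (0::real^'n) (R + 1) \<in> sets borel" by simp
 show ?thesis unfolding eq
  by (rule cauchy_schwarz_le[OF _ _ pos slab_bound[OF assms]]) measurable
qed

text \<open>Above the top level the volume of the velocity ball takes the place of the slab
  estimate.\<close>

lemma high_part:
 assumes "0 < \<delta>" "\<delta> \<le> 1" "\<eta> > 0"
 shows "ennreal ((norm (LINT w|lborel. (1 - res bb \<eta> \<xi> w) * u w))\<^sup>2) \<le> ennreal (measure lborel (cball (0::real^'n) (R + 1))) * NN (wt0 \<delta>) \<eta> \<xi> u"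
proof -
 let ?q = "\<lambda>w. (1 - res bb \<eta> \<xi> w) * u w"
 have mq [measurable]: "?q \<in> borel_measurable borel" by measurable
 have [measurable]: "cball (0::real^'n) (R + 1) \<in> sets borel" by simp
 have pos: "measure lborel (cball (0::real^'n) (R + 1)) > 0"
  using R measure_cball[of "R + 1" "0::real^'n"] by simp
 have "(LINT w|lborel. ?q w) = (LINT v|lborel. vavg (wt0 \<delta>) ?q v)"
  using vavg_wt0_integral[OF damped_integrable assms(1)] assms by simp
 also have "\<dots> = (LINT v|lborel. indicator (cball 0 (R + 1)) v * vavg (wt0 \<delta>) ?q v)"
  by (intro Bochner_Integration.integral_cong refl)
   (use vavg_supp[OF assms(1,2)] u_supp in \<open>auto simp: indicator_def not_le\<close>)
 finally have eq: "(LINT w|lborel. ?q w) = (LINT v|lborel. indicator (cball 0 (R + 1)) v * vavg (wt0 \<delta>) ?q v)" .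
 have "(\<integral>\<^sup>+v. ennreal ((norm (indicator (cball (0::real^'n) (R + 1)) v :: complex))\<^sup>2) \<partial>lborel) = (\<integral>\<^sup>+v. indicator (cball (0::real^'n) (R + 1)) v \<partial>lborel)"
  by (intro nn_integral_cong) (auto simp: indicator_def)
 also have "\<dots> = ennreal (measure lborel (cball (0::real^'n) (R + 1)))"
  using emeasure_bounded_finite[of "cball (0::real^'n) (R+1)"] by (simp add: emeasure_eq_ennreal_measure)
 finally have p: "(\<integral>\<^sup>+v. ennreal ((norm (indicator (cball (0::real^'n) (R + 1)) v :: complex))\<^sup>2) \<partial>lborel) \<le> ennreal (measure lborel (cball (0::real^'n) (R + 1)))" by simp
 show ?thesis unfolding eq NN_def
  by (rule cauchy_schwarz_le[OF _ _ pos p]) measurable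
qed

text \<open>The averaged band F is written as \<open>res\<close> times G, where G = (1 +
  D(v)/\<eta>) F has the symbol outside the average. Cauchy-Schwarz puts the slab estimate, hence
  the gain \<delta>, on \<open>res\<close>. In G the symbol is moved inside: D(w) combines with the
  band into the damping at level 2 \<eta> by \<open>res_band\<close>, and D(v) - D(w) splits into
  averages with the weights \<open>wt i\<close>.\<close>

lemma middle_part:
 assumes d: "0 < \<delta>" "\<delta> \<le> 1" and N: "N \<ge> 1" "N \<le> norm (snd \<xi>)" "norm (snd \<xi>) \<le> 4 * N"
 defines "\<eta> \<equiv> \<delta> * N"
 shows "ennreal ((norm (LINT w|lborel. (res bb (2 * \<eta>) \<xi> w - res bb \<eta> \<xi> w) * u w))\<^sup>2) \<le>
  ennreal (slab * \<delta> * band_const) * (NN (wt0 \<delta>) (2 * \<eta>) \<xi> u + (\<Sum>i\<in>UNIV. NN (wt i \<delta>) \<eta> \<xi> u + NN (wt i \<delta>) (2 * \<eta>) \<xi> u))"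
proof -
 have \<eta>: "\<eta> > 0" and \<eta>2: "2 * \<eta> > 0" using d N by (auto simp: \<eta>_def)
 have \<xi>: "snd \<xi> \<noteq> 0" using N by auto
 let ?q = "\<lambda>w. (res bb (2 * \<eta>) \<xi> w - res bb \<eta> \<xi> w) * u w"
 let ?d = "\<lambda>\<eta> w. (1 - res bb \<eta> \<xi> w) * u w"
 let ?D = "freq bb \<xi>"
 have qd: "?q w = ?d \<eta> w - ?d (2 * \<eta>) w" for w by (simp add: algebra_simps)
 have di: "integrable lborel (?d \<eta>)" "integrable lborel (?d (2 * \<eta>))" using damped_integrable \<eta> \<eta>2 by auto
 have qi: "integrable lborel ?q" unfolding qd using di by simp
 let ?F = "vavg (wt0 \<delta>) ?q"
 let ?G = "\<lambda>v. (1 + ?D v / complex_of_real \<eta>) * ?F v"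
 have mq [measurable]: "?q \<in> borel_measurable borel" by measurable
 have [measurable]: "cball (0::real^'n) (R + 1) \<in> sets borel" by simp
 have [measurable]: "?D \<in> borel_measurable borel" unfolding freq_def by measurable
 \<comment> \<open>At the velocity v outside the average, \<open>res\<close> and 1 + D/\<eta> are
   inverse to each other.\<close>
 have GF: "res bb \<eta> \<xi> v * ?G v = ?F v" for v
  using res_band(2)[OF \<eta>, of bb \<xi> v] by (simp flip: mult.assoc)
 have "(LINT w|lborel. ?q w) = (LINT v|lborel. ?F v)"
  using vavg_wt0_integral[OF qi d(1)] by simp
 also have "\<dots> = (LINT v|lborel. (indicator (cball 0 (R + 1)) v * res bb \<eta> \<xi> v) * ?G v)"
 proof (intro Bochner_Integration.integral_cong refl)
  fix v
  show "?F v = (indicator (cball 0 (R + 1)) v * res bb \<eta> \<xi> v) * ?G v"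
   using GF[of v] vavg_supp[OF d, of v ?q] u_supp by (cases "norm v \<le> R + 1") (auto simp: mult.assoc)
 qed
 finally have eq: "(LINT w|lborel. ?q w) = (LINT v|lborel. (indicator (cball 0 (R + 1)) v * res bb \<eta> \<xi> v) * ?G v)" .
 have sb: "(\<integral>\<^sup>+v. ennreal ((norm (indicator (cball 0 (R + 1)) v * res bb \<eta> \<xi> v))\<^sup>2) \<partial>lborel) \<le> ennreal (slab * \<delta>)"
 proof (rule order_trans[OF slab_bound[OF \<xi> \<eta>]], rule ennreal_leI)
  have "slab * \<eta> / norm (snd \<xi>) \<le> slab * \<eta> / N"
   using N slab_pos \<eta> by (intro divide_left_mono mult_pos_pos) auto
  then show "slab * \<eta> / norm (snd \<xi>) \<le> slab * \<delta>" using N by (simp add: \<eta>_def)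
 qed
 let ?A = "vavg (wt0 \<delta>) (?d (2 * \<eta>))"
 let ?H = "\<lambda>i \<eta>. vavg (wt i \<delta>) (?d \<eta>)"
 have G_eq: "?G v = ?A v + (\<Sum>i\<in>UNIV. (\<i> * complex_of_real (snd \<xi> $ i * \<delta> / \<eta>)) * (?H i \<eta> v - ?H i (2 * \<eta>) v))" for v
 proof -
  have Dd: "?D v - ?D w = (\<Sum>i\<in>UNIV. \<i> * complex_of_real (snd \<xi> $ i * (a v $ i - a w $ i)))" for w
  proof -
   have "\<xi> \<bullet> bb v - \<xi> \<bullet> bb w = (\<Sum>i\<in>UNIV. snd \<xi> $ i * (a v $ i - a w $ i))"
    by (simp add: bb_def inner_prod_def inner_vec_def right_diff_distrib sum_subtractf)
   then have "complex_of_real (\<xi> \<bullet> bb v) - complex_of_real (\<xi> \<bullet> bb w) = (\<Sum>i\<in>UNIV. complex_of_real (snd \<xi> $ i * (a v $ i - a w $ i)))"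
    by (simp only: of_real_diff[symmetric] of_real_sum[symmetric])
   then show ?thesis unfolding freq_def right_diff_distrib[symmetric] by (simp only: sum_distrib_left)
  qed
  \<comment> \<open>The symbol at v is replaced by the symbol at w plus the difference, whose i-th
    part is \<xi>_i (a_i(v) - a_i(w)); \<open>wt_eq\<close> absorbs the latter into \<delta> times
    \<open>wt i\<close>.\<close>
  have ptw: "(1 + ?D v / complex_of_real \<eta>) * (complex_of_real (wt0 \<delta> v w) * ?q w) =
    complex_of_real (wt0 \<delta> v w) * ?d (2 * \<eta>) w +
    (\<Sum>i\<in>UNIV. (\<i> * complex_of_real (snd \<xi> $ i * \<delta> / \<eta>)) * (complex_of_real (wt i \<delta> v w) * ?d \<eta> w - complex_of_real (wt i \<delta> v w) * ?d (2 * \<eta>) w))" for w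
  proof -
   have "(1 + ?D v / complex_of_real \<eta>) * (complex_of_real (wt0 \<delta> v w) * ?q w) =
    complex_of_real (wt0 \<delta> v w) * (((1 + ?D w / complex_of_real \<eta>) * (res bb (2 * \<eta>) \<xi> w - res bb \<eta> \<xi> w)) * u w)
    + complex_of_real (wt0 \<delta> v w) * ((?D v - ?D w) / complex_of_real \<eta>) * ?q w"
    by (simp add: algebra_simps diff_divide_distrib)
   also have "((1 + ?D w / complex_of_real \<eta>) * (res bb (2 * \<eta>) \<xi> w - res bb \<eta> \<xi> w)) * u w = ?d (2 * \<eta>) w"
    unfolding res_band(1)[OF \<eta>] ..
   also have "complex_of_real (wt0 \<delta> v w) * ((?D v - ?D w) / complex_of_real \<eta>) * ?q w =
    (\<Sum>i\<in>UNIV. (\<i> * complex_of_real (snd \<xi> $ i * \<delta> / \<eta>)) * (complex_of_real (wt i \<delta> v w) * ?q w))"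
    unfolding Dd sum_divide_distrib sum_distrib_left sum_distrib_right
   proof (intro sum.cong refl)
    fix i
    have "complex_of_real (wt0 \<delta> v w * (snd \<xi> $ i * (a v $ i - a w $ i))) = complex_of_real (snd \<xi> $ i * (\<delta> * wt i \<delta> v w))"
     unfolding wt_eq[OF d(1)] by (simp add: wt0_def)
    then have "complex_of_real (wt0 \<delta> v w) * complex_of_real (snd \<xi> $ i * (a v $ i - a w $ i)) = complex_of_real (snd \<xi> $ i * \<delta>) * complex_of_real (wt i \<delta> v w)"
     by (simp add: mult.assoc)
    then show "complex_of_real (wt0 \<delta> v w) * (\<i> * complex_of_real (snd \<xi> $ i * (a v $ i - a w $ i)) / complex_of_real \<eta>) * ?q w =
      \<i> * complex_of_real (snd \<xi> $ i * \<delta> / \<eta>) * (complex_of_real (wt i \<delta> v w) * ?q w)"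
     unfolding of_real_divide by (simp only: times_divide_eq_right times_divide_eq_left mult.left_commute mult.assoc)
   qed
   finally show ?thesis by (simp only: qd right_diff_distrib)
  qed
  have i0: "integrable lborel (\<lambda>w. complex_of_real (wt0 \<delta> v w) * ?d (2 * \<eta>) w)" by (intro wt0_integrable di d)
  have i1: "integrable lborel (\<lambda>w. complex_of_real (wt i \<delta> v w) * ?d \<eta> w)" "integrable lborel (\<lambda>w. complex_of_real (wt i \<delta> v w) * ?d (2 * \<eta>) w)" for i
   by (intro wt_integrable di d)+
  have "?G v = (LINT w|lborel. (1 + ?D v / complex_of_real \<eta>) * (complex_of_real (wt0 \<delta> v w) * ?q w))"
   unfolding vavg_def integral_mult_right_zero ..
  also have "\<dots> = (LINT w|lborel. complex_of_real (wt0 \<delta> v w) * ?d (2 * \<eta>) w) +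
    (LINT w|lborel. (\<Sum>i\<in>UNIV. (\<i> * complex_of_real (snd \<xi> $ i * \<delta> / \<eta>)) * (complex_of_real (wt i \<delta> v w) * ?d \<eta> w - complex_of_real (wt i \<delta> v w) * ?d (2 * \<eta>) w)))"
   unfolding ptw
   by (rule Bochner_Integration.integral_add[OF i0]) (intro Bochner_Integration.integrable_sum integrable_mult_right Bochner_Integration.integrable_diff i1)
  also have "(LINT w|lborel. (\<Sum>i\<in>UNIV. (\<i> * complex_of_real (snd \<xi> $ i * \<delta> / \<eta>)) * (complex_of_real (wt i \<delta> v w) * ?d \<eta> w - complex_of_real (wt i \<delta> v w) * ?d (2 * \<eta>) w))) =
    (\<Sum>i\<in>UNIV. (LINT w|lborel. (\<i> * complex_of_real (snd \<xi> $ i * \<delta> / \<eta>)) * (complex_of_real (wt i \<delta> v w) * ?d \<eta> w - complex_of_real (wt i \<delta> v w) * ?d (2 * \<eta>) w)))"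
   by (rule Bochner_Integration.integral_sum) (intro integrable_mult_right Bochner_Integration.integrable_diff i1)
  also have "\<dots> = (\<Sum>i\<in>UNIV. (\<i> * complex_of_real (snd \<xi> $ i * \<delta> / \<eta>)) * (?H i \<eta> v - ?H i (2 * \<eta>) v))"
   unfolding integral_mult_right_zero vavg_def Bochner_Integration.integral_diff[OF i1] ..
  finally show ?thesis unfolding vavg_def .
 qed
 have G_le: "(norm (?G v))\<^sup>2 \<le> band_const * ((norm (?A v))\<^sup>2 + (\<Sum>i\<in>UNIV. (norm (?H i \<eta> v))\<^sup>2 + (norm (?H i (2 * \<eta>) v))\<^sup>2))" for v
 proof -
  let ?x = "\<lambda>i. norm (?H i \<eta> v)" and ?y = "\<lambda>i. norm (?H i (2 * \<eta>) v)"
  let ?S = "\<Sum>i\<in>UNIV. (?x i)\<^sup>2 + (?y i)\<^sup>2"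
  have "norm (?G v) \<le> norm (?A v) + (\<Sum>i\<in>UNIV. 4 * (?x i + ?y i))"
  proof -
   have "norm ((\<i> * complex_of_real (snd \<xi> $ i * \<delta> / \<eta>)) * (?H i \<eta> v - ?H i (2 * \<eta>) v)) \<le> 4 * (?x i + ?y i)" for i
   proof -
    \<comment> \<open>As \<eta> = \<delta> N, the coefficient is \<xi>_i / N, at most 4 on the
      shell.\<close>
    have "\<bar>snd \<xi> $ i * \<delta> / \<eta>\<bar> = \<bar>snd \<xi> $ i\<bar> / N" using d N by (simp add: \<eta>_def abs_mult)
    also have "\<dots> \<le> 4" using component_le_norm_cart[of "snd \<xi>" i] N by (simp add: divide_le_eq)
    finally have "\<bar>snd \<xi> $ i * \<delta> / \<eta>\<bar> \<le> 4" .
    then have "\<bar>snd \<xi> $ i * \<delta> / \<eta>\<bar> * norm (?H i \<eta> v - ?H i (2 * \<eta>) v) \<le> 4 * (?x i + ?y i)"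
     by (intro mult_mono norm_triangle_ineq4) auto
    then show ?thesis by (simp only: norm_mult norm_ii norm_of_real mult_1)
   qed
   then show ?thesis unfolding G_eq
    by (intro order_trans[OF norm_triangle_ineq] add_left_mono order_trans[OF norm_sum] sum_mono)
  qed
  then have "(norm (?G v))\<^sup>2 \<le> (norm (?A v) + (\<Sum>i\<in>UNIV. 4 * (?x i + ?y i)))\<^sup>2" by (intro power_mono) auto
  also have "\<dots> \<le> 2 * (norm (?A v))\<^sup>2 + 2 * (\<Sum>i\<in>UNIV. 4 * (?x i + ?y i))\<^sup>2"
   using sum_squares_bound[of "norm (?A v)" "\<Sum>i\<in>UNIV. 4 * (?x i + ?y i)"] by (simp add: power2_sum)
  also have "(\<Sum>i\<in>UNIV. 4 * (?x i + ?y i))\<^sup>2 \<le> real CARD('n) * (\<Sum>i\<in>UNIV. (4 * (?x i + ?y i))\<^sup>2)"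
   using sum_squared_le_sum_of_squares[of "\<lambda>i. 4 * (?x i + ?y i)" "UNIV :: 'n set"] by (simp add: mult.commute)
  also have "(\<Sum>i\<in>UNIV. (4 * (?x i + ?y i))\<^sup>2) \<le> (\<Sum>i\<in>UNIV. 32 * ((?x i)\<^sup>2 + (?y i)\<^sup>2))"
  proof (intro sum_mono)
   fix i
   show "(4 * (?x i + ?y i))\<^sup>2 \<le> 32 * ((?x i)\<^sup>2 + (?y i)\<^sup>2)"
    using sum_squares_bound[of "?x i" "?y i"] by (simp add: power_mult_distrib power2_sum)
  qed
  also have "\<dots> = 32 * ?S" by (simp add: sum_distrib_left)
  finally have "(norm (?G v))\<^sup>2 \<le> 2 * (norm (?A v))\<^sup>2 + 2 * (real CARD('n) * (32 * ?S))"
   by (simp add: mult_left_mono)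
  also have "\<dots> \<le> band_const * ((norm (?A v))\<^sup>2 + ?S)"
  proof -
   have "0 \<le> ?S" by (intro sum_nonneg) simp
   then have "0 \<le> 64 * real CARD('n) * (norm (?A v))\<^sup>2 + 2 * ?S" by simp
   then show ?thesis by (simp add: band_const_def algebra_simps)
  qed
  finally show ?thesis .
 qed
 have bc: "band_const \<ge> 0" by (simp add: band_const_def)
 have mH: "?A \<in> borel_measurable borel" "?H i \<eta> \<in> borel_measurable borel" "?H i (2 * \<eta>) \<in> borel_measurable borel" for i
  by (intro vavg_measurable; measurable)+
 have "ennreal ((norm (LINT w|lborel. ?q w))\<^sup>2) \<le> ennreal (slab * \<delta>) * (\<integral>\<^sup>+v. ennreal ((norm (?G v))\<^sup>2) \<partial>lborel)"
  unfolding eq by (rule cauchy_schwarz_le[OF _ _ _ sb]) (use slab_pos d in \<open>auto intro!: mult_pos_pos\<close>)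
 also have "(\<integral>\<^sup>+v. ennreal ((norm (?G v))\<^sup>2) \<partial>lborel) \<le>
   (\<integral>\<^sup>+v. ennreal band_const * (ennreal ((norm (?A v))\<^sup>2) + (\<Sum>i\<in>UNIV. ennreal ((norm (?H i \<eta> v))\<^sup>2) + ennreal ((norm (?H i (2 * \<eta>) v))\<^sup>2))) \<partial>lborel)"
 proof (rule nn_integral_mono)
  fix v
  have "ennreal band_const * (ennreal ((norm (?A v))\<^sup>2) + (\<Sum>i\<in>UNIV. ennreal ((norm (?H i \<eta> v))\<^sup>2) + ennreal ((norm (?H i (2 * \<eta>) v))\<^sup>2))) =
   ennreal (band_const * ((norm (?A v))\<^sup>2 + (\<Sum>i\<in>UNIV. (norm (?H i \<eta> v))\<^sup>2 + (norm (?H i (2 * \<eta>) v))\<^sup>2)))"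
   using bc by (subst ennreal_mult) (auto simp: sum_nonneg ennreal_plus simp flip: sum_ennreal)
  then show "ennreal ((norm (?G v))\<^sup>2) \<le> ennreal band_const * (ennreal ((norm (?A v))\<^sup>2) + (\<Sum>i\<in>UNIV. ennreal ((norm (?H i \<eta> v))\<^sup>2) + ennreal ((norm (?H i (2 * \<eta>) v))\<^sup>2)))"
   using ennreal_leI[OF G_le[of v]] by simp
 qed
 also have "\<dots> = ennreal band_const * (NN (wt0 \<delta>) (2 * \<eta>) \<xi> u + (\<Sum>i\<in>UNIV. NN (wt i \<delta>) \<eta> \<xi> u + NN (wt i \<delta>) (2 * \<eta>) \<xi> u))"
  unfolding NN_def using mH by (simp add: nn_integral_cmult nn_integral_add nn_integral_sum)
 finally show ?thesis
  using slab_pos d bc by (simp add: mult_left_mono ennreal_mult mult.assoc)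
qed

end

end

section \<open>Reassociation of time, space and velocity\<close>

lemma nn_integral_lborel_assoc:
 fixes h :: "'a::euclidean_space \<times> 'b::euclidean_space \<times> 'c::euclidean_space \<Rightarrow> ennreal"
 assumes h: "h \<in> borel_measurable borel"
 shows "(\<integral>\<^sup>+p. h (fst (fst p), snd (fst p), snd p) \<partial>(lborel \<Otimes>\<^sub>M lborel)) = (\<integral>\<^sup>+z. h z \<partial>lborel)"
  and "(\<integral>\<^sup>+t. (\<integral>\<^sup>+y. h (t, y) \<partial>lborel) \<partial>lborel) = (\<integral>\<^sup>+z. h z \<partial>lborel)"
proof -
 have hm [measurable (raw)]: "(\<lambda>z. h (p z, q z, r z)) \<in> borel_measurable M"
  if "p \<in> borel_measurable M" "q \<in> borel_measurable M" "r \<in> borel_measurable M" for p q r and M :: "'z measure"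
  by (rule measurable_compose[OF _ h]) (intro borel_measurable_Pair that)
 have f1: "fst \<in> borel_measurable ((lborel::'x::euclidean_space measure) \<Otimes>\<^sub>M (lborel::'y::euclidean_space measure))"
  and f2: "snd \<in> borel_measurable ((lborel::'x::euclidean_space measure) \<Otimes>\<^sub>M (lborel::'y::euclidean_space measure))"
  using measurable_fst[of "lborel::'x measure" "lborel::'y measure"] measurable_snd[of "lborel::'x measure" "lborel::'y measure"] by simp_all
 have b1: "fst \<in> borel_measurable (borel :: ('x::euclidean_space \<times> 'y::euclidean_space) measure)"
  and b2: "snd \<in> borel_measurable (borel :: ('x::euclidean_space \<times> 'y::euclidean_space) measure)"
  by (simp_all add: borel_prod[symmetric])
 have b: "(\<lambda>y. h (t, y)) \<in> borel_measurable borel" for t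
  by (rule measurable_compose[OF _ h]) simp
 have inner: "(\<integral>\<^sup>+y. h (t, y) \<partial>lborel) = (\<integral>\<^sup>+x. (\<integral>\<^sup>+v. h (t, x, v) \<partial>lborel) \<partial>lborel)" for t
  unfolding lborel_prod[symmetric]
  by (rule lborel.nn_integral_fst[symmetric]) (use b in \<open>simp add: lborel_prod\<close>)
 have "(\<integral>\<^sup>+z. h z \<partial>lborel) = (\<integral>\<^sup>+z. h z \<partial>(lborel \<Otimes>\<^sub>M lborel))" by (simp add: lborel_prod)
 also have "\<dots> = (\<integral>\<^sup>+t. (\<integral>\<^sup>+y. h (t, y) \<partial>lborel) \<partial>lborel)"
  by (rule lborel.nn_integral_fst[symmetric]) (use h in \<open>simp add: lborel_prod\<close>)
 finally show 2: "(\<integral>\<^sup>+t. (\<integral>\<^sup>+y. h (t, y) \<partial>lborel) \<partial>lborel) = (\<integral>\<^sup>+z. h z \<partial>lborel)" by simp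
 have "(\<integral>\<^sup>+p. h (fst (fst p), snd (fst p), snd p) \<partial>(lborel \<Otimes>\<^sub>M lborel)) = (\<integral>\<^sup>+X. (\<integral>\<^sup>+v. h (fst X, snd X, v) \<partial>lborel) \<partial>lborel)"
  using lborel.nn_integral_fst[of "\<lambda>p. h (fst (fst p), snd (fst p), snd p)" "lborel :: ('a \<times> 'b) measure"]
   hm[OF measurable_compose[OF f1 b1] measurable_compose[OF f1 b2] f2] by simp
 also have "\<dots> = (\<integral>\<^sup>+X. (\<integral>\<^sup>+v. h (fst X, snd X, v) \<partial>lborel) \<partial>(lborel \<Otimes>\<^sub>M lborel))" by (simp add: lborel_prod)
 also have "\<dots> = (\<integral>\<^sup>+t. (\<integral>\<^sup>+x. (\<integral>\<^sup>+v. h (t, x, v) \<partial>lborel) \<partial>lborel) \<partial>lborel)"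
 proof -
  have "(\<lambda>X. \<integral>\<^sup>+v. h (fst X, snd X, v) \<partial>lborel) \<in> borel_measurable (lborel \<Otimes>\<^sub>M lborel)"
  proof (rule lborel.borel_measurable_nn_integral)
   show "(\<lambda>(x, y). h (fst x, snd x, y)) \<in> borel_measurable ((lborel \<Otimes>\<^sub>M lborel) \<Otimes>\<^sub>M lborel)"
    using hm[OF measurable_compose[OF f1 b1] measurable_compose[OF f1 b2] f2] by (simp add: case_prod_beta' lborel_prod)
  qed
  then show ?thesis by (subst lborel.nn_integral_fst[symmetric]) simp_all
 qed
 also have "\<dots> = (\<integral>\<^sup>+z. h z \<partial>lborel)" unfolding 2[symmetric] inner ..
 finally show "(\<integral>\<^sup>+p. h (fst (fst p), snd (fst p), snd p) \<partial>(lborel \<Otimes>\<^sub>M lborel)) = (\<integral>\<^sup>+z. h z \<partial>lborel)" .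
qed

lemma assoc_measurable:
 "(\<lambda>p. (fst (fst p), snd (fst p), snd p)) \<in>
  (lborel \<Otimes>\<^sub>M lborel) \<rightarrow>\<^sub>M (borel :: ('a::euclidean_space \<times> 'b::euclidean_space \<times> 'c::euclidean_space) measure)"
proof -
 have "continuous_on UNIV (\<lambda>p :: ('a \<times> 'b) \<times> 'c. (fst (fst p), snd (fst p), snd p))" by (intro continuous_intros)
 then show ?thesis unfolding lborel_prod by (simp add: borel_measurable_continuous_onI)
qed

lemma lborel_assoc:
 "distr (lborel \<Otimes>\<^sub>M lborel) borel (\<lambda>p. (fst (fst p), snd (fst p), snd p)) =
  (lborel :: ('a::euclidean_space \<times> 'b::euclidean_space \<times> 'c::euclidean_space) measure)"
proof (rule measure_eqI)
 fix A :: "('a \<times> 'b \<times> 'c) set" assume "A \<in> sets (distr (lborel \<Otimes>\<^sub>M lborel) borel (\<lambda>p. (fst (fst p), snd (fst p), snd p)))"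
 then have A: "A \<in> sets borel" by simp
 have "emeasure (distr (lborel \<Otimes>\<^sub>M lborel) borel (\<lambda>p. (fst (fst p), snd (fst p), snd p))) A =
  (\<integral>\<^sup>+z. indicator A z \<partial>(distr (lborel \<Otimes>\<^sub>M lborel) borel (\<lambda>p. (fst (fst p), snd (fst p), snd p))))"
  using A by simp
 also have "\<dots> = (\<integral>\<^sup>+p. indicator A (fst (fst p), snd (fst p), snd p) \<partial>(lborel \<Otimes>\<^sub>M lborel))"
  by (rule nn_integral_distr[OF assoc_measurable]) (use A in simp)
 also have "\<dots> = (\<integral>\<^sup>+z. indicator A z \<partial>lborel)"
  by (rule nn_integral_lborel_assoc(1)) (use A in simp)
 finally show "emeasure (distr (lborel \<Otimes>\<^sub>M lborel) borel (\<lambda>p. (fst (fst p), snd (fst p), snd p))) A = emeasure lborel A"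
  using A by simp
qed simp

lemma measurable_pair_lborel:
 "f \<in> borel_measurable (lborel \<Otimes>\<^sub>M lborel) \<longleftrightarrow> f \<in> borel_measurable (borel \<Otimes>\<^sub>M borel)"
 unfolding measurable_cong_sets[OF sets_pair_measure_cong[OF sets_lborel sets_lborel] refl] ..

text \<open>Rate \<mu> in time and N in every space direction: the space scale 1/N is that of the
  shell, and \<mu> tends to infinity in the end.\<close>

definition lamN :: "real \<Rightarrow> real \<Rightarrow> real \<times> (real^'n) \<Rightarrow> real"
 where "lamN \<mu> N b = (if b = (1, 0) then \<mu> else N)"

definition kh :: "real \<Rightarrow> real \<Rightarrow> real \<times> (real^'n) \<Rightarrow> real"
 where "kh \<mu> N = exp_kernel.ker_hat (lamN \<mu> N)"

lemma exp_kernel_lamN: "\<mu> > 0 \<Longrightarrow> N > 0 \<Longrightarrow> exp_kernel (lamN \<mu> N :: real \<times> (real^'n) \<Rightarrow> real)"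
 by unfold_locales (simp add: lamN_def)

lemma norm_fst_snd_le: "norm (fst z, fst (snd z)) \<le> norm (z :: 'a::real_normed_vector \<times> 'b::real_normed_vector \<times> 'c::real_normed_vector)"
 by (simp add: norm_prod_def)

lemma norm_snd_snd_le: "norm (snd (snd z)) \<le> norm (z :: 'a::real_normed_vector \<times> 'b::real_normed_vector \<times> 'c::real_normed_vector)"
 by (rule order_trans[of _ "norm (snd z)"]) (simp_all add: norm_prod_def)

section \<open>The energy bound at one level\<close>

context kinetic_averaging
begin

definition gN :: "real \<Rightarrow> real \<times> (real^'n) \<Rightarrow> real^'n \<Rightarrow> real"
 where "gN \<alpha> X w = time_cutoff \<alpha> T (fst X) * f (fst X, snd X, w)"

definition gh :: "real \<Rightarrow> real \<times> (real^'n) \<Rightarrow> real^'n \<Rightarrow> complex"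
 where "gh \<alpha> \<xi> w = ft (\<lambda>X. complex_of_real (gN \<alpha> X w)) \<xi>"

definition PN :: "real \<Rightarrow> real"
 where "PN N = real DIM(real \<times> (real^'n)) * N * La"

text \<open>\<open>Lam\<close> and 12 C CP/\<eta> with c1 = \<open>Hc\<close> and c2 the slope from
  \<open>weight_properties\<close>, hence CP = 2 \<open>Hc\<close>^2. Neither \<mu> nor \<alpha>
  occurs, so both limits may be taken later.\<close>

definition KE :: real
 where "KE = (2 * pi) ^ DIM(real \<times> (real^'n)) *
  (mass * (16 * real DIM(real \<times> (real^'n)) * La * Hc\<^sup>2 + 2 * Hc\<^sup>2 * (2 ^ (DIM(real^'n) + 2) + 1)) + 24 * C * Hc\<^sup>2)"

lemma ell_bb:
 assumes "\<mu> > 0" "N > 0"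
 shows "exp_kernel.ell (lamN \<mu> N) (bb v - bb w) \<le> PN N * norm (v - w)"
proof -
 interpret exp_kernel "lamN \<mu> N :: real \<times> (real^'n) \<Rightarrow> real" by (rule exp_kernel_lamN[OF assms])
 have "ell (bb v - bb w) \<le> (\<Sum>b\<in>(Basis :: (real \<times> (real^'n)) set). N * (La * norm (v - w)))"
  unfolding ell_def
 proof (intro sum_mono)
  fix b :: "real \<times> (real^'n)" assume b: "b \<in> Basis"
  have d: "bb v - bb w = (0, a v - a w)" by (simp add: bb_def)
  show "lamN \<mu> N b * \<bar>(bb v - bb w) \<bullet> b\<bar> \<le> N * (La * norm (v - w))"
  proof (cases "b = (1, 0)")
   case True
   then show ?thesis using assms La by (simp add: d)
  next
   case False
   have "\<bar>(bb v - bb w) \<bullet> b\<bar> \<le> norm (0::real, a v - a w)" unfolding d by (rule Basis_le_norm[OF b])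
   also have "\<dots> \<le> La * norm (v - w)" using a_lip[of v w] by simp
   finally show ?thesis using False assms by (simp add: lamN_def mult_left_mono)
  qed
 qed
 then show ?thesis by (simp add: PN_def mult.assoc)
qed

lemma time_cutoff_measurable: "\<alpha> > 0 \<Longrightarrow> time_cutoff \<alpha> T \<in> borel_measurable borel"
 by (intro borel_measurable_continuous_onI continuous_time_cutoff)

lemma gN_props:
 assumes \<alpha>: "\<alpha> > 0"
 shows "case_prod (gN \<alpha>) \<in> borel_measurable (borel \<Otimes>\<^sub>M borel)"
  and "integrable (lborel \<Otimes>\<^sub>M lborel) (case_prod (gN \<alpha>))"
  and "\<bar>gN \<alpha> X w\<bar> \<le> 1" "\<bar>gN \<alpha> X w\<bar> \<le> \<bar>f (fst X, snd X, w)\<bar>" "R < norm w \<Longrightarrow> gN \<alpha> X w = 0"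
  and "(\<integral>\<^sup>+p. ennreal \<bar>case_prod (gN \<alpha>) p\<bar> \<partial>(lborel \<Otimes>\<^sub>M lborel)) \<le> ennreal (C * T)"
proof -
 let ?\<phi> = "\<lambda>p :: (real \<times> (real^'n)) \<times> (real^'n). (fst (fst p), snd (fst p), snd p)"
 have t: "\<bar>time_cutoff \<alpha> T s\<bar> \<le> 1" for s using time_cutoff_bounds[of \<alpha> T s] by simp
 show 4: "\<bar>gN \<alpha> X w\<bar> \<le> \<bar>f (fst X, snd X, w)\<bar>" for X w
  unfolding gN_def abs_mult by (rule mult_left_le_one_le) (use t in auto)
 show "\<bar>gN \<alpha> X w\<bar> \<le> 1" using 4[of X w] f_le_1[of "(fst X, snd X, w)"] by linarith
 show "R < norm w \<Longrightarrow> gN \<alpha> X w = 0" by (simp add: gN_def f_supp)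
 have fm: "f \<in> borel_measurable borel" using f_int by auto
 have e: "case_prod (gN \<alpha>) = (\<lambda>p. time_cutoff \<alpha> T (fst (fst p)) * f (?\<phi> p))" by (auto simp: gN_def)
 have m1: "(\<lambda>p. time_cutoff \<alpha> T (fst (fst p))) \<in> borel_measurable (lborel \<Otimes>\<^sub>M lborel :: ((real \<times> (real^'n)) \<times> (real^'n)) measure)"
  unfolding lborel_prod by (simp, intro borel_measurable_continuous_onI continuous_on_compose2[OF continuous_time_cutoff[OF \<alpha>, of UNIV]] continuous_intros) auto
 have m2: "(\<lambda>p. f (?\<phi> p)) \<in> borel_measurable (lborel \<Otimes>\<^sub>M lborel)"
  by (rule measurable_compose[OF assoc_measurable fm])
 have m: "case_prod (gN \<alpha>) \<in> borel_measurable (lborel \<Otimes>\<^sub>M lborel)"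
  unfolding e by (rule borel_measurable_times[OF m1 m2])
 show "case_prod (gN \<alpha>) \<in> borel_measurable (borel \<Otimes>\<^sub>M borel)"
  using m unfolding measurable_pair_lborel .
 have le: "(\<integral>\<^sup>+p. ennreal \<bar>case_prod (gN \<alpha>) p\<bar> \<partial>(lborel \<Otimes>\<^sub>M lborel)) \<le> (\<integral>\<^sup>+z. ennreal \<bar>f z\<bar> \<partial>lborel)"
 proof -
  have "(\<integral>\<^sup>+p. ennreal \<bar>case_prod (gN \<alpha>) p\<bar> \<partial>(lborel \<Otimes>\<^sub>M lborel)) \<le> (\<integral>\<^sup>+p. ennreal \<bar>f (?\<phi> p)\<bar> \<partial>(lborel \<Otimes>\<^sub>M lborel))"
   by (intro nn_integral_mono ennreal_leI) (auto simp: case_prod_beta 4)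
  also have "\<dots> = (\<integral>\<^sup>+z. ennreal \<bar>f z\<bar> \<partial>lborel)"
   by (rule nn_integral_lborel_assoc(1)) (use fm in measurable)
  finally show ?thesis .
 qed
 also have "\<dots> = ennreal (LINT z|lborel. \<bar>f z\<bar>)"
  using f_int by (intro nn_integral_eq_integral) auto
 also have "\<dots> \<le> ennreal (C * T)" by (intro ennreal_leI f_abs_integral)
 finally show 6: "(\<integral>\<^sup>+p. ennreal \<bar>case_prod (gN \<alpha>) p\<bar> \<partial>(lborel \<Otimes>\<^sub>M lborel)) \<le> ennreal (C * T)" .
 show "integrable (lborel \<Otimes>\<^sub>M lborel) (case_prod (gN \<alpha>))"
 proof (rule integrableI_bounded[OF m])
  show "(\<integral>\<^sup>+p. ennreal (norm (case_prod (gN \<alpha>) p)) \<partial>(lborel \<Otimes>\<^sub>M lborel)) < \<infinity>"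
   using le_less_trans[OF 6 ennreal_less_top] by simp
 qed
qed

text \<open>The test function \<open>phi\<close> of the averaging construction is admissible, so the kinetic equation
 controls the energy on the right-hand side of \<open>fourier_energy_bound\<close>.\<close>

lemma energy_estimate:
 assumes \<alpha>: "0 < \<alpha>" "6 * \<alpha> \<le> T" and \<mu>: "\<mu> > 0" and N: "N \<ge> 1" and \<delta>: "0 < \<delta>" "\<delta> \<le> 1" and \<eta>: "\<delta> * N \<le> \<eta>"
  and hm: "case_prod h \<in> borel_measurable (borel \<Otimes>\<^sub>M borel)" and h: "\<And>v w. \<bar>h v w\<bar> \<le> Hc"
  and hl: "\<And>v w w'. \<bar>h v w - h v w'\<bar> \<le> Hc / \<delta> * norm (w - w')"
 shows "(\<integral>\<^sup>+\<xi>. ennreal ((kh \<mu> N \<xi>)\<^sup>2) * NN (\<lambda>v w. rho \<delta> v w * h v w) \<eta> \<xi> (gh \<alpha> \<xi>) \<partial>lborel) \<le> ennreal (KE / (\<delta>\<^sup>2 * N))"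
proof -
 have \<eta>0: "\<eta> > 0" using \<eta> \<delta> N mult_pos_pos[of \<delta> N] by linarith
 have N0: "N > 0" using N by simp
 note wp = weight_properties[OF \<delta>(1) hm h hl]
 note gp = gN_props[OF \<alpha>(1)]
 interpret exp_kernel "lamN \<mu> N :: real \<times> (real^'n) \<Rightarrow> real" by (rule exp_kernel_lamN[OF \<mu> N0])
 interpret A: averaging "lamN \<mu> N :: real \<times> (real^'n) \<Rightarrow> real" bb "gN \<alpha>" "\<lambda>v w. rho \<delta> v w * h v w" \<eta> R "PN N"
   "Hc / tent_mass TYPE(real^'n) \<delta>" Hc "Hc * (2 ^ (DIM(real^'n) + 2) + 1) / \<delta>"
 proof unfold_locales
  show "0 \<le> PN N" using La N by (simp add: PN_def)
 qed (use \<eta>0 ell_bb[OF \<mu> N0] gp wp bb_measurable in \<open>simp_all\<close>)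
 let ?\<phi> = "\<lambda>z :: real \<times> (real^'n) \<times> (real^'n). A.phi (fst z, fst (snd z)) (snd (snd z))"
 let ?d = "\<lambda>z :: real \<times> (real^'n) \<times> (real^'n). A.dd (fst z, fst (snd z)) (snd (snd z))"
 define S where "S = (\<Sum>b\<in>(Basis :: (real \<times> (real^'n)) set). lamN \<mu> N b)"
 define K1 where "K1 = 2 * S * A.CP / \<eta>"
 define K2 where "K2 = 4 * S * A.CP"
 define K3 where "K3 = 2 * Hc * (Hc * (2 ^ (DIM(real^'n) + 2) + 1) / \<delta>) + \<eta> * A.Lam"
 \<comment> \<open>Only finiteness matters: the terms depend on \<mu>, but K drops out of
   \<open>lipschitz_test_bound\<close>.\<close>
 define K where "K = 2 * A.CP + \<bar>K1\<bar> + \<bar>K2\<bar> + \<bar>K3\<bar> + \<bar>A.Lam\<bar> + \<bar>A.KQ\<bar>"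
 have ph: "\<bar>A.phi Y w - A.phi Y' w\<bar> \<le> K1 * norm (Y - Y')" for Y Y' w
 proof -
  have "\<bar>A.phi Y w - A.phi Y' w\<bar> \<le> 2 * ell (Y - Y') * A.CP / \<eta>" using A.phi_shift[of Y' "Y - Y'" w] by simp
  also have "\<dots> \<le> 2 * (S * norm (Y - Y')) * A.CP / \<eta>"
   using ell_le_norm[of "Y - Y'"] \<eta>0 A.CP_nonneg unfolding S_def by (intro divide_right_mono mult_right_mono mult_left_mono) auto
  finally show ?thesis by (simp add: K1_def mult_ac)
 qed
 have dh: "\<bar>A.dd Y w - A.dd Y' w\<bar> \<le> K2 * norm (Y - Y')" for Y Y' w
 proof -
  have "\<bar>A.dd Y w - A.dd Y' w\<bar> \<le> 4 * ell (Y - Y') * A.CP" using A.dd_shift[of Y' "Y - Y'" w] by simp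
  also have "\<dots> \<le> 4 * (S * norm (Y - Y')) * A.CP"
   using ell_le_norm[of "Y - Y'"] A.CP_nonneg unfolding S_def by (intro mult_right_mono mult_left_mono) auto
  finally show ?thesis by (simp add: K2_def mult_ac)
 qed
 have comb: "\<bar>p\<bar> \<le> K * norm (z - z')"
  if "\<bar>p\<bar> \<le> k * norm ((fst z, fst (snd z)) - (fst z', fst (snd z'))) + l * norm (snd (snd z) - snd (snd z'))" "\<bar>k\<bar> + \<bar>l\<bar> \<le> K"
  for p k l and z z' :: "real \<times> (real^'n) \<times> (real^'n)"
 proof -
  have n: "norm ((fst z, fst (snd z)) - (fst z', fst (snd z'))) \<le> norm (z - z')" "norm (snd (snd z) - snd (snd z')) \<le> norm (z - z')"
   using norm_fst_snd_le[of "z - z'"] norm_snd_snd_le[of "z - z'"] by simp_all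
  have "k * norm ((fst z, fst (snd z)) - (fst z', fst (snd z'))) \<le> \<bar>k\<bar> * norm (z - z')" "l * norm (snd (snd z) - snd (snd z')) \<le> \<bar>l\<bar> * norm (z - z')"
   by (intro mult_mono n; simp)+
  moreover have "(\<bar>k\<bar> + \<bar>l\<bar>) * norm (z - z') \<le> K * norm (z - z')" using that(2) by (intro mult_right_mono) auto
  ultimately show ?thesis using that(1) by (simp add: distrib_right)
 qed
 have "admissible (A.CP / \<eta>) A.Lam K ?\<phi> ?d"
  unfolding admissible_def
 proof (intro conjI allI impI)
  show "\<bar>?\<phi> z\<bar> \<le> A.CP / \<eta>" for z by (rule A.phi_le)
  show "\<bar>?d z\<bar> \<le> K" for z
   using A.dd_le[of "(fst z, fst (snd z))" "snd (snd z)"] unfolding K_def by linarith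
  show "\<bar>?\<phi> (t, x, v) - ?\<phi> (t, x, w)\<bar> \<le> A.Lam * norm (v - w)" for t x v w
   using A.phi_lip by simp
  show "\<bar>?\<phi> z - ?\<phi> z'\<bar> \<le> K * norm (z - z')" for z z'
  proof (rule comb[of _ K1 _ _ "A.Lam"])
   show "\<bar>?\<phi> z - ?\<phi> z'\<bar> \<le> K1 * norm ((fst z, fst (snd z)) - (fst z', fst (snd z'))) + A.Lam * norm (snd (snd z) - snd (snd z'))"
    using ph[of "(fst z, fst (snd z))" "snd (snd z)" "(fst z', fst (snd z'))"]
     A.phi_lip[of "(fst z', fst (snd z'))" "snd (snd z)" "snd (snd z')"] by linarith
   show "\<bar>K1\<bar> + \<bar>A.Lam\<bar> \<le> K" unfolding K_def using A.CP_nonneg by linarith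
  qed
  show "\<bar>?d z - ?d z'\<bar> \<le> K * norm (z - z')" for z z'
  proof (rule comb[of _ K2 _ _ K3])
   show "\<bar>?d z - ?d z'\<bar> \<le> K2 * norm ((fst z, fst (snd z)) - (fst z', fst (snd z'))) + K3 * norm (snd (snd z) - snd (snd z'))"
    using dh[of "(fst z, fst (snd z))" "snd (snd z)" "(fst z', fst (snd z'))"]
     A.dd_lip[of "(fst z', fst (snd z'))" "snd (snd z)" "snd (snd z')"] unfolding K3_def by linarith
   show "\<bar>K2\<bar> + \<bar>K3\<bar> \<le> K" unfolding K_def using A.CP_nonneg by linarith
  qed
  fix t :: real and x v :: "real^'n" and s :: real assume "norm v \<le> R + 1" "0 \<le> s" "s \<le> 1"
  then have "\<bar>A.phi ((t, x) + s *\<^sub>R bb v) v - A.phi (t, x) v + s * A.dd (t, x) v\<bar> \<le> A.KQ * s\<^sup>2" by (rule A.phi_quad)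
  also have "\<dots> \<le> K * s\<^sup>2" unfolding K_def using A.CP_nonneg by (intro mult_right_mono) auto
  finally show "\<bar>?\<phi> (t + s, x + s *\<^sub>R a v, v) - ?\<phi> (t, x, v) + s * ?d (t, x, v)\<bar> \<le> K * s\<^sup>2" by (simp add: bb_def)
 qed
 note test = lipschitz_test_bound[OF this \<alpha>]
 have fm [measurable]: "f \<in> borel_measurable borel" using f_int by auto
 have "(LINT (X, w)|(lborel \<Otimes>\<^sub>M lborel). gN \<alpha> X w * A.dd X w) = (LINT p|(lborel \<Otimes>\<^sub>M lborel). (\<lambda>z. time_cutoff \<alpha> T (fst z) * f z * ?d z) (fst (fst p), snd (fst p), snd p))"
  by (intro Bochner_Integration.integral_cong refl) (auto simp: gN_def)
 also have "\<dots> = (LINT z|lborel. time_cutoff \<alpha> T (fst z) * f z * ?d z)"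
 proof -
  have "(\<lambda>z. time_cutoff \<alpha> T (fst z) * f z * ?d z) \<in> borel_measurable borel"
  proof -
   have "(\<lambda>z :: real \<times> (real^'n) \<times> (real^'n). time_cutoff \<alpha> T (fst z)) \<in> borel_measurable borel"
    by (intro borel_measurable_continuous_onI continuous_on_compose2[OF continuous_time_cutoff[OF \<alpha>(1), of UNIV]] continuous_intros) auto
   moreover have "?d \<in> borel_measurable borel"
    by (rule A.dd_measurable) (intro borel_measurable_continuous_onI continuous_intros)+
   ultimately show ?thesis using fm by (intro borel_measurable_times)
  qed
  then show ?thesis
   using integral_distr[OF assoc_measurable, of "\<lambda>z. time_cutoff \<alpha> T (fst z) * f z * ?d z"] unfolding lborel_assoc by simp
 qed
 finally have I: "(LINT (X, w)|(lborel \<Otimes>\<^sub>M lborel). gN \<alpha> X w * A.dd X w) \<le> mass * A.Lam + 12 * C * (A.CP / \<eta>)"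
  using test by linarith
 have "(2 * pi) ^ DIM(real \<times> (real^'n)) * (LINT (X, w)|(lborel \<Otimes>\<^sub>M lborel). gN \<alpha> X w * A.dd X w) \<le> (2 * pi) ^ DIM(real \<times> (real^'n)) * (mass * A.Lam + 12 * C * (A.CP / \<eta>))"
  by (intro mult_left_mono I) simp
 also have "(2 * pi) ^ DIM(real \<times> (real^'n)) * (mass * A.Lam + 12 * C * (A.CP / \<eta>)) \<le> KE / (\<delta>\<^sup>2 * N)"
 proof -
  let ?dd = "real DIM(real \<times> (real^'n))" and ?e = "2 ^ (DIM(real^'n) + 2) + 1 :: real"
  \<comment> \<open>Since \<eta> \<ge> \<delta> N and \<delta> \<le> 1, the three quantities
    N/\<eta>^2, 1/(\<delta> \<eta>) and 1/\<eta> are all at most 1/(\<delta>^2 N).\<close>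
  have dN: "\<delta> * N > 0" using \<delta> N by simp
  have e1: "(\<delta> * N)\<^sup>2 \<le> \<eta>\<^sup>2" using \<eta> dN by (intro power_mono) auto
  have "N / \<eta>\<^sup>2 \<le> N / (\<delta> * N)\<^sup>2" using e1 \<eta>0 N0 \<delta>(1) by (intro divide_left_mono mult_pos_pos zero_less_power) auto
  also have "\<dots> = 1 / (\<delta>\<^sup>2 * N)" using N0 \<delta> by (simp add: power2_eq_square field_simps)
  finally have i1: "N / \<eta>\<^sup>2 \<le> 1 / (\<delta>\<^sup>2 * N)" .
  have "1 / \<eta> \<le> 1 / (\<delta> * N)" using \<eta> \<eta>0 N0 \<delta>(1) by (intro divide_left_mono mult_pos_pos) auto
  then have i2: "1 / \<eta> \<le> 1 / (\<delta> * N)" .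
  have i3: "1 / (\<delta> * \<eta>) \<le> 1 / (\<delta>\<^sup>2 * N)"
  proof -
   have "1 / (\<delta> * \<eta>) = (1 / \<delta>) * (1 / \<eta>)" by simp
   also have "\<dots> \<le> (1 / \<delta>) * (1 / (\<delta> * N))" using i2 \<delta> by (intro mult_left_mono) auto
   finally show ?thesis by (simp add: power2_eq_square mult.assoc)
  qed
  have i4: "1 / \<eta> \<le> 1 / (\<delta>\<^sup>2 * N)"
  proof (rule order_trans[OF i2])
   have "\<delta>\<^sup>2 * N \<le> \<delta> * N" using \<delta> N0 by (simp add: power2_eq_square mult_left_le)
   then show "1 / (\<delta> * N) \<le> 1 / (\<delta>\<^sup>2 * N)" using \<delta> N0 by (intro divide_left_mono) auto
  qed
  define X1 X2 q where "X1 = 16 * ?dd * La * Hc\<^sup>2 + 2 * Hc\<^sup>2 * ?e" and "X2 = 24 * C * Hc\<^sup>2" and "q = 1 / (\<delta>\<^sup>2 * N)"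
  have "A.Lam = (16 * ?dd * La * Hc\<^sup>2) * (N / \<eta>\<^sup>2) + (2 * Hc\<^sup>2 * ?e) * (1 / (\<delta> * \<eta>))"
   unfolding A.Lam_def A.CP_def unfolding PN_def by (simp only: power2_eq_square) (simp add: field_simps)
  also have "\<dots> \<le> (16 * ?dd * La * Hc\<^sup>2) * (1 / (\<delta>\<^sup>2 * N)) + (2 * Hc\<^sup>2 * ?e) * (1 / (\<delta>\<^sup>2 * N))"
   using La by (intro add_mono mult_left_mono i1 i3) auto
  also have "\<dots> = X1 * q" unfolding X1_def q_def by (rule distrib_right[symmetric])
  finally have L: "mass * A.Lam \<le> mass * (X1 * q)"
   using mass_nonneg by (intro mult_left_mono)
  have "12 * C * (A.CP / \<eta>) = X2 * (1 / \<eta>)" by (simp add: X2_def A.CP_def power2_eq_square)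
  also have "\<dots> \<le> X2 * q" unfolding X2_def q_def using C_nonneg by (intro mult_left_mono i4) auto
  finally have "mass * A.Lam + 12 * C * (A.CP / \<eta>) \<le> (mass * X1 + X2) * q"
   using L unfolding distrib_right mult.assoc by (rule add_mono[rotated])
  then have "(2 * pi) ^ DIM(real \<times> (real^'n)) * (mass * A.Lam + 12 * C * (A.CP / \<eta>)) \<le> (2 * pi) ^ DIM(real \<times> (real^'n)) * ((mass * X1 + X2) * q)"
   by (intro mult_left_mono) auto
  also have "\<dots> = KE / (\<delta>\<^sup>2 * N)" unfolding KE_def X1_def X2_def q_def by simp
  finally show ?thesis .
 qed
 finally have E: "(2 * pi) ^ DIM(real \<times> (real^'n)) * (LINT (X, w)|(lborel \<Otimes>\<^sub>M lborel). gN \<alpha> X w * A.dd X w) \<le> KE / (\<delta>\<^sup>2 * N)".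
 \<comment> \<open>\<open>damp\<close> is one minus \<open>res\<close>, so \<open>HH\<close> is the
   average inside \<open>NN\<close>.\<close>
 have H: "A.HH \<xi> v = vavg (\<lambda>v w. rho \<delta> v w * h v w) (\<lambda>w. (1 - res bb \<eta> \<xi> w) * gh \<alpha> \<xi> w) v" for \<xi> v
  unfolding A.HH_def vavg_def A.damp_def res_def freq_def A.ghat_def gh_def ..
 have "(\<integral>\<^sup>+\<xi>. ennreal ((kh \<mu> N \<xi>)\<^sup>2) * NN (\<lambda>v w. rho \<delta> v w * h v w) \<eta> \<xi> (gh \<alpha> \<xi>) \<partial>lborel) =
  (\<integral>\<^sup>+\<xi>. (\<integral>\<^sup>+v. ennreal ((norm (complex_of_real (ker_hat \<xi>) * A.HH \<xi> v))\<^sup>2) \<partial>lborel) \<partial>lborel)"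
 proof (intro nn_integral_cong)
  fix \<xi>
  show "ennreal ((kh \<mu> N \<xi>)\<^sup>2) * NN (\<lambda>v w. rho \<delta> v w * h v w) \<eta> \<xi> (gh \<alpha> \<xi>) = (\<integral>\<^sup>+v. ennreal ((norm (complex_of_real (ker_hat \<xi>) * A.HH \<xi> v))\<^sup>2) \<partial>lborel)"
   unfolding NN_def H[symmetric] kh_def
   by (subst nn_integral_cmult[symmetric]) (auto simp: norm_mult power_mult_distrib ennreal_mult intro!: nn_integral_cong)
 qed
 also have "\<dots> = (\<integral>\<^sup>+v. (\<integral>\<^sup>+\<xi>. ennreal ((norm (complex_of_real (ker_hat \<xi>) * A.HH \<xi> v))\<^sup>2) \<partial>lborel) \<partial>lborel)"
 proof (rule lborel_pair.Fubini'[symmetric])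
  have km: "ker_hat \<in> borel_measurable borel" unfolding ker_hat_def[abs_def] by measurable
  have "(\<lambda>p. ennreal ((norm (complex_of_real (ker_hat (fst p)) * A.HH (fst p) (snd p)))\<^sup>2)) \<in> borel_measurable (borel \<Otimes>\<^sub>M borel)"
   using measurable_compose[OF measurable_fst km, of "borel :: (real^'n) measure"] by measurable
  then show "(\<lambda>(x, y). ennreal ((norm (complex_of_real (ker_hat x) * A.HH x y))\<^sup>2)) \<in> borel_measurable (lborel \<Otimes>\<^sub>M lborel)"
   unfolding measurable_pair_lborel case_prod_beta' .
 qed
 also have "\<dots> \<le> ennreal ((2 * pi) ^ DIM(real \<times> (real^'n))) * ennreal (LINT (X, w)|(lborel \<Otimes>\<^sub>M lborel). gN \<alpha> X w * A.dd X w)"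
  by (rule A.fourier_energy_bound)
 also have "\<dots> \<le> ennreal (KE / (\<delta>\<^sup>2 * N))"
  using E by (subst ennreal_mult'[symmetric]) (auto intro: ennreal_leI)
 finally show ?thesis .
qed

end

section \<open>Frequency shells and summation over the levels\<close>

lemma ft_bound_ennreal: "ennreal (norm (ft g \<xi>)) \<le> (\<integral>\<^sup>+x. ennreal (norm (g x)) \<partial>lborel)"
proof (cases "integrable lborel (\<lambda>x. cis (- (x \<bullet> \<xi>)) * g x)")
 case True
 show ?thesis using integral_norm_bound_ennreal[OF True] by (simp add: ft_def norm_mult)
next
 case False
 then show ?thesis by (simp add: ft_def not_integrable_integral_eq)
qed

text \<open>Cauchy-Schwarz for j + 2 summands: the two end levels and j bands. This is one of the
  two factors j lost on each shell; the other one counts the bands.\<close>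

lemma sum_square_bound:
 fixes y :: "nat \<Rightarrow> real"
 shows "(x + (\<Sum>k<j. y k) + z)\<^sup>2 \<le> (real j + 2) * (x\<^sup>2 + (\<Sum>k<j. (y k)\<^sup>2) + z\<^sup>2)"
proof -
 define q where "q i = (if i < j then y i else if i = j then x else z)" for i
 have "(\<Sum>i<Suc (Suc j). q i) = (\<Sum>k<j. y k) + x + z" "(\<Sum>i<Suc (Suc j). (q i)\<^sup>2) = (\<Sum>k<j. (y k)\<^sup>2) + x\<^sup>2 + z\<^sup>2"
  by (simp_all add: q_def)
 then show ?thesis
  using sum_squared_le_sum_of_squares[of q "{..<Suc (Suc j)}"] by (simp add: algebra_simps)
qed

text \<open>Neighbouring closed shells share a sphere, which is harmless because only upper bounds
  are summed.\<close>

definition shell :: "nat \<Rightarrow> (real^'n) set"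
 where "shell j = {\<zeta>. 4 ^ j \<le> norm \<zeta> \<and> norm \<zeta> \<le> 4 * 4 ^ j}"

lemma shell_measurable [measurable]: "shell j \<in> sets borel"
 unfolding shell_def by measurable

text \<open>A space component is at most 4 N, so each of its factors N^2/(N^2 + y^2) is at least
  1/(1 + 16) = 1/17. The time factor is kept for the limit in \<mu>.\<close>

lemma kh_lower:
 fixes \<xi> :: "real \<times> (real^'n)"
 assumes \<mu>: "\<mu> > 0" and N: "N > 0" and \<xi>: "norm (snd \<xi>) \<le> 4 * N"
 shows "\<mu>\<^sup>2 / (\<mu>\<^sup>2 + (fst \<xi>)\<^sup>2) * (1 / 17) ^ CARD('n) \<le> kh \<mu> N \<xi>"
proof -
 interpret exp_kernel "lamN \<mu> N :: real \<times> (real^'n) \<Rightarrow> real" by (rule exp_kernel_lamN[OF \<mu> N])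
 let ?q = "\<lambda>b. if b = (1, 0) then \<mu>\<^sup>2 / (\<mu>\<^sup>2 + (fst \<xi>)\<^sup>2) else 1 / 17"
 let ?B = "Basis :: (real \<times> (real^'n)) set"
 have e: "(1, 0) \<in> ?B" by (auto simp: Basis_prod_def)
 have c: "card (?B - {(1, 0)}) = CARD('n)" using e by (simp add: card_Diff_singleton)
 have "(\<Prod>b\<in>?B. ?q b) = \<mu>\<^sup>2 / (\<mu>\<^sup>2 + (fst \<xi>)\<^sup>2) * (\<Prod>b\<in>?B - {(1, 0)}. ?q b)"
  by (subst prod.remove[OF _ e]) auto
 also have "(\<Prod>b\<in>?B - {(1, 0)}. ?q b) = (\<Prod>b\<in>?B - {(1, 0)}. 1 / 17)" by (intro prod.cong) auto
 also have "\<dots> = (1 / 17) ^ CARD('n)" using c by simp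
 finally have eq: "(\<Prod>b\<in>?B. ?q b) = \<mu>\<^sup>2 / (\<mu>\<^sup>2 + (fst \<xi>)\<^sup>2) * (1 / 17) ^ CARD('n)" .
 have "(\<Prod>b\<in>?B. ?q b) \<le> ker_hat \<xi>"
  unfolding ker_hat_def
 proof (intro prod_mono conjI)
  fix b :: "real \<times> (real^'n)" assume b: "b \<in> ?B"
  show "0 \<le> ?q b" by simp
  show "?q b \<le> (lamN \<mu> N b)\<^sup>2 / ((lamN \<mu> N b)\<^sup>2 + (\<xi> \<bullet> b)\<^sup>2)"
  proof (cases "b = (1, 0)")
   case True
   then show ?thesis by (simp add: lamN_def inner_prod_def)
  next
   case False
   then obtain e where e: "b = (0, e)" "e \<in> Basis" using b by (auto simp: Basis_prod_def)
   have "\<bar>\<xi> \<bullet> b\<bar> \<le> 4 * N" using Basis_le_norm[OF e(2), of "snd \<xi>"] \<xi> by (simp add: e(1) inner_prod_def)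
   then have "(\<xi> \<bullet> b)\<^sup>2 \<le> (4 * N)\<^sup>2" by (intro abs_le_square_iff[THEN iffD1]) (use N in simp)
   then have "N\<^sup>2 + (\<xi> \<bullet> b)\<^sup>2 \<le> 17 * N\<^sup>2" by (simp add: power_mult_distrib)
   moreover have "0 < N\<^sup>2 + (\<xi> \<bullet> b)\<^sup>2" using N by (simp add: add_pos_nonneg)
   ultimately have "1 / 17 \<le> N\<^sup>2 / (N\<^sup>2 + (\<xi> \<bullet> b)\<^sup>2)" by (simp add: le_divide_eq)
   then show ?thesis using False by (simp add: lamN_def)
  qed
 qed
 then show ?thesis unfolding eq kh_def .
qed

context kinetic_averaging
begin

lemma f_measurable3 [measurable (raw)]:
 assumes "p \<in> borel_measurable M" "q \<in> borel_measurable M" "r \<in> borel_measurable M"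
 shows "(\<lambda>z. f (p z, q z, r z)) \<in> borel_measurable M"
proof -
 have fm: "f \<in> borel_measurable borel" using f_int by auto
 show ?thesis
  by (rule measurable_compose[OF borel_measurable_Pair[OF assms(1) borel_measurable_Pair[OF assms(2,3)]] fm])
qed

lemma res_measurable_raw [measurable (raw)]:
 assumes [measurable]: "p \<in> borel_measurable M" "q \<in> borel_measurable M"
 shows "(\<lambda>z. res bb \<eta> (p z) (q z)) \<in> borel_measurable M"
 unfolding res_def freq_def by measurable

lemma wt_measurable_raw [measurable (raw)]:
 assumes [measurable]: "p \<in> borel_measurable M" "q \<in> borel_measurable M"
 shows "(\<lambda>z. wt0 \<delta> (p z) (q z)) \<in> borel_measurable M" "(\<lambda>z. wt i \<delta> (p z) (q z)) \<in> borel_measurable M"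
 unfolding wt0_def wt_def by measurable

definition Uh :: "real \<Rightarrow> real \<times> (real^'n) \<Rightarrow> complex"
 where "Uh \<alpha> \<xi> = (LINT w|lborel. gh \<alpha> \<xi> w)"

definition E0 :: real where "E0 = (2 * pi) ^ DIM(real \<times> (real^'n)) * (C * T)"

text \<open>The lowest level, the bands, and the part above the top level; 1 + 2 CARD('n) counts the
  damped averages in one band.\<close>

definition SC :: real
 where "SC = slab * E0 + slab * band_const * (1 + 2 * real CARD('n)) * KE + measure lborel (cball (0::real^'n) (R + 1)) * KE"

text \<open>The power of 17 undoes the square of the spatial loss in
  \<open>kh_lower\<close>.\<close>

definition SD :: real where "SD = 17 ^ (2 * CARD('n)) * SC"

lemma KE_nonneg: "KE \<ge> 0"
 using mass_nonneg C_nonneg La unfolding KE_def by (intro mult_nonneg_nonneg add_nonneg_nonneg) auto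

lemma E0_nonneg: "E0 \<ge> 0"
 using C_nonneg T by (simp add: E0_def)

lemma SC_nonneg: "SC \<ge> 0"
 unfolding SC_def using slab_pos KE_nonneg E0_nonneg
 by (intro add_nonneg_nonneg mult_nonneg_nonneg) (auto simp: band_const_def)

context
 fixes \<alpha> :: real assumes \<alpha>: "0 < \<alpha>" "6 * \<alpha> \<le> T"
begin

lemma gN_measurable [measurable (raw)]:
 "p \<in> borel_measurable M \<Longrightarrow> q \<in> borel_measurable M \<Longrightarrow> (\<lambda>z. gN \<alpha> (p z) (q z)) \<in> borel_measurable M"
 using measurable_compose[OF measurable_Pair gN_props(1)[OF \<alpha>(1)], of p M q] by simp

lemma gh_measurable [measurable (raw)]:
 assumes [measurable]: "p \<in> borel_measurable M" "q \<in> borel_measurable M"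
 shows "(\<lambda>z. gh \<alpha> (p z) (q z)) \<in> borel_measurable M"
 unfolding gh_def by measurable

lemma gh_supp: "R < norm w \<Longrightarrow> gh \<alpha> \<xi> w = 0"
 by (simp add: gh_def ft_def gN_props(5)[OF \<alpha>(1)])

lemma gh_integrable: "integrable lborel (gh \<alpha> \<xi>)"
proof (rule integrableI_bounded)
 have "(\<integral>\<^sup>+w. ennreal (norm (gh \<alpha> \<xi> w)) \<partial>lborel) \<le> (\<integral>\<^sup>+w. (\<integral>\<^sup>+X. ennreal \<bar>gN \<alpha> X w\<bar> \<partial>lborel) \<partial>lborel)"
  unfolding gh_def by (intro nn_integral_mono order_trans[OF ft_bound_ennreal]) simp
 also have "\<dots> = (\<integral>\<^sup>+p. ennreal \<bar>case_prod (gN \<alpha>) p\<bar> \<partial>(lborel \<Otimes>\<^sub>M lborel))"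
  by (subst lborel_pair.nn_integral_snd[symmetric]) simp_all
 also have "\<dots> \<le> ennreal (C * T)" by (rule gN_props(6)[OF \<alpha>(1)])
 finally show "(\<integral>\<^sup>+w. ennreal (norm (gh \<alpha> \<xi> w)) \<partial>lborel) < \<infinity>"
  using le_less_trans[OF _ ennreal_less_top] by simp
qed measurable

text \<open>Plancherel in (t,x) at almost every velocity; |g| \<le> 1 bounds the square by the
  modulus, so the L^1 norm suffices.\<close>

lemma gh_energy: "(\<integral>\<^sup>+\<xi>. (\<integral>\<^sup>+w. ennreal ((norm (gh \<alpha> \<xi> w))\<^sup>2) \<partial>lborel) \<partial>lborel) \<le> ennreal E0"
proof -
 let ?P = "ennreal ((2 * pi) ^ DIM(real \<times> (real^'n)))"
 have "(\<integral>\<^sup>+\<xi>. (\<integral>\<^sup>+w. ennreal ((norm (gh \<alpha> \<xi> w))\<^sup>2) \<partial>lborel) \<partial>lborel) = (\<integral>\<^sup>+w. (\<integral>\<^sup>+\<xi>. ennreal ((norm (gh \<alpha> \<xi> w))\<^sup>2) \<partial>lborel) \<partial>lborel)"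
  by (rule lborel_pair.Fubini'[symmetric]) (unfold measurable_pair_lborel, measurable)
 also have "\<dots> \<le> (\<integral>\<^sup>+w. ?P * (\<integral>\<^sup>+X. ennreal \<bar>gN \<alpha> X w\<bar> \<partial>lborel) \<partial>lborel)"
 proof (rule nn_integral_mono_AE)
  show "AE w in lborel. (\<integral>\<^sup>+\<xi>. ennreal ((norm (gh \<alpha> \<xi> w))\<^sup>2) \<partial>lborel) \<le> ?P * (\<integral>\<^sup>+X. ennreal \<bar>gN \<alpha> X w\<bar> \<partial>lborel)"
   using lborel_pair.AE_integrable_snd[OF gN_props(2)[OF \<alpha>(1)]]
  proof eventually_elim
   fix w assume i: "integrable lborel (\<lambda>X. gN \<alpha> X w)"
   have "(\<integral>\<^sup>+\<xi>. ennreal ((norm (gh \<alpha> \<xi> w))\<^sup>2) \<partial>lborel) \<le> ?P * (\<integral>\<^sup>+X. ennreal ((norm (complex_of_real (gN \<alpha> X w)))\<^sup>2) \<partial>lborel)"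
    unfolding gh_def by (rule plancherel_le) (use i in simp)
   also have "\<dots> \<le> ?P * (\<integral>\<^sup>+X. ennreal \<bar>gN \<alpha> X w\<bar> \<partial>lborel)"
   proof (intro mult_left_mono nn_integral_mono ennreal_leI)
    fix X
    show "(norm (complex_of_real (gN \<alpha> X w)))\<^sup>2 \<le> \<bar>gN \<alpha> X w\<bar>"
     using gN_props(3)[OF \<alpha>(1), of X w] unfolding norm_of_real power2_eq_square by (intro mult_left_le) auto
   qed simp
   finally show "(\<integral>\<^sup>+\<xi>. ennreal ((norm (gh \<alpha> \<xi> w))\<^sup>2) \<partial>lborel) \<le> ?P * (\<integral>\<^sup>+X. ennreal \<bar>gN \<alpha> X w\<bar> \<partial>lborel)" .
  qed
 qed
 also have "\<dots> = ?P * (\<integral>\<^sup>+w. (\<integral>\<^sup>+X. ennreal \<bar>gN \<alpha> X w\<bar> \<partial>lborel) \<partial>lborel)"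
  by (rule nn_integral_cmult) measurable
 also have "(\<integral>\<^sup>+w. (\<integral>\<^sup>+X. ennreal \<bar>gN \<alpha> X w\<bar> \<partial>lborel) \<partial>lborel) = (\<integral>\<^sup>+p. ennreal \<bar>case_prod (gN \<alpha>) p\<bar> \<partial>(lborel \<Otimes>\<^sub>M lborel))"
  by (subst lborel_pair.nn_integral_snd[symmetric]) simp_all
 also have "?P * \<dots> \<le> ?P * ennreal (C * T)" by (intro mult_left_mono gN_props(6)[OF \<alpha>(1)]) simp
 also have "\<dots> = ennreal E0" unfolding E0_def using C_nonneg T by (simp add: ennreal_mult)
 finally show ?thesis .
qed

lemma NN_measurable [measurable]:
 "(\<lambda>\<xi>. NN (wt0 \<delta>) \<eta> \<xi> (gh \<alpha> \<xi>)) \<in> borel_measurable borel" "(\<lambda>\<xi>. NN (wt i \<delta>) \<eta> \<xi> (gh \<alpha> \<xi>)) \<in> borel_measurable borel"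
 unfolding NN_def vavg_def by measurable

lemma Uh_measurable [measurable (raw)]:
 assumes [measurable]: "p \<in> borel_measurable M"
 shows "(\<lambda>z. Uh \<alpha> (p z)) \<in> borel_measurable M"
 unfolding Uh_def by measurable

lemma kh_measurable [measurable]: "\<mu> > 0 \<Longrightarrow> N > 0 \<Longrightarrow> (kh \<mu> N :: real \<times> (real^'n) \<Rightarrow> real) \<in> borel_measurable borel"
proof -
 assume a: "\<mu> > 0" "N > 0"
 interpret exp_kernel "lamN \<mu> N :: real \<times> (real^'n) \<Rightarrow> real" by (rule exp_kernel_lamN[OF a])
 show ?thesis unfolding kh_def ker_hat_def[abs_def] by measurable
qed

text \<open>The resolvents at \<eta> = 2^k 2^j, with k from 0 to j, telescope: 1 is the lowest
  resolvent, plus the bands, plus one minus the resolvent at \<eta> = N. The slab estimate treats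
  the first, \<open>middle_part\<close> the bands and \<open>high_part\<close> the last.\<close>

lemma pointwise_shell_bound:
 assumes \<xi>: "snd \<xi> \<in> shell j"
 defines "\<delta> \<equiv> \<lambda>k. 2 ^ k / 2 ^ j :: real" and "N \<equiv> 4 ^ j :: real"
 shows "ennreal ((norm (Uh \<alpha> \<xi>))\<^sup>2) \<le> ennreal (real j + 2) *
  (ennreal (slab / 2 ^ j) * (\<integral>\<^sup>+w. ennreal ((norm (gh \<alpha> \<xi> w))\<^sup>2) \<partial>lborel) +
  (\<Sum>k<j. ennreal (slab * \<delta> k * band_const) * (NN (wt0 (\<delta> k)) (2 * (\<delta> k * N)) \<xi> (gh \<alpha> \<xi>) +
    (\<Sum>i\<in>UNIV. NN (wt i (\<delta> k)) (\<delta> k * N) \<xi> (gh \<alpha> \<xi>) + NN (wt i (\<delta> k)) (2 * (\<delta> k * N)) \<xi> (gh \<alpha> \<xi>)))) +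
  ennreal (measure lborel (cball (0::real^'n) (R + 1))) * NN (wt0 1) N \<xi> (gh \<alpha> \<xi>))"
proof -
 have N: "N \<ge> 1" "N \<le> norm (snd \<xi>)" "norm (snd \<xi>) \<le> 4 * N" using \<xi> by (auto simp: shell_def N_def)
 have \<xi>0: "snd \<xi> \<noteq> 0" using N by auto
 have N2: "N = 2 ^ j * 2 ^ j" by (simp add: N_def flip: power_mult_distrib)
 \<comment> \<open>Consecutive levels differ by the factor 2 required in \<open>middle_part\<close>,
   and \<delta> k is the level divided by N.\<close>
 have dN: "\<delta> k * N = 2 ^ k * 2 ^ j" for k by (simp add: \<delta>_def N2)
 let ?r = "\<lambda>k. res bb (2 ^ k * 2 ^ j) \<xi>" and ?u = "gh \<alpha> \<xi>"
 have ri: "integrable lborel (\<lambda>w. ?r k w * ?u w)" for k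
  by (rule res_u_integrable[OF gh_integrable gh_supp]) simp_all
 define A where "A k = (LINT w|lborel. ?r k w * ?u w)" for k
 have diff: "(LINT w|lborel. (?r (Suc k) w - ?r k w) * ?u w) = A (Suc k) - A k" for k
  unfolding A_def left_diff_distrib by (rule Bochner_Integration.integral_diff[OF ri ri])
 have high: "(LINT w|lborel. (1 - ?r j w) * ?u w) = Uh \<alpha> \<xi> - A j"
  unfolding A_def Uh_def left_diff_distrib mult_1_left by (rule Bochner_Integration.integral_diff[OF gh_integrable ri])
 have "Uh \<alpha> \<xi> = A 0 + (\<Sum>k<j. A (Suc k) - A k) + (Uh \<alpha> \<xi> - A j)" by (simp add: sum_lessThan_telescope)
 then have "norm (Uh \<alpha> \<xi>) \<le> norm (A 0 + (\<Sum>k<j. A (Suc k) - A k)) + norm (Uh \<alpha> \<xi> - A j)"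
  using norm_triangle_ineq[of "A 0 + (\<Sum>k<j. A (Suc k) - A k)" "Uh \<alpha> \<xi> - A j"] by metis
 also have "\<dots> \<le> norm (A 0) + (\<Sum>k<j. norm (A (Suc k) - A k)) + norm (Uh \<alpha> \<xi> - A j)"
  by (intro add_right_mono order_trans[OF norm_triangle_ineq] add_left_mono norm_sum)
 finally have "(norm (Uh \<alpha> \<xi>))\<^sup>2 \<le> (norm (A 0) + (\<Sum>k<j. norm (A (Suc k) - A k)) + norm (Uh \<alpha> \<xi> - A j))\<^sup>2"
  by (intro power_mono) auto
 also have "\<dots> \<le> (real j + 2) * ((norm (A 0))\<^sup>2 + (\<Sum>k<j. (norm (A (Suc k) - A k))\<^sup>2) + (norm (Uh \<alpha> \<xi> - A j))\<^sup>2)"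
  by (rule sum_square_bound)
 finally have "ennreal ((norm (Uh \<alpha> \<xi>))\<^sup>2) \<le> ennreal ((real j + 2) * ((norm (A 0))\<^sup>2 + (\<Sum>k<j. (norm (A (Suc k) - A k))\<^sup>2) + (norm (Uh \<alpha> \<xi> - A j))\<^sup>2))"
  by (rule ennreal_leI)
 also have "\<dots> = ennreal (real j + 2) * (ennreal ((norm (A 0))\<^sup>2) + (\<Sum>k<j. ennreal ((norm (A (Suc k) - A k))\<^sup>2)) + ennreal ((norm (Uh \<alpha> \<xi> - A j))\<^sup>2))"
  by (subst ennreal_mult) (auto simp: sum_nonneg)
 also have "\<dots> \<le> ennreal (real j + 2) *
  (ennreal (slab / 2 ^ j) * (\<integral>\<^sup>+w. ennreal ((norm (gh \<alpha> \<xi> w))\<^sup>2) \<partial>lborel) +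
  (\<Sum>k<j. ennreal (slab * \<delta> k * band_const) * (NN (wt0 (\<delta> k)) (2 * (\<delta> k * N)) \<xi> (gh \<alpha> \<xi>) +
    (\<Sum>i\<in>UNIV. NN (wt i (\<delta> k)) (\<delta> k * N) \<xi> (gh \<alpha> \<xi>) + NN (wt i (\<delta> k)) (2 * (\<delta> k * N)) \<xi> (gh \<alpha> \<xi>)))) +
  ennreal (measure lborel (cball (0::real^'n) (R + 1))) * NN (wt0 1) N \<xi> (gh \<alpha> \<xi>))"
 proof (intro mult_left_mono add_mono sum_mono)
  have "ennreal ((norm (A 0))\<^sup>2) \<le> ennreal (slab * (2 ^ 0 * 2 ^ j) / norm (snd \<xi>)) * (\<integral>\<^sup>+w. ennreal ((norm (gh \<alpha> \<xi> w))\<^sup>2) \<partial>lborel)"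
   unfolding A_def by (rule low_part[OF gh_integrable gh_supp \<xi>0]) auto
  also have "\<dots> \<le> ennreal (slab / 2 ^ j) * (\<integral>\<^sup>+w. ennreal ((norm (gh \<alpha> \<xi> w))\<^sup>2) \<partial>lborel)"
  proof (intro mult_right_mono ennreal_leI)
   have "slab * (2 ^ 0 * 2 ^ j) / norm (snd \<xi>) \<le> slab * 2 ^ j / N"
    using slab_pos N by (simp, intro divide_left_mono) (auto intro!: mult_pos_pos)
   also have "\<dots> = slab / 2 ^ j" by (simp add: N2)
   finally show "slab * (2 ^ 0 * 2 ^ j) / norm (snd \<xi>) \<le> slab / 2 ^ j" .
  qed simp
  finally show "ennreal ((norm (A 0))\<^sup>2) \<le> ennreal (slab / 2 ^ j) * (\<integral>\<^sup>+w. ennreal ((norm (gh \<alpha> \<xi> w))\<^sup>2) \<partial>lborel)" .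
  fix k assume k: "k \<in> {..<j}"
  have d: "0 < \<delta> k" "\<delta> k \<le> 1" using k by (auto simp: \<delta>_def divide_le_eq)
  show "ennreal ((norm (A (Suc k) - A k))\<^sup>2) \<le> ennreal (slab * \<delta> k * band_const) * (NN (wt0 (\<delta> k)) (2 * (\<delta> k * N)) \<xi> (gh \<alpha> \<xi>) +
    (\<Sum>i\<in>UNIV. NN (wt i (\<delta> k)) (\<delta> k * N) \<xi> (gh \<alpha> \<xi>) + NN (wt i (\<delta> k)) (2 * (\<delta> k * N)) \<xi> (gh \<alpha> \<xi>)))"
   using middle_part[OF gh_integrable gh_supp d N] unfolding diff[symmetric] by (simp add: dN mult.assoc)
 next
  show "ennreal ((norm (Uh \<alpha> \<xi> - A j))\<^sup>2) \<le> ennreal (measure lborel (cball (0::real^'n) (R + 1))) * NN (wt0 1) N \<xi> (gh \<alpha> \<xi>)"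
   using high_part[OF gh_integrable gh_supp, of 1 N \<xi>] N unfolding high[symmetric] by (simp add: N2)
 qed auto
 finally show ?thesis .
qed

text \<open>Integration of the pointwise bound with the weight \<open>kh\<close>^2, under which
  \<open>energy_estimate\<close> holds. Band k pairs the slab gain \<delta> with
  \<open>KE\<close>/(\<delta>^2 N) and leaves \<open>KE\<close>/(\<delta> N).\<close>

lemma shell_mu:
 assumes \<mu>: "\<mu> > 0"
 shows "(\<integral>\<^sup>+\<xi>. ennreal ((kh \<mu> (4 ^ j) \<xi>)\<^sup>2) * (indicator (shell j) (snd \<xi>) * ennreal ((norm (Uh \<alpha> \<xi>))\<^sup>2)) \<partial>lborel)
  \<le> ennreal ((real j + 2)\<^sup>2 * SC / 2 ^ j)"
proof -
 define \<delta> :: "nat \<Rightarrow> real" where "\<delta> k = 2 ^ k / 2 ^ j" for k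
 define N :: real where "N = 4 ^ j"
 have N1: "N \<ge> 1" and N0: "N > 0" by (simp_all add: N_def)
 have N2: "N = 2 ^ j * 2 ^ j" by (simp add: N_def flip: power_mult_distrib)
 have d: "0 < \<delta> k" "k < j \<Longrightarrow> \<delta> k \<le> 1" for k by (auto simp: \<delta>_def divide_le_eq)
 define V where "V = measure lborel (cball (0::real^'n) (R + 1))"
 define K where "K \<xi> = ennreal ((kh \<mu> N \<xi>)\<^sup>2)" for \<xi> :: "real \<times> (real^'n)"
 define E where "E \<xi> = (\<integral>\<^sup>+w. ennreal ((norm (gh \<alpha> \<xi> w))\<^sup>2) \<partial>lborel)" for \<xi>
 define n0 where "n0 \<delta> \<eta> \<xi> = NN (wt0 \<delta>) \<eta> \<xi> (gh \<alpha> \<xi>)" for \<delta> \<eta> \<xi>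
 define ni where "ni i \<delta> \<eta> \<xi> = NN (wt i \<delta>) \<eta> \<xi> (gh \<alpha> \<xi>)" for i \<delta> \<eta> \<xi>
 have [measurable]: "K \<in> borel_measurable borel" unfolding K_def[abs_def] using kh_measurable[OF \<mu> N0] by measurable
 have [measurable]: "E \<in> borel_measurable borel" unfolding E_def[abs_def] by measurable
 have [measurable]: "n0 \<delta> \<eta> \<in> borel_measurable borel" "ni i \<delta> \<eta> \<in> borel_measurable borel" for \<delta> \<eta> i
  unfolding n0_def[abs_def] ni_def[abs_def] by measurable
 \<comment> \<open>For the lowest level the weight is simply discarded, since
   \<open>gh_energy\<close> holds without smoothing.\<close>
 have k1: "K \<xi> \<le> 1" for \<xi>
 proof -
  interpret exp_kernel "lamN \<mu> N :: real \<times> (real^'n) \<Rightarrow> real" by (rule exp_kernel_lamN[OF \<mu> N0])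
  have "0 \<le> ker_hat \<xi>" "ker_hat \<xi> \<le> 1" unfolding ker_hat_def
   using lam_pos by (auto intro!: prod_nonneg prod_le_1 simp: divide_le_eq_1 add_pos_nonneg less_imp_neq[symmetric])
  then show ?thesis unfolding K_def kh_def by (simp add: power_le_one)
 qed
 have EN: "(\<integral>\<^sup>+\<xi>. K \<xi> * n0 d' \<eta> \<xi> \<partial>lborel) \<le> ennreal (KE / (d'\<^sup>2 * N))"
  "(\<integral>\<^sup>+\<xi>. K \<xi> * ni i d' \<eta> \<xi> \<partial>lborel) \<le> ennreal (KE / (d'\<^sup>2 * N))"
  if "0 < d'" "d' \<le> 1" "d' * N \<le> \<eta>" for d' \<eta> i
  unfolding K_def n0_def ni_def wt0_def wt_def
  by (rule energy_estimate[OF \<alpha> \<mu> N1 that one_weight[OF that(1)]], rule energy_estimate[OF \<alpha> \<mu> N1 that diff_quot_weight[OF that(1)]])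
 let ?M = "\<lambda>k \<xi>. n0 (\<delta> k) (2 * (\<delta> k * N)) \<xi> + (\<Sum>i\<in>UNIV. ni i (\<delta> k) (\<delta> k * N) \<xi> + ni i (\<delta> k) (2 * (\<delta> k * N)) \<xi>)"
 have "(\<integral>\<^sup>+\<xi>. ennreal ((kh \<mu> (4 ^ j) \<xi>)\<^sup>2) * (indicator (shell j) (snd \<xi>) * ennreal ((norm (Uh \<alpha> \<xi>))\<^sup>2)) \<partial>lborel) \<le>
  (\<integral>\<^sup>+\<xi>. ennreal (real j + 2) * (ennreal (slab / 2 ^ j) * (K \<xi> * E \<xi>) + (\<Sum>k<j. ennreal (slab * \<delta> k * band_const) * (K \<xi> * ?M k \<xi>)) + ennreal V * (K \<xi> * n0 1 N \<xi>)) \<partial>lborel)"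
 proof (rule nn_integral_mono)
  fix \<xi> :: "real \<times> (real^'n)"
  show "ennreal ((kh \<mu> (4 ^ j) \<xi>)\<^sup>2) * (indicator (shell j) (snd \<xi>) * ennreal ((norm (Uh \<alpha> \<xi>))\<^sup>2)) \<le>
   ennreal (real j + 2) * (ennreal (slab / 2 ^ j) * (K \<xi> * E \<xi>) + (\<Sum>k<j. ennreal (slab * \<delta> k * band_const) * (K \<xi> * ?M k \<xi>)) + ennreal V * (K \<xi> * n0 1 N \<xi>))"
  proof (cases "snd \<xi> \<in> shell j")
   case True
   have "K \<xi> * ennreal ((norm (Uh \<alpha> \<xi>))\<^sup>2) \<le> K \<xi> * (ennreal (real j + 2) * (ennreal (slab / 2 ^ j) * E \<xi> + (\<Sum>k<j. ennreal (slab * \<delta> k * band_const) * ?M k \<xi>) + ennreal V * n0 1 N \<xi>))"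
    using pointwise_shell_bound[OF True] unfolding E_def n0_def ni_def V_def \<delta>_def N_def by (rule mult_left_mono) simp
   also have "\<dots> = ennreal (real j + 2) * (ennreal (slab / 2 ^ j) * (K \<xi> * E \<xi>) + (\<Sum>k<j. ennreal (slab * \<delta> k * band_const) * (K \<xi> * ?M k \<xi>)) + ennreal V * (K \<xi> * n0 1 N \<xi>))"
    by (simp only: distrib_left sum_distrib_left mult.left_commute)
   finally show ?thesis using True by (simp add: K_def N_def)
  qed simp
 qed
 also have "\<dots> = ennreal (real j + 2) * (ennreal (slab / 2 ^ j) * (\<integral>\<^sup>+\<xi>. K \<xi> * E \<xi> \<partial>lborel) +
  (\<Sum>k<j. ennreal (slab * \<delta> k * band_const) * (\<integral>\<^sup>+\<xi>. K \<xi> * ?M k \<xi> \<partial>lborel)) + ennreal V * (\<integral>\<^sup>+\<xi>. K \<xi> * n0 1 N \<xi> \<partial>lborel))"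
  by (simp add: nn_integral_cmult nn_integral_add nn_integral_sum)
 also have "\<dots> \<le> ennreal (real j + 2) * (ennreal (slab / 2 ^ j) * ennreal E0 +
  (\<Sum>k<j. ennreal (slab * band_const * (1 + 2 * real CARD('n)) * KE / 2 ^ j)) + ennreal V * ennreal (KE / 2 ^ j))"
 proof (intro mult_left_mono add_mono sum_mono)
  have "(\<integral>\<^sup>+\<xi>. K \<xi> * E \<xi> \<partial>lborel) \<le> (\<integral>\<^sup>+\<xi>. E \<xi> \<partial>lborel)"
   using k1 by (intro nn_integral_mono) (metis mult_1 mult_right_mono zero_le)
  also have "\<dots> \<le> ennreal E0" unfolding E_def by (rule gh_energy)
  finally show "(\<integral>\<^sup>+\<xi>. K \<xi> * E \<xi> \<partial>lborel) \<le> ennreal E0" .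
  have "(\<integral>\<^sup>+\<xi>. K \<xi> * n0 1 N \<xi> \<partial>lborel) \<le> ennreal (KE / (1\<^sup>2 * N))" by (rule EN) auto
  also have "\<dots> \<le> ennreal (KE / 2 ^ j)"
  proof (intro ennreal_leI)
   show "KE / (1\<^sup>2 * N) \<le> KE / 2 ^ j" using KE_nonneg unfolding N2 by (intro divide_left_mono) auto
  qed
  finally show "(\<integral>\<^sup>+\<xi>. K \<xi> * n0 1 N \<xi> \<partial>lborel) \<le> ennreal (KE / 2 ^ j)" .
  fix k assume "k \<in> {..<j}"
  then have dk: "0 < \<delta> k" "\<delta> k \<le> 1" using d by auto
  have e: "\<delta> k * N \<le> 2 * (\<delta> k * N)" using dk N0 by simp
  let ?X = "KE / ((\<delta> k)\<^sup>2 * N)"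
  have alg: "x + (\<Sum>i\<in>(UNIV :: 'n set). x + x) = (1 + 2 * real CARD('n)) * x" for x :: real by (simp add: algebra_simps)
  have X0: "?X \<ge> 0" using KE_nonneg N0 by simp
  have "(\<integral>\<^sup>+\<xi>. K \<xi> * ?M k \<xi> \<partial>lborel) = (\<integral>\<^sup>+\<xi>. K \<xi> * n0 (\<delta> k) (2 * (\<delta> k * N)) \<xi> \<partial>lborel) +
   (\<Sum>i\<in>UNIV. (\<integral>\<^sup>+\<xi>. K \<xi> * ni i (\<delta> k) (\<delta> k * N) \<xi> \<partial>lborel) + (\<integral>\<^sup>+\<xi>. K \<xi> * ni i (\<delta> k) (2 * (\<delta> k * N)) \<xi> \<partial>lborel))"
   by (simp add: distrib_left sum_distrib_left nn_integral_add nn_integral_sum)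
  also have "\<dots> \<le> ennreal ?X + (\<Sum>i\<in>(UNIV :: 'n set). ennreal ?X + ennreal ?X)"
   using dk e by (intro add_mono sum_mono EN) auto
  also have "\<dots> = ennreal (?X + (\<Sum>i\<in>(UNIV :: 'n set). ?X + ?X))"
   using X0 by (simp only: ennreal_plus[symmetric] sum_ennreal add_nonneg_nonneg sum_nonneg)
  also have "\<dots> = ennreal ((1 + 2 * real CARD('n)) * ?X)" unfolding alg ..
  finally have "ennreal (slab * \<delta> k * band_const) * (\<integral>\<^sup>+\<xi>. K \<xi> * ?M k \<xi> \<partial>lborel) \<le> ennreal (slab * \<delta> k * band_const) * ennreal ((1 + 2 * real CARD('n)) * ?X)"
   by (intro mult_left_mono) auto
  also have "\<dots> = ennreal (slab * \<delta> k * band_const * ((1 + 2 * real CARD('n)) * ?X))"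
   using X0 by (intro ennreal_mult''[symmetric] mult_nonneg_nonneg) auto
  also have "\<dots> \<le> ennreal (slab * band_const * (1 + 2 * real CARD('n)) * KE / 2 ^ j)"
  proof (intro ennreal_leI)
   \<comment> \<open>The surviving factor is 2^(-k) 2^(-j); bounding 2^(-k) by 1 makes all bands
     alike and leads to their number j.\<close>
   have dN: "\<delta> k * N = 2 ^ k * 2 ^ j" by (simp add: \<delta>_def N2)
   have "slab * \<delta> k * band_const * ((1 + 2 * real CARD('n)) * ?X) = slab * band_const * (1 + 2 * real CARD('n)) * KE / (\<delta> k * N)"
    using dk N0 by (simp add: power2_eq_square)
   also have "\<dots> \<le> slab * band_const * (1 + 2 * real CARD('n)) * KE / 2 ^ j"
    unfolding dN using slab_pos KE_nonneg by (intro divide_left_mono mult_nonneg_nonneg) (auto simp: band_const_def)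
   finally show "slab * \<delta> k * band_const * ((1 + 2 * real CARD('n)) * ?X) \<le> slab * band_const * (1 + 2 * real CARD('n)) * KE / 2 ^ j" .
  qed
  finally show "ennreal (slab * \<delta> k * band_const) * (\<integral>\<^sup>+\<xi>. K \<xi> * ?M k \<xi> \<partial>lborel) \<le> ennreal (slab * band_const * (1 + 2 * real CARD('n)) * KE / 2 ^ j)" .
 qed auto
 also have "\<dots> = ennreal ((real j + 2) * (slab * E0 + real j * (slab * band_const * (1 + 2 * real CARD('n)) * KE) + V * KE) / 2 ^ j)"
 proof -
  define B where "B = slab * band_const * (1 + 2 * real CARD('n)) * KE"
  have B: "B \<ge> 0" unfolding B_def using slab_pos KE_nonneg by (intro mult_nonneg_nonneg) (auto simp: band_const_def)
  have s: "(\<Sum>k<j. ennreal (B / 2 ^ j)) = ennreal (real j * B / 2 ^ j)"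
   using B by (subst sum_ennreal) auto
  have V: "V \<ge> 0" by (simp add: V_def)
  show ?thesis unfolding B_def[symmetric] s
   using B V KE_nonneg E0_nonneg slab_pos by (simp flip: ennreal_mult ennreal_plus) (simp add: field_simps)
 qed
 also have "\<dots> \<le> ennreal ((real j + 2)\<^sup>2 * SC / 2 ^ j)"
 proof (intro ennreal_leI divide_right_mono)
  define B where "B = slab * band_const * (1 + 2 * real CARD('n)) * KE"
  have B: "B \<ge> 0" unfolding B_def using slab_pos KE_nonneg by (intro mult_nonneg_nonneg) (auto simp: band_const_def)
  have VK: "V * KE \<ge> 0" using KE_nonneg by (simp add: V_def)
  have SE: "slab * E0 \<ge> 0" using slab_pos E0_nonneg by simp
  have "slab * E0 + real j * B + V * KE \<le> (real j + 2) * (slab * E0) + (real j + 2) * B + (real j + 2) * (V * KE)"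
  proof (intro add_mono)
   show "slab * E0 \<le> (real j + 2) * (slab * E0)" using mult_right_mono[of 1 "real j + 2", OF _ SE] by simp
   show "real j * B \<le> (real j + 2) * B" using B by (intro mult_right_mono) auto
   show "V * KE \<le> (real j + 2) * (V * KE)" using mult_right_mono[of 1 "real j + 2", OF _ VK] by simp
  qed
  also have "\<dots> = (real j + 2) * SC" by (simp add: SC_def B_def V_def distrib_left)
  finally show "(real j + 2) * (slab * E0 + real j * (slab * band_const * (1 + 2 * real CARD('n)) * KE) + V * KE) \<le> (real j + 2)\<^sup>2 * SC"
   unfolding B_def power2_eq_square mult.assoc by (intro mult_left_mono) auto
 qed simp
 finally show ?thesis .
qed

text \<open>With \<mu> = n + 1 tending to infinity, the time factor of the kernel tends to 1 at each
  fixed \<tau>, while the bound of \<open>shell_mu\<close> does not depend on \<mu>. Fatou removes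
  the weight.\<close>

lemma shell_freq:
 "(\<integral>\<^sup>+\<xi>. ennreal (indicator (shell j) (snd \<xi>) * (norm (Uh \<alpha> \<xi>))\<^sup>2) \<partial>lborel) \<le> ennreal ((real j + 2)\<^sup>2 * SD / 2 ^ j)"
proof -
 \<comment> \<open>The square of the spatial lower bound in \<open>kh_lower\<close>, which is
   constant on the shell.\<close>
 define q :: real where "q = ((1 / 17) ^ CARD('n))\<^sup>2"
 have q: "q > 0" "17 ^ (2 * CARD('n)) * q = 1" by (simp_all add: q_def power_mult power_divide flip: power_mult_distrib power_mult)
 define r where "r n \<tau> = ((real (Suc n))\<^sup>2 / ((real (Suc n))\<^sup>2 + \<tau>\<^sup>2))\<^sup>2" for n and \<tau> :: real
 let ?D = "ennreal ((real j + 2)\<^sup>2 * SC / 2 ^ j)"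
 let ?X = "\<lambda>\<xi>. indicator (shell j) (snd \<xi>) * (norm (Uh \<alpha> \<xi>))\<^sup>2 :: real"
 have sm [measurable]: "(\<lambda>\<xi>::real \<times> (real^'n). snd \<xi>) \<in> borel_measurable borel" "(\<lambda>\<xi>::real \<times> (real^'n). fst \<xi>) \<in> borel_measurable borel"
  by (simp_all add: borel_prod[symmetric])
 have im [measurable]: "(\<lambda>\<xi>::real \<times> (real^'n). indicator (shell j) (snd \<xi>) :: real) \<in> borel_measurable borel"
  by (rule measurable_compose[OF sm(1)]) simp
 have "(\<integral>\<^sup>+\<xi>. ennreal (q * ?X \<xi>) \<partial>lborel) \<le> ?D"
 proof (rule nn_integral_limit_le)
  show "(\<lambda>\<xi>. ennreal (r n (fst \<xi>) * (q * ?X \<xi>))) \<in> borel_measurable lborel" for n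
   unfolding r_def by measurable
  show "AE \<xi> in lborel. (\<lambda>n. ennreal (r n (fst \<xi>) * (q * ?X \<xi>))) \<longlonglongrightarrow> ennreal (q * ?X \<xi>)"
  proof (intro AE_I2 tendsto_ennrealI)
   fix \<xi> :: "real \<times> (real^'n)"
   have "(\<lambda>n. 1 - (fst \<xi>)\<^sup>2 / ((real (Suc n))\<^sup>2 + (fst \<xi>)\<^sup>2)) \<longlonglongrightarrow> 1 - 0"
   proof (intro tendsto_diff tendsto_const)
    let ?c = "(fst \<xi>)\<^sup>2"
    have "(\<lambda>n. ?c * inverse (real (Suc n))) \<longlonglongrightarrow> 0"
     using tendsto_mult_right_zero[OF LIMSEQ_inverse_real_of_nat] .
    then show "(\<lambda>n. ?c / ((real (Suc n))\<^sup>2 + ?c)) \<longlonglongrightarrow> 0"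
    proof (rule tendsto_sandwich[OF _ _ tendsto_const, rotated -1])
     show "\<forall>\<^sub>F n in sequentially. ?c / ((real (Suc n))\<^sup>2 + ?c) \<le> ?c * inverse (real (Suc n))"
     proof (intro always_eventually allI)
      fix n
      have "real (Suc n) * 1 \<le> (real (Suc n))\<^sup>2" unfolding power2_eq_square by (intro mult_left_mono) auto
      then have "real (Suc n) \<le> (real (Suc n))\<^sup>2 + ?c" using zero_le_power2[of "fst \<xi>"] unfolding mult_1_right by (rule add_increasing2[rotated])
      then have "?c / ((real (Suc n))\<^sup>2 + ?c) \<le> ?c / real (Suc n)"
       by (intro divide_left_mono mult_pos_pos add_pos_nonneg) auto
      then show "?c / ((real (Suc n))\<^sup>2 + ?c) \<le> ?c * inverse (real (Suc n))" by (simp only: divide_inverse)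
     qed
    qed simp
   qed
   moreover have "1 - (fst \<xi>)\<^sup>2 / ((real (Suc n))\<^sup>2 + (fst \<xi>)\<^sup>2) = (real (Suc n))\<^sup>2 / ((real (Suc n))\<^sup>2 + (fst \<xi>)\<^sup>2)" for n
   proof -
    have "(real (Suc n))\<^sup>2 + (fst \<xi>)\<^sup>2 > 0" by (intro add_pos_nonneg) auto
    then show ?thesis by (simp add: field_simps)
   qed
   ultimately have "(\<lambda>n. r n (fst \<xi>)) \<longlonglongrightarrow> 1\<^sup>2"
    unfolding r_def by (intro tendsto_power) simp
   then show "(\<lambda>n. r n (fst \<xi>) * (q * ?X \<xi>)) \<longlonglongrightarrow> q * ?X \<xi>"
    using tendsto_mult_right[of "\<lambda>n. r n (fst \<xi>)" "1\<^sup>2" sequentially "q * ?X \<xi>"] by simp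
  qed
  show "(\<integral>\<^sup>+\<xi>. ennreal (r n (fst \<xi>) * (q * ?X \<xi>)) \<partial>lborel) \<le> ?D" for n
  proof (rule order_trans[OF nn_integral_mono shell_mu])
   show "real (Suc n) > 0" by simp
   fix \<xi> :: "real \<times> (real^'n)"
   show "ennreal (r n (fst \<xi>) * (q * ?X \<xi>)) \<le> ennreal ((kh (real (Suc n)) (4 ^ j) \<xi>)\<^sup>2) * (indicator (shell j) (snd \<xi>) * ennreal ((norm (Uh \<alpha> \<xi>))\<^sup>2))"
   proof (cases "snd \<xi> \<in> shell j")
    case True
    have "r n (fst \<xi>) * q = ((real (Suc n))\<^sup>2 / ((real (Suc n))\<^sup>2 + (fst \<xi>)\<^sup>2) * (1 / 17) ^ CARD('n))\<^sup>2"
     by (simp only: r_def q_def power_mult_distrib)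
    also have "\<dots> \<le> (kh (real (Suc n)) (4 ^ j) \<xi>)\<^sup>2"
     using True by (intro power_mono kh_lower) (auto simp: shell_def)
    finally have "r n (fst \<xi>) * q * (norm (Uh \<alpha> \<xi>))\<^sup>2 \<le> (kh (real (Suc n)) (4 ^ j) \<xi>)\<^sup>2 * (norm (Uh \<alpha> \<xi>))\<^sup>2"
     by (intro mult_right_mono) auto
    then show ?thesis using True by (simp add: mult.assoc ennreal_leI flip: ennreal_mult)
   qed simp
  qed
 qed
 then have "ennreal (17 ^ (2 * CARD('n))) * (\<integral>\<^sup>+\<xi>. ennreal (q * ?X \<xi>) \<partial>lborel) \<le> ennreal (17 ^ (2 * CARD('n))) * ?D"
  by (intro mult_left_mono) auto
 also have "\<dots> = ennreal ((real j + 2)\<^sup>2 * SD / 2 ^ j)"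
  by (subst ennreal_mult'[symmetric]) (simp_all add: SD_def mult_ac)
 also have "ennreal (17 ^ (2 * CARD('n))) * (\<integral>\<^sup>+\<xi>. ennreal (q * ?X \<xi>) \<partial>lborel) = (\<integral>\<^sup>+\<xi>. ennreal (17 ^ (2 * CARD('n))) * ennreal (q * ?X \<xi>) \<partial>lborel)"
  by (rule nn_integral_cmult[symmetric]) measurable
 also have "\<dots> = (\<integral>\<^sup>+\<xi>. ennreal (?X \<xi>) \<partial>lborel)"
 proof (intro nn_integral_cong)
  fix \<xi>
  have "ennreal (17 ^ (2 * CARD('n))) * ennreal (q * ?X \<xi>) = ennreal (17 ^ (2 * CARD('n)) * (q * ?X \<xi>))"
   by (rule ennreal_mult'[symmetric]) simp
  also have "17 ^ (2 * CARD('n)) * (q * ?X \<xi>) = ?X \<xi>" using q(2) by (simp only: mult.assoc[symmetric] mult_1_left)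
  finally show "ennreal (17 ^ (2 * CARD('n))) * ennreal (q * ?X \<xi>) = ennreal (?X \<xi>)" .
 qed
 finally show ?thesis .
qed

end

end

lemma ex_shell: "1 \<le> norm (\<zeta> :: real^'n) \<Longrightarrow> \<exists>j. \<zeta> \<in> shell j"
proof -
 assume a: "1 \<le> norm \<zeta>"
 obtain n where n: "norm \<zeta> < 4 ^ n" using real_arch_pow[of 4 "norm \<zeta>"] by auto
 define k where "k = (LEAST n. norm \<zeta> < 4 ^ n)"
 have k: "norm \<zeta> < 4 ^ k" unfolding k_def by (rule LeastI[of _ n]) (rule n)
 have "k \<noteq> 0"
 proof
  assume "k = 0"
  with k a show False by simp
 qed
 then obtain j where j: "k = Suc j" using not0_implies_Suc by blast
 have "\<not> norm \<zeta> < 4 ^ j" using not_less_Least[of j "\<lambda>n. norm \<zeta> < 4 ^ n"] j by (simp add: k_def)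
 then show ?thesis using k j by (intro exI[of _ j]) (simp add: shell_def)
qed

text \<open>Writing q = p^2 splits the term into two factors (j + 1) p^j up to a constant; one is
  bounded, the other summable as the derivative of the geometric series.\<close>

lemma summable_square_geometric:
 fixes q :: real
 assumes "0 \<le> q" "q < 1" shows "summable (\<lambda>j. (real j + 2)\<^sup>2 * q ^ j)"
proof -
 define p where "p = sqrt q"
 have p: "0 \<le> p" "p < 1" "q = p\<^sup>2" using assms by (auto simp: p_def real_sqrt_lt_1_iff)
 have s: "summable (\<lambda>j. real (Suc j) * p ^ j)"
  using geometric_deriv_sums[of p] p by (auto simp: sums_iff)
 have "Bseq (\<lambda>j. real (Suc j) * p ^ j)"
  by (rule convergent_imp_Bseq[OF convergentI[OF summable_LIMSEQ_zero[OF s]]])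
 then obtain B where B: "\<And>j. norm (real (Suc j) * p ^ j) \<le> B" using BseqE by blast
 have "summable (\<lambda>j. 4 * B * (real (Suc j) * p ^ j))" using s by (rule summable_mult)
 then show ?thesis
 proof (rule summable_comparison_test'[where N = 0])
  fix j :: nat
  have "(real j + 2)\<^sup>2 * q ^ j \<le> (2 * real (Suc j))\<^sup>2 * q ^ j" using assms by (intro mult_right_mono power_mono) auto
  also have "\<dots> = 4 * ((real (Suc j) * p ^ j) * (real (Suc j) * p ^ j))" unfolding p(3) by (simp only: power2_eq_square power_mult_distrib mult_ac)
  also have "\<dots> \<le> 4 * (B * (real (Suc j) * p ^ j))" using B[of j] p by (intro mult_left_mono mult_right_mono) auto
  finally show "norm ((real j + 2)\<^sup>2 * q ^ j) \<le> 4 * B * (real (Suc j) * p ^ j)" using assms by simp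
 qed
qed

lemma nn_integral_pair_snd_fst:
 fixes h :: "'a::euclidean_space \<times> 'b::euclidean_space \<Rightarrow> ennreal"
 assumes "h \<in> borel_measurable (borel \<Otimes>\<^sub>M borel)"
 shows "(\<integral>\<^sup>+y. (\<integral>\<^sup>+x. h (x, y) \<partial>lborel) \<partial>lborel) = (\<integral>\<^sup>+p. h p \<partial>(lborel \<Otimes>\<^sub>M lborel))"
  and "(\<integral>\<^sup>+x. (\<integral>\<^sup>+y. h (x, y) \<partial>lborel) \<partial>lborel) = (\<integral>\<^sup>+p. h p \<partial>(lborel \<Otimes>\<^sub>M lborel))"
 using lborel_pair.nn_integral_snd[of h] lborel.nn_integral_fst[of h] assms
 unfolding measurable_pair_lborel by auto

section \<open>The density and its spatial Fourier transform\<close>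

locale kinetic_slices = kinetic_averaging a f m T R C La Jm
 for a :: "real^'n \<Rightarrow> real^'n" and f m T R C La Jm +
 assumes slice: "\<And>t. (\<integral>\<^sup>+y. ennreal \<bar>f (t, y)\<bar> \<partial>lborel) \<le> ennreal C"
begin

definition density :: "real \<Rightarrow> real^'n \<Rightarrow> real"
 where "density t x = (LINT v|lborel. f (t, x, v))"

definition rhohat :: "real \<Rightarrow> real^'n \<Rightarrow> complex"
 where "rhohat t \<zeta> = ft (\<lambda>x. complex_of_real (density t x)) \<zeta>"

lemma density_measurable [measurable (raw)]:
 assumes [measurable]: "p \<in> borel_measurable M" "q \<in> borel_measurable M"
 shows "(\<lambda>z. density (p z) (q z)) \<in> borel_measurable M"
 unfolding density_def by measurable

lemma rhohat_measurable [measurable (raw)]: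
 assumes [measurable]: "p \<in> borel_measurable M" "q \<in> borel_measurable M"
 shows "(\<lambda>z. rhohat (p z) (q z)) \<in> borel_measurable M"
 unfolding rhohat_def by measurable

lemma density_L1: "(\<integral>\<^sup>+x. ennreal \<bar>density t x\<bar> \<partial>lborel) \<le> ennreal C"
proof -
 have "(\<integral>\<^sup>+x. ennreal \<bar>density t x\<bar> \<partial>lborel) \<le> (\<integral>\<^sup>+x. (\<integral>\<^sup>+v. ennreal \<bar>f (t, x, v)\<bar> \<partial>lborel) \<partial>lborel)"
 proof (rule nn_integral_mono)
  fix x
  show "ennreal \<bar>density t x\<bar> \<le> (\<integral>\<^sup>+v. ennreal \<bar>f (t, x, v)\<bar> \<partial>lborel)"
  proof (cases "integrable lborel (\<lambda>v. f (t, x, v))")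
   case True
   then show ?thesis using integral_norm_bound_ennreal[OF True] by (simp add: density_def)
  next
   case False
   then show ?thesis by (simp add: density_def not_integrable_integral_eq)
  qed
 qed
 also have "\<dots> = (\<integral>\<^sup>+y. ennreal \<bar>f (t, y)\<bar> \<partial>(lborel \<Otimes>\<^sub>M lborel))"
  by (rule nn_integral_pair_snd_fst(2)) (use f_measurable3[of "\<lambda>_. t" "borel \<Otimes>\<^sub>M borel" fst snd] in simp)
 also have "\<dots> \<le> ennreal C" using slice[of t] by (simp add: lborel_prod)
 finally show ?thesis .
qed

lemma density_integrable: "integrable lborel (density t)"
 using le_less_trans[OF density_L1 ennreal_less_top] by (intro integrableI_bounded) auto

definition VR :: real where "VR = measure lborel (cball (0::real^'n) R)"

lemma density_le: "\<bar>density t x\<bar> \<le> VR"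
proof -
 have i: "integrable lborel (\<lambda>v. indicat_real (cball (0::real^'n) R) v)"
  using emeasure_bounded_finite[of "cball (0::real^'n) R"] by (intro integrable_real_indicator) auto
 have b: "\<bar>f (t, x, v)\<bar> \<le> indicat_real (cball (0::real^'n) R) v" for v
  using f_le_1[of "(t, x, v)"] f_supp[of t v x] by (auto simp: indicator_def not_le)
 have fi: "integrable lborel (\<lambda>v. f (t, x, v))"
  by (rule Bochner_Integration.integrable_bound[OF i]) (use b in auto)
 have "\<bar>density t x\<bar> \<le> (LINT v|lborel. \<bar>f (t, x, v)\<bar>)" unfolding density_def by (rule integral_abs_bound)
 also have "\<dots> \<le> (LINT v|lborel. indicat_real (cball (0::real^'n) R) v)"
  using fi i b by (intro integral_mono) auto
 finally show ?thesis by (simp add: VR_def)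
qed

text \<open>With \<open>rhohat_eq_0\<close> this makes \<open>rhohat\<close> a bounded function of
  time vanishing outside [0,T], the class covered by \<open>plancherel_ge\<close>.\<close>

lemma rhohat_bound: "norm (rhohat t \<zeta>) \<le> C"
proof -
 have "ennreal (norm (rhohat t \<zeta>)) \<le> ennreal C"
  unfolding rhohat_def by (rule order_trans[OF ft_bound_ennreal]) (use density_L1[of t] in simp)
 then show ?thesis using C_nonneg by simp
qed

lemma rhohat_eq_0: "t \<notin> {0<..<T} \<Longrightarrow> rhohat t \<zeta> = 0"
 by (simp add: rhohat_def density_def f_supp ft_def)

text \<open>This controls the frequencies of norm below 1, which no shell contains. The density is
  bounded since f is bounded and its velocities lie in a ball, so its L^1 bound gives an L^2
  bound.\<close>

lemma rhohat_energy: "(\<integral>\<^sup>+p. ennreal ((norm (rhohat (fst p) (snd p)))\<^sup>2) \<partial>(lborel \<Otimes>\<^sub>M lborel)) \<le> ennreal ((2 * pi) ^ DIM(real^'n) * (VR * C) * T)"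
proof -
 let ?P = "ennreal ((2 * pi) ^ DIM(real^'n))" and ?E = "ennreal ((2 * pi) ^ DIM(real^'n) * (VR * C))"
 have V: "VR \<ge> 0" by (simp add: VR_def)
 have sl: "(\<integral>\<^sup>+\<zeta>. ennreal ((norm (rhohat t \<zeta>))\<^sup>2) \<partial>lborel) \<le> ?E" for t
 proof -
  have "(\<integral>\<^sup>+\<zeta>. ennreal ((norm (rhohat t \<zeta>))\<^sup>2) \<partial>lborel) \<le> ?P * (\<integral>\<^sup>+x. ennreal ((norm (complex_of_real (density t x)))\<^sup>2) \<partial>lborel)"
   unfolding rhohat_def by (rule plancherel_le) (use density_integrable in simp)
  also have "(\<integral>\<^sup>+x. ennreal ((norm (complex_of_real (density t x)))\<^sup>2) \<partial>lborel) \<le> (\<integral>\<^sup>+x. ennreal VR * ennreal \<bar>density t x\<bar> \<partial>lborel)"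
  proof (rule nn_integral_mono)
   fix x
   have "(norm (complex_of_real (density t x)))\<^sup>2 \<le> VR * \<bar>density t x\<bar>"
    unfolding norm_of_real power2_eq_square by (intro mult_right_mono density_le) simp
   then show "ennreal ((norm (complex_of_real (density t x)))\<^sup>2) \<le> ennreal VR * ennreal \<bar>density t x\<bar>"
    using V by (simp add: ennreal_leI flip: ennreal_mult)
  qed
  also have "\<dots> = ennreal VR * (\<integral>\<^sup>+x. ennreal \<bar>density t x\<bar> \<partial>lborel)" by (rule nn_integral_cmult) measurable
  also have "\<dots> \<le> ennreal VR * ennreal C" by (intro mult_left_mono density_L1) simp
  also have "?P * \<dots> = ?E" using V C_nonneg by (simp add: ennreal_mult)
  finally show ?thesis by (simp add: mult_left_mono)
 qed
 have "(\<integral>\<^sup>+p. ennreal ((norm (rhohat (fst p) (snd p)))\<^sup>2) \<partial>(lborel \<Otimes>\<^sub>M lborel)) = (\<integral>\<^sup>+t. (\<integral>\<^sup>+\<zeta>. ennreal ((norm (rhohat t \<zeta>))\<^sup>2) \<partial>lborel) \<partial>lborel)"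
  by (subst nn_integral_pair_snd_fst(2)[symmetric]) simp_all
 also have "\<dots> \<le> (\<integral>\<^sup>+t. ?E * indicator {0..T} t \<partial>lborel)"
 proof (rule nn_integral_mono)
  fix t
  show "(\<integral>\<^sup>+\<zeta>. ennreal ((norm (rhohat t \<zeta>))\<^sup>2) \<partial>lborel) \<le> ?E * indicator {0..T} t"
  proof (cases "t \<in> {0..T}")
   case True
   then show ?thesis using sl[of t] by simp
  next
   case False
   then have "rhohat t \<zeta> = 0" for \<zeta> by (intro rhohat_eq_0) auto
   then show ?thesis by simp
  qed
 qed
 also have "\<dots> = ?E * ennreal T" using T by (subst nn_integral_cmult_indicator) auto
 also have "\<dots> = ennreal ((2 * pi) ^ DIM(real^'n) * (VR * C) * T)"
  using V C_nonneg T by (subst ennreal_mult) auto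
 finally show ?thesis .
qed

text \<open>Separating the time transform from the space transform allows Plancherel to be reversed
  in time alone, at fixed spatial frequency.\<close>

lemma Uh_eq:
 assumes \<alpha>: "0 < \<alpha>" "6 * \<alpha> \<le> T"
 shows "Uh \<alpha> (\<tau>, \<zeta>) = ft (\<lambda>t. complex_of_real (time_cutoff \<alpha> T t) * rhohat t \<zeta>) \<tau>"
proof -
 let ?\<xi> = "(\<tau>, \<zeta>)"
 note [measurable (raw)] = gN_measurable[OF \<alpha>]
 let ?h = "\<lambda>X w. cis (- (X \<bullet> ?\<xi>)) * complex_of_real (gN \<alpha> X w)"
 have hi: "integrable (lborel \<Otimes>\<^sub>M lborel) (\<lambda>(X, w). ?h X w)"
 proof (rule Bochner_Integration.integrable_bound[OF gN_props(2)[OF \<alpha>(1)]])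
  show "(\<lambda>(X, w). ?h X w) \<in> borel_measurable (lborel \<Otimes>\<^sub>M lborel)"
   unfolding measurable_pair_lborel by measurable
 qed (auto simp: norm_mult)
 let ?H = "\<lambda>X. cis (- (X \<bullet> ?\<xi>)) * complex_of_real (time_cutoff \<alpha> T (fst X) * density (fst X) (snd X))"
 have inner: "(LINT w|lborel. ?h X w) = ?H X" for X
  by (simp add: gN_def density_def)
 have Hi: "integrable (lborel \<Otimes>\<^sub>M lborel) ?H"
  using lborel_pair.integrable_fst'[OF hi] inner by (simp add: lborel_prod)
 have "Uh \<alpha> ?\<xi> = (LINT w|lborel. (LINT X|lborel. ?h X w))" by (simp add: Uh_def gh_def ft_def)
 also have "\<dots> = (LINT X|lborel. (LINT w|lborel. ?h X w))" by (rule lborel_pair.Fubini_integral[OF hi])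
 also have "\<dots> = (LINT X|(lborel \<Otimes>\<^sub>M lborel). ?H X)" unfolding inner by (simp add: lborel_prod)
 also have "\<dots> = (LINT t|lborel. (LINT x|lborel. ?H (t, x)))" by (rule lborel_pair.integral_fst'[OF Hi, symmetric])
 also have "\<dots> = (LINT t|lborel. cis (- (t \<bullet> \<tau>)) * (complex_of_real (time_cutoff \<alpha> T t) * rhohat t \<zeta>))"
 proof (intro Bochner_Integration.integral_cong refl)
  fix t
  have "(LINT x|lborel. ?H (t, x)) = (LINT x|lborel. (cis (- (t \<bullet> \<tau>)) * complex_of_real (time_cutoff \<alpha> T t)) * (cis (- (x \<bullet> \<zeta>)) * complex_of_real (density t x)))"
  proof (intro Bochner_Integration.integral_cong refl)
   fix x
   have "cis (- ((t, x) \<bullet> ?\<xi>)) = cis (- (t \<bullet> \<tau>)) * cis (- (x \<bullet> \<zeta>))" by (simp add: cis_mult)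
   then show "?H (t, x) = (cis (- (t \<bullet> \<tau>)) * complex_of_real (time_cutoff \<alpha> T t)) * (cis (- (x \<bullet> \<zeta>)) * complex_of_real (density t x))"
    by (simp only: fst_conv snd_conv of_real_mult mult_ac)
  qed
  then show "(LINT x|lborel. ?H (t, x)) = cis (- (t \<bullet> \<tau>)) * (complex_of_real (time_cutoff \<alpha> T t) * rhohat t \<zeta>)"
   by (simp add: rhohat_def ft_def mult.assoc)
 qed
 finally show ?thesis by (simp add: ft_def)
qed

lemma shell_decay:
 "(\<integral>\<^sup>+p. ennreal (indicator (shell j) (snd p) * (norm (rhohat (fst p) (snd p)))\<^sup>2) \<partial>(lborel \<Otimes>\<^sub>M lborel)) \<le> ennreal ((real j + 2)\<^sup>2 * SD / 2 ^ j)"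
proof (rule nn_integral_limit_le)
 \<comment> \<open>The divisor 6 ensures 6 \<alpha> \<le> T, the range of the test
   estimates.\<close>
 define \<alpha> where "\<alpha> n = T / 6 * inverse (real (Suc n))" for n
 have \<alpha>: "0 < \<alpha> n" "6 * \<alpha> n \<le> T" for n
 proof -
  show "0 < \<alpha> n" using T by (simp add: \<alpha>_def)
  have "T * inverse (real (Suc n)) \<le> T * 1" using T by (intro mult_left_mono) (auto simp: inverse_eq_divide)
  then show "6 * \<alpha> n \<le> T" by (simp add: \<alpha>_def)
 qed
 have lim: "\<alpha> \<longlonglongrightarrow> 0" unfolding \<alpha>_def using tendsto_mult_right_zero[OF LIMSEQ_inverse_real_of_nat, of "T / 6"] .
 have [measurable]: "time_cutoff (\<alpha> n) T \<in> borel_measurable borel" for n by (rule time_cutoff_measurable[OF \<alpha>(1)])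
 let ?u = "\<lambda>n p. ennreal (indicator (shell j) (snd p) * (norm (complex_of_real (time_cutoff (\<alpha> n) T (fst p)) * rhohat (fst p) (snd p)))\<^sup>2)"
 have um [measurable]: "?u n \<in> borel_measurable (borel \<Otimes>\<^sub>M borel)" for n by measurable
 show "?u n \<in> borel_measurable (lborel \<Otimes>\<^sub>M lborel)" for n using um unfolding measurable_pair_lborel .
 show "AE p in lborel \<Otimes>\<^sub>M lborel. (\<lambda>n. ?u n p) \<longlonglongrightarrow> ennreal (indicator (shell j) (snd p) * (norm (rhohat (fst p) (snd p)))\<^sup>2)"
 proof (rule AE_I2)
  fix p :: "real \<times> (real^'n)"
  show "(\<lambda>n. ?u n p) \<longlonglongrightarrow> ennreal (indicator (shell j) (snd p) * (norm (rhohat (fst p) (snd p)))\<^sup>2)"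
  proof (cases "fst p \<in> {0<..<T}")
   case True
   have "\<forall>\<^sub>F n in sequentially. \<alpha> n < min (fst p) (T - fst p) / 2"
    using True by (intro order_tendstoD(2)[OF lim]) auto
   then have "\<forall>\<^sub>F n in sequentially. ?u n p = ennreal (indicator (shell j) (snd p) * (norm (rhohat (fst p) (snd p)))\<^sup>2)"
   proof eventually_elim
    case (elim n)
    then have "time_cutoff (\<alpha> n) T (fst p) = 1" using \<alpha>(1)[of n] by (intro time_cutoff_eq_1) auto
    then show ?case by simp
   qed
   then show ?thesis by (rule tendsto_eventually)
  next
   case False
   then show ?thesis by (simp add: rhohat_eq_0)
  qed
 qed
 fix n
 let ?D = "ennreal ((real j + 2)\<^sup>2 * SD / 2 ^ j)"
 let ?g = "\<lambda>\<zeta> t. complex_of_real (time_cutoff (\<alpha> n) T t) * rhohat t \<zeta>"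
 note [measurable (raw)] = Uh_measurable[OF \<alpha>]
 have "(\<integral>\<^sup>+p. ?u n p \<partial>(lborel \<Otimes>\<^sub>M lborel)) = (\<integral>\<^sup>+\<zeta>. (\<integral>\<^sup>+t. ?u n (t, \<zeta>) \<partial>lborel) \<partial>lborel)"
  by (rule nn_integral_pair_snd_fst(1)[symmetric, OF um])
 also have "\<dots> \<le> (\<integral>\<^sup>+\<zeta>. (\<integral>\<^sup>+\<tau>. ennreal (indicator (shell j) \<zeta> * (norm (Uh (\<alpha> n) (\<tau>, \<zeta>)))\<^sup>2) \<partial>lborel) \<partial>lborel)"
 proof (rule nn_integral_mono)
  fix \<zeta> :: "real^'n"
  \<comment> \<open>The factor 2 pi \<ge> 1 of Plancherel's identity is given away.\<close>
  have "(\<integral>\<^sup>+t. ennreal ((norm (?g \<zeta> t))\<^sup>2) \<partial>lborel) = 1 * (\<integral>\<^sup>+t. ennreal ((norm (?g \<zeta> t))\<^sup>2) \<partial>lborel)" by simp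
  also have "\<dots> \<le> ennreal (2 * pi) * (\<integral>\<^sup>+t. ennreal ((norm (?g \<zeta> t))\<^sup>2) \<partial>lborel)"
   using pi_gt3 by (intro mult_right_mono) auto
  also have "\<dots> \<le> (\<integral>\<^sup>+\<tau>. ennreal ((norm (ft (?g \<zeta>) \<tau>))\<^sup>2) \<partial>lborel)"
  proof (rule plancherel_ge[where B = C and T = T])
   show "?g \<zeta> \<in> borel_measurable borel" by measurable
   fix t
   show "norm (?g \<zeta> t) \<le> C"
    using mult_mono[OF time_cutoff_bounds(2)[of "\<alpha> n" T t] rhohat_bound[of t \<zeta>]] time_cutoff_bounds(1)[of "\<alpha> n" T t] by (simp add: norm_mult)
   show "t \<notin> {0..T} \<Longrightarrow> ?g \<zeta> t = 0" using rhohat_eq_0[of t \<zeta>] by fastforce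
  qed
  finally have "(\<integral>\<^sup>+t. ennreal ((norm (?g \<zeta> t))\<^sup>2) \<partial>lborel) \<le> (\<integral>\<^sup>+\<tau>. ennreal ((norm (Uh (\<alpha> n) (\<tau>, \<zeta>)))\<^sup>2) \<partial>lborel)"
   unfolding Uh_eq[OF \<alpha>] .
  then show "(\<integral>\<^sup>+t. ?u n (t, \<zeta>) \<partial>lborel) \<le> (\<integral>\<^sup>+\<tau>. ennreal (indicator (shell j) \<zeta> * (norm (Uh (\<alpha> n) (\<tau>, \<zeta>)))\<^sup>2) \<partial>lborel)"
   by (cases "\<zeta> \<in> shell j") auto
 qed
 also have "\<dots> = (\<integral>\<^sup>+\<xi>. ennreal (indicator (shell j) (snd \<xi>) * (norm (Uh (\<alpha> n) \<xi>))\<^sup>2) \<partial>(lborel \<Otimes>\<^sub>M lborel))"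
 proof -
  have "(\<lambda>\<xi>::real \<times> (real^'n). \<xi>) \<in> borel_measurable (borel \<Otimes>\<^sub>M borel)" by (simp add: borel_prod)
  note i = this
  have U: "(\<lambda>\<xi>. norm (Uh (\<alpha> n) \<xi>)) \<in> borel_measurable (borel \<Otimes>\<^sub>M borel)"
   by (rule measurable_compose[OF Uh_measurable[OF \<alpha>(1)[of n] \<alpha>(2)[of n] i]]) simp
  have I: "(\<lambda>\<xi>::real \<times> (real^'n). indicator (shell j) (snd \<xi>) :: real) \<in> borel_measurable (borel \<Otimes>\<^sub>M borel)"
   by (rule measurable_compose[OF measurable_snd]) simp
  have m: "(\<lambda>\<xi>. ennreal (indicator (shell j) (snd \<xi>) * (norm (Uh (\<alpha> n) \<xi>))\<^sup>2)) \<in> borel_measurable (borel \<Otimes>\<^sub>M borel)"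
   by (intro measurable_compose[OF _ measurable_ennreal] borel_measurable_times borel_measurable_power I U)
  show ?thesis unfolding nn_integral_pair_snd_fst(1)[OF m, symmetric] by simp
 qed
 also have "\<dots> \<le> ?D" using shell_freq[OF \<alpha>] by (simp add: lborel_prod)
 finally show "(\<integral>\<^sup>+p. ?u n p \<partial>(lborel \<Otimes>\<^sub>M lborel)) \<le> ?D" .
qed

text \<open>On shell j the Sobolev weight is at most 17 times 16^(s j), while the energy is at most
  a multiple of (j + 2)^2 2^(-j). The series converges because 16^s / 2 < 1, which is precisely s <
  1/4.\<close>

lemma sobolev_finite_nonneg:
 assumes s: "0 \<le> s" "s < 1 / 4"
 shows "(\<integral>\<^sup>+p. ennreal ((1 + (norm (snd p))\<^sup>2) powr s * (norm (rhohat (fst p) (snd p)))\<^sup>2) \<partial>(lborel \<Otimes>\<^sub>M lborel)) < \<infinity>"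
proof -
 let ?U = "\<lambda>p. (norm (rhohat (fst p) (snd p)))\<^sup>2"
 define q where "q = 16 powr s / (2::real)"
 have "16 powr s < 16 powr (1 / 4 :: real)" using s by (intro powr_less_mono) auto
 also have "16 powr (1 / 4 :: real) = 2"
 proof -
  have "16 powr (1 / 4 :: real) = (2 powr 4) powr (1 / 4)" by simp
  then show ?thesis unfolding powr_powr by simp
 qed
 finally have q: "0 \<le> q" "q < 1" by (auto simp: q_def)
 have SD0: "SD \<ge> 0" using SC_nonneg by (simp add: SD_def)
 define b :: "nat \<Rightarrow> real" where "b j = 17 * (16 powr s) ^ j" for j
 have b0: "b j \<ge> 0" for j by (simp add: b_def)
 have Um [measurable]: "(\<lambda>p. ?U p) \<in> borel_measurable (borel \<Otimes>\<^sub>M borel)" by measurable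
 have pw: "ennreal ((1 + (norm (snd p))\<^sup>2) powr s * ?U p) \<le> ennreal 2 * ennreal (?U p) + (\<Sum>j. ennreal (b j) * ennreal (indicator (shell j) (snd p) * ?U p))" for p
 proof (cases "norm (snd p) \<le> 1")
  case True
  have "(1 + (norm (snd p))\<^sup>2) powr s \<le> (1 + (norm (snd p))\<^sup>2) powr 1" using s by (intro powr_mono) auto
  also have "\<dots> = 1 + (norm (snd p))\<^sup>2" by (simp add: add_pos_nonneg)
  also have "\<dots> \<le> 2" using True by (simp add: power_le_one)
  finally have "(1 + (norm (snd p))\<^sup>2) powr s * ?U p \<le> 2 * ?U p" by (intro mult_right_mono) auto
  then have "ennreal ((1 + (norm (snd p))\<^sup>2) powr s * ?U p) \<le> ennreal 2 * ennreal (?U p)"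
   by (subst ennreal_mult'[symmetric]) (auto intro: ennreal_leI)
  then show ?thesis by (rule add_increasing2[OF zero_le])
 next
  case False
  then obtain j where j: "snd p \<in> shell j" using ex_shell[of "snd p"] by auto
  have "(norm (snd p))\<^sup>2 \<le> (4 * 4 ^ j)\<^sup>2" using j by (intro power_mono) (auto simp: shell_def)
  also have "\<dots> = 16 * 16 ^ j"
  proof -
   have "((4::real) ^ j)\<^sup>2 = (4\<^sup>2) ^ j" unfolding power_mult[symmetric] by (simp only: mult.commute)
   then show ?thesis by (simp add: power_mult_distrib)
  qed
  \<comment> \<open>The constant is 16 + 1, from |\<zeta>| \<le> 4 * 4^j and 1 \<le> 16^j.\<close>
  finally have "1 + (norm (snd p))\<^sup>2 \<le> 17 * 16 ^ j" using one_le_power[of "16::real" j] by linarith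
  then have "(1 + (norm (snd p))\<^sup>2) powr s \<le> (17 * 16 ^ j) powr s" using s by (intro powr_mono2) (auto intro: add_nonneg_nonneg)
  also have "\<dots> = 17 powr s * (16 powr s) ^ j" by (simp add: powr_mult powr_power powr_realpow[symmetric] powr_powr mult.commute)
  also have "\<dots> \<le> 17 powr 1 * (16 powr s) ^ j" using s by (intro mult_right_mono powr_mono) auto
  finally have "(1 + (norm (snd p))\<^sup>2) powr s * ?U p \<le> b j * ?U p" by (intro mult_right_mono) (auto simp: b_def)
  then have "ennreal ((1 + (norm (snd p))\<^sup>2) powr s * ?U p) \<le> ennreal (b j) * ennreal (indicator (shell j) (snd p) * ?U p)"
   using j b0[of j] by (subst ennreal_mult'[symmetric]) (auto intro: ennreal_leI)
  also have "\<dots> = (\<Sum>i\<in>{j}. ennreal (b i) * ennreal (indicator (shell i) (snd p) * ?U p))" by simp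
  also have "\<dots> \<le> (\<Sum>i. ennreal (b i) * ennreal (indicator (shell i) (snd p) * ?U p))"
   by (rule sum_le_suminf) auto
  finally show ?thesis by (rule add_increasing[OF zero_le])
 qed
 have "(\<integral>\<^sup>+p. ennreal ((1 + (norm (snd p))\<^sup>2) powr s * ?U p) \<partial>(lborel \<Otimes>\<^sub>M lborel)) \<le>
  (\<integral>\<^sup>+p. ennreal 2 * ennreal (?U p) + (\<Sum>j. ennreal (b j) * ennreal (indicator (shell j) (snd p) * ?U p)) \<partial>(lborel \<Otimes>\<^sub>M lborel))"
  by (intro nn_integral_mono pw)
 also have "\<dots> = ennreal 2 * (\<integral>\<^sup>+p. ennreal (?U p) \<partial>(lborel \<Otimes>\<^sub>M lborel)) + (\<Sum>j. ennreal (b j) * (\<integral>\<^sup>+p. ennreal (indicator (shell j) (snd p) * ?U p) \<partial>(lborel \<Otimes>\<^sub>M lborel)))"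
 proof -
  have m1: "(\<lambda>p. ennreal (?U p)) \<in> borel_measurable (lborel \<Otimes>\<^sub>M lborel)" unfolding measurable_pair_lborel by measurable
  have m2: "(\<lambda>p. ennreal (indicator (shell j) (snd p) * ?U p)) \<in> borel_measurable (lborel \<Otimes>\<^sub>M lborel)" for j
   unfolding measurable_pair_lborel by measurable
  show ?thesis using m1 m2 by (simp add: nn_integral_add nn_integral_suminf nn_integral_cmult)
 qed
 also have "\<dots> \<le> ennreal 2 * ennreal ((2 * pi) ^ DIM(real^'n) * (VR * C) * T) + (\<Sum>j. ennreal (17 * SD * ((real j + 2)\<^sup>2 * q ^ j)))"
 proof (intro add_mono mult_left_mono rhohat_energy suminf_le summableI)
  fix j
  have "ennreal (b j) * (\<integral>\<^sup>+p. ennreal (indicator (shell j) (snd p) * ?U p) \<partial>(lborel \<Otimes>\<^sub>M lborel)) \<le> ennreal (b j) * ennreal ((real j + 2)\<^sup>2 * SD / 2 ^ j)"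
   by (intro mult_left_mono shell_decay) simp
  also have "\<dots> = ennreal (17 * SD * ((real j + 2)\<^sup>2 * q ^ j))"
   by (subst ennreal_mult'[symmetric, OF b0]) (simp add: b_def q_def power_divide mult_ac)
  finally show "ennreal (b j) * (\<integral>\<^sup>+p. ennreal (indicator (shell j) (snd p) * ?U p) \<partial>(lborel \<Otimes>\<^sub>M lborel)) \<le> ennreal (17 * SD * ((real j + 2)\<^sup>2 * q ^ j))" .
 qed simp
 also have "\<dots> < \<infinity>"
 proof -
  have "(\<Sum>j. ennreal (17 * SD * ((real j + 2)\<^sup>2 * q ^ j))) = ennreal (\<Sum>j. 17 * SD * ((real j + 2)\<^sup>2 * q ^ j))"
   using SD0 q by (intro suminf_ennreal2 summable_mult summable_square_geometric) auto
  then show ?thesis by (simp add: ennreal_mult_less_top)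
 qed
 finally show ?thesis .
qed

text \<open>For negative exponents the weight is at most 1, its value for s = 0.\<close>

theorem sobolev_finite:
 assumes "s < 1 / 4"
 shows "(\<integral>\<^sup>+p. ennreal ((1 + (norm (snd p))\<^sup>2) powr s * (norm (rhohat (fst p) (snd p)))\<^sup>2) \<partial>(lborel \<Otimes>\<^sub>M lborel)) < \<infinity>"
proof (rule le_less_trans[OF nn_integral_mono sobolev_finite_nonneg[of "max s 0"]])
 fix p
 show "ennreal ((1 + (norm (snd p))\<^sup>2) powr s * (norm (rhohat (fst p) (snd p)))\<^sup>2) \<le> ennreal ((1 + (norm (snd p))\<^sup>2) powr (max s 0) * (norm (rhohat (fst p) (snd p)))\<^sup>2)"
  by (intro ennreal_leI mult_right_mono powr_mono) auto
qed (use assms in auto)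

end

section \<open>Sobolev norms through Borel representatives\<close>

lemma AE_lborel_lebesgue_on:
 fixes P :: "'a::euclidean_space \<Rightarrow> bool"
 assumes "AE t in lborel. P t" "S \<in> sets lebesgue"
 shows "AE t in lebesgue_on S. P t"
 using AE_completion[OF assms(1)] assms(2) by (subst AE_restrict_space_iff) (auto elim: eventually_mono)

lemma measurable_lebesgue_on_AE:
 fixes N k :: "real \<Rightarrow> real"
 assumes N: "N \<in> borel_measurable borel" and S: "S \<in> sets lebesgue" and AE: "AE t in lebesgue_on S. N t = k t"
 shows "k \<in> borel_measurable (lebesgue_on S)"
proof -
 have S': "S \<inter> space lebesgue \<in> sets lebesgue" using S by simp
 have Nm: "N \<in> borel_measurable lebesgue" using N by (intro measurable_completion) simp
 have 1: "(\<lambda>t. indicator S t *\<^sub>R N t) \<in> borel_measurable lebesgue"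
  using S Nm by (intro borel_measurable_scaleR borel_measurable_indicator)
 have 2: "AE t in lebesgue. indicator S t *\<^sub>R N t = indicator S t *\<^sub>R k t"
  using AE unfolding AE_restrict_space_iff[OF S'] by eventually_elim (auto simp: indicator_def)
 show ?thesis
  unfolding borel_measurable_restrict_space_iff[OF S'] by (rule borel_measurable_AE[OF 1 2])
qed

lemma complex_borel_version:
 fixes G :: "'a::euclidean_space \<Rightarrow> complex"
 assumes G: "G \<in> borel_measurable lebesgue"
 obtains H where "H \<in> borel_measurable borel" "AE \<xi> in lborel. G \<xi> = H \<xi>"
proof -
 have "(\<lambda>\<xi>. Re (G \<xi>)) \<in> borel_measurable lebesgue" "(\<lambda>\<xi>. Im (G \<xi>)) \<in> borel_measurable lebesgue"
  using G by (auto intro: measurable_compose[OF G])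
 then obtain p q where [measurable]: "p \<in> borel_measurable borel" "q \<in> borel_measurable borel"
   and pq: "AE \<xi> in lborel. Re (G \<xi>) = p \<xi>" "AE \<xi> in lborel. Im (G \<xi>) = q \<xi>"
  using completion_ex_borel_measurable_real[of "\<lambda>\<xi>. Re (G \<xi>)" lborel] completion_ex_borel_measurable_real[of "\<lambda>\<xi>. Im (G \<xi>)" lborel]
  by auto
 show thesis
 proof (rule that)
  show "(\<lambda>\<xi>. complex_of_real (p \<xi>) + \<i> * complex_of_real (q \<xi>)) \<in> borel_measurable borel" by measurable
  show "AE \<xi> in lborel. G \<xi> = complex_of_real (p \<xi>) + \<i> * complex_of_real (q \<xi>)"
   using pq by eventually_elim (simp add: complex_eq_iff)
 qed
qed

text \<open>\<open>fourier_transform\<close> is a choice that is fixed only up to null sets and may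
  vary irregularly with a parameter. Any Borel version of a transform computes the norm, and that
  version can be jointly measurable in time.\<close>

lemma Hs_norm_eq:
 fixes h :: "'a::euclidean_space \<Rightarrow> real"
 assumes h: "has_fourier_transform h G" and H [measurable]: "H \<in> borel_measurable borel" and GH: "AE \<xi> in lborel. G \<xi> = H \<xi>"
 shows "Hs_norm s h = sqrt (LINT \<xi>|lborel. (1 + (norm \<xi>)\<^sup>2) powr s * (norm (H \<xi>))\<^sup>2)"
proof -
 let ?w = "\<lambda>\<xi>::'a. (1 + (norm \<xi>)\<^sup>2) powr s"
 have m: "(\<lambda>\<xi>. ?w \<xi> * (norm (H \<xi>))\<^sup>2) \<in> borel_measurable lborel" by measurable
 have ml: "(\<lambda>\<xi>. ?w \<xi> * (norm (H \<xi>))\<^sup>2) \<in> borel_measurable lebesgue" by (rule measurable_completion[OF m])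
 have "AE \<xi> in lborel. ?w \<xi> * (norm (H \<xi>))\<^sup>2 = ?w \<xi> * (norm (fourier_transform h \<xi>))\<^sup>2"
  using fourier_transform_eq[OF h] GH by eventually_elim simp
 then have ae: "AE \<xi> in lebesgue. ?w \<xi> * (norm (H \<xi>))\<^sup>2 = ?w \<xi> * (norm (fourier_transform h \<xi>))\<^sup>2" by (rule AE_completion)
 have "(LINT \<xi>|lebesgue. ?w \<xi> * (norm (fourier_transform h \<xi>))\<^sup>2) = (LINT \<xi>|lebesgue. ?w \<xi> * (norm (H \<xi>))\<^sup>2)"
  by (rule integral_cong_AE[OF ml borel_measurable_AE[OF ml ae] ae, symmetric])
 also have "\<dots> = (LINT \<xi>|lborel. ?w \<xi> * (norm (H \<xi>))\<^sup>2)" by (rule integral_completion[OF m])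
 finally show ?thesis by (simp add: Hs_norm_def)
qed

text \<open>A single jointly measurable family U of transforms settles all three conjuncts: Fubini
  gives membership for almost every t, measurability of the distance to a fixed element, and
  integrability of the squared norm.\<close>

lemma L2_HsI:
 fixes u :: "real \<times> 'a::euclidean_space \<Rightarrow> real" and U :: "real \<Rightarrow> 'a \<Rightarrow> complex"
 assumes Um: "case_prod U \<in> borel_measurable (borel \<Otimes>\<^sub>M borel)"
  and ft: "AE t in lebesgue_on {0..T}. has_fourier_transform (\<lambda>x. u (t, x)) (U t)"
  and fin: "(\<integral>\<^sup>+p. ennreal ((1 + (norm (snd p))\<^sup>2) powr s * (norm (U (fst p) (snd p)))\<^sup>2) \<partial>(lborel \<Otimes>\<^sub>M lborel)) < \<infinity>"
 shows "L2_Hs T s u"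
proof -
 let ?w = "\<lambda>\<xi>::'a. (1 + (norm \<xi>)\<^sup>2) powr s"
 have Ur [measurable (raw)]: "(\<lambda>z. U (p z) (q z)) \<in> borel_measurable M"
  if "p \<in> borel_measurable M" "q \<in> borel_measurable M" for p q and M :: "'z measure"
  using measurable_compose[OF measurable_Pair[OF that] Um] by simp
 let ?F = "\<lambda>p. ?w (snd p) * (norm (U (fst p) (snd p)))\<^sup>2"
 have Fm: "?F \<in> borel_measurable (borel \<Otimes>\<^sub>M borel)" by measurable
 then have Fm': "?F \<in> borel_measurable (lborel \<Otimes>\<^sub>M lborel)" unfolding measurable_pair_lborel .
 have Fi: "integrable (lborel \<Otimes>\<^sub>M lborel) ?F"
  using fin by (intro integrableI_bounded Fm') simp
 have slice: "AE t in lborel. integrable lborel (\<lambda>\<xi>. ?w \<xi> * (norm (U t \<xi>))\<^sup>2)"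
  using lborel_pair.AE_integrable_fst'[OF Fi] by simp
 have S: "{0..T} \<in> sets lebesgue" by simp
 define N2 where "N2 t = (LINT \<xi>|lborel. ?w \<xi> * (norm (U t \<xi>))\<^sup>2)" for t
 have N2m [measurable]: "N2 \<in> borel_measurable borel" unfolding N2_def by measurable
 have N2i: "integrable lborel N2" unfolding N2_def using lborel_pair.integrable_fst'[OF Fi] by simp
 have N20: "N2 t \<ge> 0" for t unfolding N2_def by (rule Bochner_Integration.integral_nonneg) simp
 have Um1: "U t \<in> borel_measurable borel" for t by measurable
 show ?thesis
  unfolding L2_Hs_def
 proof (intro conjI ballI)
  show "AE t in lebesgue_on {0..T}. (\<lambda>x. u (t, x)) \<in> Hs s"
   using ft AE_lborel_lebesgue_on[OF slice S]
  proof eventually_elim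
   fix t assume t: "has_fourier_transform (\<lambda>x. u (t, x)) (U t)" "integrable lborel (\<lambda>\<xi>. ?w \<xi> * (norm (U t \<xi>))\<^sup>2)"
   have "integrable lebesgue (\<lambda>\<xi>. ?w \<xi> * (norm (U t \<xi>))\<^sup>2)"
    using t(2) by (subst integrable_completion) auto
   then show "(\<lambda>x. u (t, x)) \<in> Hs s" using t(1) unfolding Hs_def by blast
  qed
 next
  fix g :: "'a \<Rightarrow> real" assume "g \<in> Hs s"
  then obtain G where G: "has_fourier_transform g G" unfolding Hs_def by auto
  have "G \<in> borel_measurable lebesgue"
   \<comment> \<open>Membership in \<open>Hs\<close> does not state measurability of G outright;
     integrability against all Schwartz functions yields it, and then a Borel version
     exists.\<close>
   by (rule schwartz_integrals(1)) (use G in \<open>auto simp: has_fourier_transform_def\<close>)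
  then obtain H where H [measurable]: "H \<in> borel_measurable borel" and GH: "AE \<xi> in lborel. G \<xi> = H \<xi>"
   by (rule complex_borel_version)
  let ?N = "\<lambda>t. sqrt (LINT \<xi>|lborel. ?w \<xi> * (norm (U t \<xi> - H \<xi>))\<^sup>2)"
  show "(\<lambda>t. Hs_norm s (\<lambda>x. u (t, x) - g x)) \<in> borel_measurable (lebesgue_on {0..T})"
  proof (rule measurable_lebesgue_on_AE[OF _ S])
   show "?N \<in> borel_measurable borel" by measurable
   show "AE t in lebesgue_on {0..T}. ?N t = Hs_norm s (\<lambda>x. u (t, x) - g x)"
    using ft
   proof eventually_elim
    fix t assume t: "has_fourier_transform (\<lambda>x. u (t, x)) (U t)"
    have "(\<lambda>\<xi>. U t \<xi> - H \<xi>) \<in> borel_measurable borel" by measurable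
    moreover have "AE \<xi> in lborel. U t \<xi> - G \<xi> = U t \<xi> - H \<xi>" using GH by eventually_elim simp
    ultimately show "?N t = Hs_norm s (\<lambda>x. u (t, x) - g x)"
     by (rule Hs_norm_eq[OF has_fourier_transform_diff[OF t G], symmetric])
   qed
  qed
 next
  have ae: "AE t in lebesgue_on {0..T}. N2 t = (Hs_norm s (\<lambda>x. u (t, x)))\<^sup>2"
   using ft
  proof eventually_elim
   fix t assume t: "has_fourier_transform (\<lambda>x. u (t, x)) (U t)"
   have "Hs_norm s (\<lambda>x. u (t, x)) = sqrt (N2 t)"
    unfolding N2_def by (rule Hs_norm_eq[OF t Um1]) simp
   then show "N2 t = (Hs_norm s (\<lambda>x. u (t, x)))\<^sup>2" using N20[of t] by simp
  qed
  have "integrable lebesgue N2" using N2i by (subst integrable_completion) auto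
  have S': "{0..T} \<inter> space lebesgue \<in> sets lebesgue" by simp
  have "integrable (lebesgue_on {0..T}) N2"
   unfolding integrable_restrict_space[OF S'] by (rule integrable_mult_indicator[OF S \<open>integrable lebesgue N2\<close>])
  then show "integrable (lebesgue_on {0..T}) (\<lambda>t. (Hs_norm s (\<lambda>x. u (t, x)))\<^sup>2)"
   by (rule integrable_cong_AE_imp[OF _ measurable_lebesgue_on_AE[OF N2m S ae]]) (use ae in \<open>auto elim: eventually_mono\<close>)
 qed
qed

section \<open>Normalisation of the hypotheses\<close>

lemma AE_lborel_pair:
 fixes P :: "'a::euclidean_space \<times> 'b::euclidean_space \<Rightarrow> bool"
 assumes "AE z in lborel. P z"
 shows "AE x in lborel. AE y in lborel. P (x, y)"
 using assms unfolding lborel_prod[symmetric] by (rule lborel_pair.AE_pair)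

lemma partial_eq_0:
 assumes "closed K" "\<And>z. z \<notin> K \<Longrightarrow> \<phi> z = 0" "z \<notin> K"
 shows "partial b \<phi> z = 0"
proof -
 have "((\<lambda>_. 0) has_derivative (\<lambda>_. 0)) (at z)" by simp
 then have "(\<phi> has_derivative (\<lambda>_. 0)) (at z)"
  by (rule has_derivative_transform_within_open[of _ _ _ _ "- K"]) (use assms in auto)
 from frechet_derivative_at[OF this] show ?thesis by (simp add: partial_def fun_eq_iff flip: frechet_derivative_at)
qed

lemma smooth_partial_measurable:
 fixes \<phi> :: "'a::euclidean_space \<Rightarrow> real"
 assumes "smooth \<phi>" "b \<in> Basis"
 shows "partial b \<phi> \<in> borel_measurable borel"
proof -
 have "iterated_partial [b] \<phi> differentiable_on UNIV"
  using assms unfolding smooth_def by (metis Cons_in_lists_iff lists.Nil)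
 then have "partial b \<phi> differentiable_on UNIV" by simp
 then show ?thesis by (intro borel_measurable_continuous_onI differentiable_imp_continuous_on)
qed

lemma positive_time_borel: "(positive_time :: (real \<times> 'a::euclidean_space) set) \<in> sets borel"
 by (intro borel_open open_Times) auto

text \<open>Only an upper bound for integrals of functions of a(v) is kept: the density in the
  change of variables is replaced by its essential supremum.\<close>

lemma bounded_jacobian_change:
 fixes a :: "real^'n \<Rightarrow> real^'n"
 assumes J: "Linfty lebesgue (inverse_jacobian a)" and cv: "change_of_variables a"
 obtains Jm where "Jm > 0" "\<And>\<psi>. \<psi> \<in> borel_measurable borel \<Longrightarrow>
   (\<integral>\<^sup>+v. \<psi> (a v) \<partial>lborel) \<le> ennreal Jm * (\<integral>\<^sup>+w. \<psi> w \<partial>lborel)"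
proof -
 obtain B where B: "AE w in lebesgue. \<bar>inverse_jacobian a w\<bar> \<le> B" using J unfolding Linfty_def by auto
 \<comment> \<open>The maximum with 1 makes the constant positive.\<close>
 show thesis
 proof (rule that[of "max B 1"])
  fix \<psi> :: "real^'n \<Rightarrow> ennreal" assume p [measurable]: "\<psi> \<in> borel_measurable borel"
  have "(\<integral>\<^sup>+v. \<psi> (a v) \<partial>lborel) = (\<integral>\<^sup>+v. \<psi> (a v) \<partial>lebesgue)" by (rule nn_integral_completion[symmetric])
  also have "\<dots> = (\<integral>\<^sup>+w. \<psi> w * ennreal (inverse_jacobian a w) \<partial>lebesgue)"
   using cv p unfolding change_of_variables_def by blast
  also have "\<dots> \<le> (\<integral>\<^sup>+w. \<psi> w * ennreal (max B 1) \<partial>lebesgue)"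
   by (rule nn_integral_mono_AE) (use B in \<open>auto elim!: eventually_mono intro!: mult_left_mono ennreal_leI\<close>)
  also have "\<dots> = (\<integral>\<^sup>+w. \<psi> w * ennreal (max B 1) \<partial>lborel)" by (rule nn_integral_completion)
  also have "\<dots> = ennreal (max B 1) * (\<integral>\<^sup>+w. \<psi> w \<partial>lborel)" by (simp add: nn_integral_multc mult.commute)
  finally show "(\<integral>\<^sup>+v. \<psi> (a v) \<partial>lborel) \<le> ennreal (max B 1) * (\<integral>\<^sup>+w. \<psi> w \<partial>lborel)" .
 qed simp
qed

text \<open>All bounds given almost everywhere are made to hold everywhere: take a Borel version,
  clamp it to [-1,1], restrict it to times in ]0,T[ and velocities in a ball containing K, and erase
  the time slices of too large L^1 norm.\<close>

lemma regular_representative: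
 fixes f :: "real \<times> (real^'n) \<times> (real^'n) \<Rightarrow> real"
 assumes T: "T > 0" and f: "Linfty (lebesgue_on positive_time) f"
  and f1: "AE z in lebesgue_on positive_time. -1 \<le> f z \<and> f z \<le> 1" and L1: "Linfty_L1 T f"
  and K: "compact K" "AE (t, x, v) in lebesgue_on positive_time. v \<notin> K \<longrightarrow> f (t, x, v) = 0"
 obtains F R C where "F \<in> borel_measurable borel" "R \<ge> 0" "C \<ge> 0" "\<forall>z. \<bar>F z\<bar> \<le> 1"
  "\<forall>t x v. t \<notin> {0<..<T} \<or> R < norm v \<longrightarrow> F (t, x, v) = 0"
  "\<forall>t. (\<integral>\<^sup>+y. ennreal \<bar>F (t, y)\<bar> \<partial>lborel) \<le> ennreal C"
  "AE z in lborel. fst z \<in> {0<..<T} \<longrightarrow> F z = f z"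
proof -
 let ?P = "positive_time :: (real \<times> (real^'n) \<times> (real^'n)) set"
 have P: "?P \<in> sets lebesgue" using positive_time_borel by (metis sets_completionI_sets sets_lborel)
 have P': "?P \<inter> space lebesgue \<in> sets lebesgue" using P by simp
 have "(\<lambda>z. indicator ?P z *\<^sub>R f z) \<in> borel_measurable lebesgue"
  using f unfolding Linfty_def borel_measurable_restrict_space_iff[OF P'] by blast
 then obtain g where g [measurable]: "g \<in> borel_measurable borel" and fg: "AE z in lborel. indicator ?P z *\<^sub>R f z = g z"
  using completion_ex_borel_measurable_real[of "\<lambda>z. indicator ?P z *\<^sub>R f z" lborel] by auto
 obtain R where R: "R \<ge> 0" "\<And>v. v \<in> K \<Longrightarrow> norm v \<le> R"
  using compact_imp_bounded[OF K(1)] unfolding bounded_pos by (meson less_imp_le)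
 obtain C1 where C1: "AE t in lebesgue_on {0..T}. integrable lebesgue (\<lambda>z. f (t, z)) \<and> (LINT z|lebesgue. \<bar>f (t, z)\<bar>) \<le> C1"
  using L1 unfolding Linfty_L1_def by auto
 define C where "C = max C1 0"
 define S where "S = {z :: real \<times> (real^'n) \<times> (real^'n). 0 < fst z \<and> fst z < T \<and> norm (snd (snd z)) \<le> R}"
 have mfst: "(fst :: real \<times> (real^'n) \<times> (real^'n) \<Rightarrow> real) \<in> borel_measurable borel"
  and mss: "(\<lambda>z :: real \<times> (real^'n) \<times> (real^'n). norm (snd (snd z))) \<in> borel_measurable borel"
  by (intro borel_measurable_continuous_onI continuous_intros)+
 have S: "S \<in> sets borel"
 proof -
  have "S = {z. 0 < fst z} \<inter> {z. fst z < T} \<inter> {z. norm (snd (snd z)) \<le> R}" by (auto simp: S_def)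
  moreover have "{z :: real \<times> (real^'n) \<times> (real^'n). 0 < fst z} \<in> sets borel" "{z :: real \<times> (real^'n) \<times> (real^'n). fst z < T} \<in> sets borel"
   "{z :: real \<times> (real^'n) \<times> (real^'n). norm (snd (snd z)) \<le> R} \<in> sets borel"
   using borel_measurable_less[OF borel_measurable_const[of 0] mfst] borel_measurable_less[OF mfst borel_measurable_const[of T]]
    borel_measurable_le[OF mss borel_measurable_const[of R]] by simp_all
  ultimately show ?thesis by (metis sets.Int)
 qed
 define g1 where "g1 z = indicator S z * max (-1) (min 1 (g z))" for z
 have g1m [measurable]: "g1 \<in> borel_measurable borel" unfolding g1_def using S by measurable
 have g1b: "\<bar>g1 z\<bar> \<le> 1" for z by (auto simp: g1_def indicator_def)
 have g1s: "g1 (t, x, v) = 0" if "t \<notin> {0<..<T} \<or> R < norm v" for t x v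
  using that by (auto simp: g1_def S_def indicator_def)
 have sl: "(\<lambda>y. h (t, y)) \<in> borel_measurable borel" if "h \<in> borel_measurable borel"
  for t and h :: "real \<times> (real^'n) \<times> (real^'n) \<Rightarrow> real"
  by (rule measurable_compose[OF _ that]) simp
 have e1: "AE z in lborel. fst z \<in> {0<..<T} \<longrightarrow> g1 z = f z"
 proof -
  have "AE z in lebesgue. z \<in> ?P \<longrightarrow> -1 \<le> f z \<and> f z \<le> 1" using f1 unfolding AE_restrict_space_iff[OF P'] .
  then have 1: "AE z in lborel. z \<in> ?P \<longrightarrow> -1 \<le> f z \<and> f z \<le> 1" unfolding AE_completion_iff .
  have "AE z in lebesgue. z \<in> ?P \<longrightarrow> (case z of (t, x, v) \<Rightarrow> v \<notin> K \<longrightarrow> f (t, x, v) = 0)"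
   using K(2) unfolding AE_restrict_space_iff[OF P'] .
  then have 2: "AE z in lborel. z \<in> ?P \<longrightarrow> (case z of (t, x, v) \<Rightarrow> v \<notin> K \<longrightarrow> f (t, x, v) = 0)" unfolding AE_completion_iff .
  show ?thesis using 1 2 fg
  proof eventually_elim
   fix z assume z: "z \<in> ?P \<longrightarrow> -1 \<le> f z \<and> f z \<le> 1" "z \<in> ?P \<longrightarrow> (case z of (t, x, v) \<Rightarrow> v \<notin> K \<longrightarrow> f (t, x, v) = 0)"
    "indicator ?P z *\<^sub>R f z = g z"
   obtain t x v where tv: "z = (t, x, v)" by (cases z) auto
   show "fst z \<in> {0<..<T} \<longrightarrow> g1 z = f z"
   proof
    assume t: "fst z \<in> {0<..<T}"
    then have zP: "z \<in> ?P" by (simp add: tv)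
    then have gz: "g z = f z" using z(3) by simp
    show "g1 z = f z"
    proof (cases "norm v \<le> R")
     case True
     then have "z \<in> S" using t by (simp add: S_def tv)
     then show ?thesis using z(1) zP gz by (simp add: g1_def)
    next
     case False
     then have "v \<notin> K" using R(2) by auto
     then have "f z = 0" using z(2) zP by (simp add: tv)
     then show ?thesis using False g1s[of t v x] by (simp add: tv)
    qed
   qed
  qed
 qed
 define n where "n t = (\<integral>\<^sup>+y. ennreal \<bar>g1 (t, y)\<bar> \<partial>lborel)" for t
 have nm [measurable]: "n \<in> borel_measurable borel"
 proof -
  have "(\<lambda>z. ennreal \<bar>g1 z\<bar>) \<in> borel_measurable borel" by measurable
  then have "(\<lambda>(t, y). ennreal \<bar>g1 (t, y)\<bar>) \<in> borel_measurable (borel \<Otimes>\<^sub>M borel)"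
   by (simp add: borel_prod case_prod_beta')
  then have "(\<lambda>(t, y). ennreal \<bar>g1 (t, y)\<bar>) \<in> borel_measurable (borel \<Otimes>\<^sub>M lborel)"
   using measurable_cong_sets[OF sets_pair_measure_cong[OF refl sets_lborel] refl] by blast
  then show ?thesis unfolding n_def by (rule lborel.borel_measurable_nn_integral)
 qed
 have nC: "AE t in lborel. n t \<le> ennreal C"
 proof -
  have "AE t in lebesgue. t \<in> {0..T} \<longrightarrow> integrable lebesgue (\<lambda>z. f (t, z)) \<and> (LINT z|lebesgue. \<bar>f (t, z)\<bar>) \<le> C1"
   using C1 by (subst (asm) AE_restrict_space_iff) auto
  then have "AE t in lborel. t \<in> {0..T} \<longrightarrow> integrable lebesgue (\<lambda>z. f (t, z)) \<and> (LINT z|lebesgue. \<bar>f (t, z)\<bar>) \<le> C1"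
   unfolding AE_completion_iff .
  with AE_lborel_pair[OF e1] show ?thesis
  proof eventually_elim
   fix t assume t: "AE y in lborel. fst (t, y) \<in> {0<..<T} \<longrightarrow> g1 (t, y) = f (t, y)"
    "t \<in> {0..T} \<longrightarrow> integrable lebesgue (\<lambda>z. f (t, z)) \<and> (LINT z|lebesgue. \<bar>f (t, z)\<bar>) \<le> C1"
   show "n t \<le> ennreal C"
   proof (cases "t \<in> {0<..<T}")
    case True
    then have i: "integrable lebesgue (\<lambda>z. \<bar>f (t, z)\<bar>)" and l: "(LINT z|lebesgue. \<bar>f (t, z)\<bar>) \<le> C1" using t(2) by auto
    have "n t = (\<integral>\<^sup>+y. ennreal \<bar>f (t, y)\<bar> \<partial>lborel)"
     unfolding n_def by (rule nn_integral_cong_AE) (use t(1) True in \<open>auto elim: eventually_mono\<close>)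
    also have "\<dots> = (\<integral>\<^sup>+y. ennreal \<bar>f (t, y)\<bar> \<partial>lebesgue)" by (rule nn_integral_completion[symmetric])
    also have "\<dots> = ennreal (LINT z|lebesgue. \<bar>f (t, z)\<bar>)" by (rule nn_integral_eq_integral[OF i]) simp
    also have "\<dots> \<le> ennreal C" using l by (intro ennreal_leI) (simp add: C_def)
    finally show ?thesis .
   next
    case False
    then have "g1 (t, y) = 0" for y using g1s[of t "snd y" "fst y"] by simp
    then show ?thesis by (simp add: n_def)
   qed
  qed
 qed
 \<comment> \<open>The erased times form a null set by \<open>nC\<close>, so F still agrees with f
   almost everywhere, while its slice bound holds for every t.\<close>
 define F where "F z = (if n (fst z) \<le> ennreal C then g1 z else 0)" for z
 show thesis
 proof (rule that[of F R C])
  have nf: "(\<lambda>z :: real \<times> (real^'n) \<times> (real^'n). n (fst z)) \<in> borel_measurable borel" by (rule measurable_compose[OF mfst nm])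
  show "F \<in> borel_measurable borel" unfolding F_def[abs_def] using nf by measurable
  show "\<forall>z. \<bar>F z\<bar> \<le> 1" using g1b by (simp add: F_def)
  have "F (t, x, v) = 0" if "t \<notin> {0<..<T} \<or> R < norm v" for t x v using g1s[OF that] by (simp add: F_def)
  then show "\<forall>t x v. t \<notin> {0<..<T} \<or> R < norm v \<longrightarrow> F (t, x, v) = 0" by blast
  have "(\<integral>\<^sup>+y. ennreal \<bar>F (t, y)\<bar> \<partial>lborel) \<le> ennreal C" for t
   by (cases "n t \<le> ennreal C") (simp_all add: F_def n_def)
  then show "\<forall>t. (\<integral>\<^sup>+y. ennreal \<bar>F (t, y)\<bar> \<partial>lborel) \<le> ennreal C" by blast
  have "AE z in (lborel :: real measure) \<Otimes>\<^sub>M (lborel :: ((real^'n) \<times> (real^'n)) measure). n (fst z) \<le> ennreal C"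
  proof (rule lborel_pair.AE_pair_measure)
   have "{z :: real \<times> (real^'n) \<times> (real^'n). n (fst z) \<le> ennreal C} \<in> sets borel" using nf by measurable
   then show "{z \<in> space (lborel \<Otimes>\<^sub>M lborel). n (fst z) \<le> ennreal C} \<in> sets ((lborel :: real measure) \<Otimes>\<^sub>M (lborel :: ((real^'n) \<times> (real^'n)) measure))"
    unfolding lborel_prod by (simp only: sets_lborel space_lborel space_borel UNIV_I simp_thms)
   from nC show "AE t in lborel. AE y in (lborel :: ((real^'n) \<times> (real^'n)) measure). n (fst (t, y)) \<le> ennreal C"
    by eventually_elim simp
  qed
  then have "AE z in lborel :: (real \<times> (real^'n) \<times> (real^'n)) measure. n (fst z) \<le> ennreal C" unfolding lborel_prod .
  with e1 show "AE z in lborel. fst z \<in> {0<..<T} \<longrightarrow> F z = f z"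
   by eventually_elim (simp add: F_def)
 qed (use R C_def in auto)
qed

theorem corollary2:
  fixes a :: "real^'n \<Rightarrow> real^'n"
    and f :: "real \<times> (real^'n) \<times> (real^'n) \<Rightarrow> real"
    and u :: "real \<times> (real^'n) \<Rightarrow> real"
    and m :: "'n \<Rightarrow> (real \<times> (real^'n) \<times> (real^'n)) signed_measure"
    and T s :: real
  assumes "T > 0"
    and "\<exists>L. L-lipschitz_on UNIV a"
    and "inj a"
    and "Linfty lebesgue (inverse_jacobian a)"
    and "change_of_variables a"
    and "Linfty (lebesgue_on positive_time) f"
    and "AE (t, x) in lebesgue_on positive_time. u (t, x) = (LINT v|lebesgue. f (t, x, v))"
    and "AE z in lebesgue_on positive_time. -1 \<le> f z \<and> f z \<le> 1"
    and "\<And>i. finite_signed_measure (m i)"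
    and "solves_kinetic_equation a f m"
    and "Linfty_L1 T f"
    and "\<exists>K. compact K \<and>
           (AE (t, x, v) in lebesgue_on positive_time. v \<notin> K \<longrightarrow> f (t, x, v) = 0)"
    and "s < 1/4"
  shows "L2_Hs T s u"
proof -
 obtain L where L: "L-lipschitz_on UNIV a" using assms(2) by auto
 obtain K where K: "compact K" "AE (t, x, v) in lebesgue_on positive_time. v \<notin> K \<longrightarrow> f (t, x, v) = 0" using assms(12) by auto
 obtain Jm where Jm: "Jm > 0" "\<And>\<psi>. \<psi> \<in> borel_measurable borel \<Longrightarrow>
   (\<integral>\<^sup>+v. \<psi> (a v) \<partial>lborel) \<le> ennreal Jm * (\<integral>\<^sup>+w. \<psi> w \<partial>lborel)"
  using bounded_jacobian_change[OF assms(4,5)] by metis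
 obtain F R C where Fm: "F \<in> borel_measurable borel" and R: "R \<ge> 0" and C: "C \<ge> 0" and F1: "\<forall>z. \<bar>F z\<bar> \<le> 1"
  and Fs': "\<forall>t x v. t \<notin> {0<..<T} \<or> R < norm v \<longrightarrow> F (t, x, v) = 0"
  and Fsl: "\<forall>t. (\<integral>\<^sup>+y. ennreal \<bar>F (t, y)\<bar> \<partial>lborel) \<le> ennreal C"
  and Ff: "AE z in lborel. fst z \<in> {0<..<T} \<longrightarrow> F z = f z"
  by (rule regular_representative[OF assms(1,6,8,11) K])
 have Fs: "F (t, x, v) = 0" if "t \<notin> {0<..<T} \<or> R < norm v" for t x v using Fs' that by blast
 let ?P = "positive_time :: (real \<times> (real^'n) \<times> (real^'n)) set"
 have P: "?P \<in> sets lebesgue" using positive_time_borel by (metis sets_completionI_sets sets_lborel)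
 have P': "?P \<inter> space lebesgue \<in> sets lebesgue" using P by simp
 have mfst: "(fst :: real \<times> (real^'n) \<times> (real^'n) \<Rightarrow> real) \<in> borel_measurable borel"
  by (intro borel_measurable_continuous_onI continuous_intros)
 have ac: "continuous_on A a" for A using lipschitz_on_continuous_on[OF L] continuous_on_subset by blast
 \<comment> \<open>Integrating the slice bound in time produces both integrability of F and the
   assumption \<open>f_slice\<close>.\<close>
 have band: "(\<integral>\<^sup>+z. ennreal (\<bar>F z\<bar> * indicator {p..q} (fst z)) \<partial>lborel) \<le> ennreal (C * (q - p))" if "p \<le> q" for p q
 proof -
  have im: "(\<lambda>z :: real \<times> (real^'n) \<times> (real^'n). indicator {p..q} (fst z) :: real) \<in> borel_measurable borel"
   by (rule measurable_compose[OF mfst]) simp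
  have "(\<integral>\<^sup>+z. ennreal (\<bar>F z\<bar> * indicator {p..q} (fst z)) \<partial>lborel) = (\<integral>\<^sup>+t. (\<integral>\<^sup>+y. ennreal (\<bar>F (t, y)\<bar> * indicator {p..q} t) \<partial>lborel) \<partial>lborel)"
   using nn_integral_lborel_assoc(2)[of "\<lambda>z. ennreal (\<bar>F z\<bar> * indicator {p..q} (fst z))"] Fm im by simp
  also have "\<dots> \<le> (\<integral>\<^sup>+t. ennreal C * indicator {p..q} t \<partial>lborel)"
  proof (rule nn_integral_mono)
   fix t
   show "(\<integral>\<^sup>+y. ennreal (\<bar>F (t, y)\<bar> * indicator {p..q} t) \<partial>lborel) \<le> ennreal C * indicator {p..q} t"
    using spec[OF Fsl, of t] by (cases "t \<in> {p..q}") auto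
  qed
  also have "\<dots> = ennreal (C * (q - p))" using that C by (subst nn_integral_cmult_indicator) (auto simp: ennreal_mult)
  finally show ?thesis .
 qed
 interpret kinetic_slices a F m T R C L Jm
 proof unfold_locales
  show "T > 0" "R \<ge> 0" "Jm > 0" by fact+
  show "L \<ge> 0" using L by (rule lipschitz_on_nonneg)
  show "norm (a v - a w) \<le> L * norm (v - w)" for v w using lipschitz_onD[OF L, of v w] by (simp add: dist_norm)
  show "\<bar>F z\<bar> \<le> 1" for z using F1 by blast
  show "F (t, x, v) = 0" if "t \<notin> {0<..<T} \<or> R < norm v" for t x v using that by (rule Fs)
  show "(\<integral>\<^sup>+y. ennreal \<bar>F (t, y)\<bar> \<partial>lborel) \<le> ennreal C" for t using Fsl by blast
  show "finite_signed_measure (m i)" for i by (rule assms(9))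
  show "(\<integral>\<^sup>+v. \<psi> (a v) \<partial>lborel) \<le> ennreal Jm * (\<integral>\<^sup>+w. \<psi> w \<partial>lborel)" if "\<psi> \<in> borel_measurable borel" for \<psi>
   by (rule Jm(2)[OF that])
  show "integrable lborel F"
  proof (rule integrableI_bounded)
   have "(\<integral>\<^sup>+z. ennreal (norm (F z)) \<partial>lborel) = (\<integral>\<^sup>+z. ennreal (\<bar>F z\<bar> * indicator {0..T} (fst z)) \<partial>lborel)"
   proof (intro nn_integral_cong)
    fix z
    show "ennreal (norm (F z)) = ennreal (\<bar>F z\<bar> * indicator {0..T} (fst z))"
     using Fs[of "fst z" "snd (snd z)" "fst (snd z)"] by (cases "fst z \<in> {0..T}") auto
   qed
   also have "\<dots> \<le> ennreal (C * (T - 0))" using assms(1) by (intro band) auto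
   finally show "(\<integral>\<^sup>+z. ennreal (norm (F z)) \<partial>lborel) < \<infinity>" by (rule le_less_trans) simp
  qed (use Fm in simp)
  show "(LINT z|lborel. \<bar>F z\<bar> * indicator {p..q} (fst z)) \<le> C * (q - p)" if "0 \<le> p" "p \<le> q" "q \<le> T" for p q
   using C that band[OF that(2)] by (intro integral_real_bounded) auto
  fix \<phi> :: "real \<times> (real^'n) \<times> (real^'n) \<Rightarrow> real" assume "test_function ({0<..<T} \<times> UNIV) \<phi>"
  then obtain S where sm: "smooth \<phi>" and S: "compact S" "S \<subseteq> {0<..<T} \<times> UNIV" "\<And>z. z \<notin> S \<Longrightarrow> \<phi> z = 0"
   unfolding test_function_def by auto
  have "S \<subseteq> positive_time" using S(2) by auto
  then have tp: "test_function positive_time \<phi>" unfolding test_function_def using sm S by blast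
  let ?D = "\<lambda>z. partial (1, 0, 0) \<phi> z + (\<Sum>i\<in>UNIV. a (snd (snd z)) $ i * partial (0, axis i 1, 0) \<phi> z)"
  \<comment> \<open>The test function is supported in ]0,T[, so the values of f at later times do
    not enter and F may replace f in the weak equation.\<close>
  have D0: "?D z = 0" if "fst z \<notin> {0<..<T}" for z
  proof -
   have "z \<notin> S" using that S(2) by (auto simp: mem_Times_iff)
   then show ?thesis using partial_eq_0[OF compact_imp_closed[OF S(1)] S(3)] by simp
  qed
  have am: "(\<lambda>z :: real \<times> (real^'n) \<times> (real^'n). a (snd (snd z)) $ i) \<in> borel_measurable borel" for i
   by (intro borel_measurable_continuous_onI continuous_on_component continuous_on_compose2[OF ac[of UNIV]] continuous_intros) auto
  have b1: "(1, 0, 0) \<in> (Basis :: (real \<times> (real^'n) \<times> (real^'n)) set)"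
   unfolding Basis_prod_def[where 'a = real] by (intro UnI1 image_eqI[of _ _ 1]) (simp_all add: zero_prod_def)
  have b2: "(0, axis i 1, 0) \<in> (Basis :: (real \<times> (real^'n) \<times> (real^'n)) set)" for i
   by (auto simp: Basis_prod_def axis_in_Basis_iff)
  have Dm: "?D \<in> borel_measurable borel"
   by (intro borel_measurable_add borel_measurable_sum borel_measurable_times am smooth_partial_measurable[OF sm] b1 b2)
  have FD: "(\<lambda>z. F z * ?D z) \<in> borel_measurable lborel" using borel_measurable_times[OF Fm Dm] by simp
  have FDl: "(\<lambda>z. F z * ?D z) \<in> borel_measurable lebesgue" by (rule measurable_completion[OF FD])
  have "AE z in lborel. F z * ?D z = indicator ?P z *\<^sub>R (f z * ?D z)"
   using Ff
  proof eventually_elim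
   fix z assume z: "fst z \<in> {0<..<T} \<longrightarrow> F z = f z"
   show "F z * ?D z = indicator ?P z *\<^sub>R (f z * ?D z)"
   proof (cases "fst z \<in> {0<..<T}")
    case True
    then have "z \<in> ?P" by (simp add: mem_Times_iff)
    then show ?thesis using True z by simp
   next
    case False
    then have D: "?D z = 0" by (rule D0)
    show ?thesis unfolding D by simp
   qed
  qed
  then have ae: "AE z in lebesgue. F z * ?D z = indicator ?P z *\<^sub>R (f z * ?D z)" by (rule AE_completion)
  have "(LINT z|lborel. F z * ?D z) = (LINT z|lebesgue. F z * ?D z)" by (rule integral_completion[OF FD, symmetric])
  also have "\<dots> = (LINT z|lebesgue. indicator ?P z *\<^sub>R (f z * ?D z))"
   by (rule integral_cong_AE[OF FDl borel_measurable_AE[OF FDl ae] ae])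
  also have "\<dots> = (LINT z|lebesgue_on ?P. f z * ?D z)" by (rule integral_restrict_space[OF P', symmetric])
  also have "\<dots> = (LINT (t, x, v)|lebesgue_on ?P. f (t, x, v) * (partial (1, 0, 0) \<phi> (t, x, v) + (\<Sum>i\<in>UNIV. a v $ i * partial (0, axis i 1, 0) \<phi> (t, x, v))))"
   by (intro Bochner_Integration.integral_cong refl) auto
  also have "\<dots> = (\<Sum>i\<in>UNIV. signed_integral (m i) (partial (0, 0, axis i 1) \<phi>))"
   using assms(10) tp unfolding solves_kinetic_equation_def by blast
  finally show "(LINT z|lborel. F z * ?D z) = (\<Sum>i\<in>UNIV. signed_integral (m i) (partial (0, 0, axis i 1) \<phi>))" .
 qed
 show ?thesis
 proof (rule L2_HsI[OF _ _ sobolev_finite[OF assms(13)]])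
  show "case_prod rhohat \<in> borel_measurable (borel \<Otimes>\<^sub>M borel)"
   using rhohat_measurable[OF measurable_fst measurable_snd] by (simp add: case_prod_beta')
  let ?Q = "positive_time :: (real \<times> (real^'n)) set"
  have Q: "?Q \<in> sets lebesgue" using positive_time_borel by (metis sets_completionI_sets sets_lborel)
  have Q': "?Q \<inter> space lebesgue \<in> sets lebesgue" using Q by simp
  have "AE z in lebesgue. z \<in> ?Q \<longrightarrow> (case z of (t, x) \<Rightarrow> u (t, x) = (LINT v|lebesgue. f (t, x, v)))"
   using assms(7) unfolding AE_restrict_space_iff[OF Q'] .
  then have "AE z in lborel. z \<in> ?Q \<longrightarrow> (case z of (t, x) \<Rightarrow> u (t, x) = (LINT v|lebesgue. f (t, x, v)))"
   unfolding AE_completion_iff .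
  then have u: "AE t in lborel. AE x in lborel. 0 < t \<longrightarrow> u (t, x) = (LINT v|lebesgue. f (t, x, v))"
   using AE_lborel_pair by force
  have Fft: "AE t in lborel. AE x in lborel. AE v in lborel. t \<in> {0<..<T} \<longrightarrow> F (t, x, v) = f (t, x, v)"
   using AE_lborel_pair[OF Ff]
  proof eventually_elim
   fix t assume "AE y in lborel. fst (t, y) \<in> {0<..<T} \<longrightarrow> F (t, y) = f (t, y)"
   from AE_lborel_pair[OF this] show "AE x in lborel. AE v in lborel. t \<in> {0<..<T} \<longrightarrow> F (t, x, v) = f (t, x, v)" by simp
  qed
  have "AE t in lborel. t \<in> {0..T} \<longrightarrow> has_fourier_transform (\<lambda>x. u (t, x)) (rhohat t)"
   \<comment> \<open>The endpoints are removed as null sets: F vanishes there, and the equation for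
     u is given only at positive times.\<close>
   using u Fft AE_lborel_singleton[of 0] AE_lborel_singleton[of T]
  proof eventually_elim
   fix t assume u: "AE x in lborel. 0 < t \<longrightarrow> u (t, x) = (LINT v|lebesgue. f (t, x, v))"
    and Ff: "AE x in lborel. AE v in lborel. t \<in> {0<..<T} \<longrightarrow> F (t, x, v) = f (t, x, v)" and ne: "t \<noteq> 0" "t \<noteq> T"
   show "t \<in> {0..T} \<longrightarrow> has_fourier_transform (\<lambda>x. u (t, x)) (rhohat t)"
   proof
    assume "t \<in> {0..T}"
    with ne have t: "t \<in> {0<..<T}" by auto
    have "AE x in lborel. u (t, x) = density t x"
     using u Ff
    proof eventually_elim
     fix x assume ux: "0 < t \<longrightarrow> u (t, x) = (LINT v|lebesgue. f (t, x, v))"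
      and "AE v in lborel. t \<in> {0<..<T} \<longrightarrow> F (t, x, v) = f (t, x, v)"
     then have ae: "AE v in lebesgue. F (t, x, v) = f (t, x, v)" using t by (auto intro: AE_completion)
     have Fx: "(\<lambda>v. F (t, x, v)) \<in> borel_measurable lborel"
      by (rule f_measurable3) simp_all
     have Fxl: "(\<lambda>v. F (t, x, v)) \<in> borel_measurable lebesgue" by (rule measurable_completion[OF Fx])
     have "density t x = (LINT v|lebesgue. F (t, x, v))" unfolding density_def by (rule integral_completion[OF Fx, symmetric])
     also have "\<dots> = (LINT v|lebesgue. f (t, x, v))" by (rule integral_cong_AE[OF Fxl borel_measurable_AE[OF Fxl ae] ae])
     finally show "u (t, x) = density t x" using ux t by simp
    qed
    then show "has_fourier_transform (\<lambda>x. u (t, x)) (rhohat t)"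
     unfolding rhohat_def[abs_def] by (rule has_fourier_transform_ft[OF density_integrable])
   qed
  qed
  then have "AE t in lebesgue. t \<in> {0..T} \<longrightarrow> has_fourier_transform (\<lambda>x. u (t, x)) (rhohat t)" by (rule AE_completion)
  then show "AE t in lebesgue_on {0..T}. has_fourier_transform (\<lambda>x. u (t, x)) (rhohat t)"
   by (subst AE_restrict_space_iff) auto
 qed
qed

end
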